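(* Let $m$ be either an exponential weight $m(v)=\exp(-a|v|^{s})$ with $a>0$, $s\in(0,1]$, or an algebraic weight $m(v)=(1+|v|^{\beta})^{-1}$ with $\beta>0$. Let $\gamma\in[0,d-2]$ and $b\in L^{1}(\mathbb{S}^{d-1})$. Set $\mathbf{X}=L^{1}(\mathbb{R}^{d},m^{-1}(v)\,dv)$ and $\mathbf{Y}=L^{1}(\mathbb{R}^{d},(1+|v|)^{\gamma}m^{-1}(v)\,dv)\subset\mathbf{X}$. Then the linear Boltzmann operator $\mathcal{L}$ with domain $\mathscr{D}(\mathcal{L})=\mathbf{Y}$ is the generator of a positive $C_0$-semigroup $(V(t))_{t\ge 0}$ on $\mathbf{X}$. Moreover, there exist $C>0$ and $\lambda_\star>0$ such that $$\|V(t)f_{0}-\varrho_0\,\mathcal{M}\|_{\mathbf{X}}\le C\exp(-\lambda_\star t)\,\|f_{0}\|_{\mathbf{X}}\qquad\text{for all nonnegative } f_0\in\mathbf{X}\text{ and all } t\ge 0,$$ where $\varrho_0=\int_{\mathbb{R}^d}f_0(v)\,dv$.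
   Context: Let $d\ge 2$ and $\mathcal{M}(v)=(2\pi)^{-d/2}\exp(-|v|^2/2)$, $v\in\mathbb{R}^d$. For $v,v_*\in\mathbb{R}^d$ and $\sigma\in\mathbb{S}^{d-1}$ set $v'=\frac{v+v_*}{2}+\frac{|v-v_*|}{2}\sigma$, $v_*'=\frac{v+v_*}{2}-\frac{|v-v_*|}{2}\sigma$ and $\cos\theta=\left\langle \frac{v-v_*}{|v-v_*|},\sigma\right\rangle$. The angular kernel $b:[-1,1]\to[0,\infty)$ is measurable; $b\in L^1(\mathbb{S}^{d-1})$ means $\ell_b=\int_{\mathbb{S}^{d-1}}b(\cos\theta)\,d\sigma<\infty$ (this integral does not depend on $v,v_*$), and it is assumed that $\ell_b>0$. The collision kernel is $B(v-v_*,\sigma)=|v-v_*|^{\gamma}b(\cos\theta)$. Define the gain operator $Kf(v)=\int_{\mathbb{R}^d\times\mathbb{S}^{d-1}}B(v-v_*,\sigma)f(v')\mathcal{M}(v_*')\,dv_*\,d\sigma$, the collision frequency $\Sigma(v)=\int_{\mathbb{R}^d\times\mathbb{S}^{d-1}}B(v-v_*,\sigma)\mathcal{M}(v_* )\,dv_*\,d\sigma=\ell_b\int_{\mathbb{R}^d}|v-v_*|^{\gamma}\mathcal{M}(v_* )\,dv_*$, and the linear Boltzmann operator $\mathcal{L}f=Kf-\Sigma f$. A semigroup is positive if it maps nonnegative functions to nonnegative functions. *)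

theory Defs
  imports "HOL-Analysis.Analysis"
begin

section \<open>Surface measure on the unit sphere\<close>

text \<open>
  The measure \<open>d\<sigma>\<close>, as the cone measure: \<open>\<sigma>(A) = d \<cdot> Leb {x. 0 < |x| \<le> 1, x/|x| \<in> A}\<close>.
  The factor \<open>d\<close> is the one for which integration in polar coordinates reads
  \<open>dx = r\<^sup>d\<^sup>-\<^sup>1 dr d\<sigma>\<close>.
\<close>

definition sphere_measure :: "('a::euclidean_space) measure" where
  "sphere_measure =
     scale_measure (of_nat DIM('a))
       (distr (restrict_space lborel (cball 0 1 - {0})) (restrict_space borel (sphere 0 1)) sgn)"

lemma sets_sphere_measure [measurable_cong]:
  "sets (sphere_measure :: 'a::euclidean_space measure) = sets (restrict_space borel (sphere 0 1))"
  by (simp add: sphere_measure_def)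

lemma space_sphere_measure [simp]:
  "space (sphere_measure :: 'a::euclidean_space measure) = sphere 0 1"
  using sets_eq_imp_space_eq[OF sets_sphere_measure] by (simp add: space_restrict_space)


section \<open>Collision kernel and linear Boltzmann operator\<close>

definition maxwellian :: "'a::euclidean_space \<Rightarrow> real" where
  "maxwellian v = (2 * pi) powr (- real DIM('a) / 2) * exp (- (norm v)\<^sup>2 / 2)"

definition post_v :: "'a::euclidean_space \<Rightarrow> 'a \<Rightarrow> 'a \<Rightarrow> 'a" where
  "post_v v vs \<sigma> = (v + vs) /\<^sub>R 2 + (norm (v - vs) / 2) *\<^sub>R \<sigma>"

definition post_vs :: "'a::euclidean_space \<Rightarrow> 'a \<Rightarrow> 'a \<Rightarrow> 'a" where
  "post_vs v vs \<sigma> = (v + vs) /\<^sub>R 2 - (norm (v - vs) / 2) *\<^sub>R \<sigma>"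

text \<open>\<open>sgn x = x/|x|\<close>; on the diagonal \<open>v = vs\<close> (a null set) the value is \<open>0\<close>.\<close>

definition cos_dev :: "'a::euclidean_space \<Rightarrow> 'a \<Rightarrow> 'a \<Rightarrow> real" where
  "cos_dev v vs \<sigma> = inner (sgn (v - vs)) \<sigma>"

text \<open>
  In Isabelle/HOL \<open>0 powr 0 = 0\<close>, so for \<open>\<gamma> = 0\<close> this kernel differs from \<open>b (cos \<theta>)\<close> on the
  null set \<open>v = vs\<close>, and only there.
\<close>

definition coll_kernel :: "real \<Rightarrow> (real \<Rightarrow> real) \<Rightarrow> 'a::euclidean_space \<Rightarrow> 'a \<Rightarrow> 'a \<Rightarrow> real" where
  "coll_kernel \<gamma> b v vs \<sigma> = norm (v - vs) powr \<gamma> * b (cos_dev v vs \<sigma>)"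

definition gain :: "real \<Rightarrow> (real \<Rightarrow> real) \<Rightarrow> ('a::euclidean_space \<Rightarrow> real) \<Rightarrow> 'a \<Rightarrow> real" where
  "gain \<gamma> b f v =
     (LINT (vs, \<sigma>)|(lborel \<Otimes>\<^sub>M sphere_measure).
        coll_kernel \<gamma> b v vs \<sigma> * f (post_v v vs \<sigma>) * maxwellian (post_vs v vs \<sigma>))"

definition coll_freq :: "real \<Rightarrow> (real \<Rightarrow> real) \<Rightarrow> 'a::euclidean_space \<Rightarrow> real" where
  "coll_freq \<gamma> b v =
     (LINT (vs, \<sigma>)|(lborel \<Otimes>\<^sub>M sphere_measure). coll_kernel \<gamma> b v vs \<sigma> * maxwellian vs)"

definition lin_boltzmann ::
    "real \<Rightarrow> (real \<Rightarrow> real) \<Rightarrow> ('a::euclidean_space \<Rightarrow> real) \<Rightarrow> 'a \<Rightarrow> real" where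
  "lin_boltzmann \<gamma> b f v = gain \<gamma> b f v - coll_freq \<gamma> b v * f v"


section \<open>Weights\<close>

definition exp_weight :: "real \<Rightarrow> real \<Rightarrow> 'a::euclidean_space \<Rightarrow> real" where
  "exp_weight a s v = exp (- a * norm v powr s)"

definition alg_weight :: "real \<Rightarrow> 'a::euclidean_space \<Rightarrow> real" where
  "alg_weight \<beta> v = inverse (1 + norm v powr \<beta>)"

definition X_measure :: "('a::euclidean_space \<Rightarrow> real) \<Rightarrow> 'a measure" where
  "X_measure m = density lborel (\<lambda>v. ennreal (inverse (m v)))"

definition Y_measure :: "real \<Rightarrow> ('a::euclidean_space \<Rightarrow> real) \<Rightarrow> 'a measure" where
  "Y_measure \<gamma> m = density lborel (\<lambda>v. ennreal ((1 + norm v) powr \<gamma> * inverse (m v)))"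


section \<open>Semigroups on \<open>L\<^sup>1\<close>\<close>

text \<open>
  Elements of the Banach space \<open>L\<^sup>1(M)\<close> are represented by integrable functions; equality in
  \<open>L\<^sup>1(M)\<close> is equality almost everywhere.  An operator on \<open>L\<^sup>1(M)\<close> is thus a map on functions
  that preserves integrability and respects almost everywhere equality.
\<close>

definition L1 :: "'a measure \<Rightarrow> ('a \<Rightarrow> real) set" where
  "L1 M = {f. integrable M f}"

definition L1_norm :: "'a measure \<Rightarrow> ('a \<Rightarrow> real) \<Rightarrow> real" where
  "L1_norm M f = (LINT x|M. \<bar>f x\<bar>)"

definition L1_bounded_operator :: "'a measure \<Rightarrow> (('a \<Rightarrow> real) \<Rightarrow> ('a \<Rightarrow> real)) \<Rightarrow> bool" where
  "L1_bounded_operator M T \<longleftrightarrow>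
     (\<forall>f\<in>L1 M. T f \<in> L1 M) \<and>
     (\<forall>f\<in>L1 M. \<forall>g\<in>L1 M. (AE x in M. f x = g x) \<longrightarrow> (AE x in M. T f x = T g x)) \<and>
     (\<forall>f\<in>L1 M. \<forall>g\<in>L1 M. AE x in M. T (\<lambda>y. f y + g y) x = T f x + T g x) \<and>
     (\<forall>c. \<forall>f\<in>L1 M. AE x in M. T (\<lambda>y. c * f y) x = c * T f x) \<and>
     (\<exists>C. \<forall>f\<in>L1 M. L1_norm M (T f) \<le> C * L1_norm M f)"

definition C0_semigroup :: "'a measure \<Rightarrow> (real \<Rightarrow> ('a \<Rightarrow> real) \<Rightarrow> ('a \<Rightarrow> real)) \<Rightarrow> bool" where
  "C0_semigroup M V \<longleftrightarrow>
     (\<forall>t\<ge>0. L1_bounded_operator M (V t)) \<and>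
     (\<forall>f\<in>L1 M. AE x in M. V 0 f x = f x) \<and>
     (\<forall>s\<ge>0. \<forall>t\<ge>0. \<forall>f\<in>L1 M. AE x in M. V (s + t) f x = V s (V t f) x) \<and>
     (\<forall>f\<in>L1 M. ((\<lambda>t. L1_norm M (\<lambda>x. V t f x - f x)) \<longlongrightarrow> 0) (at_right 0))"

definition positive_semigroup :: "'a measure \<Rightarrow> (real \<Rightarrow> ('a \<Rightarrow> real) \<Rightarrow> ('a \<Rightarrow> real)) \<Rightarrow> bool" where
  "positive_semigroup M V \<longleftrightarrow>
     (\<forall>t\<ge>0. \<forall>f\<in>L1 M. (AE x in M. 0 \<le> f x) \<longrightarrow> (AE x in M. 0 \<le> V t f x))"

definition generator_graph ::
    "'a measure \<Rightarrow> (real \<Rightarrow> ('a \<Rightarrow> real) \<Rightarrow> ('a \<Rightarrow> real)) \<Rightarrow> (('a \<Rightarrow> real) \<times> ('a \<Rightarrow> real)) set" where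
  "generator_graph M V =
     {(f, g). f \<in> L1 M \<and> g \<in> L1 M \<and>
        ((\<lambda>t. L1_norm M (\<lambda>x. (V t f x - f x) / t - g x)) \<longlongrightarrow> 0) (at_right 0)}"

definition is_generator ::
    "'a measure \<Rightarrow> (real \<Rightarrow> ('a \<Rightarrow> real) \<Rightarrow> ('a \<Rightarrow> real)) \<Rightarrow>
      ('a \<Rightarrow> real) set \<Rightarrow> (('a \<Rightarrow> real) \<Rightarrow> ('a \<Rightarrow> real)) \<Rightarrow> bool" where
  "is_generator M V D A \<longleftrightarrow>
     D = Domain (generator_graph M V) \<and> (\<forall>f\<in>D. (f, A f) \<in> generator_graph M V)"


section \<open>The integral of the angular kernel does not depend on the velocities\<close>

definition ell :: "(real \<Rightarrow> real) \<Rightarrow> 'a::euclidean_space \<Rightarrow> 'a \<Rightarrow> real" where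
  "ell b v vs = (LINT \<sigma>|sphere_measure. b (cos_dev v vs \<sigma>))"

lemma lborel_distr_orthogonal:
  fixes T :: "'a::euclidean_space \<Rightarrow> 'a"
  assumes T: "orthogonal_transformation T"
  shows "distr lborel borel T = lborel"
proof -
  have linT: "linear T" using T by (simp add: orthogonal_transformation_linear)
  have mT [measurable]: "T \<in> borel_measurable borel"
    using linT by (intro borel_measurable_continuous_onI)
      (simp add: linear_continuous_on linear_conv_bounded_linear)
  define \<mu> where "\<mu> = distr lborel borel T"
  have sets_mu [measurable_cong]: "sets \<mu> = sets borel" by (simp add: \<mu>_def)
  have space_mu: "space \<mu> = UNIV" by (simp add: \<mu>_def)
  have nn_mu: "(\<integral>\<^sup>+x. f x \<partial>\<mu>) = (\<integral>\<^sup>+x. f (T x) \<partial>lborel)"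
    if [measurable]: "f \<in> borel_measurable borel" for f
    unfolding \<mu>_def by (subst nn_integral_distr) auto
  have lborel_shift: "(\<integral>\<^sup>+x. f (x + c) \<partial>lborel) = (\<integral>\<^sup>+x. f x \<partial>lborel)"
    if [measurable]: "f \<in> borel_measurable borel" for f :: "'a \<Rightarrow> ennreal" and c :: 'a
  proof -
    have "(\<integral>\<^sup>+x. f x \<partial>lborel) = (\<integral>\<^sup>+x. f x \<partial>(distr lborel borel ((+) c)))"
      by (simp add: lborel_distr_plus)
    also have "\<dots> = (\<integral>\<^sup>+x. f (c + x) \<partial>lborel)"
      by (subst nn_integral_distr) auto
    finally show ?thesis by (simp add: add.commute)
  qed
  have mu_shift: "(\<integral>\<^sup>+x. f (x + c) \<partial>\<mu>) = (\<integral>\<^sup>+x. f x \<partial>\<mu>)"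
    if [measurable]: "f \<in> borel_measurable borel" for f :: "'a \<Rightarrow> ennreal" and c :: 'a
  proof -
    obtain d where d: "c = T d"
      using orthogonal_transformation_surj[OF T] by (metis surjD)
    have "(\<integral>\<^sup>+x. f (x + c) \<partial>\<mu>) = (\<integral>\<^sup>+x. f (T (x + d)) \<partial>lborel)"
      by (subst nn_mu) (auto simp: d linear_add[OF linT])
    also have "\<dots> = (\<integral>\<^sup>+x. f (T x) \<partial>lborel)"
      by (subst lborel_shift[where f = "\<lambda>x. f (T x)"]) auto
    finally show ?thesis by (simp add: nn_mu)
  qed
  have vimage_ball: "T -` ball 0 r = ball 0 r" for r
    by (auto simp: orthogonal_transformation_norm[OF T])
  have mu_ball: "emeasure \<mu> (ball 0 r) = emeasure lborel (ball (0::'a) r)" for r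
    unfolding \<mu>_def by (subst emeasure_distr) (auto simp: vimage_ball)
  interpret mu: sigma_finite_measure \<mu>
  proof
    show "\<exists>A. countable A \<and> A \<subseteq> sets \<mu> \<and> \<Union>A = space \<mu> \<and> (\<forall>a\<in>A. emeasure \<mu> a \<noteq> \<infinity>)"
    proof (intro exI[of _ "range (\<lambda>n::nat. ball 0 (real n))"] conjI ballI)
      show "\<Union>(range (\<lambda>n::nat. ball (0::'a) (real n))) = space \<mu>"
        using reals_Archimedean2 by (auto simp: space_mu)
      show "emeasure \<mu> a \<noteq> \<infinity>" if "a \<in> range (\<lambda>n::nat. ball (0::'a) (real n))" for a
        using that emeasure_lborel_ball_finite[where 'a = 'a] by (auto simp: mu_ball less_top)
    qed (auto simp: sets_mu)
  qed
  interpret pair_sigma_finite \<mu> lborel ..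
  define B where "B = ball (0::'a) 1"
  have [measurable]: "B \<in> sets borel" by (simp add: B_def)
  have B_neg: "indicator B (- x) = (indicator B x :: ennreal)" for x
    by (simp add: B_def indicator_def)
  have "emeasure \<mu> A = emeasure lborel A" if [measurable]: "A \<in> sets borel" for A
  proof -
    have "emeasure \<mu> A * emeasure lborel B
        = (\<integral>\<^sup>+x. (\<integral>\<^sup>+y. indicator A x * indicator B y \<partial>lborel) \<partial>\<mu>)"
      by (simp add: nn_integral_cmult nn_integral_multc sets_mu)
    also have "\<dots> = (\<integral>\<^sup>+x. (\<integral>\<^sup>+y. indicator A x * indicator B (y - x) \<partial>lborel) \<partial>\<mu>)"
    proof (rule nn_integral_cong)
      fix x
      show "(\<integral>\<^sup>+y. indicator A x * indicator B y \<partial>lborel)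
          = (\<integral>\<^sup>+y. indicator A x * indicator B (y - x) \<partial>lborel)"
        using lborel_shift[of "\<lambda>y. indicator A x * indicator B y" "- x"] by simp
    qed
    also have "\<dots> = (\<integral>\<^sup>+y. (\<integral>\<^sup>+x. indicator A x * indicator B (y - x) \<partial>\<mu>) \<partial>lborel)"
      by (subst Fubini') auto
    also have "\<dots> = (\<integral>\<^sup>+y. (\<integral>\<^sup>+x. indicator A (x + y) * indicator B x \<partial>\<mu>) \<partial>lborel)"
    proof (rule nn_integral_cong)
      fix y
      show "(\<integral>\<^sup>+x. indicator A x * indicator B (y - x) \<partial>\<mu>)
          = (\<integral>\<^sup>+x. indicator A (x + y) * indicator B x \<partial>\<mu>)"
        using mu_shift[of "\<lambda>x. indicator A x * indicator B (y - x)" y] by (simp add: B_neg)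
    qed
    also have "\<dots> = (\<integral>\<^sup>+x. (\<integral>\<^sup>+y. indicator A (x + y) * indicator B x \<partial>lborel) \<partial>\<mu>)"
      by (subst Fubini') auto
    also have "\<dots> = (\<integral>\<^sup>+x. (\<integral>\<^sup>+y. indicator A y * indicator B x \<partial>lborel) \<partial>\<mu>)"
    proof (rule nn_integral_cong)
      fix x
      show "(\<integral>\<^sup>+y. indicator A (x + y) * indicator B x \<partial>lborel)
          = (\<integral>\<^sup>+y. indicator A y * indicator B x \<partial>lborel)"
        using lborel_shift[of "\<lambda>y. indicator A y * indicator B x" x] by (simp add: add.commute)
    qed
    also have "\<dots> = emeasure lborel A * emeasure lborel B"
      using mu_ball[of 1] by (simp add: nn_integral_cmult nn_integral_multc sets_mu flip: B_def)
    finally have eq: "emeasure lborel B * emeasure \<mu> A = emeasure lborel B * emeasure lborel A"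
      by (simp add: mult.commute)
    have "emeasure lborel B \<noteq> \<infinity>"
      using emeasure_lborel_ball_finite[of "0::'a" 1] by (simp add: B_def)
    moreover have "emeasure lborel B \<noteq> 0"
      using content_ball_pos[of 1 "0::'a"] by (auto simp: B_def measure_def)
    ultimately show ?thesis using eq by (simp add: ennreal_mult_cancel_left)
  qed
  then have "\<mu> = lborel"
    by (intro measure_eqI) (auto simp: sets_mu)
  then show ?thesis by (simp add: \<mu>_def)
qed

lemma sphere_measure_orthogonal:
  fixes T :: "'a::euclidean_space \<Rightarrow> 'a"
  assumes T: "orthogonal_transformation T"
  shows "distr sphere_measure sphere_measure T = sphere_measure"
proof -
  have linT: "linear T" using T by (simp add: orthogonal_transformation_linear)
  have mT [measurable]: "T \<in> borel_measurable borel"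
    using linT by (intro borel_measurable_continuous_onI)
      (simp add: linear_continuous_on linear_conv_bounded_linear)
  let ?S = "restrict_space borel (sphere (0::'a) 1)"
  let ?C = "cball (0::'a) 1 - {0}"
  let ?R = "restrict_space lborel ?C"
  have mTS: "T \<in> measurable ?S ?S"
    by (rule measurable_restrict_space3)
       (auto simp: orthogonal_transformation_norm[OF T])
  then have mTS': "T \<in> measurable sphere_measure sphere_measure"
    by (simp cong: measurable_cong_sets add: sets_sphere_measure)
  have msgn: "(sgn :: 'a \<Rightarrow> 'a) \<in> measurable ?R ?S"
    by (rule measurable_restrict_space3) (auto simp: norm_sgn)
  have em: "emeasure (sphere_measure::'a measure) A
      = of_nat DIM('a) * emeasure lborel (sgn -` A \<inter> ?C)"
    if A: "A \<in> sets ?S" for A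
    using A msgn unfolding sphere_measure_def
    by (subst emeasure_scale_measure)
       (auto simp: emeasure_distr emeasure_restrict_space space_restrict_space)
  show ?thesis
  proof (rule measure_eqI)
    fix A assume "A \<in> sets (distr sphere_measure sphere_measure T)"
    then have A: "A \<in> sets ?S" by (simp add: sets_sphere_measure)
    have TA: "T -` A \<inter> sphere 0 1 \<in> sets ?S"
      using measurable_sets[OF mTS A] by (simp add: space_restrict_space)
    have sgnT: "sgn (T x) = T (sgn x)" for x
      by (simp add: sgn_div_norm orthogonal_transformation_norm[OF T] linear_scale[OF linT])
    have m1: "sgn -` A \<inter> ?C \<in> sets borel"
    proof -
      have "sgn -` A \<inter> ?C \<in> sets ?R"
        using measurable_sets[OF msgn A] by (simp add: space_restrict_space)
      then show ?thesis by (subst (asm) sets_restrict_space_iff) auto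
    qed
    have "emeasure (distr sphere_measure sphere_measure T) A
        = emeasure sphere_measure (T -` A \<inter> sphere 0 1)"
      using A by (subst emeasure_distr[OF mTS']) (auto simp: sets_sphere_measure)
    also have "\<dots> = of_nat DIM('a) * emeasure lborel (sgn -` (T -` A \<inter> sphere 0 1) \<inter> ?C)"
      by (rule em[OF TA])
    also have "sgn -` (T -` A \<inter> sphere 0 1) \<inter> ?C = T -` (sgn -` A \<inter> ?C)"
      using orthogonal_transformation_norm[OF T]
      by (auto simp: sgnT norm_sgn linear_0[OF linT]) (metis norm_eq_zero)+
    also have "emeasure lborel (T -` (sgn -` A \<inter> ?C))
        = emeasure (distr lborel borel T) (sgn -` A \<inter> ?C)"
      using m1 by (subst emeasure_distr) auto
    also have "\<dots> = emeasure lborel (sgn -` A \<inter> ?C)"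
      by (simp add: lborel_distr_orthogonal[OF T])
    finally show "emeasure (distr sphere_measure sphere_measure T) A = emeasure sphere_measure A"
      by (simp add: em[OF A])
  qed simp
qed

lemma exists_reflection:
  fixes e e' :: "'a::euclidean_space"
  assumes "norm e = 1" "norm e' = 1"
  obtains T where "orthogonal_transformation T" "T e = e'"
proof (cases "e = e'")
  case True
  then show ?thesis using that[of "\<lambda>x. x"] by simp
next
  case False
  define w where "w = e - e'"
  define T where "T x = x - (2 * inner w x / inner w w) *\<^sub>R w" for x
  have ww: "inner w w \<noteq> 0" using False by (simp add: w_def)
  have "inner e e = 1" "inner e' e' = 1"
    using assms by (simp_all add: norm_eq_1)
  then have "inner w w = 2 * inner w e"
    by (simp add: w_def inner_diff inner_commute)
  then have "T e = e'" using ww by (simp add: T_def w_def)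
  moreover have "linear T"
    by (intro linearI) (simp_all add: T_def inner_add_right algebra_simps add_divide_distrib)
  moreover have "norm (T x) = norm x" for x
  proof -
    have "inner (T x) (T x) = inner x x"
      using ww by (simp add: T_def inner_diff inner_commute field_simps power2_eq_square)
    then show ?thesis by (simp add: norm_eq_sqrt_inner)
  qed
  ultimately show ?thesis using that[of T] by (simp add: orthogonal_transformation)
qed

lemma ell_independent:
  fixes v vs w ws :: "'a::euclidean_space"
  assumes b: "b \<in> borel_measurable (restrict_space borel {-1..1})"
    and "v \<noteq> vs" "w \<noteq> ws"
  shows "integrable sphere_measure (\<lambda>\<sigma>. b (cos_dev v vs \<sigma>))
           \<longleftrightarrow> integrable sphere_measure (\<lambda>\<sigma>. b (cos_dev w ws \<sigma>))" (is ?int)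
    and "ell b v vs = ell b w ws" (is ?eq)
proof -
  obtain T where T: "orthogonal_transformation T" "T (sgn (w - ws)) = sgn (v - vs)"
    using exists_reflection[of "sgn (w - ws)" "sgn (v - vs)"] assms by (auto simp: norm_sgn)
  have linT: "linear T" using T by (simp add: orthogonal_transformation_linear)
  have mT: "T \<in> borel_measurable borel"
    using linT by (intro borel_measurable_continuous_onI)
      (simp add: linear_continuous_on linear_conv_bounded_linear)
  have mTS: "T \<in> measurable sphere_measure sphere_measure"
    using measurable_restrict_space3[OF mT, of "sphere 0 1" "sphere 0 1"]
    by (auto simp: orthogonal_transformation_norm[OF T(1)] sets_sphere_measure
        cong: measurable_cong_sets)
  have "(\<lambda>\<sigma>. cos_dev v vs \<sigma>) \<in> measurable (restrict_space borel (sphere 0 1))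
          (restrict_space borel {-1..1})"
  proof (rule measurable_restrict_space3)
    show "cos_dev v vs \<in> borel_measurable borel" unfolding cos_dev_def by measurable
    have "\<bar>cos_dev v vs \<sigma>\<bar> \<le> 1" if "norm \<sigma> = 1" for \<sigma>
      using Cauchy_Schwarz_ineq2[of "sgn (v - vs)" \<sigma>] that assms
      by (simp add: cos_dev_def norm_sgn)
    then show "cos_dev v vs \<in> sphere 0 1 \<rightarrow> {-1..1}"
      by (force simp: abs_le_iff)
  qed
  then have mb: "(\<lambda>\<sigma>. b (cos_dev v vs \<sigma>)) \<in> borel_measurable sphere_measure"
    using measurable_compose[OF _ b] by (simp add: sets_sphere_measure cong: measurable_cong_sets)
  have eq: "cos_dev v vs (T \<sigma>) = cos_dev w ws \<sigma>" for \<sigma>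
    using T unfolding cos_dev_def orthogonal_transformation_def by metis
  have "integrable (distr sphere_measure sphere_measure T) (\<lambda>\<sigma>. b (cos_dev v vs \<sigma>))
      \<longleftrightarrow> integrable sphere_measure (\<lambda>\<sigma>. b (cos_dev v vs (T \<sigma>)))"
    by (rule integrable_distr_eq[OF mTS mb])
  then show ?int by (simp add: sphere_measure_orthogonal[OF T(1)] eq)
  have "(LINT \<sigma>|distr sphere_measure sphere_measure T. b (cos_dev v vs \<sigma>))
      = (LINT \<sigma>|sphere_measure. b (cos_dev v vs (T \<sigma>)))"
    by (rule integral_distr[OF mTS mb])
  then show ?eq by (simp add: sphere_measure_orthogonal[OF T(1)] eq ell_def)
qed

end

theory Submission
  imports Defs "HOL-Probability.Distributions"
begin

text \<open>
  \<^bold>\<open>Generation.\<close> The gain operator is an integral operator with a nonnegative kernel \<open>k(v, w)\<close> with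
  \<open>\<integral> k(v, w) dv = \<Sigma>(w)\<close>, and the weight \<open>W = 1/m\<close> is a Lyapunov function,
  \<open>\<integral> k(v, w) W(v) dv \<le> \<theta> \<Sigma>(w) W(w) + C\<close> with \<open>\<theta> < 1\<close>. Picard iteration of Duhamel's formula gives a
  minimal nonnegative solution. The Lyapunov inequality bounds \<open>\<Sigma> W V(t) f\<close> in
  \<open>L\<^sup>1((0, T) \<times> \<real>\<^sup>d)\<close>, hence mass is conserved, and a pointwise inequality between solutions of equal mass
  is an equality: this yields the semigroup law and the invariance of the Maxwellian. The domain is \<open>\<Y>\<close>
  because \<open>(1 - \<theta>) \<parallel>\<Sigma> f\<parallel> \<le> \<parallel>\<L> f\<parallel> + C \<parallel>f\<parallel>\<close>, applied to time averages of \<open>V(t) f\<close>.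

  \<^bold>\<open>Relaxation.\<close> The kernel \<open>k(v, w)\<close> is bounded below when \<open>w\<close> stays in a ball and \<open>v\<close> in another ball at positive
  distance, so one collision gives Doeblin's minorization on the sublevel sets of \<open>W\<close>. Together with the
  Lyapunov inequality this is Harris' theorem in weighted \<open>L\<^sup>1\<close>.

  \<^bold>\<open>The kernel.\<close> For fixed \<open>\<sigma>\<close> the map \<open>g \<mapsto> g - |g| \<sigma>\<close> preserves the lines of direction \<open>\<sigma>\<close>, so the change of
  variables from \<open>v\<^sub>*\<close> to \<open>v'\<close> is one-dimensional. Elastic reflection of \<open>\<sigma>\<close> turns the kernel of the dual
  operator into \<open>k\<close>.
\<close>

section \<open>Positive mild solutions of an abstract jump equation\<close>

text \<open>The collision frequency may grow like (1 + |v|)^\<gamma>, so the gain operator is not a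
  bounded perturbation of the multiplication by -\<open>S\<close>, and no contraction argument for
  Duhamel's formula is at hand. Monotonicity replaces it: nonnegative data are treated with values
  in \<open>ennreal\<close>, where the iteration always converges, and every balance is written
  without subtraction. The price is that each cancellation needs a finiteness proof. What has to be
  won is the finiteness of the time integral of the mass weighted by \<open>S W\<close>; it is
  bounded by induction along the iterates, with a constant that survives the limit. Signed functions
  appear only afterwards, as differences of two flows. The abstract part sees the kernel only
  through its mass, the Lyapunov inequality, a stationary density and a minorization. In Harris'
  argument the unweighted norm contracts only as long as the weighted norm is not much larger, the
  weighted norm only when it is; a suitable combination of both contracts in either case.\<close>

lemma nn_integral_Icc_shift:
  fixes h :: "real \<Rightarrow> ennreal"
  assumes [measurable]: "h \<in> borel_measurable borel"
  shows "(\<integral>\<^sup>+s\<in>{c..c+t}. h s \<partial>lborel) = (\<integral>\<^sup>+s\<in>{0..t}. h (c + s) \<partial>lborel)"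
proof -
  have "(\<integral>\<^sup>+s\<in>{c..c+t}. h s \<partial>lborel) = (\<integral>\<^sup>+s. h s * indicator {c..c+t} s \<partial>(distr lborel borel ((+) c)))"
    by (simp add: lborel_distr_plus)
  also have "\<dots> = (\<integral>\<^sup>+s. h (c + s) * indicator {c..c+t} (c + s) \<partial>lborel)"
    by (subst nn_integral_distr) auto
  also have "\<dots> = (\<integral>\<^sup>+s\<in>{0..t}. h (c + s) \<partial>lborel)"
    by (intro nn_integral_cong) (auto simp: indicator_def)
  finally show ?thesis .
qed

lemma nn_integral_Icc_split:
  fixes h :: "real \<Rightarrow> ennreal"
  assumes [measurable]: "h \<in> borel_measurable borel" and "0 \<le> s" "0 \<le> t"
  shows "(\<integral>\<^sup>+r\<in>{0..s+t}. h r \<partial>lborel)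
    = (\<integral>\<^sup>+r\<in>{0..s}. h r \<partial>lborel) + (\<integral>\<^sup>+r\<in>{0..t}. h (s + r) \<partial>lborel)"
proof -
  have "(\<integral>\<^sup>+r\<in>{0..s+t}. h r \<partial>lborel) = (\<integral>\<^sup>+r. h r * indicator {0..s} r + h r * indicator {s..s+t} r \<partial>lborel)"
    using AE_lborel_singleton[of s] assms by (intro nn_integral_cong_AE) (auto simp: indicator_def)
  also have "\<dots> = (\<integral>\<^sup>+r\<in>{0..s}. h r \<partial>lborel) + (\<integral>\<^sup>+r\<in>{s..s+t}. h r \<partial>lborel)"
    by (intro nn_integral_add) auto
  finally show ?thesis by (simp add: nn_integral_Icc_shift)
qed

text \<open>The factor \<open>a\<close> stands in front of the integral, instead of a division on
  the right, so that \<open>a = 0\<close> is included.\<close>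

lemma nn_integral_Icc_exp:
  fixes a r t :: real
  assumes "0 \<le> a" "r \<le> t"
  shows "ennreal a * (\<integral>\<^sup>+s\<in>{r..t}. ennreal (exp (- a * (s - r))) \<partial>lborel) = ennreal (1 - exp (- a * (t - r)))"
proof (cases "a = 0")
  case False
  have "(\<integral>\<^sup>+s\<in>{r..t}. ennreal (exp (- a * (s - r))) \<partial>lborel)
      = ennreal ((- exp (- a * (t - r)) / a) - (- exp (- a * (r - r)) / a))"
    using assms False
    by (intro nn_integral_FTC_Icc) (auto intro!: derivative_eq_intros)
  also have "\<dots> = ennreal ((1 - exp (- a * (t - r))) / a)" by (simp add: diff_divide_distrib)
  finally show ?thesis using assms False by (simp add: ennreal_mult''[symmetric])
qed simp

text \<open>The scalar fact behind the integrated form of the mild equation \<open>y' = - a y + h\<close>.\<close>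

lemma nn_integral_convolution_exp:
  fixes a t :: real and h :: "real \<Rightarrow> ennreal"
  assumes [measurable]: "h \<in> borel_measurable borel" and "0 \<le> a"
  shows "ennreal a * (\<integral>\<^sup>+s\<in>{0..t}. (\<integral>\<^sup>+r\<in>{0..s}. ennreal (exp (- a * (s - r))) * h r \<partial>lborel) \<partial>lborel)
    = (\<integral>\<^sup>+r\<in>{0..t}. ennreal (1 - exp (- a * (t - r))) * h r \<partial>lborel)"
proof -
  have "ennreal a * (\<integral>\<^sup>+s\<in>{0..t}. (\<integral>\<^sup>+r\<in>{0..s}. ennreal (exp (- a * (s - r))) * h r \<partial>lborel) \<partial>lborel)
      = ennreal a * (\<integral>\<^sup>+s. \<integral>\<^sup>+r. ennreal (exp (- a * (s - r))) * h r * indicator {0..s} r * indicator {0..t} s \<partial>lborel \<partial>lborel)"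
    by (subst nn_integral_multc[symmetric]) (auto simp: indicator_def)
  also have "\<dots> = ennreal a * (\<integral>\<^sup>+r. \<integral>\<^sup>+s. ennreal (exp (- a * (s - r))) * h r * indicator {0..s} r * indicator {0..t} s \<partial>lborel \<partial>lborel)"
  proof -
    have [measurable]: "Measurable.pred (borel \<Otimes>\<^sub>M borel) (\<lambda>x. fst x \<in> {0..snd x::real})" by (simp add: atLeastAtMost_iff)
    show ?thesis by (subst lborel_pair.Fubini') (auto simp: indicator_def[abs_def])
  qed
  also have "\<dots> = (\<integral>\<^sup>+r. ennreal a * (\<integral>\<^sup>+s\<in>{r..t}. ennreal (exp (- a * (s - r))) \<partial>lborel) * (h r * indicator {0..t} r) \<partial>lborel)"
  proof -
    \<comment> \<open>The triangle 0 \<le> r \<le> s \<le> t, sliced in the other order: for fixed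
      \<open>r\<close> the variable \<open>s\<close> runs over [r, t].\<close>
    have "ennreal (exp (- a * (s - r))) * h r * indicator {0..s} r * indicator {0..t} s
        = ennreal (exp (- a * (s - r))) * indicator {r..t} s * (h r * indicator {0..t} r)" for r s
      by (auto simp: indicator_def)
    then have inner: "(\<integral>\<^sup>+s. ennreal (exp (- a * (s - r))) * h r * indicator {0..s} r * indicator {0..t} s \<partial>lborel)
        = (\<integral>\<^sup>+s\<in>{r..t}. ennreal (exp (- a * (s - r))) \<partial>lborel) * (h r * indicator {0..t} r)" for r
      by (simp add: nn_integral_multc)
    have [measurable]: "Measurable.pred (borel \<Otimes>\<^sub>M borel) (\<lambda>x::real \<times> real. snd x \<in> {fst x..t})"
      unfolding atLeastAtMost_iff by measurable
    have [measurable]: "(\<lambda>r. \<integral>\<^sup>+s\<in>{r..t}. ennreal (exp (- a * (s - r))) \<partial>lborel) \<in> borel_measurable borel"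
      unfolding indicator_def[abs_def]
      by (intro lborel.borel_measurable_nn_integral) (simp add: split_beta')
    show ?thesis unfolding inner
      by (subst nn_integral_cmult[symmetric]) (auto simp: mult.assoc)
  qed
  also have "\<dots> = (\<integral>\<^sup>+r\<in>{0..t}. ennreal (1 - exp (- a * (t - r))) * h r \<partial>lborel)"
  proof (intro nn_integral_cong)
    fix r
    show "ennreal a * (\<integral>\<^sup>+s\<in>{r..t}. ennreal (exp (- a * (s - r))) \<partial>lborel) * (h r * indicator {0..t} r)
        = ennreal (1 - exp (- a * (t - r))) * h r * indicator {0..t} r"
    proof (cases "r \<in> {0..t}")
      case True
      then have "r \<le> t" by simp
      show ?thesis unfolding nn_integral_Icc_exp[OF assms(2) \<open>r \<le> t\<close>] by (simp only: mult.assoc)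
    qed simp
  qed
  finally show ?thesis .
qed

lemma ennreal_le_of_add_le:
  fixes a b c :: ennreal
  assumes "a + c \<le> b + c" "c < \<infinity>"
  shows "a \<le> b"
  using assms by (metis add.commute ennreal_add_left_cancel_le infinity_ennreal_def less_irrefl)

text \<open>\<open>k v w\<close> is the rate of jumps from \<open>w\<close> to \<open>v\<close>, so
  the second argument is the point of departure, and \<open>k_mass\<close> says that what leaves
  \<open>w\<close> at rate \<open>S w\<close> arrives somewhere. \<open>W\<close> is the weight of
  the space; \<open>lyapunov\<close> says that a jump lowers the mean of \<open>W\<close> by the
  factor \<open>th\<close>, up to a constant. The lower bound on \<open>S\<close> turns this into
  decay in time; \<open>S\<close> has no upper bound.\<close>

locale jump_process = sigma_finite_measure N for N :: "'a measure" +
  fixes k :: "'a \<Rightarrow> 'a \<Rightarrow> ennreal" and S W :: "'a \<Rightarrow> real" and th C S\<^sub>0 :: real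
  assumes space_N [simp]: "space N = UNIV"
    and k_pair [measurable]: "(\<lambda>(x, y). k x y) \<in> borel_measurable (N \<Otimes>\<^sub>M N)"
    and S_meas [measurable]: "S \<in> borel_measurable N"
    and W_meas [measurable]: "W \<in> borel_measurable N"
    and S\<^sub>0: "0 < S\<^sub>0" "\<And>x. S\<^sub>0 \<le> S x"
    and W_ge_1: "\<And>x. 1 \<le> W x"
    and th: "0 \<le> th" "th < 1" and C_nonneg: "0 \<le> C"
    and k_mass: "\<And>w. (\<integral>\<^sup>+v. k v w \<partial>N) = ennreal (S w)"
    and lyapunov: "\<And>w. (\<integral>\<^sup>+v. k v w * ennreal (W v) \<partial>N) \<le> ennreal (th * (S w * W w) + C)"
begin

sublocale pair: pair_sigma_finite lborel N ..
sublocale self_pair: pair_sigma_finite N N ..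

lemma S_pos: "0 < S x" and S_nonneg: "0 \<le> S x"
  using S\<^sub>0(1) S\<^sub>0(2)[of x] by auto
lemma W_pos: "0 < W x" and W_nonneg: "0 \<le> W x"
  using W_ge_1[of x] by auto

lemma k_meas [measurable (raw)]:
  assumes "a \<in> measurable L N" "b \<in> measurable L N"
  shows "(\<lambda>x. k (a x) (b x)) \<in> borel_measurable L"
  using measurable_compose[OF measurable_Pair[OF assms] k_pair] by simp

definition gainK :: "('a \<Rightarrow> ennreal) \<Rightarrow> 'a \<Rightarrow> ennreal" where
  "gainK f v = (\<integral>\<^sup>+w. k v w * f w \<partial>N)"

lemma gainK_meas [measurable]:
  assumes [measurable]: "f \<in> borel_measurable N"
  shows "gainK f \<in> borel_measurable N"
  unfolding gainK_def[abs_def] by measurable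

lemma gainK_meas2 [measurable]:
  assumes [measurable]: "(\<lambda>(t, x). f t x) \<in> borel_measurable (L \<Otimes>\<^sub>M N)"
  shows "(\<lambda>(t, x). gainK (f t) x) \<in> borel_measurable (L \<Otimes>\<^sub>M N)"
  unfolding gainK_def[abs_def] by measurable

lemma gainK_mono: "(\<And>x. f x \<le> g x) \<Longrightarrow> gainK f v \<le> gainK g v"
  unfolding gainK_def by (intro nn_integral_mono mult_left_mono) auto

lemma gainK_add:
  assumes [measurable]: "f \<in> borel_measurable N" "g \<in> borel_measurable N"
  shows "gainK (\<lambda>x. f x + g x) v = gainK f v + gainK g v"
  unfolding gainK_def by (simp add: distrib_left nn_integral_add)

lemma gainK_cmult:
  assumes [measurable]: "f \<in> borel_measurable N"
  shows "gainK (\<lambda>x. c * f x) v = c * gainK f v"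
  unfolding gainK_def by (simp add: mult.left_commute nn_integral_cmult)

lemma gainK_nn_integral:
  assumes [measurable]: "(\<lambda>(t, x). f t x) \<in> borel_measurable (borel \<Otimes>\<^sub>M N)"
  shows "gainK (\<lambda>x. \<integral>\<^sup>+s\<in>{0..t}. f s x \<partial>lborel) v = (\<integral>\<^sup>+s\<in>{0..t}. gainK (f s) v \<partial>(lborel :: real measure))"
proof -
  have "gainK (\<lambda>x. \<integral>\<^sup>+s\<in>{0..t}. f s x \<partial>lborel) v = (\<integral>\<^sup>+x. \<integral>\<^sup>+s. k v x * (f s x * indicator {0..t} s) \<partial>lborel \<partial>N)"
    unfolding gainK_def by (simp add: nn_integral_cmult)
  also have "\<dots> = (\<integral>\<^sup>+s. \<integral>\<^sup>+x. k v x * (f s x * indicator {0..t} s) \<partial>N \<partial>lborel)"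
    by (subst pair.Fubini') auto
  also have "\<dots> = (\<integral>\<^sup>+s\<in>{0..t}. gainK (f s) v \<partial>lborel)"
    unfolding gainK_def by (simp add: nn_integral_multc mult.assoc[symmetric])
  finally show ?thesis .
qed

lemma gainK_SUP:
  assumes [measurable]: "\<And>n. f n \<in> borel_measurable N" and "\<And>x. incseq (\<lambda>n. f n x)"
  shows "gainK (\<lambda>x. SUP n. f n x) v = (SUP n::nat. gainK (f n) v)"
proof -
  have "gainK (\<lambda>x. SUP n. f n x) v = (\<integral>\<^sup>+x. (SUP n. k v x * f n x) \<partial>N)"
    unfolding gainK_def by (simp add: SUP_mult_left_ennreal)
  also have "\<dots> = (SUP n. gainK (f n) v)"
    unfolding gainK_def using assms(2)
    by (intro nn_integral_monotone_convergence_SUP) (auto simp: incseq_def le_fun_def intro!: mult_left_mono)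
  finally show ?thesis .
qed

text \<open>Tonelli moves the test function to the dual operator, where \<open>k_mass\<close> (for
  \<phi> = 1) and \<open>lyapunov\<close> (for \<phi> = \<open>W\<close>) can be inserted.\<close>

lemma nn_integral_gainK:
  assumes [measurable]: "f \<in> borel_measurable N" "\<phi> \<in> borel_measurable N"
  shows "(\<integral>\<^sup>+v. \<phi> v * gainK f v \<partial>N) = (\<integral>\<^sup>+w. (\<integral>\<^sup>+v. k v w * \<phi> v \<partial>N) * f w \<partial>N)"
proof -
  have "(\<integral>\<^sup>+v. \<phi> v * gainK f v \<partial>N) = (\<integral>\<^sup>+v. \<integral>\<^sup>+w. \<phi> v * (k v w * f w) \<partial>N \<partial>N)"
    unfolding gainK_def by (simp add: nn_integral_cmult)
  also have "\<dots> = (\<integral>\<^sup>+w. \<integral>\<^sup>+v. \<phi> v * (k v w * f w) \<partial>N \<partial>N)"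
    by (subst self_pair.Fubini') auto
  also have "\<dots> = (\<integral>\<^sup>+w. \<integral>\<^sup>+v. k v w * \<phi> v * f w \<partial>N \<partial>N)"
    by (simp add: mult_ac)
  also have "\<dots> = (\<integral>\<^sup>+w. (\<integral>\<^sup>+v. k v w * \<phi> v \<partial>N) * f w \<partial>N)"
    by (subst nn_integral_multc) auto
  finally show ?thesis .
qed

lemma nn_integral_gainK_mass:
  assumes [measurable]: "f \<in> borel_measurable N"
  shows "(\<integral>\<^sup>+v. gainK f v \<partial>N) = (\<integral>\<^sup>+w. ennreal (S w) * f w \<partial>N)"
  using nn_integral_gainK[of f "\<lambda>_. 1"] by (simp add: k_mass)

lemma nn_integral_gainK_W:
  assumes [measurable]: "f \<in> borel_measurable N"
  shows "(\<integral>\<^sup>+v. ennreal (W v) * gainK f v \<partial>N)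
    \<le> ennreal th * (\<integral>\<^sup>+w. ennreal (S w * W w) * f w \<partial>N) + ennreal C * (\<integral>\<^sup>+w. f w \<partial>N)"
proof -
  have "(\<integral>\<^sup>+v. ennreal (W v) * gainK f v \<partial>N) \<le> (\<integral>\<^sup>+w. ennreal (th * (S w * W w) + C) * f w \<partial>N)"
    by (subst nn_integral_gainK) (auto intro!: nn_integral_mono mult_right_mono lyapunov)
  also have "\<dots> = (\<integral>\<^sup>+w. ennreal th * (ennreal (S w * W w) * f w) + ennreal C * f w \<partial>N)"
    using th C_nonneg S_nonneg W_nonneg
    by (intro nn_integral_cong) (simp add: ennreal_plus ennreal_mult distrib_right mult.assoc)
  also have "\<dots> = ennreal th * (\<integral>\<^sup>+w. ennreal (S w * W w) * f w \<partial>N) + ennreal C * (\<integral>\<^sup>+w. f w \<partial>N)"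
    by (simp add: nn_integral_add nn_integral_cmult)
  finally show ?thesis .
qed

section \<open>Picard iteration of Duhamel's formula\<close>

definition free :: "real \<Rightarrow> ('a \<Rightarrow> ennreal) \<Rightarrow> 'a \<Rightarrow> ennreal" where
  "free t f v = ennreal (exp (- S v * t)) * f v"

definition duhamel :: "(real \<Rightarrow> 'a \<Rightarrow> ennreal) \<Rightarrow> real \<Rightarrow> 'a \<Rightarrow> ennreal" where
  "duhamel u t v = (\<integral>\<^sup>+s\<in>{0..t}. ennreal (exp (- S v * (t - s))) * gainK (u s) v \<partial>lborel)"

text \<open>\<open>iter f n t\<close> collects the paths with fewer than \<open>n\<close> jumps up
  to time \<open>t\<close>. The start from zero makes the sequence increasing, so that its limit is
  a supremum.\<close>

primrec iter :: "('a \<Rightarrow> ennreal) \<Rightarrow> nat \<Rightarrow> real \<Rightarrow> 'a \<Rightarrow> ennreal" where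
  "iter f 0 = (\<lambda>t v. 0)"
| "iter f (Suc n) = (\<lambda>t v. free t f v + duhamel (iter f n) t v)"

definition flow :: "real \<Rightarrow> ('a \<Rightarrow> ennreal) \<Rightarrow> 'a \<Rightarrow> ennreal" where
  "flow t f v = (SUP n. iter f n t v)"

lemma free_meas2 [measurable]:
  assumes [measurable]: "f \<in> borel_measurable N"
  shows "(\<lambda>(t, v). free t f v) \<in> borel_measurable (borel \<Otimes>\<^sub>M N)"
  unfolding free_def[abs_def] by measurable

lemma duhamel_meas2 [measurable]:
  assumes u[measurable]: "(\<lambda>(t, v). u t v) \<in> borel_measurable (borel \<Otimes>\<^sub>M N)"
  shows "(\<lambda>(t, v). duhamel u t v) \<in> borel_measurable (borel \<Otimes>\<^sub>M N)"
proof -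
  have [measurable]: "(\<lambda>p. gainK (u (snd p)) (snd (fst p))) \<in> borel_measurable ((borel \<Otimes>\<^sub>M N) \<Otimes>\<^sub>M borel)"
    using measurable_compose[OF _ gainK_meas2[OF u], of "\<lambda>p. (snd p, snd (fst p))"] by simp
  have [measurable]: "Measurable.pred ((borel \<Otimes>\<^sub>M N) \<Otimes>\<^sub>M borel) (\<lambda>p. snd p \<in> {0..fst (fst p)::real})"
    unfolding atLeastAtMost_iff by measurable
  have "(\<lambda>p. \<integral>\<^sup>+s. ennreal (exp (- S (snd p) * (fst p - s))) * gainK (u s) (snd p) * indicator {0..fst p} s \<partial>lborel) \<in> borel_measurable (borel \<Otimes>\<^sub>M N)"
    unfolding indicator_def[abs_def]
    by (intro lborel.borel_measurable_nn_integral) (simp add: split_beta')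
  then show ?thesis unfolding duhamel_def[abs_def] split_beta' .
qed

lemma iter_meas2 [measurable]:
  assumes [measurable]: "f \<in> borel_measurable N"
  shows "(\<lambda>(t, v). iter f n t v) \<in> borel_measurable (borel \<Otimes>\<^sub>M N)"
proof (induction n)
  case (Suc n)
  note Suc[measurable]
  have "(\<lambda>p. (\<lambda>(t, v). free t f v) p + (\<lambda>(t, v). duhamel (iter f n) t v) p) \<in> borel_measurable (borel \<Otimes>\<^sub>M N)"
    by measurable
  then show ?case by (simp add: split_beta')
qed simp

lemma flow_meas2 [measurable]:
  assumes [measurable]: "f \<in> borel_measurable N"
  shows "(\<lambda>(t, v). flow t f v) \<in> borel_measurable (borel \<Otimes>\<^sub>M N)"
proof -
  have "(\<lambda>p. SUP n. (\<lambda>(t, v). iter f n t v) p) \<in> borel_measurable (borel \<Otimes>\<^sub>M N)"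
    by measurable
  then show ?thesis by (simp add: flow_def split_beta')
qed

lemma meas2_fixed:
  assumes "(\<lambda>(t, v). u t v) \<in> borel_measurable (borel \<Otimes>\<^sub>M N)"
  shows "u t \<in> borel_measurable N" "(\<lambda>t. u t v) \<in> borel_measurable borel"
  using measurable_compose[OF measurable_Pair1' assms, of t]
    measurable_compose[OF measurable_Pair2' assms, of v] by auto

lemmas free_meas [measurable] = meas2_fixed(1)[OF free_meas2]
lemmas iter_meas [measurable] = meas2_fixed(1)[OF iter_meas2]
lemmas flow_meas [measurable] = meas2_fixed(1)[OF flow_meas2]
lemma duhamel_mono: "(\<And>s x. 0 \<le> s \<Longrightarrow> s \<le> t \<Longrightarrow> u s x \<le> u' s x) \<Longrightarrow> duhamel u t v \<le> duhamel u' t v"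
  unfolding duhamel_def
  by (intro nn_integral_mono) (auto simp: indicator_def intro!: mult_left_mono gainK_mono)

lemma iter_Suc_mono: "iter f n t v \<le> iter f (Suc n) t v"
proof (induction n arbitrary: t v)
  case (Suc n)
  then show ?case by (auto intro!: add_left_mono duhamel_mono)
qed simp

lemma incseq_iter: "incseq (\<lambda>n. iter f n t v)"
  by (rule incseq_SucI) (rule iter_Suc_mono)

lemma gainK_iter_meas [measurable]:
  assumes [measurable]: "f \<in> borel_measurable N"
  shows "(\<lambda>s. gainK (iter f n s) v) \<in> borel_measurable borel"
  by (rule meas2_fixed(2)[OF gainK_meas2]) measurable

lemma gainK_flow_meas [measurable]:
  assumes [measurable]: "f \<in> borel_measurable N"
  shows "(\<lambda>s. gainK (flow s f) v) \<in> borel_measurable borel"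
  by (rule meas2_fixed(2)[OF gainK_meas2[where f = "\<lambda>s. flow s f"]]) measurable

lemma gainK_flow:
  assumes [measurable]: "f \<in> borel_measurable N"
  shows "gainK (flow s f) v = (SUP n. gainK (iter f n s) v)"
  unfolding flow_def by (rule gainK_SUP) (auto intro: incseq_iter)

lemma gainK_iter_mono: "gainK (iter f n s) v \<le> gainK (iter f (Suc n) s) v"
  by (intro gainK_mono iter_Suc_mono)

lemma incseq_gainK_iter: "incseq (\<lambda>n. gainK (iter f n s) v)"
  by (rule incseq_SucI) (rule gainK_iter_mono)

lemma flow_eq_SUP_Suc: "flow t f v = (SUP n. iter f (Suc n) t v)"
proof -
  have "iter f n t v \<le> (SUP n. iter f (Suc n) t v)" for n
    by (rule order_trans[OF iter_Suc_mono]) (rule SUP_upper2[of n], auto)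
  moreover have "iter f (Suc n) t v \<le> (SUP n. iter f n t v)" for n
    by (rule SUP_upper) simp
  ultimately show ?thesis unfolding flow_def
    by (intro antisym SUP_least)
qed

text \<open>The iterates increase, so monotone convergence applies twice, inside
  \<open>gainK\<close> and in the time integral. Both sides may be infinite.\<close>

lemma mild:
  assumes [measurable]: "f \<in> borel_measurable N"
  shows "flow t f v = free t f v + duhamel (\<lambda>s. flow s f) t v"
proof -
  have *: "duhamel (\<lambda>s. flow s f) t v = (SUP n. duhamel (iter f n) t v)"
  proof -
    have "duhamel (\<lambda>s. flow s f) t v = (\<integral>\<^sup>+s. (SUP n. ennreal (exp (- S v * (t - s))) * gainK (iter f n s) v * indicator {0..t} s) \<partial>lborel)"
      unfolding duhamel_def
      by (intro nn_integral_cong) (simp add: gainK_flow SUP_mult_left_ennreal SUP_mult_right_ennreal)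
    also have "\<dots> = (SUP n. duhamel (iter f n) t v)"
      unfolding duhamel_def
    proof (intro nn_integral_monotone_convergence_SUP)
      show "incseq (\<lambda>n s. ennreal (exp (- S v * (t - s))) * gainK (iter f n s) v * indicator {0..t} s)"
        using incseq_gainK_iter by (auto simp: incseq_def le_fun_def intro!: mult_left_mono mult_right_mono)
    qed measurable
    finally show ?thesis .
  qed
  have "flow t f v = (SUP n. free t f v + duhamel (iter f n) t v)"
    by (simp add: flow_eq_SUP_Suc)
  also have "\<dots> = free t f v + (SUP n. duhamel (iter f n) t v)"
    by (rule ennreal_SUP_add_right[symmetric]) simp
  finally show ?thesis by (simp add: *)
qed

text \<open>By induction a supersolution dominates every iterate. This comparison is the only way in
  which the flow is ever bounded from above pointwise.\<close>

lemma flow_minimal: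
  assumes "\<And>t v. 0 \<le> t \<Longrightarrow> free t f v + duhamel u t v \<le> u t v" and "0 \<le> t"
  shows "flow t f v \<le> u t v"
proof -
  have "iter f n t v \<le> u t v" if "0 \<le> t" for n t v
    using that
  proof (induction n arbitrary: t v)
    case (Suc n)
    have "iter f (Suc n) t v \<le> free t f v + duhamel u t v"
      using Suc by (auto intro!: add_left_mono duhamel_mono)
    also have "\<dots> \<le> u t v" using assms(1) Suc.prems by blast
    finally show ?case .
  qed simp
  with assms(2) show ?thesis unfolding flow_def by (auto intro: SUP_least)
qed

lemma flow_mono: "(\<And>x. f x \<le> g x) \<Longrightarrow> flow t f v \<le> flow t g v"
proof -
  assume fg: "\<And>x. f x \<le> g x"
  have "iter f n t v \<le> iter g n t v" for n t v
  proof (induction n arbitrary: t v)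
    case (Suc n)
    then show ?case using fg unfolding iter.simps free_def
      by (intro add_mono mult_left_mono duhamel_mono) auto
  qed simp
  then show ?thesis unfolding flow_def by (intro SUP_mono) auto
qed

lemma flow_add:
  assumes [measurable]: "f \<in> borel_measurable N" "g \<in> borel_measurable N"
  shows "flow t (\<lambda>x. f x + g x) v = flow t f v + flow t g v"
proof -
  have *: "iter (\<lambda>x. f x + g x) n t v = iter f n t v + iter g n t v" for n t v
  proof (induction n arbitrary: t v)
    case (Suc n)
    have "iter (\<lambda>x. f x + g x) n = (\<lambda>t v. iter f n t v + iter g n t v)"
      using Suc by auto
    then have "duhamel (iter (\<lambda>x. f x + g x) n) t v = duhamel (iter f n) t v + duhamel (iter g n) t v"
      by (simp add: duhamel_def gainK_add distrib_left distrib_right nn_integral_add)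
    then show ?case by (simp add: free_def distrib_left add_ac)
  qed simp
  show ?thesis unfolding flow_def *
    by (intro ennreal_SUP_add incseq_iter)
qed

lemma flow_cmult:
  assumes [measurable]: "f \<in> borel_measurable N"
  shows "flow t (\<lambda>x. c * f x) v = c * flow t f v"
proof -
  have *: "iter (\<lambda>x. c * f x) n t v = c * iter f n t v" for n t v
  proof (induction n arbitrary: t v)
    case (Suc n)
    have "iter (\<lambda>x. c * f x) n = (\<lambda>t v. c * iter f n t v)"
      using Suc by auto
    then have "duhamel (iter (\<lambda>x. c * f x) n) t v = c * duhamel (iter f n) t v"
      by (simp add: duhamel_def gainK_cmult nn_integral_cmult[symmetric] mult_ac)
    then show ?case by (simp add: free_def distrib_left mult_ac)
  qed simp
  show ?thesis unfolding flow_def * by (simp add: SUP_mult_left_ennreal)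
qed

lemma flow_0 [simp]:
  assumes [measurable]: "f \<in> borel_measurable N"
  shows "flow 0 f v = f v"
proof -
  have "duhamel u 0 v = 0" for u
  proof -
    have "duhamel u 0 v = (\<integral>\<^sup>+s. 0 \<partial>(lborel :: real measure))"
      unfolding duhamel_def using AE_lborel_singleton[of 0]
      by (intro nn_integral_cong_AE) (auto simp: indicator_def elim!: eventually_mono)
    then show ?thesis by simp
  qed
  then show ?thesis by (simp add: mild free_def)
qed

lemma free_le: "0 \<le> t \<Longrightarrow> free t f v \<le> f v"
  using mult_right_mono[of "ennreal (exp (- S v * t))" 1 "f v"] S_nonneg[of v]
  by (simp add: free_def ennreal_le_1)

lemma duhamel_le: "duhamel u t v \<le> (\<integral>\<^sup>+s\<in>{0..t}. gainK (u s) v \<partial>lborel)"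
  unfolding duhamel_def
proof (intro nn_integral_mono)
  fix s
  show "ennreal (exp (- S v * (t - s))) * gainK (u s) v * indicator {0..t} s \<le> gainK (u s) v * indicator {0..t} s"
    using mult_right_mono[of "ennreal (exp (- S v * (t - s)))" 1 "gainK (u s) v"] S_nonneg[of v]
    by (auto simp: indicator_def ennreal_le_1)
qed

section \<open>The time-integrated form of the mild equation\<close>

lemma S_integral_free:
  assumes [measurable]: "f \<in> borel_measurable N" and "0 \<le> t"
  shows "ennreal (S v) * (\<integral>\<^sup>+s\<in>{0..t}. free s f v \<partial>lborel) + free t f v = f v"
proof -
  have "(\<integral>\<^sup>+s\<in>{0..t}. free s f v \<partial>lborel)
      = (\<integral>\<^sup>+s\<in>{0..t}. ennreal (exp (- S v * (s - 0))) \<partial>lborel) * f v"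
    by (subst nn_integral_multc[symmetric]) (auto simp: free_def mult_ac)
  then have "ennreal (S v) * (\<integral>\<^sup>+s\<in>{0..t}. free s f v \<partial>lborel)
      = ennreal (1 - exp (- S v * (t - 0))) * f v"
    using nn_integral_Icc_exp[of "S v" 0 t] S_nonneg[of v] assms(2) by (simp add: mult.assoc[symmetric])
  moreover have "ennreal (1 - exp (- S v * (t - 0))) + ennreal (exp (- S v * t)) = 1"
    using S_nonneg[of v] assms(2) by (subst ennreal_plus[symmetric]) auto
  ultimately show ?thesis unfolding free_def by (metis distrib_right mult_1)
qed

lemma S_integral_duhamel:
  assumes [measurable]: "(\<lambda>(t, v). u t v) \<in> borel_measurable (borel \<Otimes>\<^sub>M N)"
  shows "ennreal (S v) * (\<integral>\<^sup>+s\<in>{0..t}. duhamel u s v \<partial>lborel)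
    = (\<integral>\<^sup>+r\<in>{0..t}. ennreal (1 - exp (- S v * (t - r))) * gainK (u r) v \<partial>lborel)"
  unfolding duhamel_def
  using meas2_fixed(2)[OF gainK_meas2[OF assms]] S_nonneg[of v]
  by (intro nn_integral_convolution_exp)

text \<open>The weights exp(-S (t - s)) in Duhamel's term and 1 - exp(-S (t - s)) in its time
  integral add up to 1, so the exponentials disappear. The gain is taken from an arbitrary
  \<open>u\<close>, which covers both a Picard step, with \<open>u\<close> the previous iterate, and
  the fixed point.\<close>

lemma integrated_step:
  assumes [measurable]: "f \<in> borel_measurable N"
    and u [measurable]: "(\<lambda>(t, v). u t v) \<in> borel_measurable (borel \<Otimes>\<^sub>M N)" and "0 \<le> t"
  shows "(free t f v + duhamel u t v)
      + ennreal (S v) * (\<integral>\<^sup>+s\<in>{0..t}. free s f v + duhamel u s v \<partial>lborel)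
    = f v + (\<integral>\<^sup>+s\<in>{0..t}. gainK (u s) v \<partial>lborel)"
proof -
  have [measurable]: "(\<lambda>s. gainK (u s) v) \<in> borel_measurable borel"
    "(\<lambda>s. free s f v) \<in> borel_measurable borel" "(\<lambda>s. duhamel u s v) \<in> borel_measurable borel"
    using meas2_fixed(2)[OF gainK_meas2[OF u]] meas2_fixed(2)[OF free_meas2[OF assms(1)]]
      meas2_fixed(2)[OF duhamel_meas2[OF u]] by auto
  have "duhamel u t v + ennreal (S v) * (\<integral>\<^sup>+s\<in>{0..t}. duhamel u s v \<partial>lborel)
      = (\<integral>\<^sup>+s. (ennreal (exp (- S v * (t - s))) + ennreal (1 - exp (- S v * (t - s)))) * gainK (u s) v * indicator {0..t} s \<partial>lborel)"
    unfolding S_integral_duhamel[OF u] unfolding duhamel_def distrib_right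
    by (subst nn_integral_add) auto
  also have "\<dots> = (\<integral>\<^sup>+s\<in>{0..t}. gainK (u s) v \<partial>lborel)"
  proof (intro nn_integral_cong)
    fix s
    have "ennreal (exp (- S v * (t - s))) + ennreal (1 - exp (- S v * (t - s))) = 1" if "s \<le> t"
      using that S_nonneg[of v] by (subst ennreal_plus[symmetric]) auto
    then show "(ennreal (exp (- S v * (t - s))) + ennreal (1 - exp (- S v * (t - s)))) * gainK (u s) v * indicator {0..t} s = gainK (u s) v * indicator {0..t} s"
      by (auto simp: indicator_def)
  qed
  finally have 1: "duhamel u t v + ennreal (S v) * (\<integral>\<^sup>+s\<in>{0..t}. duhamel u s v \<partial>lborel)
      = (\<integral>\<^sup>+s\<in>{0..t}. gainK (u s) v \<partial>lborel)" .
  have "(\<integral>\<^sup>+s\<in>{0..t}. free s f v + duhamel u s v \<partial>lborel)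
      = (\<integral>\<^sup>+s\<in>{0..t}. free s f v \<partial>lborel) + (\<integral>\<^sup>+s\<in>{0..t}. duhamel u s v \<partial>lborel)"
    by (simp add: distrib_right nn_integral_add)
  then show ?thesis
    using S_integral_free[OF assms(1,3), of v, symmetric] 1[symmetric] by (simp only: distrib_left add_ac)
qed

lemma integrated:
  assumes [measurable]: "f \<in> borel_measurable N" and "0 \<le> t"
  shows "flow t f v + ennreal (S v) * (\<integral>\<^sup>+s\<in>{0..t}. flow s f v \<partial>lborel)
    = f v + (\<integral>\<^sup>+s\<in>{0..t}. gainK (flow s f) v \<partial>lborel)"
  using integrated_step[OF assms(1) flow_meas2[OF assms(1)] assms(2), of v] by (simp add: mild[symmetric])

end

lemma AE_eq_of_le_nn_integral_eq:
  assumes [measurable]: "f \<in> borel_measurable M" "g \<in> borel_measurable M"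
    and "\<And>x. f x \<le> g x" and "(\<integral>\<^sup>+x. f x \<partial>M) = (\<integral>\<^sup>+x. g x \<partial>M)" "(\<integral>\<^sup>+x. f x \<partial>M) < \<infinity>"
  shows "AE x in M. f x = g x"
proof -
  have "(\<integral>\<^sup>+x. g x - f x \<partial>M) = (\<integral>\<^sup>+x. g x \<partial>M) - (\<integral>\<^sup>+x. f x \<partial>M)"
    using assms by (intro nn_integral_diff) auto
  also have "\<dots> = 0" using assms(4,5) by simp
  finally have "AE x in M. g x - f x = 0"
    by (simp add: nn_integral_0_iff_AE)
  then show ?thesis
  proof eventually_elim
    case (elim x)
    then show ?case using assms(3)[of x] by (metis add.right_neutral diff_add_cancel_ennreal add.commute)
  qed
qed

context jump_process
begin

section \<open>Weighted balances: mass conservation and the Lyapunov estimate in time\<close>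

definition wnorm :: "('a \<Rightarrow> ennreal) \<Rightarrow> ennreal" where
  "wnorm f = (\<integral>\<^sup>+v. ennreal (W v) * f v \<partial>N)"

definition accum :: "('a \<Rightarrow> real) \<Rightarrow> (real \<Rightarrow> 'a \<Rightarrow> ennreal) \<Rightarrow> real \<Rightarrow> ennreal" where
  "accum \<phi> u t = (\<integral>\<^sup>+s\<in>{0..t}. (\<integral>\<^sup>+v. ennreal (\<phi> v) * u s v \<partial>N) \<partial>lborel)"

lemma nn_integral_time_swap:
  assumes u [measurable]: "(\<lambda>(t, v). u t v) \<in> borel_measurable (borel \<Otimes>\<^sub>M N)"
    and [measurable]: "\<phi> \<in> borel_measurable N"
  shows "(\<integral>\<^sup>+v. \<phi> v * (\<integral>\<^sup>+s\<in>{0..t}. u s v \<partial>lborel) \<partial>N) = (\<integral>\<^sup>+s\<in>{0..t}. (\<integral>\<^sup>+v. \<phi> v * u s v \<partial>N) \<partial>(lborel :: real measure))"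
proof -
  note [measurable] = meas2_fixed[OF u]
  have "(\<integral>\<^sup>+v. \<phi> v * (\<integral>\<^sup>+s\<in>{0..t}. u s v \<partial>lborel) \<partial>N) = (\<integral>\<^sup>+v. \<integral>\<^sup>+s. \<phi> v * (u s v * indicator {0..t} s) \<partial>lborel \<partial>N)"
    by (simp add: nn_integral_cmult)
  also have "\<dots> = (\<integral>\<^sup>+s. \<integral>\<^sup>+v. \<phi> v * (u s v * indicator {0..t} s) \<partial>N \<partial>lborel)"
    by (subst pair.Fubini') auto
  also have "\<dots> = (\<integral>\<^sup>+s\<in>{0..t}. (\<integral>\<^sup>+v. \<phi> v * u s v \<partial>N) \<partial>lborel)"
    by (simp add: nn_integral_multc mult.assoc[symmetric])
  finally show ?thesis .
qed

lemma nn_integral_time_meas [measurable]: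
  assumes u [measurable]: "(\<lambda>(t, v). u t v) \<in> borel_measurable (borel \<Otimes>\<^sub>M N)"
  shows "(\<lambda>v. \<integral>\<^sup>+s\<in>{0..t}. u s v \<partial>(lborel :: real measure)) \<in> borel_measurable N"
  by measurable

text \<open>\<open>integrated_step\<close> tested against \<phi>. The loss is measured by the new
  function \<open>y\<close>, the gain by the old one \<open>u\<close>; for the iterates this shift
  of the index is what makes the induction on the bounds possible.\<close>

lemma weighted_step:
  assumes [measurable]: "f \<in> borel_measurable N" "\<phi> \<in> borel_measurable N"
    and u [measurable]: "(\<lambda>(t, v). u t v) \<in> borel_measurable (borel \<Otimes>\<^sub>M N)"
    and y [measurable]: "(\<lambda>(t, v). y t v) \<in> borel_measurable (borel \<Otimes>\<^sub>M N)"
    and y_eq: "\<And>t v. y t v = free t f v + duhamel u t v"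
    and "0 \<le> t" and phi_nonneg: "\<And>v. 0 \<le> \<phi> v"
  shows "(\<integral>\<^sup>+v. ennreal (\<phi> v) * y t v \<partial>N) + accum (\<lambda>v. S v * \<phi> v) y t
    = (\<integral>\<^sup>+v. ennreal (\<phi> v) * f v \<partial>N) + accum \<phi> (\<lambda>s. gainK (u s)) t"
proof -
  note [measurable] = meas2_fixed[OF u] meas2_fixed[OF y]
  note gm [measurable] = gainK_meas2[OF u]
  have S\<phi>: "ennreal (S v * \<phi> v) = ennreal (\<phi> v) * ennreal (S v)" for v
    using S_nonneg phi_nonneg by (simp add: ennreal_mult mult.commute)
  have "accum (\<lambda>v. S v * \<phi> v) y t = (\<integral>\<^sup>+v. ennreal (\<phi> v) * ennreal (S v) * (\<integral>\<^sup>+s\<in>{0..t}. y s v \<partial>lborel) \<partial>N)"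
    unfolding accum_def S\<phi> by (rule nn_integral_time_swap[OF y, symmetric]) measurable
  moreover have "accum \<phi> (\<lambda>s. gainK (u s)) t = (\<integral>\<^sup>+v. ennreal (\<phi> v) * (\<integral>\<^sup>+s\<in>{0..t}. gainK (u s) v \<partial>lborel) \<partial>N)"
    unfolding accum_def by (rule nn_integral_time_swap[OF gm, symmetric]) measurable
  moreover have "y t v + ennreal (S v) * (\<integral>\<^sup>+s\<in>{0..t}. y s v \<partial>lborel) = f v + (\<integral>\<^sup>+s\<in>{0..t}. gainK (u s) v \<partial>lborel)" for v
    using integrated_step[OF assms(1) u \<open>0 \<le> t\<close>, of v] by (simp add: y_eq)
  then have "ennreal (\<phi> v) * y t v + ennreal (\<phi> v) * ennreal (S v) * (\<integral>\<^sup>+s\<in>{0..t}. y s v \<partial>lborel)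
      = ennreal (\<phi> v) * f v + ennreal (\<phi> v) * (\<integral>\<^sup>+s\<in>{0..t}. gainK (u s) v \<partial>lborel)" for v
    by (simp add: distrib_left[symmetric] mult.assoc)
  then have "(\<integral>\<^sup>+v. ennreal (\<phi> v) * y t v + ennreal (\<phi> v) * ennreal (S v) * (\<integral>\<^sup>+s\<in>{0..t}. y s v \<partial>lborel) \<partial>N)
      = (\<integral>\<^sup>+v. ennreal (\<phi> v) * f v + ennreal (\<phi> v) * (\<integral>\<^sup>+s\<in>{0..t}. gainK (u s) v \<partial>lborel) \<partial>N)"
    by simp
  ultimately show ?thesis by (simp add: nn_integral_add)
qed

lemma iter_weighted:
  assumes "f \<in> borel_measurable N" "\<phi> \<in> borel_measurable N" and "0 \<le> t" and "\<And>v. 0 \<le> \<phi> v"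
  shows "(\<integral>\<^sup>+v. ennreal (\<phi> v) * iter f (Suc n) t v \<partial>N) + accum (\<lambda>v. S v * \<phi> v) (iter f (Suc n)) t
    = (\<integral>\<^sup>+v. ennreal (\<phi> v) * f v \<partial>N) + accum \<phi> (\<lambda>s. gainK (iter f n s)) t"
  by (rule weighted_step[OF assms(1,2) iter_meas2[OF assms(1)] iter_meas2[OF assms(1)] _ assms(3,4)]) simp

lemma accum_mono: "(\<And>s v. 0 \<le> s \<Longrightarrow> s \<le> t \<Longrightarrow> u s v \<le> u' s v) \<Longrightarrow> accum \<phi> u t \<le> accum \<phi> u' t"
  unfolding accum_def
  by (intro nn_integral_mono) (auto simp: indicator_def intro!: nn_integral_mono mult_left_mono)

lemma accum_gainK_mass:
  assumes u: "(\<lambda>(t, v). u t v) \<in> borel_measurable (borel \<Otimes>\<^sub>M N)"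
  shows "accum (\<lambda>_. 1) (\<lambda>s. gainK (u s)) t = accum S u t"
  unfolding accum_def using meas2_fixed(1)[OF u] by (simp add: nn_integral_gainK_mass)

lemma accum_gainK_W:
  assumes u [measurable]: "(\<lambda>(t, v). u t v) \<in> borel_measurable (borel \<Otimes>\<^sub>M N)"
  shows "accum W (\<lambda>s. gainK (u s)) t \<le> ennreal th * accum (\<lambda>v. S v * W v) u t + ennreal C * accum (\<lambda>_. 1) u t"
proof -
  note [measurable] = meas2_fixed(1)[OF u]
  have "accum W (\<lambda>s. gainK (u s)) t
    \<le> (\<integral>\<^sup>+s\<in>{0..t}. ennreal th * (\<integral>\<^sup>+w. ennreal (S w * W w) * u s w \<partial>N) + ennreal C * (\<integral>\<^sup>+w. ennreal 1 * u s w \<partial>N) \<partial>lborel)"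
    unfolding accum_def
    by (intro nn_integral_mono mult_right_mono) (auto intro!: order_trans[OF nn_integral_gainK_W])
  also have "\<dots> = ennreal th * accum (\<lambda>v. S v * W v) u t + ennreal C * accum (\<lambda>_. 1) u t"
    unfolding accum_def by (simp add: distrib_right nn_integral_add nn_integral_cmult mult.assoc)
  finally show ?thesis .
qed

lemma accum_SUP:
  assumes [measurable]: "f \<in> borel_measurable N" "\<phi> \<in> borel_measurable N"
  shows "accum \<phi> (\<lambda>s. flow s f) t = (SUP n. accum \<phi> (iter f n) t)"
proof -
  have "(\<integral>\<^sup>+v. ennreal (\<phi> v) * flow s f v \<partial>N) = (SUP n. \<integral>\<^sup>+v. ennreal (\<phi> v) * iter f n s v \<partial>N)" for s
    unfolding flow_def SUP_mult_left_ennreal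
    by (intro nn_integral_monotone_convergence_SUP)
      (auto simp: incseq_def le_fun_def intro!: mult_left_mono incseqD[OF incseq_iter])
  then have "accum \<phi> (\<lambda>s. flow s f) t = (\<integral>\<^sup>+s. (SUP n. (\<integral>\<^sup>+v. ennreal (\<phi> v) * iter f n s v \<partial>N) * indicator {0..t} s) \<partial>lborel)"
    unfolding accum_def by (simp add: SUP_mult_right_ennreal)
  also have "\<dots> = (SUP n. accum \<phi> (iter f n) t)"
    unfolding accum_def
    by (intro nn_integral_monotone_convergence_SUP)
      (auto simp: incseq_def le_fun_def intro!: mult_right_mono nn_integral_mono mult_left_mono incseqD[OF incseq_iter])
  finally show ?thesis .
qed

text \<open>By \<open>k_mass\<close> the gain of iterate n + 1 is the accumulated loss of iterate n,
  and this is at most the loss of iterate n + 1. The loss can be cancelled because it is finite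
  along the iterates, by induction; for the flow itself it is not yet known to be finite.\<close>

lemma iter_mass:
  assumes [measurable]: "f \<in> borel_measurable N" and fin: "(\<integral>\<^sup>+v. f v \<partial>N) < \<infinity>" and "0 \<le> t"
  shows "(\<integral>\<^sup>+v. iter f n t v \<partial>N) \<le> (\<integral>\<^sup>+v. f v \<partial>N)"
proof -
  have step: "(\<integral>\<^sup>+v. iter f (Suc n) t v \<partial>N) + accum S (iter f (Suc n)) t = (\<integral>\<^sup>+v. f v \<partial>N) + accum S (iter f n) t" for n
    using iter_weighted[of f "\<lambda>_. 1" t n] accum_gainK_mass[OF iter_meas2, of f n t] assms by simp
  have fin_acc: "accum S (iter f n) t < \<infinity>" for n
  proof (induction n)
    case (Suc n)
    have "accum S (iter f (Suc n)) t \<le> (\<integral>\<^sup>+v. f v \<partial>N) + accum S (iter f n) t"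
      by (subst step[symmetric]) simp
    also have "\<dots> < \<infinity>" using fin Suc by simp
    finally show ?case .
  qed (simp add: accum_def)
  have "(\<integral>\<^sup>+v. iter f (Suc n) t v \<partial>N) \<le> (\<integral>\<^sup>+v. f v \<partial>N)"
  proof (rule ennreal_le_of_add_le[OF _ fin_acc])
    have "accum S (iter f n) t \<le> accum S (iter f (Suc n)) t"
      by (intro accum_mono iter_Suc_mono)
    then show "(\<integral>\<^sup>+v. iter f (Suc n) t v \<partial>N) + accum S (iter f (Suc n)) t \<le> (\<integral>\<^sup>+v. f v \<partial>N) + accum S (iter f (Suc n)) t"
      unfolding step by (intro add_left_mono)
  qed
  then show ?thesis
    by (rule order_trans[OF nn_integral_mono[OF iter_Suc_mono]])
qed

lemma flow_mass_le:
  assumes [measurable]: "f \<in> borel_measurable N" and fin: "(\<integral>\<^sup>+v. f v \<partial>N) < \<infinity>" and "0 \<le> t"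
  shows "(\<integral>\<^sup>+v. flow t f v \<partial>N) \<le> (\<integral>\<^sup>+v. f v \<partial>N)"
proof -
  have "(\<integral>\<^sup>+v. flow t f v \<partial>N) = (SUP n. \<integral>\<^sup>+v. iter f n t v \<partial>N)"
    unfolding flow_def
    by (intro nn_integral_monotone_convergence_SUP) (auto simp: incseq_def le_fun_def intro!: incseqD[OF incseq_iter])
  then show ?thesis using iter_mass[OF assms] by (auto intro: SUP_least)
qed

lemma nn_integral_le_wnorm: "(\<integral>\<^sup>+v. f v \<partial>N) \<le> wnorm f"
  unfolding wnorm_def
proof (intro nn_integral_mono)
  fix v
  show "f v \<le> ennreal (W v) * f v"
    using mult_right_mono[of 1 "ennreal (W v)" "f v"] W_ge_1[of v] by (simp add: ennreal_ge_1)
qed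

lemma nn_integral_Icc_const: "0 \<le> t \<Longrightarrow> (\<integral>\<^sup>+s\<in>{0..t}. c \<partial>lborel) = ennreal t * c"
  by (simp add: nn_integral_cmult_indicator mult.commute)

lemma accum_mass_le:
  assumes "\<And>s. 0 \<le> s \<Longrightarrow> s \<le> t \<Longrightarrow> (\<integral>\<^sup>+v. u s v \<partial>N) \<le> c" and "0 \<le> t"
  shows "accum (\<lambda>_. 1) u t \<le> ennreal t * c"
proof -
  have "accum (\<lambda>_. 1) u t \<le> (\<integral>\<^sup>+s\<in>{0..t}. c \<partial>lborel)"
    unfolding accum_def using assms by (intro nn_integral_mono) (auto simp: indicator_def)
  then show ?thesis using nn_integral_Icc_const[OF assms(2)] by simp
qed

text \<open>One step replaces a bound x by B + \<open>th\<close> x, where B is the bracket on the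
  right. Hence the fixed point B / (1 - \<open>th\<close>) bounds all iterates, uniformly in
  \<open>n\<close>.\<close>

lemma iter_rate:
  assumes [measurable]: "f \<in> borel_measurable N" and fin: "(\<integral>\<^sup>+v. f v \<partial>N) < \<infinity>" and "0 \<le> t"
  shows "accum (\<lambda>v. S v * W v) (iter f n) t \<le> ennreal (1 / (1 - th)) * (wnorm f + ennreal (C * t) * (\<integral>\<^sup>+v. f v \<partial>N))"
    (is "_ \<le> ennreal (1 / (1 - th)) * ?B")
proof (induction n)
  case (Suc n)
  have "accum (\<lambda>v. S v * W v) (iter f (Suc n)) t \<le> wnorm f + accum W (\<lambda>s. gainK (iter f n s)) t"
    unfolding wnorm_def using assms W_nonneg
    by (subst iter_weighted[of f W t n, symmetric]) auto
  also have "\<dots> \<le> wnorm f + (ennreal th * accum (\<lambda>v. S v * W v) (iter f n) t + ennreal C * (ennreal t * (\<integral>\<^sup>+v. f v \<partial>N)))"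
    using assms iter_mass[OF assms(1,2)]
    by (intro add_left_mono order_trans[OF accum_gainK_W] mult_left_mono accum_mass_le) auto
  also have "\<dots> = ?B + ennreal th * accum (\<lambda>v. S v * W v) (iter f n) t"
    using C_nonneg assms(3) by (simp add: ennreal_mult mult.assoc add_ac)
  also have "\<dots> \<le> ?B + ennreal th * (ennreal (1 / (1 - th)) * ?B)"
    using Suc by (intro add_left_mono mult_left_mono) auto
  also have "\<dots> = (1 + ennreal th * ennreal (1 / (1 - th))) * ?B"
    by (simp only: distrib_right mult_1 mult.assoc)
  also have "1 + ennreal th * ennreal (1 / (1 - th)) = ennreal (1 + th * (1 / (1 - th)))"
    using th by (simp add: ennreal_mult[symmetric])
  also have "1 + th * (1 / (1 - th)) = 1 / (1 - th)" using th by (simp add: field_simps)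
  finally show ?case .
qed (simp add: accum_def)

lemma flow_rate:
  assumes "f \<in> borel_measurable N" and "(\<integral>\<^sup>+v. f v \<partial>N) < \<infinity>" and "0 \<le> t"
  shows "accum (\<lambda>v. S v * W v) (\<lambda>s. flow s f) t \<le> ennreal (1 / (1 - th)) * (wnorm f + ennreal (C * t) * (\<integral>\<^sup>+v. f v \<partial>N))"
  using iter_rate[OF assms] assms(1) by (subst accum_SUP) (auto intro: SUP_least)

lemma flow_rate_finite:
  assumes "f \<in> borel_measurable N" and "wnorm f < \<infinity>" and "0 \<le> t"
  shows "accum (\<lambda>v. S v * W v) (\<lambda>s. flow s f) t < \<infinity>"
proof -
  have "(\<integral>\<^sup>+v. f v \<partial>N) < \<infinity>" using nn_integral_le_wnorm assms(2) by (rule le_less_trans)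
  with assms(2) show ?thesis
    by (intro le_less_trans[OF flow_rate[OF assms(1) _ assms(3)]]) (auto simp: ennreal_mult_less_top)
qed

lemma flow_weighted:
  assumes "f \<in> borel_measurable N" "\<phi> \<in> borel_measurable N" and "0 \<le> t" and "\<And>v. 0 \<le> \<phi> v"
  shows "(\<integral>\<^sup>+v. ennreal (\<phi> v) * flow t f v \<partial>N) + accum (\<lambda>v. S v * \<phi> v) (\<lambda>s. flow s f) t
    = (\<integral>\<^sup>+v. ennreal (\<phi> v) * f v \<partial>N) + accum \<phi> (\<lambda>s. gainK (flow s f)) t"
  by (intro weighted_step flow_meas2 mild assms)

text \<open>The accumulated gain in the weight \<open>W\<close> is at most the fraction
  \<open>th\<close> of the accumulated loss, plus the contribution of \<open>C\<close>. Since
  \<open>flow_rate_finite\<close> makes this fraction finite it cancels, and the fraction 1 -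
  \<open>th\<close> of the loss survives as a dissipation term, from which exponential decay is
  extracted later.\<close>

lemma flow_lyapunov:
  assumes [measurable]: "f \<in> borel_measurable N" and fin: "wnorm f < \<infinity>" and "0 \<le> t"
  shows "wnorm (flow t f) + ennreal (1 - th) * accum (\<lambda>v. S v * W v) (\<lambda>s. flow s f) t
    \<le> wnorm f + ennreal (C * t) * (\<integral>\<^sup>+v. f v \<partial>N)"
proof (rule ennreal_le_of_add_le)
  let ?a = "accum (\<lambda>v. S v * W v) (\<lambda>s. flow s f) t"
  have fin1: "(\<integral>\<^sup>+v. f v \<partial>N) < \<infinity>" using nn_integral_le_wnorm assms(2) by (rule le_less_trans)
  have "ennreal (1 - th) + ennreal th = 1"
    using th by (subst ennreal_plus[symmetric]) auto
  then have "wnorm (flow t f) + ennreal (1 - th) * ?a + ennreal th * ?a = wnorm (flow t f) + ?a"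
    by (simp only: add.assoc distrib_right[symmetric] mult_1)
  also have "\<dots> = wnorm f + accum W (\<lambda>s. gainK (flow s f)) t"
    unfolding wnorm_def using assms W_nonneg by (intro flow_weighted) auto
  also have "\<dots> \<le> wnorm f + (ennreal th * ?a + ennreal C * (ennreal t * (\<integral>\<^sup>+v. f v \<partial>N)))"
    using assms flow_mass_le[OF assms(1) fin1]
    by (intro add_left_mono order_trans[OF accum_gainK_W] mult_left_mono accum_mass_le) auto
  also have "\<dots> = wnorm f + ennreal (C * t) * (\<integral>\<^sup>+v. f v \<partial>N) + ennreal th * ?a"
    using C_nonneg assms(3) by (simp add: ennreal_mult mult.assoc add_ac)
  finally show "wnorm (flow t f) + ennreal (1 - th) * ?a + ennreal th * ?a
    \<le> wnorm f + ennreal (C * t) * (\<integral>\<^sup>+v. f v \<partial>N) + ennreal th * ?a" .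
  show "ennreal th * ?a < \<infinity>" using flow_rate_finite[OF assms] by (simp add: ennreal_mult_less_top)
qed

lemma flow_wnorm_le:
  assumes "f \<in> borel_measurable N" and "wnorm f < \<infinity>" and "0 \<le> t"
  shows "wnorm (flow t f) \<le> ennreal (1 + C * t) * wnorm f"
proof -
  have "wnorm (flow t f) \<le> wnorm f + ennreal (C * t) * (\<integral>\<^sup>+v. f v \<partial>N)"
    using flow_lyapunov[OF assms] by (rule order_trans[rotated]) simp
  also have "\<dots> \<le> wnorm f + ennreal (C * t) * wnorm f"
    by (intro add_left_mono mult_left_mono nn_integral_le_wnorm) simp
  also have "\<dots> = ennreal (1 + C * t) * wnorm f"
    using C_nonneg assms(3) by (simp add: ennreal_plus distrib_right)
  finally show ?thesis .
qed

text \<open>Accumulated gain and loss are the same quantity \<open>accum S\<close>, but they cancel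
  only if it is finite, which follows from \<open>flow_rate_finite\<close> because \<open>W\<close>
  is at least 1. Otherwise mass could be lost through infinitely many jumps in finite time, and only
  \<open>flow_mass_le\<close> would remain.\<close>

lemma flow_mass:
  assumes [measurable]: "f \<in> borel_measurable N" and fin: "wnorm f < \<infinity>" and "0 \<le> t"
  shows "(\<integral>\<^sup>+v. flow t f v \<partial>N) = (\<integral>\<^sup>+v. f v \<partial>N)"
proof -
  have "accum S (\<lambda>s. flow s f) t \<le> accum (\<lambda>v. S v * W v) (\<lambda>s. flow s f) t"
    unfolding accum_def using W_ge_1 S_nonneg
    by (intro nn_integral_mono mult_right_mono ennreal_leI) (use mult_left_mono[OF W_ge_1 S_nonneg] in auto)
  then have "accum S (\<lambda>s. flow s f) t < \<infinity>" using flow_rate_finite[OF assms] by (rule le_less_trans)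
  moreover have "(\<integral>\<^sup>+v. flow t f v \<partial>N) + accum S (\<lambda>s. flow s f) t = (\<integral>\<^sup>+v. f v \<partial>N) + accum S (\<lambda>s. flow s f) t"
    using flow_weighted[of f "\<lambda>_. 1" t] accum_gainK_mass[OF flow_meas2, of f t] assms by simp
  ultimately show ?thesis
    by (auto simp: add.commute[of _ "accum S (\<lambda>s. flow s f) t"] ennreal_add_left_cancel)
qed

text \<open>The shifted path t -> \<open>flow (s + t) f\<close> solves the mild equation with
  initial value \<open>flow s f\<close>: the time integral in Duhamel's formula is cut at time
  \<open>s\<close>. Minimality of the flow gives the inequality.\<close>

lemma flow_flow_le:
  assumes [measurable]: "f \<in> borel_measurable N" and "0 \<le> s" "0 \<le> t"
  shows "flow t (flow s f) v \<le> flow (s + t) f v"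
proof (rule flow_minimal[where u = "\<lambda>t. flow (s + t) f"])
  fix t v assume "0 \<le> (t::real)"
  have e: "free (s + t) f v = ennreal (exp (- S v * t)) * free s f v" for v
  proof -
    have "exp (- S v * (s + t)) = exp (- S v * t) * exp (- S v * s)"
      by (simp add: exp_add[symmetric] algebra_simps)
    then show ?thesis by (simp add: free_def ennreal_mult mult.assoc)
  qed
  have "duhamel (\<lambda>s. flow s f) (s + t) v
      = ennreal (exp (- S v * t)) * duhamel (\<lambda>s. flow s f) s v + duhamel (\<lambda>t. flow (s + t) f) t v"
  proof -
    have e2: "ennreal (exp (- S v * (s + t - r))) = ennreal (exp (- S v * t)) * ennreal (exp (- S v * (s - r)))" for r
    proof -
      have "exp (- S v * (s + t - r)) = exp (- S v * t) * exp (- S v * (s - r))"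
        by (simp add: exp_add[symmetric] algebra_simps)
      then show ?thesis by (simp add: ennreal_mult)
    qed
    have "duhamel (\<lambda>s. flow s f) (s + t) v
        = (\<integral>\<^sup>+r\<in>{0..s}. ennreal (exp (- S v * (s + t - r))) * gainK (flow r f) v \<partial>lborel)
          + (\<integral>\<^sup>+r\<in>{0..t}. ennreal (exp (- S v * (s + t - (s + r)))) * gainK (flow (s + r) f) v \<partial>lborel)"
      unfolding duhamel_def using \<open>0 \<le> s\<close> \<open>0 \<le> t\<close> by (intro nn_integral_Icc_split) measurable
    moreover have "(\<integral>\<^sup>+r\<in>{0..s}. ennreal (exp (- S v * (s + t - r))) * gainK (flow r f) v \<partial>lborel)
        = ennreal (exp (- S v * t)) * duhamel (\<lambda>s. flow s f) s v"
      unfolding e2 duhamel_def by (subst nn_integral_cmult[symmetric]) (auto simp: mult.assoc)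
    moreover have "(\<integral>\<^sup>+r\<in>{0..t}. ennreal (exp (- S v * (s + t - (s + r)))) * gainK (flow (s + r) f) v \<partial>lborel)
        = duhamel (\<lambda>t. flow (s + t) f) t v" unfolding duhamel_def by simp
    ultimately show ?thesis by simp
  qed
  then have "free t (flow s f) v + duhamel (\<lambda>t. flow (s + t) f) t v = free (s + t) f v + duhamel (\<lambda>s. flow s f) (s + t) v"
    by (simp add: e mild[OF assms(1), of s] free_def[of t] distrib_left add_ac)
  also have "\<dots> = flow (s + t) f v" by (rule mild[OF assms(1), symmetric])
  finally show "free t (flow s f) v + duhamel (\<lambda>t. flow (s + t) f) t v \<le> flow (s + t) f v" by simp
qed fact

lemma wnorm_flow_finite:
  assumes "f \<in> borel_measurable N" and "wnorm f < \<infinity>" and "0 \<le> t"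
  shows "wnorm (flow t f) < \<infinity>"
  using assms(2) by (intro le_less_trans[OF flow_wnorm_le[OF assms]]) (auto simp: ennreal_mult_less_top)

lemma flow_semigroup:
  assumes [measurable]: "f \<in> borel_measurable N" and "wnorm f < \<infinity>" and "0 \<le> s" "0 \<le> t"
  shows "AE v in N. flow t (flow s f) v = flow (s + t) f v"
proof (rule AE_eq_of_le_nn_integral_eq)
  have fin1: "(\<integral>\<^sup>+v. f v \<partial>N) < \<infinity>" using nn_integral_le_wnorm assms(2) by (rule le_less_trans)
  have "(\<integral>\<^sup>+v. flow t (flow s f) v \<partial>N) = (\<integral>\<^sup>+v. f v \<partial>N)"
    using assms wnorm_flow_finite[OF assms(1-3)] by (simp add: flow_mass)
  moreover have "(\<integral>\<^sup>+v. flow (s + t) f v \<partial>N) = (\<integral>\<^sup>+v. f v \<partial>N)"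
    using assms by (intro flow_mass) auto
  ultimately show "(\<integral>\<^sup>+v. flow t (flow s f) v \<partial>N) = (\<integral>\<^sup>+v. flow (s + t) f v \<partial>N)"
    "(\<integral>\<^sup>+v. flow t (flow s f) v \<partial>N) < \<infinity>" using fin1 by auto
qed (use assms in \<open>auto intro: flow_flow_le\<close>)

text \<open>The path that stays at \<open>f\<close> solves the mild equation, so the minimal
  solution lies below it; the masses agree.\<close>

lemma flow_stationary:
  assumes [measurable]: "f \<in> borel_measurable N" and fin: "wnorm f < \<infinity>" and "0 \<le> t"
    and st: "\<And>v. gainK f v = ennreal (S v) * f v"
  shows "AE v in N. flow t f v = f v"
proof (rule AE_eq_of_le_nn_integral_eq)
  show "flow t f v \<le> f v" for v
  proof (rule flow_minimal[where u = "\<lambda>t. f"])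
    fix t v assume "0 \<le> (t::real)"
    have "(\<integral>\<^sup>+s\<in>{0..t}. ennreal (exp (- S v * (t - s))) \<partial>lborel)
      = ennreal (exp (- S v * (t - t)) / S v - exp (- S v * (t - 0)) / S v)"
      using \<open>0 \<le> t\<close> S_pos[of v]
      by (intro nn_integral_FTC_Icc) (auto intro!: derivative_eq_intros)
    also have "\<dots> = ennreal ((1 - exp (- S v * t)) / S v)" by (simp add: diff_divide_distrib)
    finally have "(\<integral>\<^sup>+s\<in>{0..t}. ennreal (exp (- S v * (t - s))) \<partial>lborel) * ennreal (S v) = ennreal (1 - exp (- S v * t))"
      using S_pos[of v] \<open>0 \<le> t\<close> by (simp add: ennreal_mult''[symmetric])
    moreover have "duhamel (\<lambda>t. f) t v = (\<integral>\<^sup>+s\<in>{0..t}. ennreal (exp (- S v * (t - s))) \<partial>lborel) * (ennreal (S v) * f v)"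
      unfolding duhamel_def st by (subst nn_integral_multc[symmetric]) (auto simp: mult_ac)
    ultimately have "duhamel (\<lambda>t. f) t v = ennreal (1 - exp (- S v * t)) * f v"
      by (metis mult.assoc mult.commute)
    moreover have "ennreal (exp (- S v * t)) + ennreal (1 - exp (- S v * t)) = 1"
      using S_nonneg[of v] \<open>0 \<le> t\<close> by (subst ennreal_plus[symmetric]) auto
    ultimately show "free t f v + duhamel (\<lambda>t. f) t v \<le> f v"
      unfolding free_def by (metis distrib_right mult_1 order_refl)
  qed fact
  show "(\<integral>\<^sup>+v. flow t f v \<partial>N) = (\<integral>\<^sup>+v. f v \<partial>N)" by (rule flow_mass[OF assms(1-3)])
  then show "(\<integral>\<^sup>+v. flow t f v \<partial>N) < \<infinity>" using le_less_trans[OF nn_integral_le_wnorm[of f] fin] by simp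
qed auto

end

section \<open>The semigroup on \<open>L\<^sup>1\<close>\<close>

lemma nn_integral_tendsto_0_at_right:
  fixes u :: "real \<Rightarrow> 'b \<Rightarrow> ennreal"
  assumes [measurable]: "\<And>t. u t \<in> borel_measurable M" "w \<in> borel_measurable M"
    and le: "\<And>t x. 0 < t \<Longrightarrow> t < 1 \<Longrightarrow> u t x \<le> w x" and fin: "(\<integral>\<^sup>+x. w x \<partial>M) < \<infinity>"
    and lim: "AE x in M. ((\<lambda>t. u t x) \<longlongrightarrow> 0) (at_right 0)"
  shows "((\<lambda>t. \<integral>\<^sup>+x. u t x \<partial>M) \<longlongrightarrow> 0) (at_right 0)"
proof (rule tendsto_at_right_sequentially[of 0 1])
  fix T :: "nat \<Rightarrow> real" assume T: "\<And>n. 0 < T n" "\<And>n. T n < 1" "T \<longlonglongrightarrow> 0"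
  have "(\<lambda>n. \<integral>\<^sup>+x. u (T n) x \<partial>M) \<longlonglongrightarrow> (\<integral>\<^sup>+x. 0 \<partial>M)"
  proof (rule nn_integral_dominated_convergence[where w = w])
    show "AE x in M. (\<lambda>n. u (T n) x) \<longlonglongrightarrow> 0"
      using lim
    proof eventually_elim
      case (elim x)
      have "filterlim T (at_right 0) sequentially"
        using T by (auto simp: filterlim_at intro!: always_eventually) (metis less_irrefl)
      with elim show ?case by (rule filterlim_compose)
    qed
  qed (use le T fin in auto)
  then show "(\<lambda>n. \<integral>\<^sup>+x. u (T n) x \<partial>M) \<longlonglongrightarrow> 0" by simp
qed simp

text \<open>The hypothesis is the subtraction-free form of a - b = l - d. If \<open>d\<close> or
  \<open>l\<close> is infinite the bound is trivial; if both are finite and \<open>a\<close> is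
  infinite then so is \<open>b\<close>, and both values of \<open>enn2real\<close> are 0. Hence no
  finiteness has to be assumed.\<close>

lemma enn2real_abs_diff_le:
  fixes a b d l :: ennreal
  assumes "a + d = b + l"
  shows "ennreal \<bar>enn2real a - enn2real b\<bar> \<le> d + l"
proof (cases "d = \<infinity> \<or> l = \<infinity>")
  case False
  then obtain d' l' where dl: "d = ennreal d'" "l = ennreal l'" "0 \<le> d'" "0 \<le> l'"
    by (metis ennreal_cases infinity_ennreal_def)
  show ?thesis
  proof (cases "a = \<infinity>")
    case True
    then have "b + l = \<infinity>" using assms by (metis ennreal_add_eq_top infinity_ennreal_def)
    then have "b = \<infinity>" using False by (auto simp: ennreal_add_eq_top)
    with True show ?thesis by simp
  next
    case a: False
    then have "b \<noteq> \<infinity>" using assms False by (auto simp: ennreal_add_eq_top)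
    with a obtain a' b' where ab: "a = ennreal a'" "b = ennreal b'" "0 \<le> a'" "0 \<le> b'"
      by (metis ennreal_cases infinity_ennreal_def)
    have "a' + d' = b' + l'" using assms ab dl by (simp add: ennreal_plus[symmetric] del: ennreal_plus)
    then show ?thesis using ab dl by (simp add: ennreal_plus[symmetric] del: ennreal_plus)
  qed
qed auto

lemma ennreal_abs_eq: "ennreal \<bar>x\<bar> = ennreal x + ennreal (- x)"
  by (cases "0 \<le> x") (auto simp: ennreal_neg)

lemma enn2real_pos_minus_neg: "enn2real (ennreal x) - enn2real (ennreal (- x)) = x"
  by (cases "0 \<le> x") (auto simp: ennreal_neg)

context jump_process
begin

section \<open>The flow on almost everywhere classes of nonnegative functions\<close>

lemma wnorm_add:
  assumes [measurable]: "f \<in> borel_measurable N" "g \<in> borel_measurable N"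
  shows "wnorm (\<lambda>v. f v + g v) = wnorm f + wnorm g"
  unfolding wnorm_def by (simp add: distrib_left nn_integral_add)

lemma wnorm_cmult:
  assumes [measurable]: "f \<in> borel_measurable N"
  shows "wnorm (\<lambda>v. c * f v) = c * wnorm f"
  unfolding wnorm_def by (simp add: mult.left_commute nn_integral_cmult)

lemma wnorm_mono: "(\<And>v. f v \<le> g v) \<Longrightarrow> wnorm f \<le> wnorm g"
  unfolding wnorm_def by (intro nn_integral_mono mult_left_mono) auto

lemma wnorm_mono_AE: "(AE v in N. f v \<le> g v) \<Longrightarrow> wnorm f \<le> wnorm g"
  unfolding wnorm_def by (intro nn_integral_mono_AE) (auto elim!: eventually_mono intro: mult_left_mono)

lemma wnorm_finite_AE:
  assumes [measurable]: "f \<in> borel_measurable N" and "wnorm f < \<infinity>"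
  shows "AE v in N. f v < \<infinity>"
proof -
  have "(\<integral>\<^sup>+v. f v \<partial>N) \<noteq> \<infinity>" using le_less_trans[OF nn_integral_le_wnorm assms(2)] by simp
  from nn_integral_PInf_AE[OF assms(1) this] show ?thesis by (simp add: less_top)
qed

lemma AE_flow_finite:
  assumes [measurable]: "f \<in> borel_measurable N" and "wnorm f < \<infinity>" "0 \<le> t"
  shows "AE v in N. flow t f v < \<infinity>"
  using wnorm_flow_finite[OF assms] by (intro wnorm_finite_AE) auto

text \<open>The flow is monotone for pointwise inequalities only, so both functions are compared
  with their pointwise maximum \<open>h\<close>. It lies above each of them and has the same mass,
  and so do the flows.\<close>

lemma flow_cong_AE:
  assumes [measurable]: "f \<in> borel_measurable N" "g \<in> borel_measurable N" and "wnorm f < \<infinity>" "0 \<le> t"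
    and eq: "AE v in N. f v = g v"
  shows "AE v in N. flow t f v = flow t g v"
proof -
  define h where "h v = max (f v) (g v)" for v
  have [measurable]: "h \<in> borel_measurable N" by (simp add: h_def[abs_def])
  have *: "AE v in N. flow t f' v = flow t h v"
    if [measurable]: "f' \<in> borel_measurable N" and eq': "AE v in N. f' v = h v" and le: "\<And>v. f' v \<le> h v" and fin: "wnorm f' < \<infinity>" for f'
  proof (rule AE_eq_of_le_nn_integral_eq)
    have "wnorm h = wnorm f'" unfolding wnorm_def using eq' by (intro nn_integral_cong_AE) auto
    moreover have "(\<integral>\<^sup>+v. f' v \<partial>N) = (\<integral>\<^sup>+v. h v \<partial>N)" using eq' by (intro nn_integral_cong_AE) auto
    ultimately show "(\<integral>\<^sup>+v. flow t f' v \<partial>N) = (\<integral>\<^sup>+v. flow t h v \<partial>N)"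
      using fin \<open>0 \<le> t\<close> by (simp add: flow_mass)
    show "(\<integral>\<^sup>+v. flow t f' v \<partial>N) < \<infinity>"
      using fin le_less_trans[OF nn_integral_le_wnorm fin] \<open>0 \<le> t\<close> by (simp add: flow_mass)
  qed (use le in \<open>auto intro: flow_mono\<close>)
  have "wnorm g = wnorm f"
    unfolding wnorm_def using eq by (intro nn_integral_cong_AE) auto
  then have "wnorm g < \<infinity>" using assms(3) by simp
  then have "AE v in N. flow t g v = flow t h v"
    using eq by (intro *) (auto simp: h_def elim!: eventually_mono)
  moreover have "AE v in N. flow t f v = flow t h v"
    using eq assms(3) by (intro *) (auto simp: h_def elim!: eventually_mono)
  ultimately show ?thesis by eventually_elim simp
qed

section \<open>Behaviour of the flow as time tends to zero\<close>

definition loss :: "real \<Rightarrow> ('a \<Rightarrow> ennreal) \<Rightarrow> 'a \<Rightarrow> ennreal" where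
  "loss t f v = ennreal (1 - exp (- S v * t)) * f v"

definition source :: "real \<Rightarrow> ('a \<Rightarrow> ennreal) \<Rightarrow> 'a \<Rightarrow> ennreal" where
  "source t f = duhamel (\<lambda>s. flow s f) t"

lemma loss_meas2 [measurable]:
  assumes [measurable]: "f \<in> borel_measurable N"
  shows "(\<lambda>(t, v). loss t f v) \<in> borel_measurable (borel \<Otimes>\<^sub>M N)"
  unfolding loss_def[abs_def] by measurable

lemma source_meas2 [measurable]:
  assumes [measurable]: "f \<in> borel_measurable N"
  shows "(\<lambda>(t, v). source t f v) \<in> borel_measurable (borel \<Otimes>\<^sub>M N)"
  unfolding source_def by measurable

lemmas loss_meas [measurable] = meas2_fixed(1)[OF loss_meas2]
lemmas source_meas [measurable] = meas2_fixed(1)[OF source_meas2]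

lemma loss_mono: "s \<le> t \<Longrightarrow> loss s f v \<le> loss t f v"
  unfolding loss_def using S_nonneg[of v]
  by (intro mult_right_mono ennreal_leI) (auto intro: mult_left_mono)

lemma loss_le: "loss t f v \<le> f v"
  unfolding loss_def using mult_right_mono[of "ennreal (1 - exp (- S v * t))" 1 "f v"]
  by (simp add: ennreal_le_1)

lemma free_plus_loss:
  assumes "0 \<le> t" shows "free t f v + loss t f v = f v"
proof -
  have "ennreal (exp (- S v * t)) + ennreal (1 - exp (- S v * t)) = 1"
    using S_nonneg[of v] assms by (subst ennreal_plus[symmetric]) auto
  then show ?thesis unfolding free_def loss_def by (metis distrib_right mult_1)
qed

lemma flow_eq_free_source: "f \<in> borel_measurable N \<Longrightarrow> flow t f v = free t f v + source t f v"
  unfolding source_def by (rule mild)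

text \<open>The subtraction-free form of flow - f = source - loss. The right side is the mass that
  has arrived by a jump, minus the part of \<open>f\<close> that has jumped away; both are small for
  small \<open>t\<close>.\<close>

lemma flow_plus_loss:
  assumes "f \<in> borel_measurable N" "0 \<le> t"
  shows "flow t f v + loss t f v = f v + source t f v"
  unfolding flow_eq_free_source[OF assms(1)] free_plus_loss[OF assms(2), of f v, symmetric]
  by (simp add: add_ac)

lemma loss_tendsto_0:
  assumes [measurable]: "f \<in> borel_measurable N" "\<phi> \<in> borel_measurable N"
    and fin: "(\<integral>\<^sup>+v. ennreal (\<phi> v) * f v \<partial>N) < \<infinity>"
  shows "((\<lambda>t. \<integral>\<^sup>+v. ennreal (\<phi> v) * loss t f v \<partial>N) \<longlongrightarrow> 0) (at_right 0)"
proof (rule nn_integral_tendsto_0_at_right[where w = "\<lambda>v. ennreal (\<phi> v) * f v"])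
  \<comment> \<open>Only the product of \<phi> and \<open>f\<close> is known to be finite almost
    everywhere, not \<open>f\<close> itself, so the product is handled as one real number
    \<open>r\<close>.\<close>
  have "(\<integral>\<^sup>+v. ennreal (\<phi> v) * f v \<partial>N) \<noteq> \<infinity>" using fin by simp
  from nn_integral_PInf_AE[OF _ this]
  have "AE v in N. ennreal (\<phi> v) * f v \<noteq> \<infinity>" by simp
  then show "AE v in N. ((\<lambda>t. ennreal (\<phi> v) * loss t f v) \<longlongrightarrow> 0) (at_right 0)"
  proof eventually_elim
    case (elim v)
    then obtain r where r: "ennreal (\<phi> v) * f v = ennreal r" "0 \<le> r"
      by (cases "ennreal (\<phi> v) * f v") auto
    have "ennreal (\<phi> v) * loss t f v = ennreal ((1 - exp (- S v * t)) * r)" if "0 < t" for t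
    proof -
      have "ennreal (\<phi> v) * loss t f v = ennreal (1 - exp (- S v * t)) * (ennreal (\<phi> v) * f v)"
        by (simp add: loss_def mult_ac)
      also have "\<dots> = ennreal ((1 - exp (- S v * t)) * r)"
        using S_nonneg[of v] that r by (subst ennreal_mult) auto
      finally show ?thesis .
    qed
    moreover have "((\<lambda>t. ennreal ((1 - exp (- S v * t)) * r)) \<longlongrightarrow> ennreal ((1 - exp (- S v * 0)) * r)) (at_right 0)"
      by (intro tendsto_intros)
    ultimately show ?case
      by (subst filterlim_cong[OF refl refl, of _ "\<lambda>t. ennreal ((1 - exp (- S v * t)) * r)"])
        (auto simp: eventually_at_right_less eventually_at_filter)
  qed
qed (use fin in \<open>auto intro!: mult_left_mono loss_le\<close>)

lemma accum_tendsto_0: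
  assumes u [measurable]: "(\<lambda>(t, v). u t v) \<in> borel_measurable (borel \<Otimes>\<^sub>M N)" "\<phi> \<in> borel_measurable N"
    and "accum \<phi> u 1 < \<infinity>"
  shows "(accum \<phi> u \<longlongrightarrow> 0) (at_right 0)"
  unfolding accum_def
proof (rule nn_integral_tendsto_0_at_right)
  show "(\<integral>\<^sup>+s\<in>{0..1}. (\<integral>\<^sup>+v. ennreal (\<phi> v) * u s v \<partial>N) \<partial>lborel) < \<infinity>"
    using assms(3) by (simp add: accum_def)
  show "AE s in lborel. ((\<lambda>t. (\<integral>\<^sup>+v. ennreal (\<phi> v) * u s v \<partial>N) * indicator {0..t} s) \<longlongrightarrow> 0) (at_right 0)"
    using AE_lborel_singleton[of 0]
  proof eventually_elim
    case (elim s)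
    have "\<forall>\<^sub>F t in at_right 0. (\<integral>\<^sup>+v. ennreal (\<phi> v) * u s v \<partial>N) * indicator {0..t} s = 0"
    proof (cases "s < 0")
      case False
      with elim have "\<forall>\<^sub>F t in at_right 0. t \<in> {0<..<s}" by (intro eventually_at_right_real) simp
      then show ?thesis by eventually_elim simp
    qed simp
    then show ?case by (rule tendsto_eventually)
  qed
  fix t s :: real assume "0 < t" "t < 1"
  then show "(\<integral>\<^sup>+v. ennreal (\<phi> v) * u s v \<partial>N) * indicator {0..t} s \<le> (\<integral>\<^sup>+v. ennreal (\<phi> v) * u s v \<partial>N) * indicator {0..1} s"
    by (auto simp: indicator_def)
qed measurable

text \<open>A majorant of \<open>wnorm (source t f)\<close> that increases with \<open>t\<close>, so
  that its value at the end point also bounds time integrals of the source.\<close>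

definition source_bound :: "('a \<Rightarrow> ennreal) \<Rightarrow> real \<Rightarrow> ennreal" where
  "source_bound f t = ennreal th * accum (\<lambda>v. S v * W v) (\<lambda>s. flow s f) t + ennreal (C * t) * wnorm f"

lemma wnorm_source_le:
  assumes [measurable]: "f \<in> borel_measurable N" and fin: "wnorm f < \<infinity>" and "0 \<le> t"
  shows "wnorm (source t f) \<le> source_bound f t"
proof -
  have fin1: "(\<integral>\<^sup>+v. f v \<partial>N) < \<infinity>" by (rule le_less_trans[OF nn_integral_le_wnorm fin])
  have "wnorm (source t f) \<le> (\<integral>\<^sup>+v. ennreal (W v) * (\<integral>\<^sup>+s\<in>{0..t}. gainK (flow s f) v \<partial>lborel) \<partial>N)"
    unfolding wnorm_def source_def by (intro nn_integral_mono mult_left_mono duhamel_le) auto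
  also have "\<dots> = accum W (\<lambda>s. gainK (flow s f)) t"
    unfolding accum_def by (intro nn_integral_time_swap gainK_meas2) auto
  also have "\<dots> \<le> ennreal th * accum (\<lambda>v. S v * W v) (\<lambda>s. flow s f) t + ennreal C * (ennreal t * (\<integral>\<^sup>+v. f v \<partial>N))"
    using assms flow_mass_le[OF assms(1) fin1]
    by (intro order_trans[OF accum_gainK_W] add_left_mono mult_left_mono accum_mass_le) auto
  also have "\<dots> \<le> source_bound f t"
    unfolding source_bound_def using C_nonneg assms(3)
    by (auto simp: ennreal_mult mult.assoc intro!: add_left_mono mult_left_mono nn_integral_le_wnorm)
  finally show ?thesis .
qed

lemma source_bound_mono: "0 \<le> s \<Longrightarrow> s \<le> t \<Longrightarrow> source_bound f s \<le> source_bound f t"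
  unfolding source_bound_def accum_def using C_nonneg
  by (intro add_mono mult_left_mono mult_right_mono nn_integral_mono ennreal_leI) (auto simp: indicator_def mult_left_mono)

lemma ennreal_tendsto_cmult_0:
  fixes u :: "real \<Rightarrow> ennreal"
  assumes "(u \<longlongrightarrow> 0) F" "c < \<infinity>"
  shows "((\<lambda>t. c * u t) \<longlongrightarrow> 0) F"
  using ennreal_tendsto_cmult[OF _ assms(1), of c] assms(2) by auto

lemma ennreal_tendsto_time_0:
  fixes c :: ennreal assumes "c < \<infinity>" shows "((\<lambda>t. ennreal (r * t) * c) \<longlongrightarrow> 0) (at_right 0)"
proof -
  have "((\<lambda>t. ennreal (r * t)) \<longlongrightarrow> ennreal (r * 0)) (at_right 0)" by (intro tendsto_intros)
  then have "((\<lambda>t. c * ennreal (r * t)) \<longlongrightarrow> 0) (at_right 0)" using assms by (intro ennreal_tendsto_cmult_0) auto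
  then show ?thesis by (simp add: mult.commute)
qed

lemma source_bound_tendsto_0:
  assumes [measurable]: "f \<in> borel_measurable N" and fin: "wnorm f < \<infinity>"
  shows "(source_bound f \<longlongrightarrow> 0) (at_right 0)"
proof -
  have "(accum (\<lambda>v. S v * W v) (\<lambda>s. flow s f) \<longlongrightarrow> 0) (at_right 0)"
    using flow_rate_finite[OF assms, of 1] by (intro accum_tendsto_0) auto
  then have "((\<lambda>t. ennreal th * accum (\<lambda>v. S v * W v) (\<lambda>s. flow s f) t + ennreal (C * t) * wnorm f) \<longlongrightarrow> 0 + 0) (at_right 0)"
    using fin by (intro tendsto_add ennreal_tendsto_cmult_0 ennreal_tendsto_time_0) auto
  then show ?thesis by (simp add: source_bound_def[abs_def])
qed

text \<open>The extension to signed functions through positive and negative parts. Where a flow is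
  infinite, \<open>enn2real\<close> returns 0; for data of finite norm and t \<ge> 0 this happens on
  a null set only, by \<open>AE_flow_finite\<close>. Linearity therefore holds almost everywhere,
  not pointwise.\<close>

definition op :: "real \<Rightarrow> ('a \<Rightarrow> real) \<Rightarrow> 'a \<Rightarrow> real" where
  "op t f v = enn2real (flow t (\<lambda>x. ennreal (f x)) v) - enn2real (flow t (\<lambda>x. ennreal (- f x)) v)"

abbreviation X :: "'a measure" where "X \<equiv> density N (\<lambda>v. ennreal (W v))"

lemma op_meas [measurable]:
  assumes [measurable]: "f \<in> borel_measurable N" shows "op t f \<in> borel_measurable N"
  unfolding op_def[abs_def] by measurable

lemma wnorm_abs:
  assumes [measurable]: "f \<in> borel_measurable N"
  shows "wnorm (\<lambda>v. ennreal \<bar>f v\<bar>) = wnorm (\<lambda>v. ennreal (f v)) + wnorm (\<lambda>v. ennreal (- f v))"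
  unfolding ennreal_abs_eq by (rule wnorm_add) measurable

lemma L1_X: "f \<in> L1 X \<longleftrightarrow> f \<in> borel_measurable N \<and> wnorm (\<lambda>v. ennreal \<bar>f v\<bar>) < \<infinity>"
proof -
  have "(\<integral>\<^sup>+v. ennreal (norm (f v)) \<partial>X) = wnorm (\<lambda>v. ennreal \<bar>f v\<bar>)" if "f \<in> borel_measurable N"
    using that unfolding wnorm_def by (subst nn_integral_density) auto
  then show ?thesis unfolding L1_def mem_Collect_eq integrable_iff_bounded by auto
qed

lemma L1_norm_X: "f \<in> borel_measurable N \<Longrightarrow> L1_norm X f = enn2real (wnorm (\<lambda>v. ennreal \<bar>f v\<bar>))"
  unfolding L1_norm_def wnorm_def
  by (subst integral_eq_nn_integral) (auto simp: nn_integral_density)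

lemma AE_X: "(AE v in X. P v) \<longleftrightarrow> (AE v in N. P v)"
  using W_pos by (subst AE_density) (auto simp: ennreal_zero_less_mult_iff)

text \<open>Any decomposition of \<open>f\<close> as a difference of nonnegative functions of finite
  norm may replace the positive and negative parts: the identity f^+ + q = f^- + p holds almost
  everywhere, passes through the additive flow, and can then be subtracted because all four flows
  are finite almost everywhere.\<close>

lemma op_decomp:
  assumes f [measurable]: "f \<in> borel_measurable N" and [measurable]: "p \<in> borel_measurable N" "q \<in> borel_measurable N"
    and fin: "wnorm p < \<infinity>" "wnorm q < \<infinity>" and "0 \<le> t"
    and eq: "AE v in N. f v = enn2real (p v) - enn2real (q v)"
  shows "AE v in N. op t f v = enn2real (flow t p v) - enn2real (flow t q v)"
proof -
  have fin_p: "AE v in N. p v < \<infinity>" and fin_q: "AE v in N. q v < \<infinity>"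
    using wnorm_finite_AE[OF _ fin(1)] wnorm_finite_AE[OF _ fin(2)] by auto
  have e: "AE v in N. ennreal (f v) + q v = ennreal (- f v) + p v"
    using eq fin_p fin_q
  proof eventually_elim
    case (elim v)
    from elim(2,3) obtain a b where ab: "p v = ennreal a" "q v = ennreal b" "0 \<le> a" "0 \<le> b"
      by (metis ennreal_cases infinity_ennreal_def less_irrefl)
    with elim(1) show ?case
      by (cases "0 \<le> f v") (auto simp: ennreal_neg ennreal_plus[symmetric] simp del: ennreal_plus)
  qed
  have finf: "wnorm (\<lambda>v. ennreal (f v)) < \<infinity>" "wnorm (\<lambda>v. ennreal (- f v)) < \<infinity>"
  proof -
    have "AE v in N. ennreal (f v) \<le> p v"
      using eq fin_p
    proof eventually_elim
      case (elim v)
      then have "ennreal (f v) \<le> ennreal (enn2real (p v))" by (intro ennreal_leI) simp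
      then show ?case using elim by (auto simp: ennreal_enn2real_if split: if_splits)
    qed
    moreover have "AE v in N. ennreal (- f v) \<le> q v"
      using eq fin_q
    proof eventually_elim
      case (elim v)
      then have "ennreal (- f v) \<le> ennreal (enn2real (q v))" by (intro ennreal_leI) simp
      then show ?case using elim by (auto simp: ennreal_enn2real_if split: if_splits)
    qed
    ultimately show "wnorm (\<lambda>v. ennreal (f v)) < \<infinity>" "wnorm (\<lambda>v. ennreal (- f v)) < \<infinity>"
      using fin by (auto intro: le_less_trans[OF wnorm_mono_AE])
  qed
  have fin_sum: "wnorm (\<lambda>v. ennreal (f v) + q v) < \<infinity>"
    using fin finf by (subst wnorm_add) auto
  have "AE v in N. flow t (\<lambda>v. ennreal (f v) + q v) v = flow t (\<lambda>v. ennreal (- f v) + p v) v"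
    using fin_sum \<open>0 \<le> t\<close> e by (intro flow_cong_AE) auto
  moreover have "flow t (\<lambda>v. ennreal (f v) + q v) v = flow t (\<lambda>v. ennreal (f v)) v + flow t q v" for v
    by (rule flow_add) measurable
  moreover have "flow t (\<lambda>v. ennreal (- f v) + p v) v = flow t (\<lambda>v. ennreal (- f v)) v + flow t p v" for v
    by (rule flow_add) measurable
  ultimately have "AE v in N. flow t (\<lambda>v. ennreal (f v)) v + flow t q v = flow t (\<lambda>v. ennreal (- f v)) v + flow t p v"
    by simp
  moreover have "AE v in N. flow t p v < \<infinity>" "AE v in N. flow t q v < \<infinity>"
    "AE v in N. flow t (\<lambda>v. ennreal (f v)) v < \<infinity>" "AE v in N. flow t (\<lambda>v. ennreal (- f v)) v < \<infinity>"
    using AE_flow_finite[OF _ fin(1) \<open>0 \<le> t\<close>] AE_flow_finite[OF _ fin(2) \<open>0 \<le> t\<close>]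
      AE_flow_finite[OF _ finf(1) \<open>0 \<le> t\<close>] AE_flow_finite[OF _ finf(2) \<open>0 \<le> t\<close>] by auto
  ultimately show ?thesis
  proof eventually_elim
    case (elim v)
    then have "enn2real (flow t (\<lambda>v. ennreal (f v)) v) + enn2real (flow t q v)
        = enn2real (flow t (\<lambda>v. ennreal (- f v)) v) + enn2real (flow t p v)"
      by (simp add: enn2real_plus[symmetric])
    then show ?case unfolding op_def by linarith
  qed
qed

lemma wnorm_parts_finite:
  assumes "f \<in> L1 X"
  shows "f \<in> borel_measurable N" "wnorm (\<lambda>v. ennreal (f v)) < \<infinity>" "wnorm (\<lambda>v. ennreal (- f v)) < \<infinity>"
  using assms wnorm_abs[of f] by (auto simp: L1_X)

lemma wnorm_op_le:
  assumes "f \<in> L1 X" "0 \<le> t"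
  shows "wnorm (\<lambda>v. ennreal \<bar>op t f v\<bar>) \<le> ennreal (1 + C * t) * wnorm (\<lambda>v. ennreal \<bar>f v\<bar>)"
proof -
  note fin = wnorm_parts_finite[OF assms(1)]
  note [measurable] = fin(1)
  have "ennreal \<bar>op t f v\<bar> \<le> flow t (\<lambda>x. ennreal (- f x)) v + flow t (\<lambda>x. ennreal (f x)) v" for v
    unfolding op_def by (rule enn2real_abs_diff_le) (rule add.commute)
  then have "wnorm (\<lambda>v. ennreal \<bar>op t f v\<bar>) \<le> wnorm (flow t (\<lambda>x. ennreal (- f x))) + wnorm (flow t (\<lambda>x. ennreal (f x)))"
    by (subst wnorm_add[symmetric]) (auto intro: wnorm_mono)
  also have "\<dots> \<le> ennreal (1 + C * t) * wnorm (\<lambda>x. ennreal (- f x)) + ennreal (1 + C * t) * wnorm (\<lambda>x. ennreal (f x))"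
    using fin assms(2) by (intro add_mono flow_wnorm_le) auto
  also have "\<dots> = ennreal (1 + C * t) * wnorm (\<lambda>v. ennreal \<bar>f v\<bar>)"
    unfolding wnorm_abs[OF fin(1)] by (simp add: distrib_left add.commute)
  finally show ?thesis .
qed

lemma op_L1:
  assumes "f \<in> L1 X" "0 \<le> t" shows "op t f \<in> L1 X"
  using assms le_less_trans[OF wnorm_op_le[OF assms]] by (auto simp: L1_X ennreal_mult_less_top)

lemma op_cmult:
  assumes [measurable]: "f \<in> borel_measurable N"
  shows "op t (\<lambda>y. c * f y) v = c * op t f v"
proof (cases "0 \<le> c")
  case True
  have "(\<lambda>x. ennreal (c * f x)) = (\<lambda>x. ennreal c * ennreal (f x))"
    using True by (simp add: ennreal_mult')
  moreover have "(\<lambda>x. ennreal (- (c * f x))) = (\<lambda>x. ennreal c * ennreal (- f x))"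
    using ennreal_mult'[OF True, of "- f _"] by simp
  ultimately show ?thesis using True unfolding op_def
    by (simp add: flow_cmult enn2real_mult right_diff_distrib)
next
  case False
  have "(\<lambda>x. ennreal (c * f x)) = (\<lambda>x. ennreal (- c) * ennreal (- f x))"
    using False ennreal_mult'[of "- c" "- f _"] by simp
  moreover have "(\<lambda>x. ennreal (- (c * f x))) = (\<lambda>x. ennreal (- c) * ennreal (f x))"
    using False ennreal_mult'[of "- c" "f _"] by simp
  ultimately show ?thesis using False unfolding op_def
    by (simp add: flow_cmult enn2real_mult left_diff_distrib right_diff_distrib)
qed

lemma op_cong_AE:
  assumes "f \<in> L1 X" "g \<in> L1 X" "0 \<le> t" "AE v in N. f v = g v"
  shows "AE v in N. op t f v = op t g v"
proof -
  note fg = wnorm_parts_finite[OF assms(1)] wnorm_parts_finite[OF assms(2)]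
  have "AE v in N. flow t (\<lambda>x. ennreal (f x)) v = flow t (\<lambda>x. ennreal (g x)) v"
    using fg assms(3,4) by (intro flow_cong_AE) auto
  moreover have "AE v in N. flow t (\<lambda>x. ennreal (- f x)) v = flow t (\<lambda>x. ennreal (- g x)) v"
    using fg assms(3,4) by (intro flow_cong_AE) auto
  ultimately show ?thesis by eventually_elim (simp add: op_def)
qed

lemma op_add:
  assumes "f \<in> L1 X" "g \<in> L1 X" "0 \<le> t"
  shows "AE v in N. op t (\<lambda>y. f y + g y) v = op t f v + op t g v"
proof -
  note fg = wnorm_parts_finite[OF assms(1)] wnorm_parts_finite[OF assms(2)]
  note [measurable] = fg(1,4)
  let ?p = "\<lambda>x. ennreal (f x) + ennreal (g x)" and ?q = "\<lambda>x. ennreal (- f x) + ennreal (- g x)"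
  have "AE v in N. op t (\<lambda>y. f y + g y) v = enn2real (flow t ?p v) - enn2real (flow t ?q v)"
  proof (rule op_decomp)
    show "AE v in N. f v + g v = enn2real (?p v) - enn2real (?q v)"
      using enn2real_pos_minus_neg[of "f _"] enn2real_pos_minus_neg[of "g _"]
      by (auto simp: enn2real_plus algebra_simps)
  qed (use fg assms(3) in \<open>auto simp: wnorm_add\<close>)
  moreover have "AE v in N. flow t (\<lambda>x. ennreal (f x)) v < \<infinity>" "AE v in N. flow t (\<lambda>x. ennreal (g x)) v < \<infinity>"
    "AE v in N. flow t (\<lambda>x. ennreal (- f x)) v < \<infinity>" "AE v in N. flow t (\<lambda>x. ennreal (- g x)) v < \<infinity>"
    using AE_flow_finite[OF _ fg(2) \<open>0 \<le> t\<close>] AE_flow_finite[OF _ fg(3) \<open>0 \<le> t\<close>]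
      AE_flow_finite[OF _ fg(5) \<open>0 \<le> t\<close>] AE_flow_finite[OF _ fg(6) \<open>0 \<le> t\<close>] by auto
  ultimately show ?thesis
  proof eventually_elim
    case (elim v)
    then show ?case by (simp add: op_def flow_add enn2real_plus)
  qed
qed

lemma op_bounded:
  assumes "0 \<le> t" shows "L1_bounded_operator X (op t)"
  unfolding L1_bounded_operator_def AE_X
proof (intro conjI ballI allI impI)
  show "\<exists>c. \<forall>f\<in>L1 X. L1_norm X (op t f) \<le> c * L1_norm X f"
  proof (intro exI[of _ "1 + C * t"] ballI)
    fix f assume f: "f \<in> L1 X"
    note m = wnorm_parts_finite(1)[OF f]
    have "wnorm (\<lambda>v. ennreal \<bar>f v\<bar>) < \<infinity>" using f by (simp add: L1_X)
    then have "enn2real (wnorm (\<lambda>v. ennreal \<bar>op t f v\<bar>)) \<le> enn2real (ennreal (1 + C * t) * wnorm (\<lambda>v. ennreal \<bar>f v\<bar>))"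
      by (intro enn2real_mono wnorm_op_le[OF f assms]) (auto simp: ennreal_mult_less_top)
    then show "L1_norm X (op t f) \<le> (1 + C * t) * L1_norm X f"
      using C_nonneg assms m by (simp add: L1_norm_X enn2real_mult del: ennreal_plus)
  qed
  fix f g assume "f \<in> L1 X" "g \<in> L1 X" "AE v in N. f v = g v"
  then show "AE v in N. op t f v = op t g v" using assms by (intro op_cong_AE)
qed (use assms in \<open>auto intro: op_L1 op_add simp: op_cmult dest: wnorm_parts_finite(1)\<close>)

lemma op_0: "f \<in> borel_measurable N \<Longrightarrow> op 0 f v = f v"
  by (simp add: op_def enn2real_pos_minus_neg)

text \<open>\<open>op t f\<close> is a difference of two flows that are not its positive and
  negative parts, hence \<open>op_decomp\<close>; the rest is the semigroup law for each
  part.\<close>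

lemma op_semigroup:
  assumes "f \<in> L1 X" "0 \<le> s" "0 \<le> t"
  shows "AE v in N. op (s + t) f v = op s (op t f) v"
proof -
  note fin = wnorm_parts_finite[OF assms(1)]
  note [measurable] = fin(1)
  have "AE v in N. op s (op t f) v = enn2real (flow s (flow t (\<lambda>x. ennreal (f x))) v) - enn2real (flow s (flow t (\<lambda>x. ennreal (- f x))) v)"
    using fin assms wnorm_flow_finite
    by (intro op_decomp[of "op t f" "flow t (\<lambda>x. ennreal (f x))" "flow t (\<lambda>x. ennreal (- f x))"]) (auto simp: op_def)
  moreover have "AE v in N. flow s (flow t (\<lambda>x. ennreal (f x))) v = flow (t + s) (\<lambda>x. ennreal (f x)) v"
    using fin assms by (intro flow_semigroup) auto
  moreover have "AE v in N. flow s (flow t (\<lambda>x. ennreal (- f x))) v = flow (t + s) (\<lambda>x. ennreal (- f x)) v"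
    using fin assms by (intro flow_semigroup) auto
  ultimately show ?thesis by eventually_elim (simp add: op_def add.commute)
qed

lemma op_positive:
  assumes "f \<in> L1 X" "0 \<le> t" and "AE v in N. 0 \<le> f v"
  shows "AE v in N. 0 \<le> op t f v"
proof -
  note fin = wnorm_parts_finite[OF assms(1)]
  have zero: "flow t (\<lambda>x. 0) v = 0" for v
    using flow_cmult[of "\<lambda>_. 0" t 0 v] by simp
  have "AE v in N. flow t (\<lambda>x. ennreal (- f x)) v = flow t (\<lambda>x. 0) v"
    using fin assms by (intro flow_cong_AE) (auto simp: ennreal_neg)
  then show ?thesis by eventually_elim (simp add: op_def zero)
qed

definition op_bound :: "('a \<Rightarrow> real) \<Rightarrow> real \<Rightarrow> ennreal" where
  "op_bound f t = (source_bound (\<lambda>v. ennreal (f v)) t + wnorm (loss t (\<lambda>v. ennreal (f v))))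
    + (source_bound (\<lambda>v. ennreal (- f v)) t + wnorm (loss t (\<lambda>v. ennreal (- f v))))"

lemma op_diff_le:
  assumes [measurable]: "f \<in> borel_measurable N" and "0 \<le> t"
  shows "ennreal \<bar>op t f v - f v\<bar>
    \<le> (source t (\<lambda>v. ennreal (f v)) v + loss t (\<lambda>v. ennreal (f v)) v)
      + (source t (\<lambda>v. ennreal (- f v)) v + loss t (\<lambda>v. ennreal (- f v)) v)"
proof -
  have *: "ennreal \<bar>enn2real (flow t p v) - enn2real (p v)\<bar> \<le> loss t p v + source t p v"
    if "p \<in> borel_measurable N" for p
    using flow_plus_loss[OF that assms(2)] by (rule enn2real_abs_diff_le)
  let ?a = "enn2real (flow t (\<lambda>x. ennreal (f x)) v) - enn2real (ennreal (f v))"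
    and ?b = "enn2real (flow t (\<lambda>x. ennreal (- f x)) v) - enn2real (ennreal (- f v))"
  have "op t f v - f v = ?a - ?b"
    using enn2real_pos_minus_neg[of "f v"] by (simp add: op_def)
  then have "ennreal \<bar>op t f v - f v\<bar> \<le> ennreal (\<bar>?a\<bar> + \<bar>?b\<bar>)" by (intro ennreal_leI) linarith
  also have "\<dots> = ennreal \<bar>?a\<bar> + ennreal \<bar>?b\<bar>" by simp
  also have "\<dots> \<le> (loss t (\<lambda>v. ennreal (f v)) v + source t (\<lambda>v. ennreal (f v)) v)
      + (loss t (\<lambda>v. ennreal (- f v)) v + source t (\<lambda>v. ennreal (- f v)) v)"
    by (intro add_mono *) auto
  finally show ?thesis by (simp add: add_ac)
qed

lemma wnorm_op_diff_le:
  assumes "f \<in> L1 X" "0 \<le> t"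
  shows "wnorm (\<lambda>v. ennreal \<bar>op t f v - f v\<bar>) \<le> op_bound f t"
proof -
  note fin = wnorm_parts_finite[OF assms(1)]
  note [measurable] = fin(1)
  have "wnorm (\<lambda>v. ennreal \<bar>op t f v - f v\<bar>) \<le> (wnorm (source t (\<lambda>v. ennreal (f v))) + wnorm (loss t (\<lambda>v. ennreal (f v))))
      + (wnorm (source t (\<lambda>v. ennreal (- f v))) + wnorm (loss t (\<lambda>v. ennreal (- f v))))"
    by (subst wnorm_add[symmetric], measurable)+ (intro wnorm_mono op_diff_le fin(1) assms(2))
  also have "\<dots> \<le> op_bound f t"
    unfolding op_bound_def using fin assms(2) by (intro add_mono wnorm_source_le order_refl) auto
  finally show ?thesis .
qed

lemma op_bound_tendsto_0:
  assumes "f \<in> L1 X" shows "(op_bound f \<longlongrightarrow> 0) (at_right 0)"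
proof -
  note fin = wnorm_parts_finite[OF assms(1)]
  have "(op_bound f \<longlongrightarrow> (0 + 0) + (0 + 0)) (at_right 0)"
    unfolding op_bound_def[abs_def]
  proof (intro tendsto_add source_bound_tendsto_0)
    show "((\<lambda>t. wnorm (loss t (\<lambda>v. ennreal (f v)))) \<longlongrightarrow> 0) (at_right 0)"
      "((\<lambda>t. wnorm (loss t (\<lambda>v. ennreal (- f v)))) \<longlongrightarrow> 0) (at_right 0)"
      using fin unfolding wnorm_def by (auto intro!: loss_tendsto_0)
  qed (use fin in auto)
  then show ?thesis by simp
qed

lemma tendsto_enn2real_0:
  assumes "(u \<longlongrightarrow> 0) F" shows "((\<lambda>t. enn2real (u t)) \<longlongrightarrow> 0) F"
  using tendsto_enn2real[of u 0 F] assms by simp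

lemma op_strongly_continuous:
  assumes "f \<in> L1 X"
  shows "((\<lambda>t. L1_norm X (\<lambda>v. op t f v - f v)) \<longlongrightarrow> 0) (at_right 0)"
proof -
  note [measurable] = wnorm_parts_finite(1)[OF assms]
  have "((\<lambda>t. wnorm (\<lambda>v. ennreal \<bar>op t f v - f v\<bar>)) \<longlongrightarrow> 0) (at_right 0)"
  proof (rule tendsto_sandwich[OF _ _ tendsto_const op_bound_tendsto_0[OF assms]])
    show "\<forall>\<^sub>F t in at_right 0. wnorm (\<lambda>v. ennreal \<bar>op t f v - f v\<bar>) \<le> op_bound f t"
      using wnorm_op_diff_le[OF assms] by (auto simp: eventually_at_filter)
  qed simp
  then show ?thesis by (simp add: L1_norm_X tendsto_enn2real_0)
qed

theorem op_C0_semigroup: "C0_semigroup X op"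
  unfolding C0_semigroup_def AE_X
  by (auto intro: op_bounded op_semigroup op_strongly_continuous simp: op_0 dest: wnorm_parts_finite(1))

theorem op_positive_semigroup: "positive_semigroup X op"
  unfolding positive_semigroup_def AE_X using op_positive by blast

end

section \<open>Identification of the generator\<close>

text \<open>Finiteness of \<open>a\<close> is essential, as the first inequality holds trivially for
  infinite \<open>a\<close>. Each use is preceded by a qualitative bound of this kind.\<close>

lemma ennreal_absorb:
  fixes a b :: ennreal
  assumes "a \<le> b + ennreal c * a" "a < \<infinity>" "0 \<le> c" "c < 1"
  shows "a \<le> ennreal (1 / (1 - c)) * b"
proof (cases "b = \<infinity>")
  case False
  obtain a' where a: "a = ennreal a'" "0 \<le> a'" using assms(2) by (cases a) auto
  obtain b' where b: "b = ennreal b'" "0 \<le> b'" using False by (cases b) auto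
  have "a' \<le> b' + c * a'"
    using assms a b by (simp add: ennreal_mult[symmetric] ennreal_plus[symmetric] del: ennreal_plus)
  then have "a' \<le> 1 / (1 - c) * b'" using assms(4) by (simp add: field_simps)
  then show ?thesis using a b assms(4) by (simp add: ennreal_mult[symmetric] ennreal_leI)
qed (use assms in \<open>simp add: ennreal_mult_top\<close>)

lemma ennreal_mult_le_cancel:
  fixes a b :: ennreal
  assumes "ennreal t * a \<le> ennreal t * b" "0 < t"
  shows "a \<le> b"
  using assms by (auto simp: ennreal_mult_le_mult_iff)

context jump_process
begin

text \<open>The graph norm of the multiplication by \<open>S\<close>. For the collision frequency,
  which is comparable with (1 + |v|)^\<gamma>, it is equivalent to the norm of the claimed
  domain.\<close>

definition ynorm :: "('a \<Rightarrow> ennreal) \<Rightarrow> ennreal" where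
  "ynorm f = (\<integral>\<^sup>+v. ennreal (S v * W v) * f v \<partial>N)"

definition generator :: "('a \<Rightarrow> real) \<Rightarrow> 'a \<Rightarrow> real" where
  "generator f v = enn2real (gainK (\<lambda>x. ennreal (f x)) v) - enn2real (gainK (\<lambda>x. ennreal (- f x)) v) - S v * f v"

lemma generator_meas [measurable]:
  assumes [measurable]: "f \<in> borel_measurable N" shows "generator f \<in> borel_measurable N"
  unfolding generator_def[abs_def] by measurable

lemma ynorm_add:
  assumes [measurable]: "f \<in> borel_measurable N" "g \<in> borel_measurable N"
  shows "ynorm (\<lambda>v. f v + g v) = ynorm f + ynorm g"
  unfolding ynorm_def by (simp add: distrib_left nn_integral_add)

lemma ynorm_mono_AE: "(AE v in N. f v \<le> g v) \<Longrightarrow> ynorm f \<le> ynorm g"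
  unfolding ynorm_def by (intro nn_integral_mono_AE) (auto elim!: eventually_mono intro: mult_left_mono)

lemma wnorm_le_ynorm:
  assumes [measurable]: "f \<in> borel_measurable N"
  shows "ennreal S\<^sub>0 * wnorm f \<le> ynorm f"
proof -
  have "ennreal S\<^sub>0 * wnorm f = (\<integral>\<^sup>+v. ennreal S\<^sub>0 * (ennreal (W v) * f v) \<partial>N)"
    unfolding wnorm_def by (simp add: nn_integral_cmult)
  also have "\<dots> \<le> ynorm f"
    unfolding ynorm_def
  proof (rule nn_integral_mono)
    fix v
    have "ennreal S\<^sub>0 * ennreal (W v) \<le> ennreal (S v * W v)"
      using S\<^sub>0 W_nonneg[of v] by (subst ennreal_mult[symmetric]) (auto intro!: ennreal_leI mult_right_mono)
    then show "ennreal S\<^sub>0 * (ennreal (W v) * f v) \<le> ennreal (S v * W v) * f v"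
      by (subst mult.assoc[symmetric]) (rule mult_right_mono, auto)
  qed
  finally show ?thesis .
qed

lemma wnorm_finite_of_ynorm:
  assumes "f \<in> borel_measurable N" "ynorm f < \<infinity>" shows "wnorm f < \<infinity>"
  using wnorm_le_ynorm[OF assms(1)] assms(2) S\<^sub>0(1)
  by (metis ennreal_eq_0_iff ennreal_mult_eq_top_iff infinity_ennreal_def leD less_top not_less)

lemma wnorm_gainK_le:
  "f \<in> borel_measurable N \<Longrightarrow> wnorm (gainK f) \<le> ennreal th * ynorm f + ennreal C * (\<integral>\<^sup>+v. f v \<partial>N)"
  unfolding wnorm_def ynorm_def by (rule nn_integral_gainK_W)

lemma wnorm_gainK_finite:
  assumes "f \<in> borel_measurable N" "ynorm f < \<infinity>" shows "wnorm (gainK f) < \<infinity>"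
proof -
  have "(\<integral>\<^sup>+v. f v \<partial>N) < \<infinity>"
    using le_less_trans[OF nn_integral_le_wnorm wnorm_finite_of_ynorm[OF assms]] .
  then show ?thesis
    using assms(2) by (intro le_less_trans[OF wnorm_gainK_le[OF assms(1)]]) (auto simp: ennreal_mult_less_top)
qed

lemma accum_W_time:
  assumes "(\<lambda>(t, v). u t v) \<in> borel_measurable (borel \<Otimes>\<^sub>M N)"
  shows "wnorm (\<lambda>v. \<integral>\<^sup>+s\<in>{0..t}. u s v \<partial>lborel) = accum W u t"
  unfolding wnorm_def accum_def by (rule nn_integral_time_swap[OF assms]) measurable

lemma accum_SW_time:
  assumes "(\<lambda>(t, v). u t v) \<in> borel_measurable (borel \<Otimes>\<^sub>M N)"
  shows "ynorm (\<lambda>v. \<integral>\<^sup>+s\<in>{0..t}. u s v \<partial>lborel) = accum (\<lambda>v. S v * W v) u t"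
  unfolding ynorm_def accum_def by (rule nn_integral_time_swap[OF assms]) measurable

lemma ynorm_eq_wnorm: "ynorm f = wnorm (\<lambda>v. ennreal (S v) * f v)"
  unfolding wnorm_def ynorm_def
  by (intro nn_integral_cong) (simp add: ennreal_mult S_nonneg W_nonneg mult_ac)

lemma accum_le:
  assumes "\<And>s v. 0 \<le> s \<Longrightarrow> s \<le> t \<Longrightarrow> u s v \<le> w v" "0 \<le> t"
  shows "accum \<phi> u t \<le> ennreal t * (\<integral>\<^sup>+v. ennreal (\<phi> v) * w v \<partial>N)"
proof -
  have "accum \<phi> u t \<le> (\<integral>\<^sup>+s\<in>{0..t}. (\<integral>\<^sup>+v. ennreal (\<phi> v) * w v \<partial>N) \<partial>lborel)"
    unfolding accum_def using assms(1)
    by (intro nn_integral_mono) (auto simp: indicator_def intro!: nn_integral_mono mult_left_mono)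
  then show ?thesis by (simp add: nn_integral_Icc_const assms(2))
qed

lemma meas_time [measurable]:
  assumes [measurable]: "p \<in> borel_measurable N"
  shows "(\<lambda>s. flow s p v) \<in> borel_measurable borel" "(\<lambda>s. loss s p v) \<in> borel_measurable borel"
    "(\<lambda>s. source s p v) \<in> borel_measurable borel"
    "(\<lambda>s. gainK (loss s p) v) \<in> borel_measurable borel" "(\<lambda>s. gainK (source s p) v) \<in> borel_measurable borel"
  using meas2_fixed(2)[OF flow_meas2[OF assms]] meas2_fixed(2)[OF loss_meas2[OF assms]]
    meas2_fixed(2)[OF source_meas2[OF assms]] meas2_fixed(2)[OF gainK_meas2[OF loss_meas2[OF assms]]]
    meas2_fixed(2)[OF gainK_meas2[OF source_meas2[OF assms]]] by auto

section \<open>First-order expansion of the flow at time zero\<close>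

lemma integral_flow_plus_loss:
  assumes [measurable]: "p \<in> borel_measurable N" and "0 \<le> t"
  shows "(\<integral>\<^sup>+s\<in>{0..t}. flow s p v \<partial>lborel) + (\<integral>\<^sup>+s\<in>{0..t}. loss s p v \<partial>lborel)
    = ennreal t * p v + (\<integral>\<^sup>+s\<in>{0..t}. source s p v \<partial>lborel)"
proof -
  have "(\<integral>\<^sup>+s\<in>{0..t}. flow s p v \<partial>lborel) + (\<integral>\<^sup>+s\<in>{0..t}. loss s p v \<partial>lborel)
      = (\<integral>\<^sup>+s\<in>{0..t}. flow s p v + loss s p v \<partial>lborel)"
    by (simp add: distrib_right nn_integral_add)
  also have "\<dots> = (\<integral>\<^sup>+s. p v * indicator {0..t} s + source s p v * indicator {0..t} s \<partial>lborel)"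
    by (intro nn_integral_cong) (auto simp: indicator_def flow_plus_loss)
  also have "\<dots> = ennreal t * p v + (\<integral>\<^sup>+s\<in>{0..t}. source s p v \<partial>lborel)"
    using assms(2) by (simp add: nn_integral_add nn_integral_Icc_const)
  finally show ?thesis .
qed

lemma integral_gainK_flow_plus_loss:
  assumes [measurable]: "p \<in> borel_measurable N" and "0 \<le> t"
  shows "(\<integral>\<^sup>+s\<in>{0..t}. gainK (flow s p) v \<partial>lborel) + (\<integral>\<^sup>+s\<in>{0..t}. gainK (loss s p) v \<partial>lborel)
    = ennreal t * gainK p v + (\<integral>\<^sup>+s\<in>{0..t}. gainK (source s p) v \<partial>lborel)"
proof -
  have K: "gainK (flow s p) v + gainK (loss s p) v = gainK p v + gainK (source s p) v" if "0 \<le> s" for s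
    using flow_plus_loss[OF assms(1) that] by (simp add: gainK_add[symmetric])
  have "(\<integral>\<^sup>+s\<in>{0..t}. gainK (flow s p) v \<partial>lborel) + (\<integral>\<^sup>+s\<in>{0..t}. gainK (loss s p) v \<partial>lborel)
      = (\<integral>\<^sup>+s\<in>{0..t}. gainK (flow s p) v + gainK (loss s p) v \<partial>lborel)"
    by (simp add: distrib_right nn_integral_add)
  also have "\<dots> = (\<integral>\<^sup>+s. gainK p v * indicator {0..t} s + gainK (source s p) v * indicator {0..t} s \<partial>lborel)"
    by (intro nn_integral_cong) (auto simp: indicator_def K)
  also have "\<dots> = ennreal t * gainK p v + (\<integral>\<^sup>+s\<in>{0..t}. gainK (source s p) v \<partial>lborel)"
    using assms(2) by (simp add: nn_integral_add nn_integral_Icc_const)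
  finally show ?thesis .
qed

text \<open>The remainder of the first-order expansion of the flow at time \<open>0\<close>.\<close>

definition remainder :: "real \<Rightarrow> ('a \<Rightarrow> ennreal) \<Rightarrow> 'a \<Rightarrow> ennreal" where
  "remainder t p v =
     (ennreal (S v) * (\<integral>\<^sup>+s\<in>{0..t}. source s p v \<partial>lborel) + (\<integral>\<^sup>+s\<in>{0..t}. gainK (loss s p) v \<partial>lborel))
     + ((\<integral>\<^sup>+s\<in>{0..t}. gainK (source s p) v \<partial>lborel) + ennreal (S v) * (\<integral>\<^sup>+s\<in>{0..t}. loss s p v \<partial>lborel))"

lemma remainder_meas [measurable]:
  assumes [measurable]: "p \<in> borel_measurable N" shows "remainder t p \<in> borel_measurable N"
  unfolding remainder_def[abs_def]
  using nn_integral_time_meas[OF source_meas2[OF assms]] nn_integral_time_meas[OF loss_meas2[OF assms]]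
    nn_integral_time_meas[OF gainK_meas2[OF source_meas2[OF assms]]]
    nn_integral_time_meas[OF gainK_meas2[OF loss_meas2[OF assms]]]
  by measurable

text \<open>Substituting flow = p + source - loss, additively, in the integrated equation replaces
  the time integrals of the flow by \<open>t\<close> times \<open>p\<close> and \<open>t\<close>
  times \<open>gainK p\<close>. The four integrals left over, two on each side, make up
  \<open>remainder\<close>.\<close>

lemma flow_expansion:
  assumes [measurable]: "p \<in> borel_measurable N" and "0 \<le> t"
  shows "ennreal \<bar>enn2real (flow t p v + ennreal t * (ennreal (S v) * p v)) - enn2real (p v + ennreal t * gainK p v)\<bar>
    \<le> remainder t p v"
  unfolding remainder_def
proof (rule enn2real_abs_diff_le)
  define IF where "IF = (\<integral>\<^sup>+s\<in>{0..t}. flow s p v \<partial>lborel)"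
  define IL where "IL = (\<integral>\<^sup>+s\<in>{0..t}. loss s p v \<partial>lborel)"
  define IS where "IS = (\<integral>\<^sup>+s\<in>{0..t}. source s p v \<partial>lborel)"
  define KF where "KF = (\<integral>\<^sup>+s\<in>{0..t}. gainK (flow s p) v \<partial>lborel)"
  define KL where "KL = (\<integral>\<^sup>+s\<in>{0..t}. gainK (loss s p) v \<partial>lborel)"
  define KS where "KS = (\<integral>\<^sup>+s\<in>{0..t}. gainK (source s p) v \<partial>lborel)"
  have 1: "flow t p v + ennreal (S v) * IF = p v + KF"
    unfolding IF_def KF_def by (rule integrated[OF assms])
  have 2: "IF + IL = ennreal t * p v + IS"
    unfolding IF_def IL_def IS_def by (rule integral_flow_plus_loss[OF assms])
  have 3: "KF + KL = ennreal t * gainK p v + KS"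
    unfolding KF_def KL_def KS_def by (rule integral_gainK_flow_plus_loss[OF assms])
  have "flow t p v + ennreal t * (ennreal (S v) * p v) + (ennreal (S v) * IS + KL)
      = flow t p v + ennreal (S v) * (ennreal t * p v + IS) + KL"
    by (simp add: distrib_left mult_ac add_ac)
  also have "\<dots> = (flow t p v + ennreal (S v) * IF) + ennreal (S v) * IL + KL"
    unfolding 2[symmetric] by (simp add: distrib_left add_ac)
  also have "\<dots> = p v + (KF + KL) + ennreal (S v) * IL"
    unfolding 1 by (simp add: add_ac)
  also have "\<dots> = p v + ennreal t * gainK p v + (KS + ennreal (S v) * IL)"
    unfolding 3 by (simp add: add_ac)
  finally show "flow t p v + ennreal t * (ennreal (S v) * p v) + (ennreal (S v) * IS + KL)
      = p v + ennreal t * gainK p v + (KS + ennreal (S v) * IL)" .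
qed

text \<open>By conservation of mass, what arrives has the mass of what has left. The right side is
  explicit and bounded by \<open>t\<close> times a quantity that tends to zero, which is not visible
  for the source.\<close>

lemma accum_source_mass:
  assumes [measurable]: "p \<in> borel_measurable N" and fin: "wnorm p < \<infinity>" and "0 \<le> t"
  shows "accum (\<lambda>_. 1) (\<lambda>s. source s p) t = accum (\<lambda>_. 1) (\<lambda>s. loss s p) t"
proof -
  have fin1: "(\<integral>\<^sup>+v. p v \<partial>N) < \<infinity>" by (rule le_less_trans[OF nn_integral_le_wnorm fin])
  have "(\<integral>\<^sup>+v. source s p v \<partial>N) = (\<integral>\<^sup>+v. loss s p v \<partial>N)" if "0 \<le> s" for s
  proof -
    have "(\<integral>\<^sup>+v. p v \<partial>N) + (\<integral>\<^sup>+v. loss s p v \<partial>N) = (\<integral>\<^sup>+v. flow s p v + loss s p v \<partial>N)"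
      using flow_mass[OF assms(1) fin that] by (simp add: nn_integral_add)
    also have "\<dots> = (\<integral>\<^sup>+v. p v \<partial>N) + (\<integral>\<^sup>+v. source s p v \<partial>N)"
      using that by (simp add: flow_plus_loss nn_integral_add)
    finally show ?thesis using fin1 by (auto simp: ennreal_add_left_cancel)
  qed
  then show ?thesis unfolding accum_def by (intro nn_integral_cong) (auto simp: indicator_def)
qed

text \<open>The time integral of the source in the weight \<open>S W\<close> has to be o(t), whereas
  \<open>flow_rate\<close> yields only a bound that does not vanish with \<open>t\<close>.
  \<open>S\<close> times the time integral of the source is the time integral of (1 - exp(-S (t -
  r))) times the gain of the flow. The flow is at most \<open>p\<close> plus the source: the first
  part contributes \<open>t\<close> times a loss term of \<open>gainK p\<close>, the second is a
  gain of the source, which by \<open>lyapunov\<close> is the fraction \<open>th\<close> of the left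
  side and a mass term. The fraction is absorbed.\<close>

lemma accum_SW_source:
  assumes [measurable]: "p \<in> borel_measurable N" and fin: "wnorm p < \<infinity>" and "0 \<le> t"
  shows "accum (\<lambda>v. S v * W v) (\<lambda>s. source s p) t
    \<le> ennreal (1 / (1 - th)) * (ennreal t * (wnorm (loss t (gainK p)) + ennreal C * (\<integral>\<^sup>+v. loss t p v \<partial>N)))"
proof -
  let ?a = "accum (\<lambda>v. S v * W v) (\<lambda>s. source s p) t"
  have le: "ennreal (S v) * (\<integral>\<^sup>+s\<in>{0..t}. source s p v \<partial>lborel)
      \<le> ennreal t * loss t (gainK p) v + (\<integral>\<^sup>+s\<in>{0..t}. gainK (source s p) v \<partial>lborel)" for v
  proof -
    have "ennreal (S v) * (\<integral>\<^sup>+s\<in>{0..t}. source s p v \<partial>lborel)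
        = (\<integral>\<^sup>+r\<in>{0..t}. ennreal (1 - exp (- S v * (t - r))) * gainK (flow r p) v \<partial>lborel)"
      unfolding source_def by (intro S_integral_duhamel flow_meas2) measurable
    also have "\<dots> \<le> (\<integral>\<^sup>+r. loss t (gainK p) v * indicator {0..t} r + gainK (source r p) v * indicator {0..t} r \<partial>lborel)"
    proof (intro nn_integral_mono)
      fix r
      have "ennreal (1 - exp (- S v * (t - r))) * gainK (flow r p) v \<le> loss t (gainK p) v + gainK (source r p) v"
        if "0 \<le> r" "r \<le> t"
      proof -
        have "gainK (flow r p) v \<le> gainK (\<lambda>v. p v + source r p v) v"
          using that(1) by (intro gainK_mono) (simp add: flow_eq_free_source free_le add_right_mono)
        also have "\<dots> = gainK p v + gainK (source r p) v" by (simp add: gainK_add)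
        finally have "ennreal (1 - exp (- S v * (t - r))) * gainK (flow r p) v
            \<le> ennreal (1 - exp (- S v * (t - r))) * gainK p v + ennreal (1 - exp (- S v * (t - r))) * gainK (source r p) v"
          by (metis distrib_left mult_left_mono zero_le)
        also have "\<dots> \<le> loss t (gainK p) v + 1 * gainK (source r p) v"
          unfolding loss_def using that S_nonneg[of v]
          by (intro add_mono mult_right_mono) (auto intro!: ennreal_leI mult_left_mono simp: ennreal_le_1)
        finally show ?thesis by simp
      qed
      then show "ennreal (1 - exp (- S v * (t - r))) * gainK (flow r p) v * indicator {0..t} r
        \<le> loss t (gainK p) v * indicator {0..t} r + gainK (source r p) v * indicator {0..t} r"
        by (auto simp: indicator_def)
    qed
    also have "\<dots> = ennreal t * loss t (gainK p) v + (\<integral>\<^sup>+s\<in>{0..t}. gainK (source s p) v \<partial>lborel)"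
      using assms(3) by (simp add: nn_integral_add nn_integral_Icc_const)
    finally show ?thesis .
  qed
  have "?a = wnorm (\<lambda>v. ennreal (S v) * (\<integral>\<^sup>+s\<in>{0..t}. source s p v \<partial>lborel))"
    by (simp add: accum_SW_time[symmetric] ynorm_eq_wnorm source_meas2)
  also have "\<dots> \<le> wnorm (\<lambda>v. ennreal t * loss t (gainK p) v + (\<integral>\<^sup>+s\<in>{0..t}. gainK (source s p) v \<partial>lborel))"
    by (intro wnorm_mono le)
  also have "\<dots> = ennreal t * wnorm (loss t (gainK p)) + accum W (\<lambda>s. gainK (source s p)) t"
    using nn_integral_time_meas[OF gainK_meas2[OF source_meas2[OF assms(1)]]]
    by (simp add: wnorm_add wnorm_cmult accum_W_time gainK_meas2 source_meas2)
  also have "\<dots> \<le> ennreal t * wnorm (loss t (gainK p)) + (ennreal th * ?a + ennreal C * accum (\<lambda>_. 1) (\<lambda>s. source s p) t)"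
    by (intro add_left_mono accum_gainK_W source_meas2 assms)
  also have "\<dots> \<le> ennreal t * wnorm (loss t (gainK p)) + (ennreal th * ?a + ennreal C * (ennreal t * (\<integral>\<^sup>+v. 1 * loss t p v \<partial>N)))"
    using accum_le[of t "\<lambda>s. loss s p" "loss t p" "\<lambda>_. 1"] assms
    by (intro add_left_mono mult_left_mono) (auto simp: accum_source_mass loss_mono)
  also have "\<dots> = ennreal t * (wnorm (loss t (gainK p)) + ennreal C * (\<integral>\<^sup>+v. loss t p v \<partial>N)) + ennreal th * ?a"
    by (simp add: distrib_left mult_ac add_ac)
  finally have "?a \<le> ennreal t * (wnorm (loss t (gainK p)) + ennreal C * (\<integral>\<^sup>+v. loss t p v \<partial>N)) + ennreal th * ?a" .
  \<comment> \<open>The finiteness required by the absorption: the source is a part of the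
    flow.\<close>
  moreover have "?a \<le> accum (\<lambda>v. S v * W v) (\<lambda>s. flow s p) t"
    by (intro accum_mono) (simp add: flow_eq_free_source)
  then have "?a < \<infinity>" using flow_rate_finite[OF assms] by (rule le_less_trans)
  ultimately show ?thesis using th by (intro ennreal_absorb) auto
qed

definition remainder_bound :: "('a \<Rightarrow> ennreal) \<Rightarrow> real \<Rightarrow> ennreal" where
  "remainder_bound p t =
     2 * (ennreal (1 / (1 - th)) * (wnorm (loss t (gainK p)) + ennreal C * (\<integral>\<^sup>+v. loss t p v \<partial>N)))
     + 2 * ynorm (loss t p) + 2 * (ennreal C * (\<integral>\<^sup>+v. loss t p v \<partial>N))"

lemma wnorm_remainder_le:
  assumes [measurable]: "p \<in> borel_measurable N" and fin: "wnorm p < \<infinity>" and "0 \<le> t"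
  shows "wnorm (remainder t p) \<le> ennreal t * remainder_bound p t"
proof -
  note m = source_meas2[OF assms(1)] loss_meas2[OF assms(1)]
  note [measurable] = m[THEN nn_integral_time_meas] m[THEN gainK_meas2, THEN nn_integral_time_meas]
  let ?a = "accum (\<lambda>v. S v * W v) (\<lambda>s. source s p) t" and ?l = "accum (\<lambda>v. S v * W v) (\<lambda>s. loss s p) t"
    and ?m = "accum (\<lambda>_. 1) (\<lambda>s. loss s p) t"
  have th1: "ennreal th * x \<le> x" for x
    using mult_right_mono[of "ennreal th" 1 x] th by (simp add: ennreal_le_1)
  have "wnorm (remainder t p) = (?a + accum W (\<lambda>s. gainK (loss s p)) t) + (accum W (\<lambda>s. gainK (source s p)) t + ?l)"
    unfolding remainder_def[abs_def] using m
    by (simp add: wnorm_add accum_W_time gainK_meas2 ynorm_eq_wnorm[symmetric] accum_SW_time)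
  also have "\<dots> \<le> (?a + (ennreal th * ?l + ennreal C * ?m)) + ((ennreal th * ?a + ennreal C * ?m) + ?l)"
    using accum_gainK_W[OF m(1), of t] accum_gainK_W[OF m(2), of t] accum_source_mass[OF assms]
    by (intro add_mono) auto
  also have "\<dots> \<le> (?a + (?l + ennreal C * ?m)) + ((?a + ennreal C * ?m) + ?l)"
    by (intro add_mono order_refl th1)
  also have "\<dots> = 2 * ?a + 2 * ?l + 2 * (ennreal C * ?m)"
    by (simp add: mult_2 add_ac)
  also have "\<dots> \<le> 2 * (ennreal (1 / (1 - th)) * (ennreal t * (wnorm (loss t (gainK p)) + ennreal C * (\<integral>\<^sup>+v. loss t p v \<partial>N))))
      + 2 * (ennreal t * ynorm (loss t p)) + 2 * (ennreal C * (ennreal t * (\<integral>\<^sup>+v. loss t p v \<partial>N)))"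
    using accum_SW_source[OF assms] accum_le[of t "\<lambda>s. loss s p" "loss t p" "\<lambda>_. 1"]
      accum_le[of t "\<lambda>s. loss s p" "loss t p" "\<lambda>v. S v * W v"] assms(3)
    by (intro add_mono mult_left_mono) (auto simp: loss_mono ynorm_def)
  also have "\<dots> = ennreal t * remainder_bound p t"
    unfolding remainder_bound_def by (simp add: distrib_left mult_ac)
  finally show ?thesis .
qed

text \<open>The finiteness of \<open>ynorm p\<close> enters twice as a dominating function, directly
  for the loss of \<open>p\<close> in the weight \<open>S W\<close>, and through
  \<open>wnorm_gainK_finite\<close> for the loss of \<open>gainK p\<close> in the weight
  \<open>W\<close>.\<close>

lemma remainder_bound_tendsto_0:
  assumes p: "p \<in> borel_measurable N" and fin: "ynorm p < \<infinity>"
  shows "(remainder_bound p \<longlongrightarrow> 0) (at_right 0)"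
proof -
  have w: "wnorm p < \<infinity>" by (rule wnorm_finite_of_ynorm[OF assms])
  have "((\<lambda>t. wnorm (loss t (gainK p))) \<longlongrightarrow> 0) (at_right 0)"
    using wnorm_gainK_finite[OF assms] p unfolding wnorm_def by (intro loss_tendsto_0) auto
  moreover have "((\<lambda>t. ynorm (loss t p)) \<longlongrightarrow> 0) (at_right 0)"
    using assms unfolding ynorm_def by (intro loss_tendsto_0) auto
  moreover have "((\<lambda>t. \<integral>\<^sup>+v. loss t p v \<partial>N) \<longlongrightarrow> 0) (at_right 0)"
    using loss_tendsto_0[OF p, of "\<lambda>_. 1"] le_less_trans[OF nn_integral_le_wnorm w] by simp
  ultimately have "(remainder_bound p \<longlongrightarrow> 2 * (ennreal (1 / (1 - th)) * (0 + 0)) + 2 * 0 + 2 * 0) (at_right 0)"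
    unfolding remainder_bound_def[abs_def]
    by (intro tendsto_add ennreal_tendsto_cmult ennreal_tendsto_cmult_0) (auto simp: ennreal_mult_less_top)
  then show ?thesis by simp
qed

lemma op_expansion:
  assumes f [measurable]: "f \<in> borel_measurable N" and fin: "ynorm (\<lambda>v. ennreal \<bar>f v\<bar>) < \<infinity>" and "0 \<le> t"
  shows "wnorm (\<lambda>v. ennreal \<bar>op t f v - f v - t * generator f v\<bar>)
    \<le> ennreal t * (remainder_bound (\<lambda>v. ennreal (f v)) t + remainder_bound (\<lambda>v. ennreal (- f v)) t)"
proof -
  let ?p = "\<lambda>v. ennreal (f v)" and ?q = "\<lambda>v. ennreal (- f v)"
  have y: "ynorm ?p < \<infinity>" "ynorm ?q < \<infinity>"
    using fin unfolding ennreal_abs_eq by (auto simp: ynorm_add)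
  have w: "wnorm ?p < \<infinity>" "wnorm ?q < \<infinity>"
    using y by (auto intro!: wnorm_finite_of_ynorm[unfolded infinity_ennreal_def])
  have "AE v in N. flow t ?p v < \<infinity>" "AE v in N. flow t ?q v < \<infinity>"
    using AE_flow_finite[OF _ w(1) assms(3)] AE_flow_finite[OF _ w(2) assms(3)] by auto
  moreover have "AE v in N. gainK ?p v < \<infinity>" "AE v in N. gainK ?q v < \<infinity>"
    using wnorm_finite_AE[OF _ wnorm_gainK_finite[OF _ y(1)]] wnorm_finite_AE[OF _ wnorm_gainK_finite[OF _ y(2)]] by auto
  ultimately have "AE v in N. ennreal \<bar>op t f v - f v - t * generator f v\<bar> \<le> remainder t ?p v + remainder t ?q v"
  proof eventually_elim
    case (elim v)
    have e: "enn2real (flow t h v + ennreal t * (ennreal (S v) * h v)) - enn2real (h v + ennreal t * gainK h v)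
        = enn2real (flow t h v) + t * (S v * enn2real (h v)) - enn2real (h v) - t * enn2real (gainK h v)"
      if "flow t h v < \<infinity>" "gainK h v < \<infinity>" "h v < \<infinity>" for h
      using that \<open>0 \<le> t\<close> S_nonneg[of v] by (simp add: enn2real_plus enn2real_mult ennreal_mult_less_top)
    let ?a = "enn2real (flow t ?p v + ennreal t * (ennreal (S v) * ?p v)) - enn2real (?p v + ennreal t * gainK ?p v)"
      and ?b = "enn2real (flow t ?q v + ennreal t * (ennreal (S v) * ?q v)) - enn2real (?q v + ennreal t * gainK ?q v)"
    have "op t f v - f v - t * generator f v = ?a - ?b"
    proof -
      define P where "P = enn2real (ennreal (f v))"
      define Q where "Q = enn2real (ennreal (- f v))"
      have f: "f v = P - Q" using enn2real_pos_minus_neg[of "f v"] by (simp add: P_def Q_def)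
      show ?thesis
        unfolding e[OF elim(1,3), OF ennreal_less_top[folded infinity_ennreal_def]]
          e[OF elim(2,4), OF ennreal_less_top[folded infinity_ennreal_def]] op_def generator_def P_def[symmetric] Q_def[symmetric]
        by (simp add: f algebra_simps)
    qed
    then have "ennreal \<bar>op t f v - f v - t * generator f v\<bar> \<le> ennreal (\<bar>?a\<bar> + \<bar>?b\<bar>)" by (intro ennreal_leI) linarith
    also have "\<dots> = ennreal \<bar>?a\<bar> + ennreal \<bar>?b\<bar>" by simp
    also have "\<dots> \<le> remainder t ?p v + remainder t ?q v"
      using assms(3) by (intro add_mono flow_expansion) auto
    finally show ?case .
  qed
  then have "wnorm (\<lambda>v. ennreal \<bar>op t f v - f v - t * generator f v\<bar>) \<le> wnorm (remainder t ?p) + wnorm (remainder t ?q)"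
    by (subst wnorm_add[symmetric]) (auto intro: wnorm_mono_AE)
  also have "\<dots> \<le> ennreal t * remainder_bound ?p t + ennreal t * remainder_bound ?q t"
    using w assms(3) by (intro add_mono wnorm_remainder_le) auto
  finally show ?thesis by (simp add: distrib_left)
qed

text \<open>The image \<open>g\<close> is any representative of \<open>generator f\<close>. This
  freedom is needed because the collision operator, a Bochner integral, coincides with
  \<open>generator\<close> only almost everywhere.\<close>

theorem op_generator_on_domain:
  assumes f [measurable]: "f \<in> borel_measurable N" and fin: "ynorm (\<lambda>v. ennreal \<bar>f v\<bar>) < \<infinity>"
    and g [measurable]: "g \<in> borel_measurable N" and eq: "AE v in N. g v = generator f v"
  shows "(f, g) \<in> generator_graph X op"
proof -
  let ?p = "\<lambda>v. ennreal (f v)" and ?q = "\<lambda>v. ennreal (- f v)"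
  have y: "ynorm ?p < \<infinity>" "ynorm ?q < \<infinity>"
    using fin unfolding ennreal_abs_eq by (auto simp: ynorm_add)
  have "wnorm (\<lambda>v. ennreal \<bar>f v\<bar>) < \<infinity>"
    by (intro wnorm_finite_of_ynorm fin) measurable
  then have fX: "f \<in> L1 X" using f by (simp add: L1_X)
  have "AE v in N. ennreal \<bar>g v\<bar> \<le> (gainK ?q v + gainK ?p v) + ennreal (S v) * ennreal \<bar>f v\<bar>"
    using eq
  proof eventually_elim
    case (elim v)
    have "\<bar>g v\<bar> \<le> \<bar>enn2real (gainK ?p v) - enn2real (gainK ?q v)\<bar> + S v * \<bar>f v\<bar>"
      unfolding elim generator_def using S_nonneg[of v] by (auto simp: abs_mult intro!: order_trans[OF abs_triangle_ineq4])
    then have "ennreal \<bar>g v\<bar> \<le> ennreal \<bar>enn2real (gainK ?p v) - enn2real (gainK ?q v)\<bar> + ennreal (S v) * ennreal \<bar>f v\<bar>"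
      using S_nonneg[of v] by (simp add: ennreal_mult[symmetric] ennreal_plus[symmetric] ennreal_leI del: ennreal_plus)
    also have "\<dots> \<le> (gainK ?q v + gainK ?p v) + ennreal (S v) * ennreal \<bar>f v\<bar>"
      by (intro add_right_mono enn2real_abs_diff_le add.commute)
    finally show ?case .
  qed
  then have "wnorm (\<lambda>v. ennreal \<bar>g v\<bar>) \<le> (wnorm (gainK ?q) + wnorm (gainK ?p)) + ynorm (\<lambda>v. ennreal \<bar>f v\<bar>)"
    unfolding ynorm_eq_wnorm by ((subst wnorm_add[symmetric], measurable)+) (rule wnorm_mono_AE)
  also have "\<dots> < \<infinity>" using wnorm_gainK_finite[OF _ y(1)] wnorm_gainK_finite[OF _ y(2)] fin by simp
  finally have gX: "g \<in> L1 X" by (simp add: L1_X)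
  have le: "wnorm (\<lambda>v. ennreal \<bar>(op t f v - f v) / t - g v\<bar>) \<le> remainder_bound ?p t + remainder_bound ?q t"
    if "0 < t" for t
  proof (rule ennreal_mult_le_cancel[OF _ that])
    have "ennreal t * wnorm (\<lambda>v. ennreal \<bar>(op t f v - f v) / t - g v\<bar>) = wnorm (\<lambda>v. ennreal t * ennreal \<bar>(op t f v - f v) / t - g v\<bar>)"
      by (rule wnorm_cmult[symmetric]) measurable
    also have "\<dots> = wnorm (\<lambda>v. ennreal \<bar>op t f v - f v - t * g v\<bar>)"
    proof -
      have "t * \<bar>(op t f v - f v) / t - g v\<bar> = \<bar>op t f v - f v - t * g v\<bar>" for v
      proof -
        have "t * (a / t - b) = a - t * b" for a b
          using that by (simp add: right_diff_distrib)
        from this[of "op t f v - f v" "g v", symmetric] show ?thesis using that by (simp add: abs_mult)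
      qed
      then show ?thesis using that by (simp add: ennreal_mult[symmetric])
    qed
    also have "\<dots> \<le> wnorm (\<lambda>v. ennreal \<bar>op t f v - f v - t * generator f v\<bar>)"
      using eq by (intro wnorm_mono_AE) (auto elim!: eventually_mono)
    also have "\<dots> \<le> ennreal t * (remainder_bound ?p t + remainder_bound ?q t)"
      using that by (intro op_expansion f fin) auto
    finally show "ennreal t * wnorm (\<lambda>v. ennreal \<bar>(op t f v - f v) / t - g v\<bar>)
      \<le> ennreal t * (remainder_bound ?p t + remainder_bound ?q t)" .
  qed
  have "((\<lambda>t. remainder_bound ?p t + remainder_bound ?q t) \<longlongrightarrow> 0 + 0) (at_right 0)"
    using y by (intro tendsto_add remainder_bound_tendsto_0) auto
  then have lim: "((\<lambda>t. remainder_bound ?p t + remainder_bound ?q t) \<longlongrightarrow> 0) (at_right 0)" by simp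
  have "((\<lambda>t. wnorm (\<lambda>v. ennreal \<bar>(op t f v - f v) / t - g v\<bar>)) \<longlongrightarrow> 0) (at_right 0)"
  proof (rule tendsto_sandwich[OF _ _ tendsto_const lim])
    show "\<forall>\<^sub>F t in at_right 0. wnorm (\<lambda>v. ennreal \<bar>(op t f v - f v) / t - g v\<bar>) \<le> remainder_bound ?p t + remainder_bound ?q t"
      using le by (simp add: eventually_at_filter)
  qed simp
  then have "((\<lambda>t. L1_norm X (\<lambda>v. (op t f v - f v) / t - g v)) \<longlongrightarrow> 0) (at_right 0)"
    by (simp add: L1_norm_X tendsto_enn2real_0)
  with fX gX show ?thesis by (simp add: generator_graph_def)
qed

section \<open>Functions in the domain of the generator have finite \<open>ynorm\<close>\<close>

lemma gainK_cong_AE: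
  assumes "AE x in N. f x = g x" shows "gainK f v = gainK g v"
  unfolding gainK_def using assms by (intro nn_integral_cong_AE) auto

text \<open>The time integral of \<open>op s f\<close> over [0, t] has finite \<open>ynorm\<close>
  by \<open>flow_rate_finite\<close> even if \<open>f\<close> does not, so the resolvent-type
  estimate with the factor 1 / (1 - \<open>th\<close>) is legitimate for it. Divided by
  \<open>t\<close> it approximates \<open>f\<close>, but only in the weight \<open>W\<close>.
  Therefore \<open>S\<close> is truncated at \<open>n\<close>: on the approximation error the
  truncated weight costs a factor \<open>n\<close>, which is harmless as \<open>t\<close> tends to
  zero with \<open>n\<close> fixed.\<close>

lemma generator_graph_estimate:
  assumes f: "f \<in> L1 X" and "0 < t"
  shows "ennreal t * (\<integral>\<^sup>+v. ennreal (min (S v) (real n) * W v) * ennreal \<bar>f v\<bar> \<partial>N)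
    \<le> ennreal (1 / (1 - th)) * (wnorm (\<lambda>v. ennreal \<bar>op t f v - f v\<bar>) + ennreal C * (ennreal t * wnorm (\<lambda>v. ennreal \<bar>f v\<bar>)))
      + ennreal (real n) * (ennreal t * op_bound f t)"
proof -
  let ?p = "\<lambda>v. ennreal (f v)" and ?q = "\<lambda>v. ennreal (- f v)"
  note fin = wnorm_parts_finite[OF f]
  note [measurable] = fin(1)
  have t: "0 \<le> t" using assms(2) by simp
  define I where "I p v = (\<integral>\<^sup>+s\<in>{0..t}. flow s p v \<partial>lborel)" for p v
  have I_meas [measurable]: "I p \<in> borel_measurable N" if [measurable]: "p \<in> borel_measurable N" for p
    unfolding I_def[abs_def] by (intro nn_integral_time_meas flow_meas2 that)
  have yI: "ynorm (I p) < \<infinity>" if "p \<in> borel_measurable N" "wnorm p < \<infinity>" for p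
    using flow_rate_finite[OF that t] unfolding I_def[abs_def] accum_SW_time[OF flow_meas2[OF that(1)]] .
  have wI: "wnorm (I p) < \<infinity>" if "p \<in> borel_measurable N" "wnorm p < \<infinity>" for p
    by (rule wnorm_finite_of_ynorm[OF I_meas[OF that(1)] yI[OF that]])
  \<comment> \<open>\<open>x\<close> stands for the time integral of \<open>op s f\<close> over
    [0, t], and \<open>d\<close> for its absolute value.\<close>
  define x where "x v = enn2real (I ?p v) - enn2real (I ?q v)" for v
  define d where "d v = ennreal \<bar>x v\<bar>" for v
  have [measurable]: "x \<in> borel_measurable N" unfolding x_def[abs_def] by measurable
  have [measurable]: "d \<in> borel_measurable N" unfolding d_def[abs_def] by measurable
  have d_le: "d v \<le> I ?q v + I ?p v" for v
    unfolding d_def x_def by (rule enn2real_abs_diff_le) (rule add.commute)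
  have AE_I: "AE v in N. I ?p v < \<infinity>" "AE v in N. I ?q v < \<infinity>"
    using wnorm_finite_AE[OF _ wI[OF _ fin(2)]] wnorm_finite_AE[OF _ wI[OF _ fin(3)]] by auto
  have split: "AE v in N. I ?p v + ennreal (- x v) = I ?q v + ennreal (x v)"
    using AE_I
  proof eventually_elim
    case (elim v)
    obtain a where a: "I ?p v = ennreal a" "0 \<le> a" using elim(1) by (cases "I ?p v") auto
    obtain b where b: "I ?q v = ennreal b" "0 \<le> b" using elim(2) by (cases "I ?q v") auto
    show ?case using a b
      by (cases "0 \<le> x v") (auto simp: x_def ennreal_neg ennreal_plus[symmetric] simp del: ennreal_plus)
  qed
  have K: "ennreal \<bar>enn2real (gainK (I ?p) v) - enn2real (gainK (I ?q) v)\<bar> \<le> gainK d v" for v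
  proof -
    have "gainK (I ?p) v + gainK (\<lambda>v. ennreal (- x v)) v = gainK (I ?q) v + gainK (\<lambda>v. ennreal (x v)) v"
      using gainK_cong_AE[OF split, of v] by (simp add: gainK_add)
    then have "ennreal \<bar>enn2real (gainK (I ?p) v) - enn2real (gainK (I ?q) v)\<bar>
        \<le> gainK (\<lambda>v. ennreal (- x v)) v + gainK (\<lambda>v. ennreal (x v)) v"
      by (rule enn2real_abs_diff_le)
    also have "\<dots> = gainK d v" unfolding d_def ennreal_abs_eq by (simp add: gainK_add add.commute)
    finally show ?thesis .
  qed
  \<comment> \<open>\<open>integrated\<close> for both parts, subtracted: \<open>S x\<close> equals
    \<open>f - op t f\<close> plus the gain of \<open>x\<close>, and the absolute value of the
    latter is at most the gain of |x|.\<close>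
  have "AE v in N. ennreal (S v) * d v \<le> ennreal \<bar>op t f v - f v\<bar> + gainK d v"
  proof -
    have "AE v in N. flow t ?p v < \<infinity>" "AE v in N. flow t ?q v < \<infinity>"
      using AE_flow_finite[OF _ fin(2) t] AE_flow_finite[OF _ fin(3) t] by auto
    with AE_I show ?thesis
    proof eventually_elim
      case (elim v)
      have e: "enn2real (flow t h v) + S v * enn2real (I h v) = enn2real (h v) + enn2real (gainK (I h) v)"
        if [measurable]: "h \<in> borel_measurable N" and "flow t h v < \<infinity>" "I h v < \<infinity>" "h v < \<infinity>" for h
      proof -
        have *: "flow t h v + ennreal (S v) * I h v = h v + gainK (I h) v"
          using integrated[OF that(1) t, of v] unfolding I_def[abs_def] gainK_nn_integral[OF flow_meas2[OF that(1)]] .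
        have "flow t h v + ennreal (S v) * I h v < \<infinity>" using that by (simp add: ennreal_mult_less_top)
        then have "gainK (I h) v < \<infinity>" unfolding * by simp
        then show ?thesis using arg_cong[OF *, of enn2real] that S_nonneg[of v]
          by (simp add: enn2real_plus enn2real_mult ennreal_mult_less_top)
      qed
      have "S v * x v = f v - op t f v + (enn2real (gainK (I ?p) v) - enn2real (gainK (I ?q) v))"
        using e[of ?p] e[of ?q] elim enn2real_pos_minus_neg[of "f v"]
        unfolding x_def op_def right_diff_distrib by simp
      then have "S v * \<bar>x v\<bar> \<le> \<bar>op t f v - f v\<bar> + \<bar>enn2real (gainK (I ?p) v) - enn2real (gainK (I ?q) v)\<bar>"
        using abs_mult[of "S v" "x v"] S_nonneg[of v] by simp
      then have "ennreal (S v) * d v \<le> ennreal \<bar>op t f v - f v\<bar> + ennreal \<bar>enn2real (gainK (I ?p) v) - enn2real (gainK (I ?q) v)\<bar>"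
        unfolding d_def using S_nonneg[of v]
        by (simp add: ennreal_mult[symmetric] ennreal_plus[symmetric] ennreal_leI del: ennreal_plus)
      also have "\<dots> \<le> ennreal \<bar>op t f v - f v\<bar> + gainK d v" by (intro add_left_mono K)
      finally show ?case .
    qed
  qed
  then have "ynorm d \<le> wnorm (\<lambda>v. ennreal \<bar>op t f v - f v\<bar> + gainK d v)"
    unfolding ynorm_eq_wnorm by (rule wnorm_mono_AE)
  also have "\<dots> = wnorm (\<lambda>v. ennreal \<bar>op t f v - f v\<bar>) + wnorm (gainK d)" by (rule wnorm_add) measurable
  also have "\<dots> \<le> wnorm (\<lambda>v. ennreal \<bar>op t f v - f v\<bar>) + (ennreal th * ynorm d + ennreal C * (\<integral>\<^sup>+v. d v \<partial>N))"
    by (intro add_left_mono wnorm_gainK_le) measurable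
  finally have yd_le: "ynorm d \<le> wnorm (\<lambda>v. ennreal \<bar>op t f v - f v\<bar>) + (ennreal th * ynorm d + ennreal C * (\<integral>\<^sup>+v. d v \<partial>N))" .
  have d_mass: "(\<integral>\<^sup>+v. d v \<partial>N) \<le> ennreal t * wnorm (\<lambda>v. ennreal \<bar>f v\<bar>)"
  proof -
    have I1: "(\<integral>\<^sup>+v. I p v \<partial>N) \<le> ennreal t * wnorm p" if p: "p \<in> borel_measurable N" "wnorm p < \<infinity>" for p
    proof -
      have "(\<integral>\<^sup>+v. I p v \<partial>N) = accum (\<lambda>_. 1) (\<lambda>s. flow s p) t"
        unfolding I_def accum_def using nn_integral_time_swap[OF flow_meas2[OF p(1)], of "\<lambda>_. 1" t] by simp
      also have "\<dots> \<le> ennreal t * (\<integral>\<^sup>+v. p v \<partial>N)"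
        using flow_mass_le[OF p(1) le_less_trans[OF nn_integral_le_wnorm p(2)]] t by (intro accum_mass_le) auto
      also have "\<dots> \<le> ennreal t * wnorm p" by (intro mult_left_mono nn_integral_le_wnorm) auto
      finally show ?thesis .
    qed
    have "(\<integral>\<^sup>+v. d v \<partial>N) \<le> (\<integral>\<^sup>+v. I ?q v + I ?p v \<partial>N)" by (intro nn_integral_mono d_le)
    also have "\<dots> = (\<integral>\<^sup>+v. I ?q v \<partial>N) + (\<integral>\<^sup>+v. I ?p v \<partial>N)" by (intro nn_integral_add) measurable
    also have "\<dots> \<le> ennreal t * wnorm ?q + ennreal t * wnorm ?p"
      using fin by (intro add_mono I1) auto
    also have "\<dots> = ennreal t * wnorm (\<lambda>v. ennreal \<bar>f v\<bar>)"
      by (simp add: wnorm_abs distrib_left add.commute)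
    finally show ?thesis .
  qed
  have "ynorm d \<le> wnorm (\<lambda>v. ennreal \<bar>op t f v - f v\<bar>) + (ennreal th * ynorm d + ennreal C * (ennreal t * wnorm (\<lambda>v. ennreal \<bar>f v\<bar>)))"
    by (rule order_trans[OF yd_le]) (intro add_left_mono mult_left_mono d_mass, simp)
  then have "ynorm d \<le> (wnorm (\<lambda>v. ennreal \<bar>op t f v - f v\<bar>) + ennreal C * (ennreal t * wnorm (\<lambda>v. ennreal \<bar>f v\<bar>))) + ennreal th * ynorm d"
    by (simp add: add_ac)
  moreover have "ynorm d < \<infinity>"
  proof -
    have "ynorm d \<le> ynorm (\<lambda>v. I ?q v + I ?p v)" by (intro ynorm_mono_AE) (simp add: d_le)
    also have "\<dots> = ynorm (I ?q) + ynorm (I ?p)" by (intro ynorm_add) measurable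
    also have "\<dots> < \<infinity>" using yI[OF _ fin(2)] yI[OF _ fin(3)] by simp
    finally show ?thesis .
  qed
  ultimately have yd: "ynorm d \<le> ennreal (1 / (1 - th)) * (wnorm (\<lambda>v. ennreal \<bar>op t f v - f v\<bar>) + ennreal C * (ennreal t * wnorm (\<lambda>v. ennreal \<bar>f v\<bar>)))"
    using th by (intro ennreal_absorb) auto
  \<comment> \<open>The error of replacing the time integral of the flow by \<open>t p\<close>. Its
    norm is \<open>t\<close> times a quantity that vanishes with \<open>t\<close>.\<close>
  define E where "E p v = (\<integral>\<^sup>+s\<in>{0..t}. source s p v \<partial>lborel) + (\<integral>\<^sup>+s\<in>{0..t}. loss s p v \<partial>lborel)" for p v
  have E_meas [measurable]: "E p \<in> borel_measurable N" if [measurable]: "p \<in> borel_measurable N" for p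
    unfolding E_def[abs_def] using nn_integral_time_meas[OF source_meas2[OF that]] nn_integral_time_meas[OF loss_meas2[OF that]]
    by measurable
  have wE: "wnorm (E p) \<le> ennreal t * (source_bound p t + wnorm (loss t p))"
    if p: "p \<in> borel_measurable N" "wnorm p < \<infinity>" for p
  proof -
    note [measurable] = p(1) nn_integral_time_meas[OF source_meas2[OF p(1)]] nn_integral_time_meas[OF loss_meas2[OF p(1)]]
    have "wnorm (E p) = accum W (\<lambda>s. source s p) t + accum W (\<lambda>s. loss s p) t"
      unfolding E_def[abs_def] by (simp add: wnorm_add accum_W_time source_meas2 loss_meas2)
    also have "\<dots> \<le> (\<integral>\<^sup>+s\<in>{0..t}. source_bound p t \<partial>lborel) + ennreal t * (\<integral>\<^sup>+v. ennreal (W v) * loss t p v \<partial>N)"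
    proof (intro add_mono accum_le)
      show "accum W (\<lambda>s. source s p) t \<le> (\<integral>\<^sup>+s\<in>{0..t}. source_bound p t \<partial>lborel)"
        unfolding accum_def wnorm_def[symmetric]
        using order_trans[OF wnorm_source_le[OF p] source_bound_mono]
        by (intro nn_integral_mono) (auto simp: indicator_def)
    qed (use t in \<open>auto intro: loss_mono\<close>)
    finally show ?thesis using t by (simp add: nn_integral_Icc_const distrib_left wnorm_def)
  qed
  have "AE v in N. ennreal t * ennreal \<bar>f v\<bar> \<le> d v + (E ?p v + E ?q v)"
    using split
  proof eventually_elim
    case (elim v)
    have i: "I h v + (\<integral>\<^sup>+s\<in>{0..t}. loss s h v \<partial>lborel) = ennreal t * h v + (\<integral>\<^sup>+s\<in>{0..t}. source s h v \<partial>lborel)"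
      if "h \<in> borel_measurable N" for h
      unfolding I_def by (rule integral_flow_plus_loss[OF that t])
    \<comment> \<open>At each point one of the two parts of \<open>f\<close> vanishes.
      \<open>h\<close> is the other one, so \<open>h v\<close> is |f v|, and \<open>h'\<close> is
      the vanishing part.\<close>
    have main: "ennreal t * h v \<le> d v + (E h v + E h' v)"
      if [measurable]: "h \<in> borel_measurable N" "h' \<in> borel_measurable N" and "h' v = 0"
        and "I h v \<le> I h' v + d v" for h h'
    proof -
      have "ennreal t * h v \<le> I h v + (\<integral>\<^sup>+s\<in>{0..t}. loss s h v \<partial>lborel)"
        unfolding i[OF that(1)] by simp
      also have "\<dots> \<le> (I h' v + d v) + E h v"
        using that(4) unfolding E_def by (intro add_mono) auto
      also have "I h' v \<le> I h' v + (\<integral>\<^sup>+s\<in>{0..t}. loss s h' v \<partial>lborel)" by simp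
      also have "\<dots> \<le> E h' v" unfolding i[OF that(2)] E_def using that(3) by simp
      finally show ?thesis by (simp add: add_ac)
    qed
    have le1: "I ?p v \<le> I ?q v + d v"
    proof -
      have "I ?p v \<le> I ?p v + ennreal (- x v)" by simp
      also have "\<dots> \<le> I ?q v + d v" unfolding elim d_def by (intro add_left_mono ennreal_leI) simp
      finally show ?thesis .
    qed
    have le2: "I ?q v \<le> I ?p v + d v"
    proof -
      have "I ?q v \<le> I ?q v + ennreal (x v)" by simp
      also have "\<dots> \<le> I ?p v + d v" unfolding elim[symmetric] d_def by (intro add_left_mono ennreal_leI) simp
      finally show ?thesis .
    qed
    show ?case
    proof (cases "0 \<le> f v")
      case True
      then show ?thesis using main[of ?p ?q] le1 by (simp add: ennreal_neg)
    next
      case False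
      then show ?thesis using main[of ?q ?p] le2 by (simp add: ennreal_neg add.commute)
    qed
  qed
  \<comment> \<open>The truncated weight is at most \<open>S W\<close> where it multiplies
    \<open>d\<close> and at most \<open>n W\<close> where it multiplies the error.\<close>
  then have "ennreal t * (\<integral>\<^sup>+v. ennreal (min (S v) (real n) * W v) * ennreal \<bar>f v\<bar> \<partial>N)
      \<le> (\<integral>\<^sup>+v. ennreal (S v * W v) * d v + ennreal (real n) * (ennreal (W v) * (E ?p v + E ?q v)) \<partial>N)"
  proof (subst nn_integral_cmult[symmetric], measurable, intro nn_integral_mono_AE, eventually_elim)
    case (elim v)
    have "ennreal t * (ennreal (min (S v) (real n) * W v) * ennreal \<bar>f v\<bar>) = ennreal (min (S v) (real n) * W v) * (ennreal t * ennreal \<bar>f v\<bar>)"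
      by (simp add: mult_ac)
    also have "\<dots> \<le> ennreal (min (S v) (real n) * W v) * (d v + (E ?p v + E ?q v))"
      by (intro mult_left_mono elim) auto
    also have "\<dots> \<le> ennreal (S v * W v) * d v + ennreal (real n * W v) * (E ?p v + E ?q v)"
      unfolding distrib_left using W_nonneg[of v]
      by (intro add_mono mult_right_mono ennreal_leI) auto
    finally show ?case using W_nonneg[of v] by (simp add: ennreal_mult mult.assoc)
  qed
  also have "\<dots> = ynorm d + ennreal (real n) * wnorm (\<lambda>v. E ?p v + E ?q v)"
    unfolding ynorm_def wnorm_def by (simp add: nn_integral_add nn_integral_cmult)
  also have "\<dots> = ynorm d + ennreal (real n) * (wnorm (E ?p) + wnorm (E ?q))"
    by (simp add: wnorm_add)
  also have "\<dots> \<le> ynorm d + ennreal (real n) * (ennreal t * op_bound f t)"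
    using wE[OF _ fin(2)] wE[OF _ fin(3)]
    by (intro add_left_mono mult_left_mono) (auto simp: op_bound_def distrib_left intro!: add_mono)
  finally show ?thesis using yd by (auto intro: order_trans add_right_mono)
qed

theorem generator_graph_domain:
  assumes fg: "(f, h) \<in> generator_graph X op"
  shows "f \<in> borel_measurable N" "ynorm (\<lambda>v. ennreal \<bar>f v\<bar>) < \<infinity>"
proof -
  have f: "f \<in> L1 X" and h: "h \<in> L1 X"
    and lim: "((\<lambda>t. L1_norm X (\<lambda>v. (op t f v - f v) / t - h v)) \<longlongrightarrow> 0) (at_right 0)"
    using fg by (auto simp: generator_graph_def)
  show [measurable]: "f \<in> borel_measurable N" using f by (simp add: L1_X)
  have [measurable]: "h \<in> borel_measurable N" using h by (simp add: L1_X)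
  let ?F = "wnorm (\<lambda>v. ennreal \<bar>f v\<bar>)" and ?H = "wnorm (\<lambda>v. ennreal \<bar>h v\<bar>)"
  let ?B = "ennreal (1 / (1 - th)) * (?H + ennreal C * ?F)"
  \<comment> \<open>The bound \<open>?B\<close> does not depend on \<open>n\<close>: the only term
    containing \<open>n\<close> carries \<open>op_bound f t\<close> and disappears as
    \<open>t\<close> tends to zero. Monotone convergence in \<open>n\<close> then removes the
    truncation.\<close>
  have trunc: "(\<integral>\<^sup>+v. ennreal (min (S v) (real n) * W v) * ennreal \<bar>f v\<bar> \<partial>N) \<le> ?B" (is "?L \<le> _") for n
  proof -
    let ?\<delta> = "\<lambda>t. L1_norm X (\<lambda>v. (op t f v - f v) / t - h v)"
    have "?L \<le> ennreal (1 / (1 - th)) * ((ennreal (?\<delta> t) + ?H) + ennreal C * ?F) + ennreal (real n) * op_bound f t"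
      if t: "0 < t" for t
    proof (rule ennreal_mult_le_cancel[OF _ t])
      have "wnorm (\<lambda>v. ennreal \<bar>op t f v - f v\<bar>) \<le> ennreal t * (ennreal (?\<delta> t) + ?H)"
      proof -
        have opX: "op t f \<in> L1 X" using f t by (intro op_L1) auto
        have "wnorm (\<lambda>v. ennreal \<bar>(op t f v - f v) / t - h v\<bar>) < \<infinity>"
        proof -
          have "ennreal \<bar>(op t f v - f v) / t - h v\<bar> \<le> ennreal (1 / t) * ennreal \<bar>op t f v\<bar> + ennreal (1 / t) * ennreal \<bar>f v\<bar> + ennreal \<bar>h v\<bar>" for v
          proof -
            have "\<bar>(op t f v - f v) / t - h v\<bar> \<le> 1 / t * \<bar>op t f v\<bar> + 1 / t * \<bar>f v\<bar> + \<bar>h v\<bar>"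
            proof -
              have "\<bar>(op t f v - f v) / t\<bar> \<le> 1 / t * \<bar>op t f v\<bar> + 1 / t * \<bar>f v\<bar>"
                using t abs_triangle_ineq4[of "op t f v" "f v"] by (simp add: field_simps)
              then show ?thesis by linarith
            qed
            then show ?thesis using t
              by (simp add: ennreal_mult[symmetric] ennreal_plus[symmetric] ennreal_leI del: ennreal_plus)
          qed
          then have "wnorm (\<lambda>v. ennreal \<bar>(op t f v - f v) / t - h v\<bar>)
              \<le> wnorm (\<lambda>v. ennreal (1 / t) * ennreal \<bar>op t f v\<bar> + ennreal (1 / t) * ennreal \<bar>f v\<bar> + ennreal \<bar>h v\<bar>)"
            by (rule wnorm_mono)
          also have "\<dots> < \<infinity>"
            using opX f h by (simp add: wnorm_add wnorm_cmult L1_X ennreal_mult_less_top)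
          finally show ?thesis .
        qed
        then have \<delta>: "ennreal (?\<delta> t) = wnorm (\<lambda>v. ennreal \<bar>(op t f v - f v) / t - h v\<bar>)"
          by (subst L1_norm_X) (auto simp: ennreal_enn2real_if)
        have "ennreal \<bar>op t f v - f v\<bar> \<le> ennreal t * (ennreal \<bar>(op t f v - f v) / t - h v\<bar> + ennreal \<bar>h v\<bar>)" for v
        proof -
          have "op t f v - f v = t * ((op t f v - f v) / t)" using t by simp
          then have "\<bar>op t f v - f v\<bar> = t * \<bar>(op t f v - f v) / t\<bar>"
            using t by (metis abs_mult abs_of_pos)
          also have "\<dots> \<le> t * (\<bar>(op t f v - f v) / t - h v\<bar> + \<bar>h v\<bar>)"
            using t by (intro mult_left_mono) linarith+
          finally show ?thesis using t
            by (simp add: ennreal_mult[symmetric] ennreal_plus[symmetric] ennreal_leI del: ennreal_plus)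
        qed
        then have "wnorm (\<lambda>v. ennreal \<bar>op t f v - f v\<bar>)
          \<le> wnorm (\<lambda>v. ennreal t * (ennreal \<bar>(op t f v - f v) / t - h v\<bar> + ennreal \<bar>h v\<bar>))"
          by (rule wnorm_mono)
        then show ?thesis unfolding \<delta> by (simp add: wnorm_cmult wnorm_add)
      qed
      then have "ennreal (1 / (1 - th)) * (wnorm (\<lambda>v. ennreal \<bar>op t f v - f v\<bar>) + ennreal C * (ennreal t * ?F))
          \<le> ennreal (1 / (1 - th)) * (ennreal t * (ennreal (?\<delta> t) + ?H) + ennreal C * (ennreal t * ?F))"
        by (intro mult_left_mono add_right_mono) auto
      with generator_graph_estimate[OF f t, of n]
      have "ennreal t * ?L \<le> ennreal (1 / (1 - th)) * (ennreal t * (ennreal (?\<delta> t) + ?H) + ennreal C * (ennreal t * ?F))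
          + ennreal (real n) * (ennreal t * op_bound f t)"
        by (rule order_trans[OF _ add_right_mono])
      then show "ennreal t * ?L \<le> ennreal t * (ennreal (1 / (1 - th)) * ((ennreal (?\<delta> t) + ?H) + ennreal C * ?F) + ennreal (real n) * op_bound f t)"
        by (simp add: distrib_left mult_ac)
    qed
    then have "\<forall>\<^sub>F t in at_right 0. ?L \<le> ennreal (1 / (1 - th)) * ((ennreal (?\<delta> t) + ?H) + ennreal C * ?F) + ennreal (real n) * op_bound f t"
      by (auto simp: eventually_at_filter)
    moreover have "((\<lambda>t. ennreal (1 / (1 - th)) * ((ennreal (?\<delta> t) + ?H) + ennreal C * ?F) + ennreal (real n) * op_bound f t)
        \<longlongrightarrow> ennreal (1 / (1 - th)) * ((ennreal 0 + ?H) + ennreal C * ?F) + 0) (at_right 0)"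
      by (intro tendsto_add ennreal_tendsto_cmult ennreal_tendsto_cmult_0 op_bound_tendsto_0 f tendsto_ennrealI lim tendsto_const) auto
    ultimately have "?L \<le> ennreal (1 / (1 - th)) * ((ennreal 0 + ?H) + ennreal C * ?F) + 0"
      by (intro tendsto_lowerbound) auto
    then show ?thesis by simp
  qed
  have "ynorm (\<lambda>v. ennreal \<bar>f v\<bar>) = (\<integral>\<^sup>+v. (SUP n. ennreal (min (S v) (real n) * W v) * ennreal \<bar>f v\<bar>) \<partial>N)"
    unfolding ynorm_def
  proof (intro nn_integral_cong antisym)
    fix v
    obtain n :: nat where "S v \<le> real n" using real_arch_simple by blast
    then show "ennreal (S v * W v) * ennreal \<bar>f v\<bar> \<le> (SUP n. ennreal (min (S v) (real n) * W v) * ennreal \<bar>f v\<bar>)"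
      by (intro SUP_upper2[of n]) auto
    show "(SUP n. ennreal (min (S v) (real n) * W v) * ennreal \<bar>f v\<bar>) \<le> ennreal (S v * W v) * ennreal \<bar>f v\<bar>"
      using W_nonneg[of v] by (intro SUP_least mult_right_mono ennreal_leI) auto
  qed
  also have "\<dots> = (SUP n. \<integral>\<^sup>+v. ennreal (min (S v) (real n) * W v) * ennreal \<bar>f v\<bar> \<partial>N)"
    using W_nonneg by (intro nn_integral_monotone_convergence_SUP)
      (auto simp: incseq_def le_fun_def intro!: mult_right_mono ennreal_leI)
  also have "\<dots> \<le> ?B" by (intro SUP_least trunc)
  also have "\<dots> < \<infinity>" using f h by (auto simp: L1_X ennreal_mult_less_top)
  finally show "ynorm (\<lambda>v. ennreal \<bar>f v\<bar>) < \<infinity>" .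
qed

end

section \<open>Exponential relaxation by Harris' theorem\<close>

text \<open>Here x and y are the unweighted and weighted norms before one time step, x' and y' those
  after it. If y \<le> R x, the minorization contracts x, and \<delta> is so small that the term
  \<delta> D x consumes only half of this gain. If y > R x, the choice of \<open>R\<close> gives D x
  \<le> (1 - \<kappa>) y / 2, so y contracts with the factor (1 + \<kappa>) / 2; since x is at most
  y / R, part of this contraction can be passed on to x.\<close>

lemma harris_constants:
  fixes \<kappa> D R \<alpha> :: real
  assumes \<kappa>: "0 \<le> \<kappa>" "\<kappa> < 1" and D: "0 \<le> D" and R: "R = 2 * D / (1 - \<kappa>) + 1" and \<alpha>: "0 < \<alpha>"
  shows "\<exists>\<delta> \<rho>. 0 < \<delta> \<and> 0 < \<rho> \<and> \<rho> < 1 \<and> (\<forall>x y x' y'. 0 \<le> x \<longrightarrow> 0 \<le> y \<longrightarrow> x' \<le> x \<longrightarrow> y' \<le> \<kappa> * y + D * x \<longrightarrow>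
      (y \<le> R * x \<longrightarrow> x' \<le> (1 - \<alpha>) * x) \<longrightarrow> x' + \<delta> * y' \<le> \<rho> * (x + \<delta> * y))"
proof -
  define \<delta> where "\<delta> = \<alpha> / (2 * (D + 1))"
  define \<kappa>' where "\<kappa>' = (1 + \<kappa>) / 2"
  have R1: "1 \<le> R" using \<kappa> D by (simp add: R)
  have \<delta>: "0 < \<delta>" "\<delta> * D \<le> \<alpha> / 2"
    using \<alpha> D by (auto simp: \<delta>_def field_simps)
  define \<epsilon> where "\<epsilon> = \<delta> * (1 - \<kappa>') / (1 / R + \<delta>)"
  have "0 < 1 / R + \<delta>" using \<delta> R1 by (intro add_pos_pos) auto
  then have \<epsilon>: "0 < \<epsilon>" "\<epsilon> * (1 / R + \<delta>) = \<delta> * (1 - \<kappa>')"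
    using \<delta> \<kappa> by (auto simp: \<epsilon>_def \<kappa>'_def)
  define \<rho> where "\<rho> = max (max (1 - \<epsilon>) (1 - \<alpha> / 2)) (max \<kappa> (1 / 2))"
  have \<rho>: "0 < \<rho>" "\<rho> < 1" "1 - \<epsilon> \<le> \<rho>" "1 - \<alpha> / 2 \<le> \<rho>" "\<kappa> \<le> \<rho>"
    using \<epsilon> \<alpha> \<kappa> by (auto simp: \<rho>_def)
  have "x' + \<delta> * y' \<le> \<rho> * (x + \<delta> * y)"
    if x: "0 \<le> x" and y: "0 \<le> y" and x': "x' \<le> x" and y': "y' \<le> \<kappa> * y + D * x"
      and c: "y \<le> R * x \<Longrightarrow> x' \<le> (1 - \<alpha>) * x" for x y x' y'
  proof (cases "y \<le> R * x")
    case True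
    have "x' + \<delta> * y' \<le> (1 - \<alpha>) * x + \<delta> * (\<kappa> * y + D * x)"
      using c[OF True] y' \<delta> by (intro add_mono mult_left_mono) auto
    also have "\<dots> = (1 - \<alpha> + \<delta> * D) * x + \<kappa> * (\<delta> * y)" by (simp add: algebra_simps)
    also have "\<dots> \<le> \<rho> * x + \<rho> * (\<delta> * y)"
      using \<rho> \<delta> x y by (intro add_mono mult_right_mono) auto
    finally show ?thesis by (simp add: distrib_left)
  next
    case False
    have "x \<le> y / R" using False R1 by (simp add: field_simps)
    have "D * x \<le> D * (y / R)" using \<open>x \<le> y / R\<close> D by (rule mult_left_mono)
    also have "\<dots> = (D / R) * y" by simp
    also have "D / R \<le> (1 - \<kappa>) / 2"
    proof -
      have "(1 - \<kappa>) * R = 2 * D + (1 - \<kappa>)" unfolding R distrib_left using \<kappa> by simp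
      then have "D \<le> (1 - \<kappa>) / 2 * R" using \<kappa> by (simp add: algebra_simps)
      then show ?thesis using R1 by (simp add: pos_divide_le_eq)
    qed
    finally have "D * x \<le> (1 - \<kappa>) / 2 * y" using y by (simp add: mult_right_mono)
    then have "y' \<le> \<kappa>' * y" using y' by (simp add: \<kappa>'_def field_simps)
    then have "x' + \<delta> * y' \<le> x + \<delta> * (\<kappa>' * y)"
      using x' \<delta> by (intro add_mono mult_left_mono) auto
    also have "\<dots> \<le> (1 - \<epsilon>) * (x + \<delta> * y)"
    proof -
      have "\<epsilon> * x \<le> \<epsilon> * (y / R)" using \<open>x \<le> y / R\<close> \<epsilon> by (intro mult_left_mono) auto
      then have "\<epsilon> * x + \<epsilon> * \<delta> * y \<le> \<epsilon> * (1 / R + \<delta>) * y" by (simp add: algebra_simps)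
      then show ?thesis unfolding \<epsilon>(2) by (simp add: algebra_simps)
    qed
    also have "\<dots> \<le> \<rho> * (x + \<delta> * y)" using \<rho> x y \<delta> by (intro mult_right_mono) auto
    finally show ?thesis .
  qed
  with \<delta> \<rho> show ?thesis by blast
qed

text \<open>In \<open>minorization\<close> the number \<open>A\<close> bounds \<open>S\<close> both
  on the sublevel set, where a jump starts, and on the support of \<nu>, where it ends. This bounds
  from below the probability that no other jump occurs before or after it.\<close>

locale harris_process = jump_process N k S W th C S\<^sub>0
  for N :: "'a measure" and k S W th C S\<^sub>0 +
  fixes mx :: "'a \<Rightarrow> real"
  assumes mx_meas [measurable]: "mx \<in> borel_measurable N"
    and mx_nonneg: "\<And>v. 0 \<le> mx v"
    and mx_mass: "(\<integral>\<^sup>+v. ennreal (mx v) \<partial>N) = 1"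
    and mx_W: "(\<integral>\<^sup>+v. ennreal (W v) * ennreal (mx v) \<partial>N) < \<infinity>"
    and mx_stationary: "\<And>v. (\<integral>\<^sup>+w. k v w * ennreal (mx w) \<partial>N) = ennreal (S v) * ennreal (mx v)"
    and minorization: "\<And>R. \<exists>\<nu> A. \<nu> \<in> borel_measurable N \<and> 0 < (\<integral>\<^sup>+v. \<nu> v \<partial>N) \<and> (\<integral>\<^sup>+v. \<nu> v \<partial>N) < \<infinity> \<and>
      (\<forall>v w. W w \<le> R \<longrightarrow> \<nu> v \<le> k v w) \<and> (\<forall>w. W w \<le> R \<longrightarrow> S w \<le> A) \<and> (\<forall>v. \<nu> v \<noteq> 0 \<longrightarrow> S v \<le> A)"
begin

text \<open>\<open>flow_lyapunov\<close> controls a time integral over [0, 1], while the norm at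
  time 1 is wanted. The semigroup law shows that the norm at time 1 exceeds the norm at an earlier
  time \<open>s\<close> by at most \<open>C\<close> times the mass; integrating over
  \<open>s\<close> and using the lower bound on \<open>S\<close> bounds it by the dissipation term.
  The contraction factor is 1 / (1 + (1 - \<open>th\<close>) \<open>S\<^sub>0\<close>).\<close>

lemma flow_lyapunov_contraction:
  assumes p [measurable]: "p \<in> borel_measurable N" and fin: "wnorm p < \<infinity>"
  shows "ennreal (1 + (1 - th) * S\<^sub>0) * wnorm (flow 1 p)
    \<le> wnorm p + ennreal ((1 + (1 - th) * S\<^sub>0) * C) * (\<integral>\<^sup>+v. p v \<partial>N)"
proof -
  let ?m = "\<integral>\<^sup>+v. p v \<partial>N" and ?a = "accum (\<lambda>v. S v * W v) (\<lambda>s. flow s p) 1"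
  have step: "wnorm (flow 1 p) \<le> wnorm (flow s p) + ennreal C * ?m" if s: "0 \<le> s" "s \<le> 1" for s
  proof -
    have "AE v in N. flow (1 - s) (flow s p) v = flow 1 p v"
      using flow_semigroup[OF p fin, of s "1 - s"] s by simp
    then have "wnorm (flow 1 p) = wnorm (flow (1 - s) (flow s p))"
      unfolding wnorm_def by (intro nn_integral_cong_AE) auto
    also have "\<dots> \<le> wnorm (flow s p) + ennreal (C * (1 - s)) * (\<integral>\<^sup>+v. flow s p v \<partial>N)"
      using wnorm_flow_finite[OF p fin, of s] s
      by (intro order_trans[OF _ flow_lyapunov[of "flow s p" "1 - s"]]) auto
    also have "\<dots> \<le> wnorm (flow s p) + ennreal C * ?m"
      using s C_nonneg unfolding flow_mass[OF p fin s(1)]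
      by (intro add_left_mono mult_right_mono ennreal_leI) (auto simp: mult_left_le)
    finally show ?thesis .
  qed
  have "ennreal S\<^sub>0 * wnorm (flow 1 p) = (\<integral>\<^sup>+s\<in>{0..1::real}. ennreal S\<^sub>0 * wnorm (flow 1 p) \<partial>lborel)"
    by (simp add: nn_integral_Icc_const)
  also have "\<dots> \<le> (\<integral>\<^sup>+s. (\<integral>\<^sup>+v. ennreal (S v * W v) * flow s p v \<partial>N) * indicator {0..1} s + ennreal S\<^sub>0 * (ennreal C * ?m) * indicator {0..1} s \<partial>lborel)"
  proof (intro nn_integral_mono)
    fix s :: real
    have "ennreal S\<^sub>0 * wnorm (flow 1 p) \<le> ynorm (flow s p) + ennreal S\<^sub>0 * (ennreal C * ?m)" if "0 \<le> s" "s \<le> 1"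
    proof -
      have "ennreal S\<^sub>0 * wnorm (flow 1 p) \<le> ennreal S\<^sub>0 * (wnorm (flow s p) + ennreal C * ?m)"
        by (intro mult_left_mono step that) auto
      also have "\<dots> \<le> ynorm (flow s p) + ennreal S\<^sub>0 * (ennreal C * ?m)"
        unfolding distrib_left by (intro add_right_mono wnorm_le_ynorm) measurable
      finally show ?thesis .
    qed
    then show "ennreal S\<^sub>0 * wnorm (flow 1 p) * indicator {0..1} s
      \<le> (\<integral>\<^sup>+v. ennreal (S v * W v) * flow s p v \<partial>N) * indicator {0..1} s + ennreal S\<^sub>0 * (ennreal C * ?m) * indicator {0..1} s"
      by (auto simp: indicator_def ynorm_def)
  qed
  also have "\<dots> = ?a + ennreal S\<^sub>0 * (ennreal C * ?m)"
    by (simp add: nn_integral_add accum_def nn_integral_Icc_const)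
  finally have 1: "ennreal S\<^sub>0 * wnorm (flow 1 p) \<le> ?a + ennreal S\<^sub>0 * (ennreal C * ?m)" .
  have c: "ennreal (1 + (1 - th) * S\<^sub>0) = 1 + ennreal (1 - th) * ennreal S\<^sub>0"
    using th S\<^sub>0 by (simp add: ennreal_mult ennreal_plus)
  have "ennreal (1 + (1 - th) * S\<^sub>0) * wnorm (flow 1 p)
      = wnorm (flow 1 p) + ennreal (1 - th) * (ennreal S\<^sub>0 * wnorm (flow 1 p))"
    unfolding c by (simp add: distrib_right mult.assoc)
  also have "\<dots> \<le> wnorm (flow 1 p) + ennreal (1 - th) * (?a + ennreal S\<^sub>0 * (ennreal C * ?m))"
    by (intro add_left_mono mult_left_mono 1) auto
  also have "\<dots> = (wnorm (flow 1 p) + ennreal (1 - th) * ?a) + ennreal (1 - th) * (ennreal S\<^sub>0 * (ennreal C * ?m))"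
    by (simp add: distrib_left add.assoc)
  also have "\<dots> \<le> (wnorm p + ennreal (C * 1) * ?m) + ennreal (1 - th) * (ennreal S\<^sub>0 * (ennreal C * ?m))"
    by (intro add_right_mono flow_lyapunov p fin) auto
  also have "\<dots> = wnorm p + (1 + ennreal (1 - th) * ennreal S\<^sub>0) * ennreal C * ?m"
    by (simp add: distrib_right mult.assoc add.assoc)
  also have "(1 + ennreal (1 - th) * ennreal S\<^sub>0) * ennreal C = ennreal ((1 + (1 - th) * S\<^sub>0) * C)"
    unfolding c[symmetric] using th S\<^sub>0 C_nonneg by (intro ennreal_mult[symmetric]) auto
  finally show ?thesis .
qed

text \<open>Only paths with exactly one jump, at a time \<open>s\<close> in [0, 1], are retained.
  Survival before the jump, and again after it, has probability at least exp(-B) because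
  \<open>S\<close> is bounded at both ends; the jump itself has rate at least \<nu>.\<close>

lemma flow_minorization:
  obtains \<nu> where "\<nu> \<in> borel_measurable N" "0 < (\<integral>\<^sup>+v. \<nu> v \<partial>N)" "(\<integral>\<^sup>+v. \<nu> v \<partial>N) < \<infinity>"
    "\<And>p v. p \<in> borel_measurable N \<Longrightarrow> \<nu> v * (\<integral>\<^sup>+w. p w * indicator {w. W w \<le> R} w \<partial>N) \<le> flow 1 p v"
proof -
  obtain \<nu> A where [measurable]: "\<nu> \<in> borel_measurable N" and pos: "0 < (\<integral>\<^sup>+v. \<nu> v \<partial>N)" and fin: "(\<integral>\<^sup>+v. \<nu> v \<partial>N) < \<infinity>"
    and le: "\<And>v w. W w \<le> R \<Longrightarrow> \<nu> v \<le> k v w" and A: "\<And>w. W w \<le> R \<Longrightarrow> S w \<le> A" "\<And>v. \<nu> v \<noteq> 0 \<Longrightarrow> S v \<le> A"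
    using minorization[of R] by blast
  define B where "B = max A 0"
  let ?e = "ennreal (exp (- B))"
  have e: "?e \<le> ennreal (exp (- S v * t))" if "S v \<le> A" "0 \<le> t" "t \<le> 1" for v t
  proof -
    have "S v * t \<le> B * 1" using that S_nonneg[of v] by (intro mult_mono) (auto simp: B_def)
    then show ?thesis by (intro ennreal_leI) simp
  qed
  have "?e * ?e * \<nu> v * (\<integral>\<^sup>+w. p w * indicator {w. W w \<le> R} w \<partial>N) \<le> flow 1 p v"
    if [measurable]: "p \<in> borel_measurable N" for p v
  proof (cases "\<nu> v = 0")
    case False
    have K: "?e * \<nu> v * (\<integral>\<^sup>+w. p w * indicator {w. W w \<le> R} w \<partial>N) \<le> gainK (flow s p) v" if s: "0 \<le> s" "s \<le> 1" for s
    proof -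
      have "?e * \<nu> v * (\<integral>\<^sup>+w. p w * indicator {w. W w \<le> R} w \<partial>N) = (\<integral>\<^sup>+w. ?e * \<nu> v * (p w * indicator {w. W w \<le> R} w) \<partial>N)"
        by (rule nn_integral_cmult[symmetric]) measurable
      also have "\<dots> \<le> gainK (flow s p) v"
        unfolding gainK_def
      proof (rule nn_integral_mono)
        fix w
        have "?e * \<nu> v * p w \<le> k v w * flow s p w" if "W w \<le> R"
        proof -
          have "?e * \<nu> v * p w = \<nu> v * (?e * p w)" by (simp add: mult_ac)
          also have "\<dots> \<le> k v w * free s p w"
            unfolding free_def using A(1)[OF that] s by (intro mult_mono le[OF that] mult_right_mono e) auto
          also have "\<dots> \<le> k v w * flow s p w"
            by (intro mult_left_mono) (auto simp: flow_eq_free_source)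
          finally show ?thesis .
        qed
        then show "?e * \<nu> v * (p w * indicator {w. W w \<le> R} w) \<le> k v w * flow s p w"
          by (auto simp: indicator_def)
      qed
      finally show ?thesis .
    qed
    have "?e * ?e * \<nu> v * (\<integral>\<^sup>+w. p w * indicator {w. W w \<le> R} w \<partial>N)
        = (\<integral>\<^sup>+s\<in>{0..1::real}. ?e * (?e * \<nu> v * (\<integral>\<^sup>+w. p w * indicator {w. W w \<le> R} w \<partial>N)) \<partial>lborel)"
      by (subst nn_integral_Icc_const) (auto simp: mult.assoc)
    also have "\<dots> \<le> duhamel (\<lambda>s. flow s p) 1 v"
      unfolding duhamel_def
    proof (rule nn_integral_mono)
      fix s :: real
      have "?e * (?e * \<nu> v * (\<integral>\<^sup>+w. p w * indicator {w. W w \<le> R} w \<partial>N)) \<le> ennreal (exp (- S v * (1 - s))) * gainK (flow s p) v"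
        if "0 \<le> s" "s \<le> 1"
        using that A(2)[OF False] by (intro mult_mono K e) auto
      then show "?e * (?e * \<nu> v * (\<integral>\<^sup>+w. p w * indicator {w. W w \<le> R} w \<partial>N)) * indicator {0..1} s
        \<le> ennreal (exp (- S v * (1 - s))) * gainK (flow s p) v * indicator {0..1} s"
        by (simp add: indicator_def)
    qed
    also have "\<dots> \<le> flow 1 p v" by (simp add: flow_eq_free_source source_def)
    finally show ?thesis .
  qed simp
  moreover have "(\<integral>\<^sup>+v. ?e * ?e * \<nu> v \<partial>N) = ?e * ?e * (\<integral>\<^sup>+v. \<nu> v \<partial>N)"
    by (rule nn_integral_cmult) measurable
  ultimately show ?thesis
    using that[of "\<lambda>v. ?e * ?e * \<nu> v"] pos fin
    by (auto simp: ennreal_zero_less_mult_iff ennreal_mult_less_top)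
qed

section \<open>Contraction for signed functions of zero mean\<close>

definition nx :: "('a \<Rightarrow> real) \<Rightarrow> real" where
  "nx g = enn2real (\<integral>\<^sup>+v. ennreal \<bar>g v\<bar> \<partial>N)"

definition ny :: "('a \<Rightarrow> real) \<Rightarrow> real" where
  "ny g = enn2real (wnorm (\<lambda>v. ennreal \<bar>g v\<bar>))"

lemma nn_abs:
  assumes [measurable]: "g \<in> borel_measurable N"
  shows "(\<integral>\<^sup>+v. ennreal \<bar>g v\<bar> \<partial>N) = (\<integral>\<^sup>+v. ennreal (g v) \<partial>N) + (\<integral>\<^sup>+v. ennreal (- g v) \<partial>N)"
  unfolding ennreal_abs_eq by (rule nn_integral_add) measurable

lemma ennreal_ny: "g \<in> L1 X \<Longrightarrow> ennreal (ny g) = wnorm (\<lambda>v. ennreal \<bar>g v\<bar>)"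
  by (auto simp: ny_def L1_X ennreal_enn2real_if)

lemma ennreal_nx:
  assumes "g \<in> L1 X" shows "ennreal (nx g) = (\<integral>\<^sup>+v. ennreal \<bar>g v\<bar> \<partial>N)"
proof -
  have "(\<integral>\<^sup>+v. ennreal \<bar>g v\<bar> \<partial>N) < \<infinity>"
    using assms by (intro le_less_trans[OF nn_integral_le_wnorm]) (simp add: L1_X)
  then show ?thesis by (auto simp: nx_def ennreal_enn2real_if)
qed

lemma nx_le_ny:
  assumes "g \<in> L1 X" shows "nx g \<le> ny g"
  unfolding nx_def ny_def using assms nn_integral_le_wnorm[of "\<lambda>v. ennreal \<bar>g v\<bar>"]
  by (intro enn2real_mono) (auto simp: L1_X)

lemma nx_nonneg [simp]: "0 \<le> nx g" and ny_nonneg [simp]: "0 \<le> ny g"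
  by (simp_all add: nx_def ny_def)

lemma integrable_L1X:
  assumes "g \<in> L1 X" shows "integrable N g"
  using assms ennreal_nx[OF assms] by (intro integrableI_bounded) (auto simp: L1_X ennreal_nx[symmetric])

lemma op_abs_le: "ennreal \<bar>op t g v\<bar> \<le> flow t (\<lambda>v. ennreal (g v)) v + flow t (\<lambda>v. ennreal (- g v)) v"
  unfolding op_def by (subst add.commute) (rule enn2real_abs_diff_le, rule add.commute)

lemma op_nx_le:
  assumes g: "g \<in> L1 X" and t: "0 \<le> t" shows "nx (op t g) \<le> nx g"
proof -
  note fin = wnorm_parts_finite[OF g]
  note [measurable] = fin(1)
  have "ennreal (nx (op t g)) \<le> (\<integral>\<^sup>+v. flow t (\<lambda>v. ennreal (g v)) v + flow t (\<lambda>v. ennreal (- g v)) v \<partial>N)"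
    unfolding ennreal_nx[OF op_L1[OF g t]] by (intro nn_integral_mono op_abs_le)
  also have "\<dots> = ennreal (nx g)"
    unfolding ennreal_nx[OF g] nn_abs[OF fin(1)] using fin t by (simp add: nn_integral_add flow_mass)
  finally show ?thesis by simp
qed

lemma op_ny_le:
  assumes g: "g \<in> L1 X"
  shows "ny (op 1 g) \<le> 1 / (1 + (1 - th) * S\<^sub>0) * ny g + C * nx g"
proof -
  note fin = wnorm_parts_finite[OF g]
  note [measurable] = fin(1)
  define c where "c = 1 + (1 - th) * S\<^sub>0"
  have c: "1 \<le> c" using th S\<^sub>0 by (simp add: c_def)
  have "ennreal (c * ny (op 1 g)) = ennreal c * wnorm (\<lambda>v. ennreal \<bar>op 1 g v\<bar>)"
    using c op_L1[OF g, of 1] by (simp add: ennreal_mult ennreal_ny)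
  also have "\<dots> \<le> ennreal c * wnorm (\<lambda>v. flow 1 (\<lambda>v. ennreal (g v)) v + flow 1 (\<lambda>v. ennreal (- g v)) v)"
    by (intro mult_left_mono wnorm_mono op_abs_le) auto
  also have "\<dots> = ennreal c * wnorm (flow 1 (\<lambda>v. ennreal (g v))) + ennreal c * wnorm (flow 1 (\<lambda>v. ennreal (- g v)))"
    by (simp add: wnorm_add distrib_left)
  also have "\<dots> \<le> (wnorm (\<lambda>v. ennreal (g v)) + ennreal (c * C) * (\<integral>\<^sup>+v. ennreal (g v) \<partial>N))
      + (wnorm (\<lambda>v. ennreal (- g v)) + ennreal (c * C) * (\<integral>\<^sup>+v. ennreal (- g v) \<partial>N))"
    unfolding c_def using fin by (intro add_mono flow_lyapunov_contraction) auto
  also have "\<dots> = ennreal (ny g) + ennreal (c * C) * ennreal (nx g)"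
    unfolding ennreal_nx[OF g] ennreal_ny[OF g] nn_abs[OF fin(1)] wnorm_abs[OF fin(1)] distrib_left by (simp only: add_ac)
  also have "\<dots> = ennreal (ny g + c * C * nx g)"
    using c C_nonneg by (simp add: ennreal_mult ennreal_plus)
  finally have "c * ny (op 1 g) \<le> ny g + c * C * nx g"
    using c C_nonneg by (subst (asm) ennreal_le_iff) auto
  then have "ny (op 1 g) \<le> (ny g + c * C * nx g) / c" using c by (simp add: pos_le_divide_eq mult.commute)
  also have "\<dots> = 1 / c * ny g + C * nx g" using c by (simp add: add_divide_distrib)
  finally show ?thesis unfolding c_def .
qed

lemma integral_op:
  assumes g: "g \<in> L1 X" and t: "0 \<le> t"
  shows "(\<integral>v. op t g v \<partial>N) = (\<integral>v. g v \<partial>N)"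
proof -
  note fin = wnorm_parts_finite[OF g]
  note [measurable] = fin(1)
  have int: "integrable N (\<lambda>v. enn2real (flow t p v)) \<and> (\<integral>v. enn2real (flow t p v) \<partial>N) = enn2real (\<integral>\<^sup>+v. p v \<partial>N)"
    if p [measurable]: "p \<in> borel_measurable N" and pf: "wnorm p < \<infinity>" for p
  proof -
    have eq: "(\<integral>\<^sup>+v. ennreal (enn2real (flow t p v)) \<partial>N) = (\<integral>\<^sup>+v. p v \<partial>N)"
      unfolding flow_mass[OF p pf t, symmetric] using AE_flow_finite[OF p pf t]
      by (intro nn_integral_cong_AE) (auto simp: ennreal_enn2real_if elim!: eventually_mono)
    have "(\<integral>\<^sup>+v. p v \<partial>N) < \<infinity>" by (rule le_less_trans[OF nn_integral_le_wnorm pf])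
    then show ?thesis using eq
      by (auto intro!: integrableI_nonneg simp: integral_eq_nn_integral)
  qed
  have "(\<integral>v. op t g v \<partial>N) = enn2real (\<integral>\<^sup>+v. ennreal (g v) \<partial>N) - enn2real (\<integral>\<^sup>+v. ennreal (- g v) \<partial>N)"
    unfolding op_def using int[OF _ fin(2)] int[OF _ fin(3)] by (subst Bochner_Integration.integral_diff) auto
  also have "\<dots> = (\<integral>v. g v \<partial>N)"
    by (rule real_lebesgue_integral_def[symmetric, OF integrable_L1X[OF g]])
  finally show ?thesis .
qed

text \<open>Zero mean gives the positive and the negative part the same mass
  \<open>nx g / 2\<close>. By Markov's inequality and \<open>ny g \<le> R * nx g\<close>, each of
  them keeps at least half of it on the sublevel set of \<open>W\<close> at level 4 R'. Hence both
  flows exceed \<nu> times \<open>nx g / 4\<close> at time 1, and this common amount cancels in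
  their difference.\<close>

lemma op_nx_contraction:
  obtains \<alpha> where "0 < \<alpha>" "\<And>g. g \<in> L1 X \<Longrightarrow> (\<integral>v. g v \<partial>N) = 0 \<Longrightarrow> ny g \<le> R * nx g \<Longrightarrow> nx (op 1 g) \<le> (1 - \<alpha>) * nx g"
proof -
  define R' where "R' = max R 1"
  obtain \<nu> where [measurable]: "\<nu> \<in> borel_measurable N" and pos: "0 < (\<integral>\<^sup>+v. \<nu> v \<partial>N)" and nfin: "(\<integral>\<^sup>+v. \<nu> v \<partial>N) < \<infinity>"
    and \<nu>: "\<And>p v. p \<in> borel_measurable N \<Longrightarrow> \<nu> v * (\<integral>\<^sup>+w. p w * indicator {w. W w \<le> 4 * R'} w \<partial>N) \<le> flow 1 p v"
    using flow_minorization[of "4 * R'"] by blast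
  define a where "a = enn2real (\<integral>\<^sup>+v. \<nu> v \<partial>N)"
  have a: "0 < a" "ennreal a = (\<integral>\<^sup>+v. \<nu> v \<partial>N)"
    using pos nfin by (auto simp: a_def enn2real_positive_iff ennreal_enn2real_if)
  have "nx (op 1 g) \<le> (1 - a / 2) * nx g" if g: "g \<in> L1 X" and zero: "(\<integral>v. g v \<partial>N) = 0" and ny: "ny g \<le> R * nx g" for g
  proof -
    note fin = wnorm_parts_finite[OF g]
    note [measurable] = fin(1)
    let ?p = "\<lambda>v. ennreal (g v)" and ?q = "\<lambda>v. ennreal (- g v)"
    have finI: "(\<integral>\<^sup>+v. ?p v \<partial>N) < \<infinity>" "(\<integral>\<^sup>+v. ?q v \<partial>N) < \<infinity>"
      using le_less_trans[OF nn_integral_le_wnorm fin(2)] le_less_trans[OF nn_integral_le_wnorm fin(3)] by auto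
    have "enn2real (\<integral>\<^sup>+v. ?p v \<partial>N) = enn2real (\<integral>\<^sup>+v. ?q v \<partial>N)"
      using real_lebesgue_integral_def[OF integrable_L1X[OF g]] zero by simp
    then have pq: "(\<integral>\<^sup>+v. ?p v \<partial>N) = (\<integral>\<^sup>+v. ?q v \<partial>N)"
      using finI by (metis ennreal_enn2real infinity_ennreal_def)
    have nxs: "ennreal (nx g) = (\<integral>\<^sup>+v. ?p v \<partial>N) + (\<integral>\<^sup>+v. ?q v \<partial>N)"
      by (simp add: ennreal_nx[OF g] nn_abs)
    have half: "(\<integral>\<^sup>+v. p v \<partial>N) = ennreal (nx g / 2)" if "p = ?p \<or> p = ?q" for p
    proof -
      have "nx g = enn2real ((\<integral>\<^sup>+v. ?p v \<partial>N) + (\<integral>\<^sup>+v. ?p v \<partial>N))"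
        using nxs unfolding pq[symmetric] by (metis enn2real_ennreal nx_nonneg)
      then have "enn2real (\<integral>\<^sup>+v. ?p v \<partial>N) = nx g / 2" using finI(1) by (simp add: enn2real_plus)
      then have "(\<integral>\<^sup>+v. ?p v \<partial>N) = ennreal (nx g / 2)"
        using finI(1) by (metis ennreal_enn2real infinity_ennreal_def)
      then show ?thesis using that pq by auto
    qed
    have core: "ennreal (nx g / 4) \<le> (\<integral>\<^sup>+w. p w * indicator {w. W w \<le> 4 * R'} w \<partial>N)"
      if p: "p = ?p \<or> p = ?q" for p
    proof -
      have [measurable]: "p \<in> borel_measurable N" using p by auto
      have "ennreal (4 * R') * (\<integral>\<^sup>+w. p w * indicator {w. \<not> W w \<le> 4 * R'} w \<partial>N)
          = (\<integral>\<^sup>+w. ennreal (4 * R') * (p w * indicator {w. \<not> W w \<le> 4 * R'} w) \<partial>N)"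
        by (rule nn_integral_cmult[symmetric]) measurable
      also have "\<dots> \<le> wnorm p"
        unfolding wnorm_def by (intro nn_integral_mono) (auto simp: indicator_def intro!: mult_right_mono ennreal_leI)
      also have "\<dots> \<le> wnorm (\<lambda>v. ennreal \<bar>g v\<bar>)"
        using p by (intro wnorm_mono) (auto intro!: ennreal_leI)
      also have "\<dots> = ennreal (ny g)" by (simp add: ennreal_ny g)
      also have "\<dots> \<le> ennreal (4 * R' * (nx g / 4))"
      proof (rule ennreal_leI)
        have "R * nx g \<le> R' * nx g" by (rule mult_right_mono) (auto simp: R'_def)
        then show "ny g \<le> 4 * R' * (nx g / 4)" using ny by simp
      qed
      also have "\<dots> = ennreal (4 * R') * ennreal (nx g / 4)" by (rule ennreal_mult) (auto simp: R'_def)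
      finally have tail: "(\<integral>\<^sup>+w. p w * indicator {w. \<not> W w \<le> 4 * R'} w \<partial>N) \<le> ennreal (nx g / 4)"
        by (rule ennreal_mult_le_cancel) (auto simp: R'_def)
      have "ennreal (nx g / 4) + ennreal (nx g / 4) = (\<integral>\<^sup>+v. p v \<partial>N)"
        unfolding half[OF p] by (subst ennreal_plus[symmetric]) auto
      also have "\<dots> = (\<integral>\<^sup>+w. p w * indicator {w. W w \<le> 4 * R'} w + p w * indicator {w. \<not> W w \<le> 4 * R'} w \<partial>N)"
        by (intro nn_integral_cong) (auto simp: indicator_def)
      also have "\<dots> = (\<integral>\<^sup>+w. p w * indicator {w. W w \<le> 4 * R'} w \<partial>N) + (\<integral>\<^sup>+w. p w * indicator {w. \<not> W w \<le> 4 * R'} w \<partial>N)"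
        by (rule nn_integral_add) measurable
      also have "\<dots> \<le> (\<integral>\<^sup>+w. p w * indicator {w. W w \<le> 4 * R'} w \<partial>N) + ennreal (nx g / 4)"
        by (rule add_left_mono[OF tail])
      finally show ?thesis by (rule ennreal_le_of_add_le) simp
    qed
    have low: "\<nu> v * ennreal (nx g / 4) \<le> flow 1 ?p v" "\<nu> v * ennreal (nx g / 4) \<le> flow 1 ?q v" for v
      using \<nu>[of ?p v] \<nu>[of ?q v] mult_left_mono[OF core[of ?p], of "\<nu> v"] mult_left_mono[OF core[of ?q], of "\<nu> v"]
      by auto
    \<comment> \<open>A common lower bound \<open>c\<close> of two numbers cancels in their
      difference but is counted twice in their sum.\<close>
    have diff: "ennreal \<bar>enn2real x - enn2real y\<bar> + 2 * c \<le> x + y" if a: "c \<le> x" "c \<le> y" "x < \<infinity>" "y < \<infinity>" for x y c :: ennreal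
    proof -
      obtain x' where x: "x = ennreal x'" "0 \<le> x'" using a(3) by (cases x) auto
      obtain y' where y: "y = ennreal y'" "0 \<le> y'" using a(4) by (cases y) auto
      obtain c' where c: "c = ennreal c'" "0 \<le> c'" using le_less_trans[OF a(1,3)] by (cases c) auto
      have "c' \<le> x'" "c' \<le> y'" using a x y c by auto
      then have "\<bar>x' - y'\<bar> + 2 * c' \<le> x' + y'" by linarith
      then have "ennreal (\<bar>x' - y'\<bar> + (c' + c')) \<le> ennreal (x' + y')" by (intro ennreal_leI) simp
      also have "ennreal (x' + y') = x + y" unfolding x(1) y(1) using x(2) y(2) by (rule ennreal_plus)
      also have "ennreal (\<bar>x' - y'\<bar> + (c' + c')) = ennreal \<bar>x' - y'\<bar> + ennreal (c' + c')"
        using c(2) by (intro ennreal_plus) auto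
      also have "ennreal (c' + c') = 2 * c" unfolding c(1) mult_2 using c(2) by (intro ennreal_plus)
      also have "\<bar>x' - y'\<bar> = \<bar>enn2real x - enn2real y\<bar>" unfolding x(1) y(1) using x(2) y(2) by simp
      finally show ?thesis .
    qed
    have "AE v in N. flow 1 ?p v < \<infinity>" "AE v in N. flow 1 ?q v < \<infinity>"
      using AE_flow_finite[OF _ fin(2), of 1] AE_flow_finite[OF _ fin(3), of 1] by auto
    then have "AE v in N. ennreal \<bar>op 1 g v\<bar> + 2 * (\<nu> v * ennreal (nx g / 4)) \<le> flow 1 ?p v + flow 1 ?q v"
    proof eventually_elim
      case (elim v)
      then show ?case unfolding op_def by (intro diff low)
    qed
    then have "(\<integral>\<^sup>+v. ennreal \<bar>op 1 g v\<bar> + 2 * (\<nu> v * ennreal (nx g / 4)) \<partial>N) \<le> (\<integral>\<^sup>+v. flow 1 ?p v + flow 1 ?q v \<partial>N)"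
      by (rule nn_integral_mono_AE)
    also have "\<dots> = ennreal (nx g)"
      unfolding nxs using fin by (simp add: nn_integral_add flow_mass)
    also have "(\<integral>\<^sup>+v. ennreal \<bar>op 1 g v\<bar> + 2 * (\<nu> v * ennreal (nx g / 4)) \<partial>N) = ennreal (nx (op 1 g)) + 2 * (ennreal a * ennreal (nx g / 4))"
      by (simp add: nn_integral_add nn_integral_cmult nn_integral_multc a(2) ennreal_nx op_L1 g)
    also have "2 * (ennreal a * ennreal (nx g / 4)) = ennreal (2 * (a * (nx g / 4)))"
      using a(1) ennreal_mult[of 2 "a * (nx g / 4)"] ennreal_mult[of a "nx g / 4"] by simp
    also have "ennreal (nx (op 1 g)) + ennreal (2 * (a * (nx g / 4))) = ennreal (nx (op 1 g) + 2 * (a * (nx g / 4)))"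
      using a(1) by (intro ennreal_plus[symmetric]) auto
    finally have "nx (op 1 g) + 2 * (a * (nx g / 4)) \<le> nx g" by simp
    then show ?thesis by (simp add: algebra_simps)
  qed
  with that[of "a / 2"] a(1) show ?thesis by simp
qed

lemma L1X_cong_AE: "AE v in N. f v = g v \<Longrightarrow> nx f = nx g \<and> ny f = ny g"
  unfolding nx_def ny_def wnorm_def by (auto intro!: arg_cong[of _ _ enn2real] nn_integral_cong_AE)

text \<open>The norm \<Phi> = \<open>nx\<close> + \<delta> \<open>ny\<close> contracts by the factor
  \<rho> in each unit of time, the zero mean being preserved. It is equivalent to \<open>ny\<close>,
  because \<open>nx\<close> is at most \<open>ny\<close>.\<close>

lemma op_decay_zero_mean:
  obtains c r where "0 < c" "0 < r"
    "\<And>g t. g \<in> L1 X \<Longrightarrow> (\<integral>v. g v \<partial>N) = 0 \<Longrightarrow> 0 \<le> t \<Longrightarrow> ny (op t g) \<le> c * exp (- r * t) * ny g"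
proof -
  define \<kappa> where "\<kappa> = 1 / (1 + (1 - th) * S\<^sub>0)"
  have "0 < (1 - th) * S\<^sub>0" using th S\<^sub>0 by simp
  then have \<kappa>: "0 \<le> \<kappa>" "\<kappa> < 1" by (auto simp: \<kappa>_def)
  define R where "R = 2 * C / (1 - \<kappa>) + 1"
  obtain \<alpha> where \<alpha>: "0 < \<alpha>" "\<And>g. g \<in> L1 X \<Longrightarrow> (\<integral>v. g v \<partial>N) = 0 \<Longrightarrow> ny g \<le> R * nx g \<Longrightarrow> nx (op 1 g) \<le> (1 - \<alpha>) * nx g"
    using op_nx_contraction by blast
  obtain \<delta> \<rho> where \<delta>: "0 < \<delta>" and \<rho>: "0 < \<rho>" "\<rho> < 1"
    and H: "\<forall>x y x' y'. 0 \<le> x \<longrightarrow> 0 \<le> y \<longrightarrow> x' \<le> x \<longrightarrow> y' \<le> \<kappa> * y + C * x \<longrightarrow>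
      (y \<le> R * x \<longrightarrow> x' \<le> (1 - \<alpha>) * x) \<longrightarrow> x' + \<delta> * y' \<le> \<rho> * (x + \<delta> * y)"
    using harris_constants[OF \<kappa> C_nonneg R_def \<alpha>(1)] by blast
  define \<Phi> where "\<Phi> g = nx g + \<delta> * ny g" for g
  have step: "\<Phi> (op 1 g) \<le> \<rho> * \<Phi> g" if "g \<in> L1 X" "(\<integral>v. g v \<partial>N) = 0" for g
    unfolding \<Phi>_def using that op_ny_le[of g] \<alpha>(2)[of g] op_nx_le[of g 1] by (intro H[rule_format]) (auto simp: \<kappa>_def)
  have iter: "\<Phi> (op (real n) g) \<le> \<rho> ^ n * \<Phi> g" if g: "g \<in> L1 X" "(\<integral>v. g v \<partial>N) = 0" for g n
  proof (induction n)
    case 0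
    have "op 0 g = g" using g by (auto simp: op_0 L1_X)
    then show ?case by simp
  next
    case (Suc n)
    have "\<Phi> (op (real (Suc n)) g) = \<Phi> (op 1 (op (real n) g))"
      using L1X_cong_AE[OF op_semigroup[OF g(1), of 1 "real n"]] by (simp add: \<Phi>_def add.commute)
    also have "\<dots> \<le> \<rho> * \<Phi> (op (real n) g)"
      using g by (intro step) (auto simp: op_L1 integral_op)
    also have "\<dots> \<le> \<rho> * (\<rho> ^ n * \<Phi> g)" using Suc \<rho> by (intro mult_left_mono) auto
    finally show ?case by simp
  qed
  define r where "r = - ln \<rho>"
  have r: "0 < r" "exp (- r) = \<rho>" using \<rho> by (auto simp: r_def)
  \<comment> \<open>The factor 1 + C bounds the operators over a time at most 1, (1 + \<delta>) /
    \<delta> is the cost of passing from \<open>ny\<close> to \<Phi> and back, and 1 / \<rho> pays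
    for rounding \<open>t\<close> down to an integer.\<close>
  define c where "c = (1 + C) * ((1 + \<delta>) / \<delta>) / \<rho>"
  have c: "0 < c" using C_nonneg \<delta> \<rho> by (auto simp: c_def intro!: divide_pos_pos mult_pos_pos)
  have "ny (op t g) \<le> c * exp (- r * t) * ny g" if g: "g \<in> L1 X" "(\<integral>v. g v \<partial>N) = 0" and t: "0 \<le> t" for g t
  proof -
    define n where "n = nat \<lfloor>t\<rfloor>"
    define s where "s = t - real n"
    have s: "0 \<le> s" "s \<le> 1" using t by (auto simp: s_def n_def) linarith
    have gn: "op (real n) g \<in> L1 X" using g by (intro op_L1) auto
    have "ny (op t g) = ny (op s (op (real n) g))"
      using L1X_cong_AE[OF op_semigroup[OF g(1), of s "real n"]] s by (simp add: s_def)
    also have "\<dots> \<le> (1 + C) * ny (op (real n) g)"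
    proof -
      have "ennreal (ny (op s (op (real n) g))) \<le> ennreal (1 + C * s) * ennreal (ny (op (real n) g))"
        using wnorm_op_le[OF gn s(1)] by (simp only: ennreal_ny op_L1 gn s)
      also have "\<dots> \<le> ennreal (1 + C) * ennreal (ny (op (real n) g))"
        using s C_nonneg by (intro mult_right_mono ennreal_leI) (auto simp: mult_left_le)
      also have "\<dots> = ennreal ((1 + C) * ny (op (real n) g))" using C_nonneg by (simp add: ennreal_mult del: ennreal_plus)
      finally show ?thesis using C_nonneg by (subst (asm) ennreal_le_iff) auto
    qed
    also have "\<dots> \<le> (1 + C) * ((1 + \<delta>) / \<delta> * \<rho> ^ n * ny g)"
    proof (intro mult_left_mono)
      have "\<delta> * ny (op (real n) g) \<le> \<Phi> (op (real n) g)" by (simp add: \<Phi>_def)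
      also have "\<dots> \<le> \<rho> ^ n * \<Phi> g" by (rule iter[OF g])
      also have "\<dots> \<le> \<rho> ^ n * ((1 + \<delta>) * ny g)"
        using nx_le_ny[OF g(1)] \<rho> by (intro mult_left_mono) (auto simp: \<Phi>_def algebra_simps)
      finally show "ny (op (real n) g) \<le> (1 + \<delta>) / \<delta> * \<rho> ^ n * ny g"
        using \<delta> by (simp add: field_simps)
    qed (use C_nonneg in auto)
    also have "\<rho> ^ n \<le> exp (- r * t) / \<rho>"
    proof -
      have "\<rho> ^ n * \<rho> = exp (- r * real (n + 1))"
        unfolding r(2)[symmetric] by (simp add: exp_of_nat_mult[symmetric] exp_add[symmetric] algebra_simps)
      also have "\<dots> \<le> exp (- r * t)"
        using s r by (auto simp: s_def intro!: mult_left_mono)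
      finally show ?thesis using \<rho> by (simp add: pos_le_divide_eq)
    qed
    then have "(1 + C) * ((1 + \<delta>) / \<delta> * \<rho> ^ n * ny g) \<le> (1 + C) * ((1 + \<delta>) / \<delta> * (exp (- r * t) / \<rho>) * ny g)"
      using C_nonneg \<delta> by (intro mult_left_mono mult_right_mono) auto
    also have "\<dots> = c * exp (- r * t) * ny g" by (simp add: c_def)
    finally show ?thesis .
  qed
  with that[OF c r(1)] show ?thesis by blast
qed

lemma mx_L1: "mx \<in> L1 X"
  using mx_W mx_nonneg by (simp add: L1_X wnorm_def)

lemma integral_mx: "(\<integral>v. mx v \<partial>N) = 1"
  using mx_mass mx_nonneg by (subst integral_eq_nn_integral) auto

lemma op_mx: assumes "0 \<le> t" shows "AE v in N. op t mx v = mx v"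
proof -
  have "AE v in N. op t mx v = enn2real (flow t (\<lambda>v. ennreal (mx v)) v) - enn2real (flow t (\<lambda>v. 0) v)"
    using mx_W mx_nonneg assms by (intro op_decomp) (auto simp: wnorm_def)
  moreover have "AE v in N. flow t (\<lambda>v. ennreal (mx v)) v = ennreal (mx v)"
    using mx_W assms mx_stationary by (intro flow_stationary) (auto simp: wnorm_def gainK_def)
  ultimately show ?thesis
  proof eventually_elim
    case (elim v)
    then show ?case using flow_cmult[of "\<lambda>_. 0" t 0 v] by (simp add: mx_nonneg)
  qed
qed

theorem op_exponential_decay:
  "\<exists>c>0. \<exists>r>0. \<forall>f\<in>L1 X. \<forall>t\<ge>0.
    L1_norm X (\<lambda>v. op t f v - (\<integral>w. f w \<partial>N) * mx v) \<le> c * exp (- r * t) * L1_norm X f"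
proof -
  obtain c r where c: "0 < c" and r: "0 < r"
    and decay: "\<And>g t. g \<in> L1 X \<Longrightarrow> (\<integral>v. g v \<partial>N) = 0 \<Longrightarrow> 0 \<le> t \<Longrightarrow> ny (op t g) \<le> c * exp (- r * t) * ny g"
    using op_decay_zero_mean by blast
  have norm: "L1_norm X h = ny h" if "h \<in> borel_measurable N" for h
    using that by (simp add: L1_norm_X ny_def)
  have "L1_norm X (\<lambda>v. op t f v - (\<integral>w. f w \<partial>N) * mx v) \<le> c * (1 + ny mx) * exp (- r * t) * L1_norm X f"
    if f: "f \<in> L1 X" and t: "0 \<le> t" for f t
  proof -
    have [measurable]: "f \<in> borel_measurable N" using f by (simp add: L1_X)
    define m where "m = (\<integral>w. f w \<partial>N)"
    have m: "\<bar>m\<bar> \<le> nx f"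
    proof -
      have "\<bar>m\<bar> \<le> (\<integral>w. \<bar>f w\<bar> \<partial>N)" unfolding m_def by (rule integral_abs_bound)
      also have "\<dots> = nx f" unfolding nx_def by (rule integral_eq_nn_integral) auto
      finally show ?thesis .
    qed
    \<comment> \<open>The deviation from equilibrium has zero mean, and the flow fixes
      \<open>mx\<close>. Its weighted norm is at most (1 + \<open>ny mx\<close>) times that of
      \<open>f\<close>, because |m| \<le> \<open>nx f\<close> \<le> \<open>ny f\<close>; so the
      final constant involves only the norm of \<open>f\<close>.\<close>
    define g where "g v = f v + (- m) * mx v" for v
    have g_le: "wnorm (\<lambda>v. ennreal \<bar>g v\<bar>) \<le> ennreal ((1 + ny mx) * ny f)"
    proof -
      have "ennreal \<bar>g v\<bar> \<le> ennreal \<bar>f v\<bar> + ennreal \<bar>m\<bar> * ennreal \<bar>mx v\<bar>" for v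
        using abs_triangle_ineq[of "f v" "(- m) * mx v"] unfolding g_def
        by (simp add: ennreal_mult[symmetric] ennreal_plus[symmetric] abs_mult ennreal_leI del: ennreal_plus)
      then have "wnorm (\<lambda>v. ennreal \<bar>g v\<bar>) \<le> wnorm (\<lambda>v. ennreal \<bar>f v\<bar> + ennreal \<bar>m\<bar> * ennreal \<bar>mx v\<bar>)"
        by (rule wnorm_mono)
      also have "\<dots> = ennreal (ny f) + ennreal \<bar>m\<bar> * ennreal (ny mx)"
        using f mx_L1 by (simp add: wnorm_add wnorm_cmult ennreal_ny)
      also have "\<dots> = ennreal (ny f + \<bar>m\<bar> * ny mx)"
        by (simp add: ennreal_mult)
      also have "\<dots> \<le> ennreal ((1 + ny mx) * ny f)"
      proof (rule ennreal_leI)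
        have "\<bar>m\<bar> * ny mx \<le> ny f * ny mx" using m nx_le_ny[OF f] by (intro mult_right_mono) auto
        then show "ny f + \<bar>m\<bar> * ny mx \<le> (1 + ny mx) * ny f" by (simp add: algebra_simps)
      qed
      finally show ?thesis .
    qed
    have g_meas [measurable]: "g \<in> borel_measurable N" unfolding g_def[abs_def] by measurable
    have g: "g \<in> L1 X" using le_less_trans[OF g_le] by (simp add: L1_X)
    have mm: "(\<lambda>v. (- m) * mx v) \<in> L1 X"
      using mx_L1 by (auto simp: L1_X abs_mult ennreal_mult wnorm_cmult ennreal_mult_less_top)
    have "(\<integral>v. g v \<partial>N) = 0"
      unfolding g_def using integrable_L1X[OF f] integrable_L1X[OF mx_L1]
      by (subst Bochner_Integration.integral_add) (auto simp: integral_mx m_def)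
    have ae: "AE v in N. op t g v = op t f v - m * mx v"
      using op_add[OF f mm t] op_mx[OF t]
    proof eventually_elim
      case (elim v)
      then show ?case unfolding g_def[abs_def] using op_cmult[OF mx_meas, of t "- m" v] by simp
    qed
    have "L1_norm X (\<lambda>v. op t f v - m * mx v) = ny (op t g)"
      using L1X_cong_AE[OF ae] by (simp add: norm)
    also have "\<dots> \<le> c * exp (- r * t) * ny g" by (rule decay) fact+
    also have "\<dots> \<le> c * exp (- r * t) * ((1 + ny mx) * ny f)"
    proof (intro mult_left_mono)
      have "ennreal (ny g) \<le> ennreal ((1 + ny mx) * ny f)" using g_le by (simp add: ennreal_ny[OF g])
      then show "ny g \<le> (1 + ny mx) * ny f" by (subst (asm) ennreal_le_iff) auto
    qed (use c in auto)
    finally show ?thesis unfolding m_def by (simp add: norm mult_ac)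
  qed
  moreover have "0 < c * (1 + ny mx)" using c by (intro mult_pos_pos add_pos_nonneg) auto
  ultimately show ?thesis using r by blast
qed

end

section \<open>Sphere and Maxwellian\<close>

text \<open>The surface measure viewed on the Borel sets of the whole space. Borel expressions in
  \<sigma> need no restriction to the sphere for measurability; in exchange, \<sigma> is a unit
  vector only almost everywhere.\<close>

definition sphere_borel :: "'a::euclidean_space measure" where
  "sphere_borel = distr sphere_measure borel (\<lambda>x. x)"

lemma sets_sphere_borel [simp, measurable_cong]: "sets sphere_borel = sets borel"
  and space_sphere_borel [simp]: "space sphere_borel = UNIV"
  by (simp_all add: sphere_borel_def)

lemma measurable_id_sphere: "(\<lambda>x. x) \<in> measurable sphere_measure borel"
  by (simp add: sets_sphere_measure measurable_restrict_space1 cong: measurable_cong_sets)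

lemma sgn_measurable_cone:
  "(sgn :: 'a::euclidean_space \<Rightarrow> 'a) \<in> measurable (restrict_space lborel (cball 0 1 - {0})) (restrict_space borel (sphere 0 1))"
  by (rule measurable_restrict_space3) (auto simp: norm_sgn)

lemma emeasure_sphere_measure:
  fixes A :: "'a::euclidean_space set"
  assumes A: "A \<in> sets (restrict_space borel (sphere 0 1))"
  shows "emeasure sphere_measure A = of_nat DIM('a) * emeasure lborel (sgn -` A \<inter> (cball 0 1 - {0}))"
  using A sgn_measurable_cone[where 'a='a] unfolding sphere_measure_def
  by (subst emeasure_scale_measure)
     (auto simp: emeasure_distr emeasure_restrict_space space_restrict_space)

lemma finite_sphere_measure: "finite_measure (sphere_measure :: 'a::euclidean_space measure)"
proof
  have "emeasure lborel (sgn -` sphere (0::'a) 1 \<inter> (cball 0 1 - {0})) \<le> emeasure lborel (cball (0::'a) 1)"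
    by (intro emeasure_mono) auto
  also have "\<dots> < \<infinity>" by (rule emeasure_lborel_cball_finite)
  finally have "emeasure lborel (sgn -` sphere (0::'a) 1 \<inter> (cball 0 1 - {0})) < \<infinity>" .
  moreover have "sphere 0 1 \<in> sets (restrict_space borel (sphere (0::'a) 1))"
    by (simp add: sets_restrict_space_iff)
  ultimately show "emeasure (sphere_measure :: 'a measure) (space sphere_measure) \<noteq> \<infinity>"
    by (simp add: emeasure_sphere_measure ennreal_mult_eq_top_iff)
qed

interpretation sphere_measure: finite_measure "sphere_measure :: 'a::euclidean_space measure"
  by (rule finite_sphere_measure)

interpretation sphere_borel: finite_measure "sphere_borel :: 'a::euclidean_space measure"
  unfolding sphere_borel_def by (rule sphere_measure.finite_measure_distr[OF measurable_id_sphere])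

interpretation sphere_pair: pair_sigma_finite lborel "sphere_borel :: 'a::euclidean_space measure" ..

lemma nn_integral_sphere_borel:
  "F \<in> borel_measurable borel \<Longrightarrow> (\<integral>\<^sup>+x. F x \<partial>sphere_measure) = (\<integral>\<^sup>+x. F x \<partial>sphere_borel)"
  unfolding sphere_borel_def using measurable_id_sphere by (subst nn_integral_distr) auto

lemma AE_sphere_borel: "AE \<sigma> in (sphere_borel :: 'a::euclidean_space measure). norm \<sigma> = 1"
  unfolding sphere_borel_def by (subst AE_distr_iff[OF measurable_id_sphere]) auto

lemma sphere_borel_orthogonal:
  fixes T :: "'a::euclidean_space \<Rightarrow> 'a"
  assumes T: "orthogonal_transformation T" and [measurable]: "F \<in> borel_measurable borel"
  shows "(\<integral>\<^sup>+\<sigma>. F (T \<sigma>) \<partial>sphere_borel) = (\<integral>\<^sup>+\<sigma>. F \<sigma> \<partial>sphere_borel)"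
proof -
  have linT: "linear T" using T by (simp add: orthogonal_transformation_linear)
  have mT [measurable]: "T \<in> borel_measurable borel"
    using linT by (intro borel_measurable_continuous_onI)
      (simp add: linear_continuous_on linear_conv_bounded_linear)
  have mTS: "T \<in> measurable sphere_measure sphere_measure"
    using measurable_restrict_space3[OF mT, of "sphere 0 1" "sphere 0 1"]
    by (auto simp: orthogonal_transformation_norm[OF T] sets_sphere_measure
        cong: measurable_cong_sets)
  have "(\<integral>\<^sup>+\<sigma>. F \<sigma> \<partial>sphere_borel) = (\<integral>\<^sup>+\<sigma>. F \<sigma> \<partial>(distr sphere_measure sphere_measure T))"
    by (simp add: nn_integral_sphere_borel sphere_measure_orthogonal[OF T])
  also have "\<dots> = (\<integral>\<^sup>+\<sigma>. F (T \<sigma>) \<partial>sphere_measure)"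
    using measurable_compose[OF measurable_id_sphere assms(2)] by (intro nn_integral_distr mTS) simp
  finally show ?thesis by (simp add: nn_integral_sphere_borel)
qed

text \<open>A reflection carries \<open>e\<close> to \<open>e'\<close>. Consequently the angular
  averages depend neither on the direction of v - vs nor on that of w - v and can be computed with
  one fixed axis.\<close>

lemma sphere_borel_inner_indep:
  fixes e e' :: "'a::euclidean_space"
  assumes "norm e = 1" "norm e' = 1" and [measurable]: "F \<in> borel_measurable borel"
  shows "(\<integral>\<^sup>+\<sigma>. F (inner e \<sigma>) \<partial>sphere_borel) = (\<integral>\<^sup>+\<sigma>. F (inner e' \<sigma>) \<partial>sphere_borel)"
proof -
  obtain T where T: "orthogonal_transformation T" "T e = e'"
    using exists_reflection[OF assms(1,2)] by blast
  have inner_T: "inner e' (T \<sigma>) = inner e \<sigma>" for \<sigma>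
    using T unfolding orthogonal_transformation_def by metis
  have "(\<integral>\<^sup>+\<sigma>. F (inner e' \<sigma>) \<partial>sphere_borel) = (\<integral>\<^sup>+\<sigma>. F (inner e' (T \<sigma>)) \<partial>sphere_borel)"
    by (rule sphere_borel_orthogonal[OF T(1), symmetric]) measurable
  then show ?thesis by (simp add: inner_T)
qed

lemma null_line:
  fixes e :: "'a::euclidean_space"
  assumes "2 \<le> DIM('a)"
  shows "AE x in lborel. x \<notin> span {e}"
proof -
  have "dim (span {e}) \<le> 1" using dim_le_card[of "{e}"] by simp
  then have "negligible (span {e})" using assms by (intro negligible_lowdim) simp
  moreover have "span {e} \<in> sets borel" by (intro borel_closed closed_span)
  ultimately have "emeasure lborel (span {e}) = 0"
    by (simp add: negligible_iff_null_sets null_sets_def)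
  then have "span {e} \<in> null_sets lborel" using \<open>span {e} \<in> sets borel\<close> by (intro null_setsI) auto
  then show ?thesis by (rule AE_not_in)
qed

text \<open>The cone over a single direction lies in a line, a null set in dimension at least two.
  For \<sigma> = e this discards the collisions with cos \<theta> = 1, the only ones whose
  half-angle cosine is not below 1.\<close>

lemma AE_sphere_borel_neq:
  fixes e :: "'a::euclidean_space"
  assumes "2 \<le> DIM('a)"
  shows "AE \<sigma> in sphere_borel. \<sigma> \<noteq> e"
proof -
  have meas: "sphere 0 1 \<inter> {e} \<in> sets (restrict_space borel (sphere (0::'a) 1))"
    by (simp add: sets_restrict_space_iff)
  have "sgn x \<in> {e} \<Longrightarrow> x \<in> span {e}" for x :: 'a
    using span_mul[OF span_base[of e "{e}"], of "norm x"] by (cases "x = 0") (auto simp: sgn_div_norm span_zero)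
  then have "AE x in lborel. x \<notin> sgn -` (sphere 0 1 \<inter> {e}) \<inter> (cball 0 1 - {0})"
    using null_line[OF assms, of e] by (auto elim!: eventually_mono)
  moreover have "sgn -` (sphere 0 1 \<inter> {e}) \<inter> (cball 0 1 - {0}) \<in> sets (borel :: 'a measure)"
  proof -
    have "sgn -` (sphere 0 1 \<inter> {e}) \<inter> (cball 0 1 - {0}) \<in> sets (restrict_space lborel (cball 0 1 - {0}))"
      using measurable_sets[OF sgn_measurable_cone meas] by (simp add: space_restrict_space)
    then show ?thesis by (subst (asm) sets_restrict_space_iff) auto
  qed
  ultimately have "emeasure lborel (sgn -` (sphere 0 1 \<inter> {e}) \<inter> (cball (0::'a) 1 - {0})) = 0"
    using AE_iff_null_sets[of "sgn -` (sphere 0 1 \<inter> {e}) \<inter> (cball 0 1 - {0})" lborel] by auto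
  then have "emeasure sphere_measure (sphere 0 1 \<inter> {e}) = 0"
    by (simp add: emeasure_sphere_measure[OF meas])
  then have "AE \<sigma> in sphere_measure. \<sigma> \<notin> sphere 0 1 \<inter> {e}"
    using meas by (intro AE_not_in null_setsI) (auto simp: sets_sphere_measure)
  then have "AE \<sigma> in sphere_measure. \<sigma> \<noteq> e"
    using AE_space[of sphere_measure] by eventually_elim auto
  then show ?thesis unfolding sphere_borel_def
    by (subst AE_distr_iff[OF measurable_id_sphere]) auto
qed

lemma nn_integral_pair_sphere:
  fixes F :: "'a::euclidean_space \<times> 'a \<Rightarrow> ennreal"
  assumes F [measurable]: "F \<in> borel_measurable (borel \<Otimes>\<^sub>M borel)"
  shows "(\<integral>\<^sup>+p. F p \<partial>(lborel \<Otimes>\<^sub>M sphere_measure)) = (\<integral>\<^sup>+\<sigma>. \<integral>\<^sup>+v. F (v, \<sigma>) \<partial>lborel \<partial>sphere_borel)"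
proof -
  have id: "(\<lambda>p. (fst p, snd p)) \<in> measurable (lborel \<Otimes>\<^sub>M sphere_measure) (borel \<Otimes>\<^sub>M (borel :: 'a measure))"
    using measurable_compose[OF measurable_snd measurable_id_sphere]
    by (intro measurable_Pair) (auto intro: measurable_compose[OF measurable_fst])
  have F': "F \<in> borel_measurable (lborel \<Otimes>\<^sub>M sphere_measure)"
    using measurable_compose[OF id F] by simp
  have "(\<integral>\<^sup>+p. F p \<partial>(lborel \<Otimes>\<^sub>M sphere_measure)) = (\<integral>\<^sup>+v. \<integral>\<^sup>+\<sigma>. F (v, \<sigma>) \<partial>sphere_measure \<partial>lborel)"
    by (rule sphere_measure.nn_integral_fst[OF F', symmetric])
  also have "\<dots> = (\<integral>\<^sup>+v. \<integral>\<^sup>+\<sigma>. F (v, \<sigma>) \<partial>sphere_borel \<partial>lborel)"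
    by (intro nn_integral_cong nn_integral_sphere_borel) measurable
  also have "\<dots> = (\<integral>\<^sup>+\<sigma>. \<integral>\<^sup>+v. F (v, \<sigma>) \<partial>lborel \<partial>sphere_borel)"
    by (subst sphere_pair.Fubini') (auto simp: split_beta')
  finally show ?thesis .
qed

section \<open>Gaussian integrals\<close>

lemma norm_power2_Basis: "(norm v)\<^sup>2 = (\<Sum>b\<in>Basis. (v \<bullet> b)\<^sup>2)" for v :: "'a::euclidean_space"
  by (subst power2_norm_eq_inner, subst euclidean_inner) (simp add: power2_eq_square)

lemma nn_integral_gaussian:
  fixes s :: real
  assumes "0 < s"
  shows "(\<integral>\<^sup>+v. ennreal (exp (- (norm v)\<^sup>2 / (2 * s\<^sup>2))) \<partial>(lborel :: 'a::euclidean_space measure))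
    = ennreal (sqrt (2 * pi * s\<^sup>2) ^ DIM('a))"
proof -
  let ?c = "sqrt (2 * pi * s\<^sup>2)"
  have c: "0 < ?c" using assms by simp
  have "exp (- (norm v)\<^sup>2 / (2 * s\<^sup>2)) = (\<Prod>b\<in>Basis. ?c * normal_density 0 s (v \<bullet> b))" for v :: 'a
  proof -
    have "(\<Prod>b\<in>Basis. ?c * normal_density 0 s (v \<bullet> b)) = (\<Prod>b\<in>Basis. exp (- (v \<bullet> b)\<^sup>2 / (2 * s\<^sup>2)))"
      using c by (intro prod.cong) (auto simp: normal_density_def)
    also have "\<dots> = exp (- (norm v)\<^sup>2 / (2 * s\<^sup>2))"
      by (simp add: exp_sum[symmetric] norm_power2_Basis sum_negf sum_divide_distrib[symmetric])
    finally show ?thesis by simp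
  qed
  then have "(\<integral>\<^sup>+v. ennreal (exp (- (norm v)\<^sup>2 / (2 * s\<^sup>2))) \<partial>(lborel :: 'a measure))
      = (\<integral>\<^sup>+v. (\<Prod>b\<in>Basis. ennreal (?c * normal_density 0 s (v \<bullet> b))) \<partial>(lborel :: 'a measure))"
    using c by (simp add: prod_ennreal)
  also have "\<dots> = (\<Prod>b\<in>(Basis :: 'a set). (\<integral>\<^sup>+x. ennreal (?c * normal_density 0 s x) \<partial>lborel))"
    by (rule nn_integral_lborel_prod) auto
  also have "(\<integral>\<^sup>+x. ennreal (?c * normal_density 0 s x) \<partial>lborel) = ennreal ?c"
    using assms c by (subst nn_integral_eq_integral) auto
  finally show ?thesis using c by (simp add: ennreal_power)
qed

lemma maxwellian_pos: "0 < maxwellian v"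
  by (simp add: maxwellian_def)

lemma maxwellian_nonneg [simp]: "0 \<le> maxwellian v"
  using maxwellian_pos[of v] by simp

lemma maxwellian_measurable [measurable]: "maxwellian \<in> borel_measurable borel"
  unfolding maxwellian_def[abs_def] by measurable

lemma nn_integral_maxwellian: "(\<integral>\<^sup>+v. ennreal (maxwellian v) \<partial>(lborel :: 'a::euclidean_space measure)) = 1"
proof -
  let ?c = "(2 * pi) powr (- real DIM('a) / 2)"
  have "(\<integral>\<^sup>+v. ennreal (maxwellian v) \<partial>(lborel :: 'a measure))
      = (\<integral>\<^sup>+v. ennreal ?c * ennreal (exp (- (norm v)\<^sup>2 / (2 * 1\<^sup>2))) \<partial>(lborel :: 'a measure))"
    by (simp add: maxwellian_def ennreal_mult)
  also have "\<dots> = ennreal ?c * ennreal (sqrt (2 * pi * 1\<^sup>2) ^ DIM('a))"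
    using nn_integral_gaussian[of 1, where 'a='a] by (subst nn_integral_cmult) auto
  also have "sqrt (2 * pi * 1\<^sup>2) ^ DIM('a) = (2 * pi) powr (real DIM('a) / 2)"
    by (simp add: powr_half_sqrt[symmetric] powr_realpow[symmetric] powr_powr)
  also have "ennreal ?c * ennreal ((2 * pi) powr (real DIM('a) / 2)) = 1"
    by (subst ennreal_mult[symmetric]) (auto simp: powr_add[symmetric])
  finally show ?thesis .
qed

lemma nn_integral_exp_maxwellian:
  "(\<integral>\<^sup>+v. ennreal (exp (c * norm v) * maxwellian v) \<partial>(lborel :: 'a::euclidean_space measure)) < \<infinity>"
proof -
  let ?k = "(2 * pi) powr (- real DIM('a) / 2) * exp (c\<^sup>2)"
  have le: "exp (c * norm v) * maxwellian v \<le> ?k * exp (- (norm v)\<^sup>2 / (2 * (sqrt 2)\<^sup>2))" for v :: 'a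
  proof -
    \<comment> \<open>Completing the square sacrifices half of the Gaussian exponent and leaves a
      Gaussian of variance 2.\<close>
    have "0 \<le> (c - norm v / 2)\<^sup>2" by simp
    then have "c * norm v + (- (norm v)\<^sup>2 / 2) \<le> c\<^sup>2 + (- (norm v)\<^sup>2 / 4)"
      by (simp add: power2_diff field_simps)
    then have "exp (c * norm v) * exp (- (norm v)\<^sup>2 / 2) \<le> exp (c\<^sup>2) * exp (- (norm v)\<^sup>2 / 4)"
      by (simp add: exp_add[symmetric])
    then have "(2 * pi) powr (- real DIM('a) / 2) * (exp (c * norm v) * exp (- (norm v)\<^sup>2 / 2))
        \<le> (2 * pi) powr (- real DIM('a) / 2) * (exp (c\<^sup>2) * exp (- (norm v)\<^sup>2 / 4))"
      by (rule mult_left_mono) auto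
    then show ?thesis unfolding maxwellian_def by (simp add: mult_ac)
  qed
  have "(\<integral>\<^sup>+v. ennreal (exp (c * norm v) * maxwellian v) \<partial>(lborel :: 'a measure))
      \<le> (\<integral>\<^sup>+v. ennreal ?k * ennreal (exp (- (norm v)\<^sup>2 / (2 * (sqrt 2)\<^sup>2))) \<partial>(lborel :: 'a measure))"
    by (intro nn_integral_mono) (subst ennreal_mult[symmetric], simp, simp, rule ennreal_leI, rule le)
  also have "\<dots> = ennreal ?k * (\<integral>\<^sup>+v. ennreal (exp (- (norm v)\<^sup>2 / (2 * (sqrt 2)\<^sup>2))) \<partial>(lborel :: 'a measure))"
    by (rule nn_integral_cmult) measurable
  also have "\<dots> < \<infinity>"
    by (subst nn_integral_gaussian) (auto simp: ennreal_mult_less_top)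
  finally show ?thesis .
qed

section \<open>Carleman's representation\<close>

lemma nn_integral_UN_incseq:
  assumes [measurable]: "f \<in> borel_measurable M" "\<And>n::nat. A n \<in> sets M" and "incseq A"
  shows "(\<integral>\<^sup>+x\<in>(\<Union>n. A n). f x \<partial>M) = (SUP n. \<integral>\<^sup>+x\<in>A n. f x \<partial>M)"
proof -
  have "f x * indicator (\<Union>n. A n) x = (SUP n. f x * indicator (A n) x)" for x
  proof (cases "x \<in> (\<Union>n. A n)")
    case True
    then obtain n where "x \<in> A n" by blast
    then have "f x \<le> (SUP n. f x * indicator (A n) x)" by (intro SUP_upper2[of n]) auto
    moreover have "(SUP n. f x * indicator (A n) x) \<le> f x" by (intro SUP_least) (auto simp: indicator_def)
    ultimately show ?thesis using True by simp
  qed auto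
  then have "(\<integral>\<^sup>+x\<in>(\<Union>n. A n). f x \<partial>M) = (\<integral>\<^sup>+x. (SUP n. f x * indicator (A n) x) \<partial>M)" by simp
  also have "\<dots> = (SUP n. \<integral>\<^sup>+x\<in>A n. f x \<partial>M)"
    using assms(3) by (intro nn_integral_monotone_convergence_SUP)
      (auto simp: incseq_def le_fun_def indicator_def intro!: mult_left_mono)
  finally show ?thesis .
qed

text \<open>The map \<xi> -> \<xi>/2 - \<rho>/(2 \<xi>) increases from the negative half-line onto
  the real line, with inverse x -> x - sqrt(x^2 + \<rho>). This inverse is g -> g - |g| \<sigma> on
  a line of direction \<sigma> at distance sqrt \<rho> from the origin, read in the coordinate along
  \<sigma>.\<close>

lemma nn_integral_hyperbolic_substitution:
  fixes F :: "real \<Rightarrow> ennreal" and \<rho> :: real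
  assumes [measurable]: "F \<in> borel_measurable borel" and \<rho>: "0 < \<rho>"
  shows "(\<integral>\<^sup>+x. F x \<partial>lborel)
    = (\<integral>\<^sup>+\<xi>\<in>{..<0}. F ((\<xi>\<^sup>2 - \<rho>) / (2 * \<xi>)) * ennreal ((\<xi>\<^sup>2 + \<rho>) / (2 * \<xi>\<^sup>2)) \<partial>lborel)"
proof -
  define g where "g \<xi> = (\<xi>\<^sup>2 - \<rho>) / (2 * \<xi>)" for \<xi> :: real
  define g' where "g' \<xi> = (\<xi>\<^sup>2 + \<rho>) / (2 * \<xi>\<^sup>2)" for \<xi> :: real
  have [measurable]: "g \<in> borel_measurable borel" "g' \<in> borel_measurable borel"
    unfolding g_def[abs_def] g'_def[abs_def] by measurable
  have g_eq: "g \<xi> = \<xi> / 2 - \<rho> / 2 * inverse \<xi>" if "\<xi> < 0" for \<xi>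
    using that by (simp add: g_def field_simps power2_eq_square)
  have mono: "g \<xi> \<le> g \<eta>" if "\<xi> \<le> \<eta>" "\<eta> < 0" for \<xi> \<eta>
  proof -
    have "inverse \<eta> \<le> inverse \<xi>" using that by (intro le_imp_inverse_le_neg) auto
    then have "\<rho> / 2 * inverse \<eta> \<le> \<rho> / 2 * inverse \<xi>" using \<rho> by (intro mult_left_mono) auto
    then show ?thesis using that g_eq[of \<xi>] g_eq[of \<eta>] by linarith
  qed
  \<comment> \<open>Compact intervals exhausting the negative half-line, since the substitution rule
    is applied on closed intervals. The shift by 2 ensures n + 2 > 1/(n + 2) already for n =
    0.\<close>
  define a where "a n = - real (n + 2)" for n
  define b where "b n = - 1 / real (n + 2)" for n
  have ab: "a n < b n" "b n < 0" for n
  proof -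
    have "1 / real (n + 2) \<le> 1 / 1" by (intro divide_left_mono) auto
    then show "a n < b n" unfolding a_def b_def by linarith
  qed (auto simp: b_def field_simps)
  have a_mono: "a (Suc n) \<le> a n" and b_mono: "b n \<le> b (Suc n)" for n
    by (auto simp: a_def b_def field_simps)
  have UN: "(\<Union>n. {a n..b n}) = {..<0}"
  proof (intro antisym subsetI)
    fix \<xi> :: real assume "\<xi> \<in> {..<0}"
    then have \<xi>: "\<xi> < 0" by simp
    obtain n :: nat where n: "max (- \<xi>) (- 1 / \<xi>) \<le> real n" using real_arch_simple by blast
    have "a n \<le> \<xi>" using n by (simp add: a_def)
    moreover have "\<xi> \<le> b n" using n \<xi> by (simp add: b_def field_simps)
    ultimately show "\<xi> \<in> (\<Union>n. {a n..b n})" by auto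
  qed (use ab in \<open>auto intro: le_less_trans\<close>)
  have UN': "(\<Union>n. {g (a n)..g (b n)}) = UNIV"
  proof (intro antisym subsetI)
    fix x :: real
    define \<xi> where "\<xi> = x - sqrt (x\<^sup>2 + \<rho>)"
    have "\<bar>x\<bar> < sqrt (x\<^sup>2 + \<rho>)" using \<rho> by (intro real_less_rsqrt) auto
    then have \<xi>: "\<xi> < 0" by (simp add: \<xi>_def)
    have "(x - \<xi>)\<^sup>2 = x\<^sup>2 + \<rho>" using \<rho> by (simp add: \<xi>_def)
    then have "\<xi>\<^sup>2 - \<rho> = x * (2 * \<xi>)" by (simp add: power2_eq_square algebra_simps)
    then have x: "g \<xi> = x" using \<xi> by (simp add: g_def)
    obtain n where "\<xi> \<in> {a n..b n}" using UN \<xi> by blast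
    then have "x \<in> {g (a n)..g (b n)}" using mono[of "a n" \<xi>] mono[of \<xi> "b n"] \<xi> ab(2)[of n] x by auto
    then show "x \<in> (\<Union>n. {g (a n)..g (b n)})" by blast
  qed auto
  have sub: "(\<integral>\<^sup>+x\<in>{g (a n)..g (b n)}. F x \<partial>lborel) = (\<integral>\<^sup>+\<xi>\<in>{a n..b n}. F (g \<xi>) * ennreal (g' \<xi>) \<partial>lborel)" for n
  proof (rule nn_integral_substitution_aux)
    have neg: "x < 0" if "x \<in> {a n..b n}" for x using that ab(2)[of n] by auto
    show "(g has_real_derivative g' x) (at x)" if "x \<in> {a n..b n}" for x
      unfolding g_def[abs_def] g'_def using neg[OF that]
      by (auto intro!: derivative_eq_intros simp: field_simps power2_eq_square)
    show "continuous_on {a n..b n} g'"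
      unfolding g'_def[abs_def] using neg by (intro continuous_intros) force
    show "0 \<le> g' x" if "x \<in> {a n..b n}" for x using \<rho> by (simp add: g'_def)
  qed (use ab in auto)
  have "(\<integral>\<^sup>+x. F x \<partial>lborel) = (\<integral>\<^sup>+x\<in>(\<Union>n. {g (a n)..g (b n)}). F x \<partial>lborel)"
    by (simp add: UN')
  also have "\<dots> = (SUP n. \<integral>\<^sup>+x\<in>{g (a n)..g (b n)}. F x \<partial>lborel)"
  proof (rule nn_integral_UN_incseq)
    show "incseq (\<lambda>n. {g (a n)..g (b n)})"
    proof (rule incseq_SucI)
      fix n
      have "g (a (Suc n)) \<le> g (a n)" using a_mono ab less_trans by (intro mono) blast+
      moreover have "g (b n) \<le> g (b (Suc n))" using b_mono ab by (intro mono)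
      ultimately show "{g (a n)..g (b n)} \<subseteq> {g (a (Suc n))..g (b (Suc n))}" by auto
    qed
  qed auto
  also have "\<dots> = (SUP n. \<integral>\<^sup>+\<xi>\<in>{a n..b n}. F (g \<xi>) * ennreal (g' \<xi>) \<partial>lborel)" by (simp add: sub)
  also have "\<dots> = (\<integral>\<^sup>+\<xi>\<in>(\<Union>n. {a n..b n}). F (g \<xi>) * ennreal (g' \<xi>) \<partial>lborel)"
  proof (rule nn_integral_UN_incseq[symmetric])
    show "incseq (\<lambda>n. {a n..b n})"
    proof (rule incseq_SucI)
      fix n show "{a n..b n} \<subseteq> {a (Suc n)..b (Suc n)}" using a_mono[of n] b_mono[of n] by auto
    qed
  qed auto
  finally show ?thesis by (simp add: UN g_def g'_def)
qed

lemma nn_integral_lborel_shift: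
  fixes F :: "'a::euclidean_space \<Rightarrow> ennreal"
  assumes [measurable]: "F \<in> borel_measurable borel"
  shows "(\<integral>\<^sup>+x. F (x + c) \<partial>lborel) = (\<integral>\<^sup>+x. F x \<partial>lborel)"
proof -
  have "(\<integral>\<^sup>+x. F x \<partial>lborel) = (\<integral>\<^sup>+x. F x \<partial>(distr lborel borel ((+) c)))"
    by (simp add: lborel_distr_plus)
  also have "\<dots> = (\<integral>\<^sup>+x. F (c + x) \<partial>lborel)" by (subst nn_integral_distr) auto
  finally show ?thesis by (simp add: add.commute)
qed

text \<open>This reduces a change of variables that preserves these lines to one real variable.\<close>

lemma nn_integral_lines:
  fixes F :: "'a::euclidean_space \<Rightarrow> ennreal"
  assumes [measurable]: "F \<in> borel_measurable borel" and e: "norm e = 1"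
  shows "(\<integral>\<^sup>+x. F x \<partial>lborel) = (\<integral>\<^sup>+x. indicator {0..1} (x \<bullet> e) * (\<integral>\<^sup>+s. F (x + s *\<^sub>R e) \<partial>lborel) \<partial>lborel)"
proof -
  \<comment> \<open>The slab {x. 0 \<le> x \<bullet> e \<le> 1} meets every line of direction
    \<open>e\<close> in a segment of length 1, so starting points in the slab count each point of
    the space once.\<close>
  let ?\<phi> = "indicator {0..1} :: real \<Rightarrow> ennreal"
  have ee: "e \<bullet> e = 1" using e by (simp add: norm_eq_1)
  have "(\<integral>\<^sup>+x. ?\<phi> (x \<bullet> e) * (\<integral>\<^sup>+s. F (x + s *\<^sub>R e) \<partial>lborel) \<partial>lborel)
      = (\<integral>\<^sup>+x. \<integral>\<^sup>+s. ?\<phi> (x \<bullet> e) * F (x + s *\<^sub>R e) \<partial>lborel \<partial>lborel)"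
    by (simp add: nn_integral_cmult)
  also have "\<dots> = (\<integral>\<^sup>+s. \<integral>\<^sup>+x. ?\<phi> (x \<bullet> e) * F (x + s *\<^sub>R e) \<partial>lborel \<partial>lborel)"
    by (subst lborel_pair.Fubini') auto
  also have "\<dots> = (\<integral>\<^sup>+s. \<integral>\<^sup>+x. ?\<phi> (x \<bullet> e - s) * F x \<partial>lborel \<partial>lborel)"
  proof (rule nn_integral_cong)
    fix s :: real
    show "(\<integral>\<^sup>+x. ?\<phi> (x \<bullet> e) * F (x + s *\<^sub>R e) \<partial>lborel) = (\<integral>\<^sup>+x. ?\<phi> (x \<bullet> e - s) * F x \<partial>lborel)"
      using nn_integral_lborel_shift[of "\<lambda>x. ?\<phi> (x \<bullet> e - s) * F x" "s *\<^sub>R e"] by (simp add: inner_add_left ee)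
  qed
  also have "\<dots> = (\<integral>\<^sup>+x. \<integral>\<^sup>+s. ?\<phi> (x \<bullet> e - s) * F x \<partial>lborel \<partial>lborel)"
    by (subst lborel_pair.Fubini') auto
  also have "\<dots> = (\<integral>\<^sup>+x. F x \<partial>lborel)"
  proof (intro nn_integral_cong)
    fix x :: 'a
    have "?\<phi> (x \<bullet> e - s) = indicator {x \<bullet> e - 1..x \<bullet> e} s" for s by (auto simp: indicator_def)
    then show "(\<integral>\<^sup>+s. ?\<phi> (x \<bullet> e - s) * F x \<partial>lborel) = F x"
      by (simp add: nn_integral_multc)
  qed
  finally show ?thesis by simp
qed

text \<open>For \<zeta> = g - |g| \<sigma> the equation |\<zeta> + |g| \<sigma>| = |g| is linear in
  |g| and gives |g| = -|\<zeta>|^2 / (2 \<zeta> \<bullet> \<sigma>), whence the argument of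
  \<open>F\<close>. Off the line spanned by \<sigma> the product \<zeta> \<bullet> \<sigma> = g
  \<bullet> \<sigma> - |g| is negative. On that null line the one-dimensional substitution would
  degenerate, having \<rho> = 0.\<close>

lemma carleman_substitution:
  fixes F :: "'a::euclidean_space \<Rightarrow> ennreal"
  assumes [measurable]: "F \<in> borel_measurable borel" and \<sigma>: "norm \<sigma> = 1" and dim: "2 \<le> DIM('a)"
  shows "(\<integral>\<^sup>+g. F g \<partial>lborel)
    = (\<integral>\<^sup>+\<zeta>. indicator {..<0} (\<zeta> \<bullet> \<sigma>) * F (\<zeta> - ((norm \<zeta>)\<^sup>2 / (2 * (\<zeta> \<bullet> \<sigma>))) *\<^sub>R \<sigma>)
        * ennreal ((norm \<zeta>)\<^sup>2 / (2 * (\<zeta> \<bullet> \<sigma>)\<^sup>2)) \<partial>lborel)"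
    (is "_ = (\<integral>\<^sup>+\<zeta>. ?G \<zeta> \<partial>lborel)")
proof -
  have \<sigma>\<sigma>: "\<sigma> \<bullet> \<sigma> = 1" using \<sigma> by (simp add: norm_eq_1)
  have line: "(\<integral>\<^sup>+s. F (g + s *\<^sub>R \<sigma>) \<partial>lborel) = (\<integral>\<^sup>+s. ?G (g + s *\<^sub>R \<sigma>) \<partial>lborel)" if g: "g \<notin> span {\<sigma>}" for g
  proof -
    define x where "x = g \<bullet> \<sigma>"
    define y where "y = g - x *\<^sub>R \<sigma>"
    have "x *\<^sub>R \<sigma> \<in> span {\<sigma>}" by (intro span_mul span_base) simp
    then have "y \<noteq> 0" using g by (auto simp: y_def)
    then have \<rho>: "0 < (norm y)\<^sup>2" by simp
    have y\<sigma>: "y \<bullet> \<sigma> = 0" by (simp add: y_def x_def inner_diff_left \<sigma>\<sigma>)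
    have nrm: "(norm (y + \<xi> *\<^sub>R \<sigma>))\<^sup>2 = \<xi>\<^sup>2 + (norm y)\<^sup>2" for \<xi>
      unfolding power2_norm_eq_inner by (simp add: inner_add_left inner_add_right y\<sigma> \<sigma>\<sigma> inner_commute[of \<sigma> y] power2_eq_square)
    have ip: "(y + \<xi> *\<^sub>R \<sigma>) \<bullet> \<sigma> = \<xi>" for \<xi> by (simp add: inner_add_left y\<sigma> \<sigma>\<sigma>)
    have gy: "g + s *\<^sub>R \<sigma> = y + (s + x) *\<^sub>R \<sigma>" for s by (simp add: y_def scaleR_add_left)
    have "(\<integral>\<^sup>+s. F (g + s *\<^sub>R \<sigma>) \<partial>lborel) = (\<integral>\<^sup>+s. F (y + s *\<^sub>R \<sigma>) \<partial>lborel)"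
      unfolding gy by (rule nn_integral_lborel_shift) measurable
    also have "\<dots> = (\<integral>\<^sup>+\<xi>\<in>{..<0}. F (y + ((\<xi>\<^sup>2 - (norm y)\<^sup>2) / (2 * \<xi>)) *\<^sub>R \<sigma>) * ennreal ((\<xi>\<^sup>2 + (norm y)\<^sup>2) / (2 * \<xi>\<^sup>2)) \<partial>lborel)"
      by (rule nn_integral_hyperbolic_substitution[OF _ \<rho>]) measurable
    also have "\<dots> = (\<integral>\<^sup>+\<xi>. ?G (y + \<xi> *\<^sub>R \<sigma>) \<partial>lborel)"
    proof (intro nn_integral_cong)
      fix \<xi> :: real
      have e: "y + ((\<xi>\<^sup>2 - (norm y)\<^sup>2) / (2 * \<xi>)) *\<^sub>R \<sigma> = y + \<xi> *\<^sub>R \<sigma> - ((\<xi>\<^sup>2 + (norm y)\<^sup>2) / (2 * \<xi>)) *\<^sub>R \<sigma>" if "\<xi> < 0"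
      proof -
        have "(\<xi>\<^sup>2 - (norm y)\<^sup>2) / (2 * \<xi>) = \<xi> - (\<xi>\<^sup>2 + (norm y)\<^sup>2) / (2 * \<xi>)"
          using that by (simp add: field_simps power2_eq_square)
        then show ?thesis by (simp add: scaleR_diff_left)
      qed
      show "F (y + ((\<xi>\<^sup>2 - (norm y)\<^sup>2) / (2 * \<xi>)) *\<^sub>R \<sigma>) * ennreal ((\<xi>\<^sup>2 + (norm y)\<^sup>2) / (2 * \<xi>\<^sup>2)) * indicator {..<0} \<xi> = ?G (y + \<xi> *\<^sub>R \<sigma>)"
      proof (cases "\<xi> < 0")
        case True
        show ?thesis unfolding nrm ip e[OF True] using True by (simp only: lessThan_iff indicator_simps mult_1 mult_1_right)
      qed (simp add: ip)
    qed
    also have "\<dots> = (\<integral>\<^sup>+s. ?G (g + s *\<^sub>R \<sigma>) \<partial>lborel)"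
      unfolding gy by (rule nn_integral_lborel_shift[symmetric]) measurable
    finally show ?thesis .
  qed
  have "(\<integral>\<^sup>+g. F g \<partial>lborel) = (\<integral>\<^sup>+g. indicator {0..1} (g \<bullet> \<sigma>) * (\<integral>\<^sup>+s. F (g + s *\<^sub>R \<sigma>) \<partial>lborel) \<partial>lborel)"
    by (rule nn_integral_lines[OF assms(1) \<sigma>])
  also have "\<dots> = (\<integral>\<^sup>+g. indicator {0..1} (g \<bullet> \<sigma>) * (\<integral>\<^sup>+s. ?G (g + s *\<^sub>R \<sigma>) \<partial>lborel) \<partial>lborel)"
    using null_line[OF dim, of \<sigma>] by (intro nn_integral_cong_AE) (auto elim!: eventually_mono simp: line)
  also have "\<dots> = (\<integral>\<^sup>+\<zeta>. ?G \<zeta> \<partial>lborel)"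
    by (rule nn_integral_lines[OF _ \<sigma>, symmetric]) measurable
  finally show ?thesis .
qed

section \<open>Collisions parametrised by the velocity after the collision\<close>

lemma nn_integral_lborel_affine:
  fixes F :: "'a::euclidean_space \<Rightarrow> ennreal"
  assumes [measurable]: "F \<in> borel_measurable borel" and c: "c \<noteq> 0"
  shows "(\<integral>\<^sup>+x. F x \<partial>lborel) = ennreal (\<bar>c\<bar> ^ DIM('a)) * (\<integral>\<^sup>+x. F (t + c *\<^sub>R x) \<partial>lborel)"
proof -
  have "(\<integral>\<^sup>+x. F x \<partial>lborel) = (\<integral>\<^sup>+x. F x \<partial>(density (distr lborel borel (\<lambda>x. t + c *\<^sub>R x)) (\<lambda>_. \<bar>c\<bar>^DIM('a))))"
    using lborel_affine[OF c, of t] by simp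
  also have "\<dots> = ennreal (\<bar>c\<bar> ^ DIM('a)) * (\<integral>\<^sup>+x. F (t + c *\<^sub>R x) \<partial>lborel)"
    by (subst nn_integral_density) (auto simp: nn_integral_distr nn_integral_cmult)
  finally show ?thesis .
qed

text \<open>With z = v' - v, the definition of v' gives vs = v + 2 z - r \<sigma> for r = |v - vs|,
  and inserting this in |v - vs| = r forces r = |z|^2 / (z \<bullet> \<sigma>).\<close>

lemma collision_geometry:
  fixes v z \<sigma> :: "'a::euclidean_space"
  assumes \<sigma>: "norm \<sigma> = 1" and pos: "0 < z \<bullet> \<sigma>"
  defines "r \<equiv> (norm z)\<^sup>2 / (z \<bullet> \<sigma>)"
  defines "vs \<equiv> v + 2 *\<^sub>R z - r *\<^sub>R \<sigma>"
  shows "norm (v - vs) = r" "cos_dev v vs \<sigma> = 1 - 2 * (z \<bullet> \<sigma>)\<^sup>2 / (norm z)\<^sup>2"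
    "post_v v vs \<sigma> = v + z" "post_vs v vs \<sigma> = v + z - r *\<^sub>R \<sigma>"
proof -
  have \<sigma>\<sigma>: "\<sigma> \<bullet> \<sigma> = 1" using \<sigma> by (simp add: norm_eq_1)
  have z: "z \<noteq> 0" using pos by auto
  have r: "0 < r" using pos z by (simp add: r_def)
  have rz: "r * (z \<bullet> \<sigma>) = (norm z)\<^sup>2" using pos by (simp add: r_def)
  have d: "v - vs = r *\<^sub>R \<sigma> - 2 *\<^sub>R z" by (simp add: vs_def)
  have "(norm (r *\<^sub>R \<sigma> - 2 *\<^sub>R z))\<^sup>2 = r\<^sup>2 - 4 * (r * (z \<bullet> \<sigma>)) + 4 * (norm z)\<^sup>2"
    unfolding power2_norm_eq_inner
    by (simp add: inner_diff_left inner_diff_right \<sigma>\<sigma> inner_commute[of \<sigma> z] power2_eq_square algebra_simps)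
  also have "\<dots> = r\<^sup>2" by (simp add: rz)
  finally show n: "norm (v - vs) = r" using r unfolding d by (simp add: power2_eq_iff_nonneg)
  have "cos_dev v vs \<sigma> = (r - 2 * (z \<bullet> \<sigma>)) / r"
    unfolding cos_dev_def sgn_div_norm n unfolding d
    by (simp add: inner_diff_left \<sigma>\<sigma> divide_inverse mult.commute)
  also have "\<dots> = 1 - 2 * (z \<bullet> \<sigma>) / r" using r by (simp add: diff_divide_distrib)
  also have "2 * (z \<bullet> \<sigma>) / r = 2 * (z \<bullet> \<sigma>)\<^sup>2 / (norm z)\<^sup>2"
    by (simp add: r_def power2_eq_square)
  finally show "cos_dev v vs \<sigma> = 1 - 2 * (z \<bullet> \<sigma>)\<^sup>2 / (norm z)\<^sup>2" .
  have mid: "(v + vs) /\<^sub>R 2 = v + z - (r / 2) *\<^sub>R \<sigma>"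
  proof -
    have "v + vs = 2 *\<^sub>R (v + z - (r / 2) *\<^sub>R \<sigma>)"
      by (simp add: vs_def scaleR_add_right scaleR_diff_right scaleR_2)
    then show ?thesis by simp
  qed
  show "post_v v vs \<sigma> = v + z" unfolding post_v_def n mid by simp
  have "post_vs v vs \<sigma> = v + z - ((r / 2) *\<^sub>R \<sigma> + (r / 2) *\<^sub>R \<sigma>)"
    unfolding post_vs_def n mid by simp
  then show "post_vs v vs \<sigma> = v + z - r *\<^sub>R \<sigma>"
    by (simp add: scaleR_add_left[symmetric])
qed

text \<open>With g = v - vs one has v' = v - (g - |g| \<sigma>) / 2, so the variable of
  \<open>carleman_substitution\<close> is \<zeta> = -2 (w - v) with w = v'. The scaling contributes
  2^d, half of which is lost to the factor 1/2 in the Jacobian.\<close>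

lemma carleman_collision:
  fixes H :: "'a::euclidean_space \<Rightarrow> ennreal" and v :: 'a
  assumes [measurable]: "H \<in> borel_measurable borel" and \<sigma>: "norm \<sigma> = 1" and dim: "2 \<le> DIM('a)"
  shows "(\<integral>\<^sup>+vs. H vs \<partial>lborel)
    = (\<integral>\<^sup>+w. indicator {0<..} ((w - v) \<bullet> \<sigma>)
        * H (v + 2 *\<^sub>R (w - v) - ((norm (w - v))\<^sup>2 / ((w - v) \<bullet> \<sigma>)) *\<^sub>R \<sigma>)
        * ennreal (2 ^ (DIM('a) - 1) * ((norm (w - v))\<^sup>2 / ((w - v) \<bullet> \<sigma>)\<^sup>2)) \<partial>lborel)"
proof -
  have "(\<integral>\<^sup>+vs. H vs \<partial>lborel) = (\<integral>\<^sup>+g. H (v - g) \<partial>lborel)"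
    using nn_integral_lborel_affine[of H "-1" v] by simp
  also have "\<dots> = (\<integral>\<^sup>+\<zeta>. indicator {..<0} (\<zeta> \<bullet> \<sigma>) * H (v - (\<zeta> - ((norm \<zeta>)\<^sup>2 / (2 * (\<zeta> \<bullet> \<sigma>))) *\<^sub>R \<sigma>))
        * ennreal ((norm \<zeta>)\<^sup>2 / (2 * (\<zeta> \<bullet> \<sigma>)\<^sup>2)) \<partial>lborel)" (is "_ = (\<integral>\<^sup>+\<zeta>. ?G \<zeta> \<partial>lborel)")
    by (rule carleman_substitution[OF _ \<sigma> dim]) measurable
  also have "\<dots> = ennreal (2 ^ DIM('a)) * (\<integral>\<^sup>+w. ?G (2 *\<^sub>R v + (- 2) *\<^sub>R w) \<partial>lborel)"
    using nn_integral_lborel_affine[of ?G "- 2" "2 *\<^sub>R v"] by simp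
  also have "\<dots> = (\<integral>\<^sup>+w. ennreal (2 ^ DIM('a)) * ?G (2 *\<^sub>R v + (- 2) *\<^sub>R w) \<partial>lborel)"
    by (rule nn_integral_cmult[symmetric]) measurable
  also have "\<dots> = (\<integral>\<^sup>+w. indicator {0<..} ((w - v) \<bullet> \<sigma>)
        * H (v + 2 *\<^sub>R (w - v) - ((norm (w - v))\<^sup>2 / ((w - v) \<bullet> \<sigma>)) *\<^sub>R \<sigma>)
        * ennreal (2 ^ (DIM('a) - 1) * ((norm (w - v))\<^sup>2 / ((w - v) \<bullet> \<sigma>)\<^sup>2)) \<partial>lborel)"
  proof (intro nn_integral_cong)
    fix w
    define z where "z = w - v"
    have \<zeta>: "2 *\<^sub>R v + (- 2) *\<^sub>R w = (- 2) *\<^sub>R z" by (simp add: z_def scaleR_diff_right)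
    have n: "(norm ((- 2) *\<^sub>R z))\<^sup>2 = 4 * (norm z)\<^sup>2" by (simp add: power_mult_distrib)
    have i: "((- 2) *\<^sub>R z) \<bullet> \<sigma> = - 2 * (z \<bullet> \<sigma>)" by simp
    show "ennreal (2 ^ DIM('a)) * ?G (2 *\<^sub>R v + (- 2) *\<^sub>R w)
      = indicator {0<..} ((w - v) \<bullet> \<sigma>)
        * H (v + 2 *\<^sub>R (w - v) - ((norm (w - v))\<^sup>2 / ((w - v) \<bullet> \<sigma>)) *\<^sub>R \<sigma>)
        * ennreal (2 ^ (DIM('a) - 1) * ((norm (w - v))\<^sup>2 / ((w - v) \<bullet> \<sigma>)\<^sup>2))"
    proof (cases "0 < z \<bullet> \<sigma>")
      case True
      have 1: "v - ((- 2) *\<^sub>R z - (4 * (norm z)\<^sup>2 / (2 * (- 2 * (z \<bullet> \<sigma>)))) *\<^sub>R \<sigma>)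
          = v + 2 *\<^sub>R z - ((norm z)\<^sup>2 / (z \<bullet> \<sigma>)) *\<^sub>R \<sigma>"
        by simp
      have 2: "ennreal (2 ^ DIM('a)) * ennreal (4 * (norm z)\<^sup>2 / (2 * (- 2 * (z \<bullet> \<sigma>))\<^sup>2))
          = ennreal (2 ^ (DIM('a) - 1) * ((norm z)\<^sup>2 / (z \<bullet> \<sigma>)\<^sup>2))"
      proof -
        have "(2::real) ^ DIM('a) = 2 * 2 ^ (DIM('a) - 1)"
          using dim by (metis One_nat_def Suc_pred DIM_positive power_Suc)
        then show ?thesis by (subst ennreal_mult[symmetric]) (auto simp: power_mult_distrib)
      qed
      have "ennreal (2 ^ DIM('a)) * ?G (2 *\<^sub>R v + (- 2) *\<^sub>R w)
          = H (v - ((- 2) *\<^sub>R z - (4 * (norm z)\<^sup>2 / (2 * (- 2 * (z \<bullet> \<sigma>)))) *\<^sub>R \<sigma>))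
            * (ennreal (2 ^ DIM('a)) * ennreal (4 * (norm z)\<^sup>2 / (2 * (- 2 * (z \<bullet> \<sigma>))\<^sup>2)))"
        unfolding \<zeta> n i using True by (simp only: indicator_simps lessThan_iff mult_ac) (simp add: mult_ac)
      then show ?thesis unfolding 1 2 z_def[symmetric] using True by simp
    next
      case False
      then show ?thesis unfolding \<zeta> i z_def[symmetric] by simp
    qed
  qed
  finally show ?thesis .
qed

text \<open>The factors are the relative speed to the power \<gamma>, the angular kernel, the
  Jacobian and the Maxwellian of the partner velocity, in the coordinates of
  \<open>collision_geometry\<close>. The point \<open>w\<close> is kept independent of
  \<open>z\<close>, because the dual representation uses the same formula with w + 2 (v - w) in its
  place.\<close>

definition carleman_integrand :: "real \<Rightarrow> (real \<Rightarrow> real) \<Rightarrow> 'a::euclidean_space \<Rightarrow> 'a \<Rightarrow> 'a \<Rightarrow> real" where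
  "carleman_integrand \<gamma> b z w \<sigma> =
     ((norm z)\<^sup>2 / (z \<bullet> \<sigma>)) powr \<gamma> * b (1 - 2 * (z \<bullet> \<sigma>)\<^sup>2 / (norm z)\<^sup>2)
     * (2 ^ (DIM('a) - 1) * ((norm z)\<^sup>2 / (z \<bullet> \<sigma>)\<^sup>2)) * maxwellian (w - ((norm z)\<^sup>2 / (z \<bullet> \<sigma>)) *\<^sub>R \<sigma>)"

text \<open>The kernel of the gain operator in Carleman's representation \<open>K f v = \<integral> k(v, w) f(w) dw\<close>.\<close>

definition carleman_kernel :: "real \<Rightarrow> (real \<Rightarrow> real) \<Rightarrow> 'a::euclidean_space \<Rightarrow> 'a \<Rightarrow> ennreal" where
  "carleman_kernel \<gamma> b v w =
     (\<integral>\<^sup>+\<sigma>. indicator {0<..} ((w - v) \<bullet> \<sigma>) * ennreal (carleman_integrand \<gamma> b (w - v) w \<sigma>) \<partial>sphere_borel)"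

lemma carleman_integrand_meas [measurable]:
  fixes x y z :: "'x \<Rightarrow> 'a::euclidean_space"
  assumes [measurable]: "b \<in> borel_measurable borel" "x \<in> borel_measurable L" "y \<in> borel_measurable L" "z \<in> borel_measurable L"
  shows "(\<lambda>t. carleman_integrand \<gamma> b (x t) (y t) (z t)) \<in> borel_measurable L"
  unfolding carleman_integrand_def by measurable

lemma carleman_kernel_meas:
  assumes [measurable]: "b \<in> borel_measurable borel"
  shows "(\<lambda>(v, w :: 'a::euclidean_space). carleman_kernel \<gamma> b v w) \<in> borel_measurable (lborel \<Otimes>\<^sub>M lborel)"
  unfolding carleman_kernel_def split_beta' by measurable

lemma coll_kernel_meas [measurable]:
  fixes x y z :: "'x \<Rightarrow> 'a::euclidean_space"
  assumes [measurable]: "b \<in> borel_measurable borel" "x \<in> borel_measurable L" "y \<in> borel_measurable L" "z \<in> borel_measurable L"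
  shows "(\<lambda>t. coll_kernel \<gamma> b (x t) (y t) (z t)) \<in> borel_measurable L"
  unfolding coll_kernel_def cos_dev_def by measurable

lemma post_meas [measurable]:
  fixes x y z :: "'x \<Rightarrow> 'a::euclidean_space"
  assumes [measurable]: "x \<in> borel_measurable L" "y \<in> borel_measurable L" "z \<in> borel_measurable L"
  shows "(\<lambda>t. post_v (x t) (y t) (z t)) \<in> borel_measurable L" "(\<lambda>t. post_vs (x t) (y t) (z t)) \<in> borel_measurable L"
  unfolding post_v_def post_vs_def by measurable

lemma add_diff_self: "x + (y - x) = y" for x y :: "'a::ab_group_add"
  by simp

lemma ennreal_mult_rearrange:
  fixes F :: ennreal
  assumes "0 \<le> a" "0 \<le> b" "0 \<le> c" "0 \<le> d"
  shows "ennreal (a * b * c) * F * ennreal d = ennreal (a * b * d * c) * F"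
  using assms by (simp add: ennreal_mult mult_ac)

context
  fixes \<gamma> :: real and b :: "real \<Rightarrow> real"
  assumes b_meas [measurable]: "b \<in> borel_measurable borel" and b_nonneg: "\<And>x. 0 \<le> b x"
begin

lemma gain_carleman_sigma:
  fixes f :: "'a::euclidean_space \<Rightarrow> ennreal"
  assumes [measurable]: "f \<in> borel_measurable borel" and \<sigma>: "norm \<sigma> = 1" and dim: "2 \<le> DIM('a)"
  shows "(\<integral>\<^sup>+vs. ennreal (coll_kernel \<gamma> b v vs \<sigma> * maxwellian (post_vs v vs \<sigma>)) * f (post_v v vs \<sigma>) \<partial>lborel)
    = (\<integral>\<^sup>+w. indicator {0<..} ((w - v) \<bullet> \<sigma>) * ennreal (carleman_integrand \<gamma> b (w - v) w \<sigma>) * f w \<partial>lborel)"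
proof (subst carleman_collision[OF _ \<sigma> dim, of _ v], measurable, intro nn_integral_cong)
  fix w
  show "indicator {0<..} ((w - v) \<bullet> \<sigma>)
      * (ennreal (coll_kernel \<gamma> b v (v + 2 *\<^sub>R (w - v) - ((norm (w - v))\<^sup>2 / ((w - v) \<bullet> \<sigma>)) *\<^sub>R \<sigma>) \<sigma>
          * maxwellian (post_vs v (v + 2 *\<^sub>R (w - v) - ((norm (w - v))\<^sup>2 / ((w - v) \<bullet> \<sigma>)) *\<^sub>R \<sigma>) \<sigma>))
        * f (post_v v (v + 2 *\<^sub>R (w - v) - ((norm (w - v))\<^sup>2 / ((w - v) \<bullet> \<sigma>)) *\<^sub>R \<sigma>) \<sigma>))
      * ennreal (2 ^ (DIM('a) - 1) * ((norm (w - v))\<^sup>2 / ((w - v) \<bullet> \<sigma>)\<^sup>2))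
    = indicator {0<..} ((w - v) \<bullet> \<sigma>) * ennreal (carleman_integrand \<gamma> b (w - v) w \<sigma>) * f w"
  proof (cases "0 < (w - v) \<bullet> \<sigma>")
    case True
    note g = collision_geometry[OF \<sigma> True, of v]
    have i: "indicator {0<..} ((w - v) \<bullet> \<sigma>) = (1 :: ennreal)" using True by simp
    show ?thesis
      unfolding coll_kernel_def g carleman_integrand_def i mult_1 add_diff_self
      by (rule ennreal_mult_rearrange) (use b_nonneg in auto)
  qed simp
qed

lemma loss_carleman_sigma:
  fixes f :: "'a::euclidean_space \<Rightarrow> ennreal"
  assumes [measurable]: "f \<in> borel_measurable borel" and \<sigma>: "norm \<sigma> = 1" and dim: "2 \<le> DIM('a)"
  shows "(\<integral>\<^sup>+ws. ennreal (coll_kernel \<gamma> b w ws \<sigma> * maxwellian ws) * f (post_v w ws \<sigma>) \<partial>lborel)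
    = (\<integral>\<^sup>+v. indicator {0<..} ((v - w) \<bullet> \<sigma>) * ennreal (carleman_integrand \<gamma> b (v - w) (w + 2 *\<^sub>R (v - w)) \<sigma>) * f v \<partial>lborel)"
proof (subst carleman_collision[OF _ \<sigma> dim, of _ w], measurable, intro nn_integral_cong)
  fix v
  show "indicator {0<..} ((v - w) \<bullet> \<sigma>)
      * (ennreal (coll_kernel \<gamma> b w (w + 2 *\<^sub>R (v - w) - ((norm (v - w))\<^sup>2 / ((v - w) \<bullet> \<sigma>)) *\<^sub>R \<sigma>) \<sigma>
          * maxwellian (w + 2 *\<^sub>R (v - w) - ((norm (v - w))\<^sup>2 / ((v - w) \<bullet> \<sigma>)) *\<^sub>R \<sigma>))
        * f (post_v w (w + 2 *\<^sub>R (v - w) - ((norm (v - w))\<^sup>2 / ((v - w) \<bullet> \<sigma>)) *\<^sub>R \<sigma>) \<sigma>))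
      * ennreal (2 ^ (DIM('a) - 1) * ((norm (v - w))\<^sup>2 / ((v - w) \<bullet> \<sigma>)\<^sup>2))
    = indicator {0<..} ((v - w) \<bullet> \<sigma>) * ennreal (carleman_integrand \<gamma> b (v - w) (w + 2 *\<^sub>R (v - w)) \<sigma>) * f v"
  proof (cases "0 < (v - w) \<bullet> \<sigma>")
    case True
    note g = collision_geometry[OF \<sigma> True, of w]
    have i: "indicator {0<..} ((v - w) \<bullet> \<sigma>) = (1 :: ennreal)" using True by simp
    show ?thesis
      unfolding coll_kernel_def g carleman_integrand_def i mult_1 add_diff_self
      by (rule ennreal_mult_rearrange) (use b_nonneg in auto)
  qed simp
qed

lemma nn_integral_gain_carleman:
  fixes f :: "'a::euclidean_space \<Rightarrow> ennreal"
  assumes [measurable]: "f \<in> borel_measurable borel" and dim: "2 \<le> DIM('a)"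
  shows "(\<integral>\<^sup>+w. carleman_kernel \<gamma> b v w * f w \<partial>lborel)
    = (\<integral>\<^sup>+\<sigma>. \<integral>\<^sup>+vs. ennreal (coll_kernel \<gamma> b v vs \<sigma> * maxwellian (post_vs v vs \<sigma>)) * f (post_v v vs \<sigma>) \<partial>lborel \<partial>sphere_borel)"
proof -
  have "(\<integral>\<^sup>+w. carleman_kernel \<gamma> b v w * f w \<partial>lborel)
      = (\<integral>\<^sup>+w. \<integral>\<^sup>+\<sigma>. indicator {0<..} ((w - v) \<bullet> \<sigma>) * ennreal (carleman_integrand \<gamma> b (w - v) w \<sigma>) * f w \<partial>sphere_borel \<partial>lborel)"
    unfolding carleman_kernel_def by (intro nn_integral_cong nn_integral_multc[symmetric]) measurable
  also have "\<dots> = (\<integral>\<^sup>+\<sigma>. \<integral>\<^sup>+w. indicator {0<..} ((w - v) \<bullet> \<sigma>) * ennreal (carleman_integrand \<gamma> b (w - v) w \<sigma>) * f w \<partial>lborel \<partial>sphere_borel)"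
    by (subst sphere_pair.Fubini') auto
  also have "\<dots> = (\<integral>\<^sup>+\<sigma>. \<integral>\<^sup>+vs. ennreal (coll_kernel \<gamma> b v vs \<sigma> * maxwellian (post_vs v vs \<sigma>)) * f (post_v v vs \<sigma>) \<partial>lborel \<partial>sphere_borel)"
    using AE_sphere_borel by (intro nn_integral_cong_AE) (auto elim!: eventually_mono simp: gain_carleman_sigma dim)
  finally show ?thesis .
qed

text \<open>The reflection in the hyperplane orthogonal to \<open>w - v\<close> exchanges the two representations.\<close>

lemma carleman_kernel_reflected:
  fixes v w :: "'a::euclidean_space"
  shows "carleman_kernel \<gamma> b v w
    = (\<integral>\<^sup>+\<sigma>. indicator {0<..} ((v - w) \<bullet> \<sigma>) * ennreal (carleman_integrand \<gamma> b (v - w) (w + 2 *\<^sub>R (v - w)) \<sigma>) \<partial>sphere_borel)"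
proof (cases "v = w")
  case False
  define z where "z = w - v"
  have z: "z \<noteq> 0" using False by (simp add: z_def)
  define T where "T \<sigma> = \<sigma> - (2 * (z \<bullet> \<sigma>) / (z \<bullet> z)) *\<^sub>R z" for \<sigma>
  have zz: "z \<bullet> z \<noteq> 0" using z by simp
  have lin: "linear T"
    by (intro linearI) (simp_all add: T_def inner_add_right algebra_simps add_divide_distrib)
  have "norm (T x) = norm x" for x
  proof -
    have "inner (T x) (T x) = inner x x"
      using zz by (simp add: T_def inner_diff inner_commute field_simps power2_eq_square)
    then show ?thesis by (simp add: norm_eq_sqrt_inner)
  qed
  with lin have T: "orthogonal_transformation T" by (simp add: orthogonal_transformation)
  have zT: "z \<bullet> T \<sigma> = - (z \<bullet> \<sigma>)" for \<sigma> using zz by (simp add: T_def inner_diff_right)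
  have "(\<integral>\<^sup>+\<sigma>. indicator {0<..} ((v - w) \<bullet> \<sigma>) * ennreal (carleman_integrand \<gamma> b (v - w) (w + 2 *\<^sub>R (v - w)) \<sigma>) \<partial>sphere_borel)
      = (\<integral>\<^sup>+\<sigma>. indicator {0<..} ((v - w) \<bullet> T \<sigma>) * ennreal (carleman_integrand \<gamma> b (v - w) (w + 2 *\<^sub>R (v - w)) (T \<sigma>)) \<partial>sphere_borel)"
    by (rule sphere_borel_orthogonal[OF T, symmetric]) measurable
  also have "\<dots> = carleman_kernel \<gamma> b v w"
    unfolding carleman_kernel_def
  proof (intro nn_integral_cong)
    fix \<sigma> :: 'a
    have vw: "v - w = - z" by (simp add: z_def)
    have ip: "(v - w) \<bullet> T \<sigma> = z \<bullet> \<sigma>" by (simp add: vw zT)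
    \<comment> \<open>Reflecting \<sigma> changes r \<sigma> by exactly -2 z, with r = |z|^2 / (z
      \<bullet> \<sigma>), and so undoes the shift by 2 (v - w) = -2 z. The two Maxwellian factors
      then have the same argument; all other factors depend on z \<bullet> \<sigma> only.\<close>
    have e: "w + 2 *\<^sub>R (v - w) - ((norm z)\<^sup>2 / (z \<bullet> \<sigma>)) *\<^sub>R T \<sigma> = w - ((norm z)\<^sup>2 / (z \<bullet> \<sigma>)) *\<^sub>R \<sigma>" if "0 < z \<bullet> \<sigma>"
    proof -
      have "((norm z)\<^sup>2 / (z \<bullet> \<sigma>)) * (2 * (z \<bullet> \<sigma>) / (z \<bullet> z)) = 2"
        using that zz by (simp add: power2_norm_eq_inner)
      then have "((norm z)\<^sup>2 / (z \<bullet> \<sigma>)) *\<^sub>R T \<sigma> = ((norm z)\<^sup>2 / (z \<bullet> \<sigma>)) *\<^sub>R \<sigma> - 2 *\<^sub>R z"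
        unfolding T_def scaleR_diff_right scaleR_scaleR by simp
      then show ?thesis by (simp add: vw)
    qed
    show "indicator {0<..} ((v - w) \<bullet> T \<sigma>) * ennreal (carleman_integrand \<gamma> b (v - w) (w + 2 *\<^sub>R (v - w)) (T \<sigma>))
      = indicator {0<..} ((w - v) \<bullet> \<sigma>) * ennreal (carleman_integrand \<gamma> b (w - v) w \<sigma>)"
    proof (cases "0 < z \<bullet> \<sigma>")
      case True
      show ?thesis
        unfolding carleman_integrand_def ip norm_minus_commute[of v w] z_def[symmetric] e[OF True] by simp
    next
      case False
      then show ?thesis unfolding ip z_def[symmetric] by simp
    qed
  qed
  finally show ?thesis by simp
qed (simp add: carleman_kernel_def)

text \<open>The kernel seen from the departing velocity \<open>w\<close>: it averages \<phi> over
  the outcomes of a collision with a Maxwellian partner. For \<phi> = 1 this is the collision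
  frequency, for \<phi> = \<open>W\<close> the left side of the Lyapunov inequality.\<close>

lemma nn_integral_loss_carleman:
  fixes \<phi> :: "'a::euclidean_space \<Rightarrow> ennreal"
  assumes [measurable]: "\<phi> \<in> borel_measurable borel" and dim: "2 \<le> DIM('a)"
  shows "(\<integral>\<^sup>+v. carleman_kernel \<gamma> b v w * \<phi> v \<partial>lborel)
    = (\<integral>\<^sup>+\<sigma>. \<integral>\<^sup>+ws. ennreal (coll_kernel \<gamma> b w ws \<sigma> * maxwellian ws) * \<phi> (post_v w ws \<sigma>) \<partial>lborel \<partial>sphere_borel)"
proof -
  have "(\<integral>\<^sup>+v. carleman_kernel \<gamma> b v w * \<phi> v \<partial>lborel)
      = (\<integral>\<^sup>+v. \<integral>\<^sup>+\<sigma>. indicator {0<..} ((v - w) \<bullet> \<sigma>) * ennreal (carleman_integrand \<gamma> b (v - w) (w + 2 *\<^sub>R (v - w)) \<sigma>) * \<phi> v \<partial>sphere_borel \<partial>lborel)"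
    unfolding carleman_kernel_reflected by (intro nn_integral_cong nn_integral_multc[symmetric]) measurable
  also have "\<dots> = (\<integral>\<^sup>+\<sigma>. \<integral>\<^sup>+v. indicator {0<..} ((v - w) \<bullet> \<sigma>) * ennreal (carleman_integrand \<gamma> b (v - w) (w + 2 *\<^sub>R (v - w)) \<sigma>) * \<phi> v \<partial>lborel \<partial>sphere_borel)"
    by (subst sphere_pair.Fubini') auto
  also have "\<dots> = (\<integral>\<^sup>+\<sigma>. \<integral>\<^sup>+ws. ennreal (coll_kernel \<gamma> b w ws \<sigma> * maxwellian ws) * \<phi> (post_v w ws \<sigma>) \<partial>lborel \<partial>sphere_borel)"
    using AE_sphere_borel by (intro nn_integral_cong_AE) (auto elim!: eventually_mono simp: loss_carleman_sigma dim)
  finally show ?thesis .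
qed

end

section \<open>Collision frequency and Lyapunov inequality\<close>

text \<open>By rotation invariance the angular integral is the same for all directions of v - vs and
  splits off. The diagonal v = vs, where \<open>sgn\<close> vanishes, is a null set.
  \<open>B\<close> and \<open>q\<close> are general because the Lyapunov inequality needs the
  formula with modified angular kernels and with the Maxwellian times an exponential.\<close>

lemma nn_integral_coll_kernel:
  fixes v e :: "'a::euclidean_space" and B q :: "_ \<Rightarrow> real"
  assumes [measurable]: "B \<in> borel_measurable borel" "q \<in> borel_measurable borel"
    and B: "\<And>x. 0 \<le> B x" and q: "\<And>v. 0 \<le> q v" and e: "norm e = 1"
  shows "(\<integral>\<^sup>+\<sigma>. \<integral>\<^sup>+vs. ennreal (coll_kernel \<gamma> B v vs \<sigma> * q vs) \<partial>lborel \<partial>sphere_borel)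
    = (\<integral>\<^sup>+\<sigma>. ennreal (B (e \<bullet> \<sigma>)) \<partial>sphere_borel) * (\<integral>\<^sup>+vs. ennreal (norm (v - vs) powr \<gamma> * q vs) \<partial>lborel)"
proof -
  have "(\<integral>\<^sup>+\<sigma>. \<integral>\<^sup>+vs. ennreal (coll_kernel \<gamma> B v vs \<sigma> * q vs) \<partial>lborel \<partial>sphere_borel)
      = (\<integral>\<^sup>+vs. \<integral>\<^sup>+\<sigma>. ennreal (coll_kernel \<gamma> B v vs \<sigma> * q vs) \<partial>sphere_borel \<partial>lborel)"
    by (subst sphere_pair.Fubini') auto
  also have "\<dots> = (\<integral>\<^sup>+vs. (\<integral>\<^sup>+\<sigma>. ennreal (B (e \<bullet> \<sigma>)) \<partial>sphere_borel) * ennreal (norm (v - vs) powr \<gamma> * q vs) \<partial>lborel)"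
  proof (rule nn_integral_cong_AE)
    show "AE vs in lborel. (\<integral>\<^sup>+\<sigma>. ennreal (coll_kernel \<gamma> B v vs \<sigma> * q vs) \<partial>sphere_borel)
      = (\<integral>\<^sup>+\<sigma>. ennreal (B (e \<bullet> \<sigma>)) \<partial>sphere_borel) * ennreal (norm (v - vs) powr \<gamma> * q vs)"
      using AE_lborel_singleton[of v]
    proof eventually_elim
      case (elim vs)
      then have n: "norm (sgn (v - vs)) = 1" by (simp add: norm_sgn)
      have "(\<integral>\<^sup>+\<sigma>. ennreal (coll_kernel \<gamma> B v vs \<sigma> * q vs) \<partial>sphere_borel)
          = (\<integral>\<^sup>+\<sigma>. ennreal (B (sgn (v - vs) \<bullet> \<sigma>)) * ennreal (norm (v - vs) powr \<gamma> * q vs) \<partial>sphere_borel)"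
        unfolding coll_kernel_def cos_dev_def using B q
        by (intro nn_integral_cong) (simp add: ennreal_mult[symmetric] mult_ac)
      also have "\<dots> = (\<integral>\<^sup>+\<sigma>. ennreal (B (sgn (v - vs) \<bullet> \<sigma>)) \<partial>sphere_borel) * ennreal (norm (v - vs) powr \<gamma> * q vs)"
        by (rule nn_integral_multc) measurable
      also have "(\<integral>\<^sup>+\<sigma>. ennreal (B (sgn (v - vs) \<bullet> \<sigma>)) \<partial>sphere_borel) = (\<integral>\<^sup>+\<sigma>. ennreal (B (e \<bullet> \<sigma>)) \<partial>sphere_borel)"
        by (rule sphere_borel_inner_indep[OF n e]) measurable
      finally show ?case .
    qed
  qed
  also have "\<dots> = (\<integral>\<^sup>+\<sigma>. ennreal (B (e \<bullet> \<sigma>)) \<partial>sphere_borel) * (\<integral>\<^sup>+vs. ennreal (norm (v - vs) powr \<gamma> * q vs) \<partial>lborel)"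
    by (rule nn_integral_cmult) measurable
  finally show ?thesis .
qed

lemma nn_integral_sphere_mono:
  assumes "\<And>\<sigma>. norm \<sigma> = 1 \<Longrightarrow> F \<sigma> \<le> G \<sigma>"
  shows "(\<integral>\<^sup>+\<sigma>. F \<sigma> \<partial>sphere_borel) \<le> (\<integral>\<^sup>+\<sigma>. G \<sigma> \<partial>sphere_borel)"
  using AE_sphere_borel by (intro nn_integral_mono_AE) (auto elim!: eventually_mono intro: assms)

lemma nn_integral_mono_neq:
  assumes "\<And>x. x \<noteq> c \<Longrightarrow> F x \<le> G x"
  shows "(\<integral>\<^sup>+x. F x \<partial>lborel) \<le> (\<integral>\<^sup>+x. G x \<partial>lborel)"
  using AE_lborel_singleton[of c] by (intro nn_integral_mono_AE) (auto elim!: eventually_mono intro: assms)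

section \<open>Two-sided bounds for the mean relative speed\<close>

lemma norm_diff_powr_le:
  fixes v vs :: "'a::euclidean_space"
  assumes "0 \<le> \<gamma>"
  shows "norm (v - vs) powr \<gamma> \<le> (1 + norm v) powr \<gamma> * exp (\<gamma> * norm vs)"
proof -
  have "norm (v - vs) \<le> norm v + norm vs" by (rule norm_triangle_ineq4)
  also have "\<dots> \<le> (1 + norm v) * (1 + norm vs)" by (simp add: algebra_simps)
  finally have "norm (v - vs) powr \<gamma> \<le> ((1 + norm v) * (1 + norm vs)) powr \<gamma>"
    using assms by (intro powr_mono2) auto
  also have "\<dots> = (1 + norm v) powr \<gamma> * (1 + norm vs) powr \<gamma>" by (simp add: powr_mult)
  also have "\<dots> \<le> (1 + norm v) powr \<gamma> * exp (norm vs) powr \<gamma>"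
    using assms by (intro mult_left_mono powr_mono2) (auto simp: exp_ge_add_one_self)
  also have "exp (norm vs) powr \<gamma> = exp (\<gamma> * norm vs)" by (simp add: exp_powr_real mult.commute)
  finally show ?thesis .
qed

lemma nn_integral_relative_speed_exp_le:
  fixes v :: "'a::euclidean_space"
  assumes "0 \<le> \<gamma>"
  shows "(\<integral>\<^sup>+vs. ennreal (norm (v - vs) powr \<gamma> * (exp (c * norm vs) * maxwellian vs)) \<partial>lborel)
    \<le> ennreal ((1 + norm v) powr \<gamma>) * (\<integral>\<^sup>+vs. ennreal (exp ((\<gamma> + c) * norm vs) * maxwellian vs) \<partial>(lborel :: 'a measure))"
proof -
  have "(\<integral>\<^sup>+vs. ennreal (norm (v - vs) powr \<gamma> * (exp (c * norm vs) * maxwellian vs)) \<partial>lborel)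
      \<le> (\<integral>\<^sup>+vs. ennreal ((1 + norm v) powr \<gamma>) * ennreal (exp ((\<gamma> + c) * norm vs) * maxwellian vs) \<partial>(lborel :: 'a measure))"
  proof (rule nn_integral_mono)
    fix vs :: 'a
    have "norm (v - vs) powr \<gamma> * (exp (c * norm vs) * maxwellian vs)
        \<le> ((1 + norm v) powr \<gamma> * exp (\<gamma> * norm vs)) * (exp (c * norm vs) * maxwellian vs)"
      by (intro mult_right_mono norm_diff_powr_le assms) auto
    also have "\<dots> = (1 + norm v) powr \<gamma> * (exp ((\<gamma> + c) * norm vs) * maxwellian vs)"
    proof -
      have "exp ((\<gamma> + c) * norm vs) = exp (\<gamma> * norm vs) * exp (c * norm vs)"
        by (simp add: distrib_right exp_add)
      then show ?thesis by (simp add: mult_ac)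
    qed
    finally show "ennreal (norm (v - vs) powr \<gamma> * (exp (c * norm vs) * maxwellian vs))
        \<le> ennreal ((1 + norm v) powr \<gamma>) * ennreal (exp ((\<gamma> + c) * norm vs) * maxwellian vs)"
      by (subst ennreal_mult[symmetric]) (auto intro: ennreal_leI)
  qed
  also have "\<dots> = ennreal ((1 + norm v) powr \<gamma>) * (\<integral>\<^sup>+vs. ennreal (exp ((\<gamma> + c) * norm vs) * maxwellian vs) \<partial>(lborel :: 'a measure))"
    by (rule nn_integral_cmult) measurable
  finally show ?thesis .
qed

text \<open>The relative speed |v - vs| alone may be small, but the Maxwellian is even, so vs may be
  averaged with -vs. The larger of |v - vs| and |v + vs| is at least |v| and at least |vs|, hence at
  least (1 + |v|) min(1, |vs|) / 2, which separates the variables. The two copies explain the factor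
  1/2 in \<open>c\<close>.\<close>

lemma nn_integral_relative_speed_ge:
  assumes \<gamma>: "0 \<le> \<gamma>"
  obtains c where "0 < c" "\<And>v :: 'a::euclidean_space.
    ennreal (c * (1 + norm v) powr \<gamma>) \<le> (\<integral>\<^sup>+vs. ennreal (norm (v - vs) powr \<gamma> * maxwellian vs) \<partial>lborel)"
proof -
  define J where "J = (\<integral>\<^sup>+vs. ennreal ((min 1 (norm vs) / 2) powr \<gamma> * maxwellian vs) \<partial>(lborel :: 'a measure))"
  have "J \<le> (\<integral>\<^sup>+vs. ennreal (maxwellian vs) \<partial>(lborel :: 'a measure))"
    unfolding J_def
  proof (intro nn_integral_mono ennreal_leI)
    fix vs :: 'a
    have "(min 1 (norm vs) / 2) powr \<gamma> \<le> 1 powr \<gamma>" using \<gamma> by (intro powr_mono2) auto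
    then show "(min 1 (norm vs) / 2) powr \<gamma> * maxwellian vs \<le> maxwellian vs"
      using mult_right_mono[of _ 1 "maxwellian vs"] by auto
  qed
  then have J_fin: "J < \<infinity>" by (rule le_less_trans) (simp add: nn_integral_maxwellian)
  have "J \<noteq> 0"
  proof
    assume "J = 0"
    then have "AE vs in lborel. ennreal ((min 1 (norm vs) / 2) powr \<gamma> * maxwellian (vs :: 'a)) = 0"
      unfolding J_def by (subst (asm) nn_integral_0_iff_AE) auto
    with AE_lborel_singleton[of 0] have "AE vs in (lborel :: 'a measure). False"
    proof eventually_elim
      case (elim vs)
      then have "0 < min 1 (norm vs) / 2" by simp
      then have "0 < (min 1 (norm vs) / 2) powr \<gamma> * maxwellian vs"
        by (intro mult_pos_pos maxwellian_pos) (metis less_irrefl powr_gt_zero)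
      with elim show ?case by (metis ennreal_eq_0_iff not_le)
    qed
    then show False by (simp add: eventually_False ae_filter_eq_bot_iff emeasure_lborel_UNIV)
  qed
  define c where "c = enn2real J / 2"
  have c: "0 < c" "ennreal (2 * c) = J"
    using \<open>J \<noteq> 0\<close> J_fin by (auto simp: c_def enn2real_positive_iff zero_less_iff_neq_zero ennreal_enn2real_if)
  have "ennreal (c * (1 + norm v) powr \<gamma>) \<le> (\<integral>\<^sup>+vs. ennreal (norm (v - vs) powr \<gamma> * maxwellian vs) \<partial>lborel)"
    (is "_ \<le> ?I") for v :: 'a
  proof -
    have "?I = (\<integral>\<^sup>+vs. ennreal (norm (v + vs) powr \<gamma> * maxwellian vs) \<partial>lborel)"
      using nn_integral_lborel_affine[of "\<lambda>vs. ennreal (norm (v - vs) powr \<gamma> * maxwellian vs)" "-1" 0]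
      by (simp add: maxwellian_def)
    then have "?I + ?I = (\<integral>\<^sup>+vs. ennreal (norm (v - vs) powr \<gamma> * maxwellian vs) + ennreal (norm (v + vs) powr \<gamma> * maxwellian vs) \<partial>lborel)"
      by (simp add: nn_integral_add)
    also have "\<dots> \<ge> (\<integral>\<^sup>+vs. ennreal ((1 + norm v) powr \<gamma>) * ennreal ((min 1 (norm vs) / 2) powr \<gamma> * maxwellian vs) \<partial>(lborel :: 'a measure))"
    proof (rule nn_integral_mono)
      fix vs :: 'a
      define mx where "mx = max (norm (v - vs)) (norm (v + vs))"
      have "2 * norm v = norm ((v - vs) + (v + vs))" by (simp add: scaleR_2[symmetric])
      also have "\<dots> \<le> norm (v - vs) + norm (v + vs)" by (rule norm_triangle_ineq)
      finally have 1: "norm v \<le> mx" by (simp add: mx_def)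
      have "2 * norm vs = norm ((v + vs) - (v - vs))" by (simp add: scaleR_2[symmetric])
      also have "\<dots> \<le> norm (v + vs) + norm (v - vs)" by (rule norm_triangle_ineq4)
      finally have 2: "norm vs \<le> mx" by (simp add: mx_def)
      have "(1 + norm v) * min 1 (norm vs) \<le> norm vs + norm v"
      proof -
        have "(1 + norm v) * min 1 (norm vs) = min 1 (norm vs) + norm v * min 1 (norm vs)" by (simp add: algebra_simps)
        also have "\<dots> \<le> norm vs + norm v * 1" by (intro add_mono mult_left_mono) auto
        finally show ?thesis by simp
      qed
      then have "(1 + norm v) * (min 1 (norm vs) / 2) \<le> mx" using 1 2 by simp
      then have "((1 + norm v) * (min 1 (norm vs) / 2)) powr \<gamma> \<le> mx powr \<gamma>"
        using \<gamma> by (intro powr_mono2) auto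
      also have "mx powr \<gamma> \<le> norm (v - vs) powr \<gamma> + norm (v + vs) powr \<gamma>"
        unfolding mx_def by (auto simp: max_def)
      finally have "(1 + norm v) powr \<gamma> * (min 1 (norm vs) / 2) powr \<gamma> \<le> norm (v - vs) powr \<gamma> + norm (v + vs) powr \<gamma>"
        by (subst (asm) powr_mult) auto
      then have "(1 + norm v) powr \<gamma> * (min 1 (norm vs) / 2) powr \<gamma> * maxwellian vs \<le> (norm (v - vs) powr \<gamma> + norm (v + vs) powr \<gamma>) * maxwellian vs"
        by (intro mult_right_mono) auto
      then show "ennreal ((1 + norm v) powr \<gamma>) * ennreal ((min 1 (norm vs) / 2) powr \<gamma> * maxwellian vs)
        \<le> ennreal (norm (v - vs) powr \<gamma> * maxwellian vs) + ennreal (norm (v + vs) powr \<gamma> * maxwellian vs)"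
        by (simp add: ennreal_mult[symmetric] ennreal_plus[symmetric] ennreal_leI distrib_right mult.assoc del: ennreal_plus)
    qed
    also have "(\<integral>\<^sup>+vs. ennreal ((1 + norm v) powr \<gamma>) * ennreal ((min 1 (norm vs) / 2) powr \<gamma> * maxwellian vs) \<partial>(lborel :: 'a measure))
        = ennreal ((1 + norm v) powr \<gamma>) * J"
      unfolding J_def by (rule nn_integral_cmult) measurable
    also have "\<dots> = ennreal (c * (1 + norm v) powr \<gamma>) + ennreal (c * (1 + norm v) powr \<gamma>)"
      unfolding c(2)[symmetric] using c(1)
      by (subst ennreal_plus[symmetric], simp, simp, subst ennreal_mult[symmetric]) (auto intro!: arg_cong[of _ _ ennreal] simp: algebra_simps)
    finally have "ennreal (c * (1 + norm v) powr \<gamma>) + ennreal (c * (1 + norm v) powr \<gamma>) \<le> ?I + ?I" .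
    then show ?thesis
      unfolding mult_2[symmetric] by (subst (asm) ennreal_mult_le_mult_iff) auto
  qed
  with c(1) that show ?thesis by blast
qed

context
  fixes \<gamma> :: real and b :: "real \<Rightarrow> real" and lb :: real and e :: "'a::euclidean_space"
  assumes \<gamma>: "0 \<le> \<gamma>" and b_meas [measurable]: "b \<in> borel_measurable borel" and b_nonneg: "\<And>x. 0 \<le> b x"
    and dim: "2 \<le> DIM('a)" and e: "norm e = 1" and lb: "0 < lb"
    and b_int: "(\<integral>\<^sup>+\<sigma>. ennreal (b (e \<bullet> \<sigma>)) \<partial>sphere_borel) = ennreal lb"
begin

lemma nn_integral_relative_speed_finite:
  "(\<integral>\<^sup>+vs. ennreal (norm (v - vs) powr \<gamma> * maxwellian vs) \<partial>(lborel :: 'a measure)) < \<infinity>"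
  using nn_integral_relative_speed_exp_le[OF \<gamma>, of v 0] nn_integral_exp_maxwellian[of \<gamma>, where 'a='a]
  by (auto intro: le_less_trans simp: ennreal_mult_less_top)

lemma coll_freq_eq:
  "coll_freq \<gamma> b v = lb * enn2real (\<integral>\<^sup>+vs. ennreal (norm (v - vs) powr \<gamma> * maxwellian vs) \<partial>(lborel :: 'a measure))"
proof -
  have id: "(\<lambda>p. (fst p, snd p)) \<in> measurable (lborel \<Otimes>\<^sub>M sphere_measure) (borel \<Otimes>\<^sub>M (borel :: 'a measure))"
    using measurable_compose[OF measurable_snd measurable_id_sphere]
    by (intro measurable_Pair) (auto intro: measurable_compose[OF measurable_fst])
  have m: "(\<lambda>p. coll_kernel \<gamma> b v (fst p) (snd p) * maxwellian (fst p)) \<in> borel_measurable (borel \<Otimes>\<^sub>M borel)"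
    by measurable
  have "coll_freq \<gamma> b v = enn2real (\<integral>\<^sup>+p. ennreal (coll_kernel \<gamma> b v (fst p) (snd p) * maxwellian (fst p)) \<partial>(lborel \<Otimes>\<^sub>M sphere_measure))"
    unfolding coll_freq_def split_beta'
    using measurable_compose[OF id m] b_nonneg
    by (intro integral_eq_nn_integral) (auto simp: coll_kernel_def)
  also have "\<dots> = enn2real (\<integral>\<^sup>+\<sigma>. \<integral>\<^sup>+vs. ennreal (coll_kernel \<gamma> b v vs \<sigma> * maxwellian vs) \<partial>lborel \<partial>sphere_borel)"
    by (subst nn_integral_pair_sphere) auto
  also have "\<dots> = lb * enn2real (\<integral>\<^sup>+vs. ennreal (norm (v - vs) powr \<gamma> * maxwellian vs) \<partial>lborel)"
    using nn_integral_coll_kernel[OF b_meas maxwellian_measurable b_nonneg maxwellian_nonneg e, of \<gamma> v] lb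
    by (simp add: b_int enn2real_mult)
  finally show ?thesis .
qed

lemma coll_freq_ennreal:
  "ennreal (coll_freq \<gamma> b v) = ennreal lb * (\<integral>\<^sup>+vs. ennreal (norm (v - vs) powr \<gamma> * maxwellian vs) \<partial>(lborel :: 'a measure))"
  unfolding coll_freq_eq using nn_integral_relative_speed_finite[of v] lb
  by (subst ennreal_mult) (auto simp: ennreal_enn2real_if)

lemma coll_freq_nonneg: "0 \<le> coll_freq \<gamma> b (v :: 'a)"
  unfolding coll_freq_eq using lb by simp

lemma coll_freq_meas: "coll_freq \<gamma> b \<in> borel_measurable (borel :: 'a measure)"
  unfolding coll_freq_eq[abs_def] by measurable

lemma carleman_kernel_mass: "(\<integral>\<^sup>+v. carleman_kernel \<gamma> b v w \<partial>lborel) = ennreal (coll_freq \<gamma> b (w :: 'a))"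
  using nn_integral_loss_carleman[OF b_meas b_nonneg _ dim, of "\<lambda>_. 1" \<gamma> w]
    nn_integral_coll_kernel[OF b_meas maxwellian_measurable b_nonneg maxwellian_nonneg e, of \<gamma> w]
  by (simp add: coll_freq_ennreal b_int)

lemma coll_freq_lower:
  obtains c where "0 < c" "\<And>v :: 'a. c * (1 + norm v) powr \<gamma> \<le> coll_freq \<gamma> b v"
proof -
  obtain c where c: "0 < c" "\<And>v :: 'a.
    ennreal (c * (1 + norm v) powr \<gamma>) \<le> (\<integral>\<^sup>+vs. ennreal (norm (v - vs) powr \<gamma> * maxwellian vs) \<partial>lborel)"
    using nn_integral_relative_speed_ge[OF \<gamma>, where 'a='a] by blast
  have "lb * c * (1 + norm v) powr \<gamma> \<le> coll_freq \<gamma> b v" for v :: 'a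
  proof -
    have "ennreal (lb * c * (1 + norm v) powr \<gamma>) = ennreal lb * ennreal (c * (1 + norm v) powr \<gamma>)"
      using lb c(1) by (subst ennreal_mult[symmetric]) (auto simp: mult.assoc)
    also have "\<dots> \<le> ennreal (coll_freq \<gamma> b v)"
      unfolding coll_freq_ennreal by (intro mult_left_mono c) auto
    finally show ?thesis using coll_freq_nonneg[of v] by simp
  qed
  then show ?thesis using that[of "lb * c"] lb c(1) by simp
qed

lemma coll_freq_upper:
  obtains c where "0 < c" "\<And>v :: 'a. coll_freq \<gamma> b v \<le> c * (1 + norm v) powr \<gamma>"
proof -
  define D where "D = (\<integral>\<^sup>+vs. ennreal (exp (\<gamma> * norm vs) * maxwellian vs) \<partial>(lborel :: 'a measure))"
  have D: "D < \<infinity>" unfolding D_def by (rule nn_integral_exp_maxwellian)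
  have "coll_freq \<gamma> b v \<le> (lb * enn2real D + 1) * (1 + norm v) powr \<gamma>" for v :: 'a
  proof -
    have "ennreal (coll_freq \<gamma> b v) \<le> ennreal lb * (ennreal ((1 + norm v) powr \<gamma>) * D)"
      unfolding coll_freq_ennreal D_def using nn_integral_relative_speed_exp_le[OF \<gamma>, of v 0]
      by (intro mult_left_mono) auto
    also have "\<dots> = ennreal (lb * enn2real D * (1 + norm v) powr \<gamma>)"
      using D lb by (simp add: ennreal_mult ennreal_enn2real_if mult_ac)
    finally have "coll_freq \<gamma> b v \<le> lb * enn2real D * (1 + norm v) powr \<gamma>"
      using lb by (subst (asm) ennreal_le_iff) auto
    then show ?thesis by (simp add: distrib_right add_increasing2)
  qed
  then show ?thesis using that[of "lb * enn2real D + 1"] lb by (simp add: add_nonneg_pos)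
qed

text \<open>A criterion covering both kinds of weights. At large velocities \<kappa>1 carries the
  contraction of \<open>W\<close> by the collision, with angular average strictly below
  \<open>lb\<close>; \<kappa>2 carries the influence of the partner velocity, which the Maxwellian
  integrates and whose angular average becomes negligible beyond a large radius \<open>n\<close>. At
  velocities below \<open>n\<close> the bounds \<open>crude\<close> and \<open>growth\<close> put
  everything into the constant \<open>C\<close>.\<close>

lemma carleman_lyapunov:
  fixes W :: "'a \<Rightarrow> real" and \<kappa>1 :: "real \<Rightarrow> real" and \<kappa>2 :: "nat \<Rightarrow> real \<Rightarrow> real"
  assumes W_meas [measurable]: "W \<in> borel_measurable borel" and W1: "\<And>v. 1 \<le> W v" and A: "0 \<le> A" and c: "0 \<le> c"
    and crude: "\<And>v vs \<sigma>. norm \<sigma> = 1 \<Longrightarrow> W (post_v v vs \<sigma>) \<le> W v * (A * exp (c * norm vs))"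
    and growth: "\<And>v. W v \<le> A * exp (c * norm v)"
    and [measurable]: "\<kappa>1 \<in> borel_measurable borel" "\<And>n. \<kappa>2 n \<in> borel_measurable borel"
    and \<kappa>_nonneg: "\<And>x. 0 \<le> \<kappa>1 x" "\<And>n x. 0 \<le> \<kappa>2 n x"
    and \<kappa>1_int: "(\<integral>\<^sup>+\<sigma>. ennreal (b (e \<bullet> \<sigma>) * \<kappa>1 (e \<bullet> \<sigma>)) \<partial>sphere_borel) < ennreal lb"
    and \<kappa>2_lim: "(\<lambda>n. \<integral>\<^sup>+\<sigma>. ennreal (b (e \<bullet> \<sigma>) * \<kappa>2 n (e \<bullet> \<sigma>)) \<partial>sphere_borel) \<longlonglongrightarrow> 0"
    and fine: "\<And>n v vs \<sigma>. norm \<sigma> = 1 \<Longrightarrow> v \<noteq> vs \<Longrightarrow> real n \<le> norm v \<Longrightarrow>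
      W (post_v v vs \<sigma>) \<le> W v * (\<kappa>1 (cos_dev v vs \<sigma>) + \<kappa>2 n (cos_dev v vs \<sigma>) * (A * exp (c * norm vs)))"
  obtains th C where "0 \<le> th" "th < 1" "0 \<le> C"
    "\<And>w. (\<integral>\<^sup>+v. carleman_kernel \<gamma> b v w * ennreal (W v) \<partial>lborel) \<le> ennreal (th * (coll_freq \<gamma> b w * W w) + C)"
proof -
  define D where "D = (\<integral>\<^sup>+vs. ennreal (exp ((\<gamma> + c) * norm vs) * maxwellian vs) \<partial>(lborel :: 'a measure))"
  have D: "D < \<infinity>" unfolding D_def by (rule nn_integral_exp_maxwellian)
  define D' where "D' = A * enn2real D"
  have D': "0 \<le> D'" using A by (simp add: D'_def)
  have DD: "ennreal A * D = ennreal D'" using D A by (simp add: D'_def ennreal_mult ennreal_enn2real_if)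
  have speed: "(\<integral>\<^sup>+vs. ennreal (norm (v - vs) powr \<gamma> * (A * exp (c * norm vs) * maxwellian vs)) \<partial>lborel)
      \<le> ennreal (D' * (1 + norm v) powr \<gamma>)" for v :: 'a
  proof -
    have "(\<integral>\<^sup>+vs. ennreal (norm (v - vs) powr \<gamma> * (A * exp (c * norm vs) * maxwellian vs)) \<partial>lborel)
        = (\<integral>\<^sup>+vs. ennreal A * ennreal (norm (v - vs) powr \<gamma> * (exp (c * norm vs) * maxwellian vs)) \<partial>lborel)"
      using A by (intro nn_integral_cong) (simp add: ennreal_mult[symmetric] mult_ac)
    also have "\<dots> = ennreal A * (\<integral>\<^sup>+vs. ennreal (norm (v - vs) powr \<gamma> * (exp (c * norm vs) * maxwellian vs)) \<partial>lborel)"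
      by (rule nn_integral_cmult) measurable
    also have "\<dots> \<le> ennreal A * (ennreal ((1 + norm v) powr \<gamma>) * D)"
      unfolding D_def by (intro mult_left_mono nn_integral_relative_speed_exp_le \<gamma>) auto
    also have "\<dots> = ennreal (D' * (1 + norm v) powr \<gamma>)"
      using D' by (simp add: ennreal_mult DD[symmetric] mult_ac)
    finally show ?thesis .
  qed
  obtain s where s: "0 < s" "\<And>v :: 'a. s * (1 + norm v) powr \<gamma> \<le> coll_freq \<gamma> b v"
    using coll_freq_lower by blast
  define k1 where "k1 = enn2real (\<integral>\<^sup>+\<sigma>. ennreal (b (e \<bullet> \<sigma>) * \<kappa>1 (e \<bullet> \<sigma>)) \<partial>sphere_borel)"
  have k1e: "(\<integral>\<^sup>+\<sigma>. ennreal (b (e \<bullet> \<sigma>) * \<kappa>1 (e \<bullet> \<sigma>)) \<partial>sphere_borel) = ennreal k1"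
    using less_trans[OF \<kappa>1_int ennreal_less_top] by (simp add: k1_def)
  have k1: "0 \<le> k1" "k1 < lb" using \<kappa>1_int lb unfolding k1e by (auto simp: k1_def ennreal_less_iff)
  \<comment> \<open>Half of the gap between k1 / lb and 1 is left for the \<kappa>2 term;
    \<open>th\<close> will be k1 / lb + \<epsilon>.\<close>
  define \<epsilon> where "\<epsilon> = (1 - k1 / lb) / 2"
  have \<epsilon>: "0 < \<epsilon>" "k1 / lb + \<epsilon> < 1" "0 \<le> k1 / lb" using k1 lb by (auto simp: \<epsilon>_def field_simps)
  \<comment> \<open>Small enough that the \<kappa>2 term, bounded by \<eta> D' (1 + |w|)^\<gamma>,
    is at most \<epsilon> times the collision frequency, by the lower bound with constant
    \<open>s\<close>. The summand 1 avoids a division by zero.\<close>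
  define \<eta> where "\<eta> = \<epsilon> * s / (D' + 1)"
  have \<eta>: "0 < \<eta>" "\<eta> * D' \<le> \<epsilon> * s"
    using \<epsilon> s D' by (auto simp: \<eta>_def field_simps)
  have "\<forall>\<^sub>F n in sequentially. (\<integral>\<^sup>+\<sigma>. ennreal (b (e \<bullet> \<sigma>) * \<kappa>2 n (e \<bullet> \<sigma>)) \<partial>sphere_borel) < ennreal \<eta>"
    using order_tendstoD(2)[OF \<kappa>2_lim] \<eta>(1) by simp
  then obtain n where n: "(\<integral>\<^sup>+\<sigma>. ennreal (b (e \<bullet> \<sigma>) * \<kappa>2 n (e \<bullet> \<sigma>)) \<partial>sphere_borel) < ennreal \<eta>"
    by (auto simp: eventually_sequentially)
  define C where "C = A * exp (c * real n) * (lb * (D' * (1 + real n) powr \<gamma>))"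
  have C: "0 \<le> C" using A D' lb by (simp add: C_def)
  have main: "(\<integral>\<^sup>+v. carleman_kernel \<gamma> b v w * ennreal (W v) \<partial>lborel) \<le> ennreal ((k1 / lb + \<epsilon>) * (coll_freq \<gamma> b w * W w) + C)"
    for w :: 'a
  proof (cases "real n \<le> norm w")
    case True
    let ?Sg = "coll_freq \<gamma> b w"
    have W0: "0 \<le> W v" for v using W1[of v] by simp
    have "(\<integral>\<^sup>+\<sigma>. \<integral>\<^sup>+ws. ennreal (coll_kernel \<gamma> (\<lambda>x. b x * \<kappa>2 n x) w ws \<sigma> * (A * exp (c * norm ws) * maxwellian ws)) \<partial>lborel \<partial>sphere_borel)
        = (\<integral>\<^sup>+\<sigma>. ennreal (b (e \<bullet> \<sigma>) * \<kappa>2 n (e \<bullet> \<sigma>)) \<partial>sphere_borel)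
          * (\<integral>\<^sup>+vs. ennreal (norm (w - vs) powr \<gamma> * (A * exp (c * norm vs) * maxwellian vs)) \<partial>lborel)"
      by (rule nn_integral_coll_kernel) (use b_nonneg \<kappa>_nonneg e A in auto)
    also have "\<dots> \<le> ennreal \<eta> * ennreal (D' * (1 + norm w) powr \<gamma>)"
      using n speed[of w] by (intro mult_mono) auto
    also have "\<dots> \<le> ennreal (\<epsilon> * ?Sg)"
    proof -
      have "\<eta> * (D' * (1 + norm w) powr \<gamma>) \<le> \<epsilon> * s * (1 + norm w) powr \<gamma>"
        using \<eta>(2) by (subst mult.assoc[symmetric]) (rule mult_right_mono, auto)
      also have "\<dots> \<le> \<epsilon> * ?Sg" using s(2)[of w] \<epsilon> by (simp add: mult.assoc)
      finally show ?thesis using \<eta>(1) D' by (subst ennreal_mult[symmetric]) (auto intro: ennreal_leI)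
    qed
    finally have k2: "(\<integral>\<^sup>+\<sigma>. \<integral>\<^sup>+ws. ennreal (coll_kernel \<gamma> (\<lambda>x. b x * \<kappa>2 n x) w ws \<sigma> * (A * exp (c * norm ws) * maxwellian ws)) \<partial>lborel \<partial>sphere_borel)
      \<le> ennreal (\<epsilon> * ?Sg)" .
    have "(\<integral>\<^sup>+v. carleman_kernel \<gamma> b v w * ennreal (W v) \<partial>lborel)
        = (\<integral>\<^sup>+\<sigma>. \<integral>\<^sup>+ws. ennreal (coll_kernel \<gamma> b w ws \<sigma> * maxwellian ws) * ennreal (W (post_v w ws \<sigma>)) \<partial>lborel \<partial>sphere_borel)"
      by (rule nn_integral_loss_carleman[OF b_meas b_nonneg _ dim]) measurable
    also have "\<dots> \<le> (\<integral>\<^sup>+\<sigma>. \<integral>\<^sup>+ws. ennreal (W w) * ennreal (coll_kernel \<gamma> (\<lambda>x. b x * \<kappa>1 x) w ws \<sigma> * maxwellian ws)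
        + ennreal (W w) * ennreal (coll_kernel \<gamma> (\<lambda>x. b x * \<kappa>2 n x) w ws \<sigma> * (A * exp (c * norm ws) * maxwellian ws)) \<partial>lborel \<partial>sphere_borel)"
    proof (rule nn_integral_sphere_mono, rule nn_integral_mono_neq[of w])
      fix \<sigma> ws :: 'a assume n\<sigma>: "norm \<sigma> = 1" and ne: "ws \<noteq> w"
        have ck: "0 \<le> coll_kernel \<gamma> b w ws \<sigma> * maxwellian ws" using b_nonneg by (simp add: coll_kernel_def)
        have "coll_kernel \<gamma> b w ws \<sigma> * maxwellian ws * W (post_v w ws \<sigma>)
            \<le> coll_kernel \<gamma> b w ws \<sigma> * maxwellian ws * (W w * (\<kappa>1 (cos_dev w ws \<sigma>) + \<kappa>2 n (cos_dev w ws \<sigma>) * (A * exp (c * norm ws))))"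
          using fine[OF n\<sigma> _ True, of ws] ne ck by (intro mult_left_mono) auto
        also have "\<dots> = W w * (coll_kernel \<gamma> (\<lambda>x. b x * \<kappa>1 x) w ws \<sigma> * maxwellian ws)
            + W w * (coll_kernel \<gamma> (\<lambda>x. b x * \<kappa>2 n x) w ws \<sigma> * (A * exp (c * norm ws) * maxwellian ws))"
          by (simp add: coll_kernel_def algebra_simps)
        finally have "ennreal (coll_kernel \<gamma> b w ws \<sigma> * maxwellian ws * W (post_v w ws \<sigma>))
            \<le> ennreal (W w * (coll_kernel \<gamma> (\<lambda>x. b x * \<kappa>1 x) w ws \<sigma> * maxwellian ws)
            + W w * (coll_kernel \<gamma> (\<lambda>x. b x * \<kappa>2 n x) w ws \<sigma> * (A * exp (c * norm ws) * maxwellian ws)))"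
          by (rule ennreal_leI)
        then show "ennreal (coll_kernel \<gamma> b w ws \<sigma> * maxwellian ws) * ennreal (W (post_v w ws \<sigma>))
            \<le> ennreal (W w) * ennreal (coll_kernel \<gamma> (\<lambda>x. b x * \<kappa>1 x) w ws \<sigma> * maxwellian ws)
            + ennreal (W w) * ennreal (coll_kernel \<gamma> (\<lambda>x. b x * \<kappa>2 n x) w ws \<sigma> * (A * exp (c * norm ws) * maxwellian ws))"
          using b_nonneg \<kappa>_nonneg W0 A ck
          by (simp add: ennreal_mult ennreal_plus coll_kernel_def)
    qed
    also have "\<dots> = (\<integral>\<^sup>+\<sigma>. ennreal (W w) * (\<integral>\<^sup>+ws. ennreal (coll_kernel \<gamma> (\<lambda>x. b x * \<kappa>1 x) w ws \<sigma> * maxwellian ws) \<partial>lborel)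
        + ennreal (W w) * (\<integral>\<^sup>+ws. ennreal (coll_kernel \<gamma> (\<lambda>x. b x * \<kappa>2 n x) w ws \<sigma> * (A * exp (c * norm ws) * maxwellian ws)) \<partial>lborel) \<partial>sphere_borel)"
      by (simp add: nn_integral_add nn_integral_cmult)
    also have "\<dots> = ennreal (W w) * (\<integral>\<^sup>+\<sigma>. \<integral>\<^sup>+ws. ennreal (coll_kernel \<gamma> (\<lambda>x. b x * \<kappa>1 x) w ws \<sigma> * maxwellian ws) \<partial>lborel \<partial>sphere_borel)
        + ennreal (W w) * (\<integral>\<^sup>+\<sigma>. \<integral>\<^sup>+ws. ennreal (coll_kernel \<gamma> (\<lambda>x. b x * \<kappa>2 n x) w ws \<sigma> * (A * exp (c * norm ws) * maxwellian ws)) \<partial>lborel \<partial>sphere_borel)"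
      by (simp add: nn_integral_add nn_integral_cmult)
    also have "(\<integral>\<^sup>+\<sigma>. \<integral>\<^sup>+ws. ennreal (coll_kernel \<gamma> (\<lambda>x. b x * \<kappa>1 x) w ws \<sigma> * maxwellian ws) \<partial>lborel \<partial>sphere_borel)
        = ennreal k1 * (\<integral>\<^sup>+vs. ennreal (norm (w - vs) powr \<gamma> * maxwellian vs) \<partial>lborel)"
      unfolding k1e[symmetric] by (rule nn_integral_coll_kernel) (use b_nonneg \<kappa>_nonneg e in auto)
    also have "\<dots> = ennreal (k1 / lb * ?Sg)"
      unfolding coll_freq_eq using nn_integral_relative_speed_finite[of w] k1 lb
      by (simp add: ennreal_mult ennreal_enn2real_if)
    also have "ennreal (W w) * ennreal (k1 / lb * ?Sg) + ennreal (W w) * (\<integral>\<^sup>+\<sigma>. \<integral>\<^sup>+ws. ennreal (coll_kernel \<gamma> (\<lambda>x. b x * \<kappa>2 n x) w ws \<sigma> * (A * exp (c * norm ws) * maxwellian ws)) \<partial>lborel \<partial>sphere_borel)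
        \<le> ennreal (W w) * ennreal (k1 / lb * ?Sg) + ennreal (W w) * ennreal (\<epsilon> * ?Sg)"
      by (intro add_left_mono mult_left_mono k2) simp
    also have "\<dots> = ennreal ((k1 / lb + \<epsilon>) * (?Sg * W w))"
    proof -
      have "0 \<le> W w" "0 \<le> k1 / lb * ?Sg" "0 \<le> \<epsilon> * ?Sg"
        using W0[of w] coll_freq_nonneg[of w] \<epsilon>(1) by (simp, intro mult_nonneg_nonneg \<epsilon>(3), simp_all)
      then have "ennreal (W w) * ennreal (k1 / lb * ?Sg) + ennreal (W w) * ennreal (\<epsilon> * ?Sg)
          = ennreal (W w * (k1 / lb * ?Sg) + W w * (\<epsilon> * ?Sg))"
        by (simp only: ennreal_mult ennreal_plus mult_nonneg_nonneg)
      also have "W w * (k1 / lb * ?Sg) + W w * (\<epsilon> * ?Sg) = (k1 / lb + \<epsilon>) * (?Sg * W w)"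
        by (simp add: distrib_right distrib_left mult_ac)
      finally show ?thesis .
    qed
    also have "\<dots> \<le> ennreal ((k1 / lb + \<epsilon>) * (?Sg * W w) + C)" using C by (intro ennreal_leI) simp
    finally show ?thesis .
  next
    case False
    have W0: "0 \<le> W v" for v using W1[of v] by simp
    have "(\<integral>\<^sup>+v. carleman_kernel \<gamma> b v w * ennreal (W v) \<partial>lborel)
        = (\<integral>\<^sup>+\<sigma>. \<integral>\<^sup>+ws. ennreal (coll_kernel \<gamma> b w ws \<sigma> * maxwellian ws) * ennreal (W (post_v w ws \<sigma>)) \<partial>lborel \<partial>sphere_borel)"
      by (rule nn_integral_loss_carleman[OF b_meas b_nonneg _ dim]) measurable
    also have "\<dots> \<le> (\<integral>\<^sup>+\<sigma>. \<integral>\<^sup>+ws. ennreal (W w) * ennreal (coll_kernel \<gamma> b w ws \<sigma> * (A * exp (c * norm ws) * maxwellian ws)) \<partial>lborel \<partial>sphere_borel)"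
    proof (rule nn_integral_sphere_mono, rule nn_integral_mono_neq[of w])
      fix \<sigma> ws :: 'a assume n\<sigma>: "norm \<sigma> = 1" and ne: "ws \<noteq> w"
        have ck: "0 \<le> coll_kernel \<gamma> b w ws \<sigma> * maxwellian ws" using b_nonneg by (simp add: coll_kernel_def)
        have "coll_kernel \<gamma> b w ws \<sigma> * maxwellian ws * W (post_v w ws \<sigma>)
            \<le> coll_kernel \<gamma> b w ws \<sigma> * maxwellian ws * (W w * (A * exp (c * norm ws)))"
          using crude[OF n\<sigma>, of w ws] ck by (intro mult_left_mono) auto
        also have "\<dots> = W w * (coll_kernel \<gamma> b w ws \<sigma> * (A * exp (c * norm ws) * maxwellian ws))" by (simp add: mult_ac)
        finally have "ennreal (coll_kernel \<gamma> b w ws \<sigma> * maxwellian ws * W (post_v w ws \<sigma>))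
            \<le> ennreal (W w * (coll_kernel \<gamma> b w ws \<sigma> * (A * exp (c * norm ws) * maxwellian ws)))"
          by (rule ennreal_leI)
        then show "ennreal (coll_kernel \<gamma> b w ws \<sigma> * maxwellian ws) * ennreal (W (post_v w ws \<sigma>))
            \<le> ennreal (W w) * ennreal (coll_kernel \<gamma> b w ws \<sigma> * (A * exp (c * norm ws) * maxwellian ws))"
          using b_nonneg W0 A ck by (simp add: ennreal_mult coll_kernel_def)
    qed
    also have "\<dots> = ennreal (W w) * (\<integral>\<^sup>+\<sigma>. \<integral>\<^sup>+ws. ennreal (coll_kernel \<gamma> b w ws \<sigma> * (A * exp (c * norm ws) * maxwellian ws)) \<partial>lborel \<partial>sphere_borel)"
      by (simp add: nn_integral_cmult)
    also have "(\<integral>\<^sup>+\<sigma>. \<integral>\<^sup>+ws. ennreal (coll_kernel \<gamma> b w ws \<sigma> * (A * exp (c * norm ws) * maxwellian ws)) \<partial>lborel \<partial>sphere_borel)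
        = ennreal lb * (\<integral>\<^sup>+vs. ennreal (norm (w - vs) powr \<gamma> * (A * exp (c * norm vs) * maxwellian vs)) \<partial>lborel)"
      unfolding b_int[symmetric] by (rule nn_integral_coll_kernel) (use b_nonneg e A in auto)
    also have "ennreal (W w) * \<dots> \<le> ennreal (A * exp (c * real n)) * (ennreal lb * ennreal (D' * (1 + real n) powr \<gamma>))"
    proof (intro mult_mono ennreal_leI order_refl)
      have "exp (c * norm w) \<le> exp (c * real n)" using False c by (auto intro: mult_left_mono)
      then show "W w \<le> A * exp (c * real n)"
        using growth[of w] A by (auto intro: order_trans mult_left_mono)
      have "D' * (1 + norm w) powr \<gamma> \<le> D' * (1 + real n) powr \<gamma>"
        using False \<gamma> D' by (intro mult_left_mono powr_mono2) auto
      then show "(\<integral>\<^sup>+vs. ennreal (norm (w - vs) powr \<gamma> * (A * exp (c * norm vs) * maxwellian vs)) \<partial>lborel) \<le> ennreal (D' * (1 + real n) powr \<gamma>)"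
        by (intro order_trans[OF speed] ennreal_leI)
    qed auto
    also have "\<dots> = ennreal C"
      unfolding C_def using A D' lb by (simp add: ennreal_mult)
    also have "\<dots> \<le> ennreal ((k1 / lb + \<epsilon>) * (coll_freq \<gamma> b w * W w) + C)"
      using \<epsilon> W0[of w] coll_freq_nonneg[of w] by (intro ennreal_leI) simp
    finally show ?thesis .
  qed
  show ?thesis using that[of "k1 / lb + \<epsilon>" C] \<epsilon> C main by simp
qed

end

section \<open>Angular averages, minorization and weights\<close>

lemma filterlim_real_powr_at_top:
  fixes \<beta> :: real
  assumes "0 < \<beta>"
  shows "filterlim (\<lambda>n. real n powr \<beta>) at_top sequentially"
proof -
  have "filterlim (\<lambda>n. exp (\<beta> * ln (real n))) at_top sequentially"
    by (intro filterlim_compose[OF exp_at_top] filterlim_tendsto_pos_mult_at_top[OF tendsto_const assms]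
        filterlim_compose[OF ln_at_top] filterlim_real_sequentially)
  moreover have "\<forall>\<^sub>F n in sequentially. exp (\<beta> * ln (real n)) = real n powr \<beta>"
    using eventually_gt_at_top[of 0] by eventually_elim (simp add: powr_def)
  ultimately show ?thesis by (rule filterlim_cong[THEN iffD1, OF refl refl, rotated])
qed

text \<open>Both pairs of velocities have the form c + y, c - y with the same |y|, so the
  parallelogram identity gives conservation of kinetic energy.\<close>

lemma maxwellian_post:
  fixes v vs \<sigma> :: "'a::euclidean_space"
  assumes "norm \<sigma> = 1"
  shows "maxwellian (post_vs v vs \<sigma>) * maxwellian (post_v v vs \<sigma>) = maxwellian vs * maxwellian v"
proof -
  define c where "c = (v + vs) /\<^sub>R 2"
  define d where "d = (v - vs) /\<^sub>R 2"
  have \<sigma>\<sigma>: "\<sigma> \<bullet> \<sigma> = 1" using assms by (simp add: norm_eq_1)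
  have v: "v = c + d" "vs = c - d"
    by (simp_all add: c_def d_def scaleR_add_right scaleR_diff_right scaleR_add_left[symmetric])
  have par: "(norm (c + y))\<^sup>2 + (norm (c - y))\<^sup>2 = 2 * (norm c)\<^sup>2 + 2 * (norm y)\<^sup>2" for y
    unfolding power2_norm_eq_inner by (simp add: inner_add_left inner_add_right inner_diff_left inner_diff_right)
  have p: "post_v v vs \<sigma> = c + norm d *\<^sub>R \<sigma>" "post_vs v vs \<sigma> = c - norm d *\<^sub>R \<sigma>"
    by (simp_all add: post_v_def post_vs_def c_def d_def)
  have "(norm (post_vs v vs \<sigma>))\<^sup>2 + (norm (post_v v vs \<sigma>))\<^sup>2 = (norm vs)\<^sup>2 + (norm v)\<^sup>2"
    unfolding p using par[of "norm d *\<^sub>R \<sigma>"] par[of d] assms by (simp add: v)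
  then have "exp (- (norm (post_vs v vs \<sigma>))\<^sup>2 / 2) * exp (- (norm (post_v v vs \<sigma>))\<^sup>2 / 2)
      = exp (- (norm vs)\<^sup>2 / 2) * exp (- (norm v)\<^sup>2 / 2)"
    unfolding exp_add[symmetric] by (intro arg_cong[of _ _ exp]) (simp add: field_simps)
  then show ?thesis unfolding maxwellian_def by (simp add: mult_ac)
qed

text \<open>This is cos(\<theta>/2) for x = cos \<theta>. The clamping to [0, 1] makes the bounds
  valid for every real argument.\<close>

definition half_angle_cos :: "real \<Rightarrow> real" where
  "half_angle_cos x = sqrt (max 0 (min 1 ((1 + x) / 2)))"

lemma half_angle_cos_meas [measurable]: "half_angle_cos \<in> borel_measurable borel"
  unfolding half_angle_cos_def[abs_def] by measurable

lemma half_angle_cos_bounds: "0 \<le> half_angle_cos x" "half_angle_cos x \<le> 1"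
  by (auto simp: half_angle_cos_def)

lemma half_angle_cos_less_1: "x < 1 \<Longrightarrow> half_angle_cos x < 1"
  by (auto simp: half_angle_cos_def)

text \<open>With u the direction of v - vs, the new velocity is vs plus |v - vs| times (u +
  \<sigma>)/2, and the vector (u + \<sigma>)/2 has length cos(\<theta>/2). A deflection thus shrinks
  a large velocity by the factor cos(\<theta>/2), up to a multiple of |vs|.\<close>

lemma norm_post_v_le:
  fixes v vs \<sigma> :: "'a::euclidean_space"
  assumes \<sigma>: "norm \<sigma> = 1" and ne: "v \<noteq> vs"
  shows "norm (post_v v vs \<sigma>) \<le> half_angle_cos (cos_dev v vs \<sigma>) * norm v + 2 * norm vs"
proof -
  define g where "g = v - vs"
  define u where "u = sgn g"
  let ?c = "u \<bullet> \<sigma>"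
  have u: "norm u = 1" "g = norm g *\<^sub>R u" using ne by (simp_all add: u_def g_def norm_sgn sgn_div_norm)
  have "\<bar>?c\<bar> \<le> 1" using Cauchy_Schwarz_ineq2[of u \<sigma>] u \<sigma> by simp
  have "(norm ((u + \<sigma>) /\<^sub>R 2))\<^sup>2 = (1 + ?c) / 2"
  proof -
    have "(norm (u + \<sigma>))\<^sup>2 = 2 + 2 * ?c"
      using u(1) \<sigma> unfolding power2_norm_eq_inner by (simp add: inner_add_left inner_add_right inner_commute norm_eq_1)
    moreover have "norm ((u + \<sigma>) /\<^sub>R 2) = norm (u + \<sigma>) / 2" by (simp only: norm_scaleR) simp
    ultimately show ?thesis by (simp only: power_divide) simp
  qed
  from real_sqrt_unique[OF this] have "norm ((u + \<sigma>) /\<^sub>R 2) = sqrt ((1 + ?c) / 2)" by simp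
  then have h: "norm ((u + \<sigma>) /\<^sub>R 2) = half_angle_cos ?c"
    using \<open>\<bar>?c\<bar> \<le> 1\<close> by (simp only: half_angle_cos_def) (simp add: abs_le_iff)
  have post: "post_v v vs \<sigma> = vs + norm g *\<^sub>R ((u + \<sigma>) /\<^sub>R 2)"
  proof -
    have "(v + vs) /\<^sub>R 2 = vs + g /\<^sub>R 2"
    proof -
      have "v + vs = 2 *\<^sub>R vs + g" by (simp add: g_def scaleR_2)
      then show ?thesis by (simp only: scaleR_add_right) simp
    qed
    moreover have "norm g *\<^sub>R ((u + \<sigma>) /\<^sub>R 2) = g /\<^sub>R 2 + (norm g / 2) *\<^sub>R \<sigma>"
    proof -
      have "norm g *\<^sub>R ((u + \<sigma>) /\<^sub>R 2) = (norm g *\<^sub>R u) /\<^sub>R 2 + (norm g / 2) *\<^sub>R \<sigma>"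
        by (simp add: scaleR_add_right)
      then show ?thesis unfolding u(2)[symmetric] .
    qed
    ultimately show ?thesis by (simp add: post_v_def g_def)
  qed
  have "norm (post_v v vs \<sigma>) \<le> norm vs + norm g * half_angle_cos ?c"
  proof -
    have "norm (norm g *\<^sub>R ((u + \<sigma>) /\<^sub>R 2)) = norm g * half_angle_cos ?c"
      by (simp only: norm_scaleR[of "norm g"] h abs_norm_cancel)
    then show ?thesis
      using norm_triangle_ineq[of vs "norm g *\<^sub>R ((u + \<sigma>) /\<^sub>R 2)"]
      unfolding post by linarith
  qed
  also have "\<dots> \<le> norm vs + (norm v + norm vs) * half_angle_cos ?c"
    using half_angle_cos_bounds[of ?c] norm_triangle_ineq4[of v vs] by (intro add_left_mono mult_right_mono) (auto simp: g_def)
  also have "\<dots> \<le> half_angle_cos ?c * norm v + 2 * norm vs"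
    using half_angle_cos_bounds[of ?c] mult_left_mono[of "half_angle_cos ?c" 1 "norm vs"] by (simp add: algebra_simps)
  finally show ?thesis by (simp add: cos_dev_def u_def g_def)
qed

lemma post_v_same: "post_v v v \<sigma> = v"
  by (simp add: post_v_def scaleR_2[symmetric])

section \<open>Inequalities for real powers\<close>

lemma powr_add_le_powr:
  fixes x y s :: real
  assumes "0 \<le> x" "0 \<le> y" "0 < s" "s \<le> 1"
  shows "(x + y) powr s \<le> x powr s + y powr s"
proof (cases "x + y = 0")
  case False
  then have p: "0 < x + y" using assms by simp
  have le: "z / (x + y) \<le> (z / (x + y)) powr s" if "0 \<le> z" "z \<le> x + y" for z
    using powr_mono'[of s 1 "z / (x + y)"] assms p that by auto
  have eq: "z powr s = (x + y) powr s * (z / (x + y)) powr s" if "0 \<le> z" for z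
    using p that by (subst powr_mult[symmetric]) auto
  have "x / (x + y) + y / (x + y) = 1" using p by (simp add: add_divide_distrib[symmetric])
  then have "1 \<le> (x / (x + y)) powr s + (y / (x + y)) powr s"
    using le[of x] le[of y] assms by linarith
  then have "(x + y) powr s * 1 \<le> (x + y) powr s * ((x / (x + y)) powr s + (y / (x + y)) powr s)"
    by (intro mult_left_mono) auto
  then show ?thesis using eq[of x] eq[of y] assms by (simp add: distrib_left)
qed (use assms in auto)

text \<open>The constant in front of the first power can be brought as close to 1 as desired, also
  for exponents above 1; the two cases are y \<le> \<eta> x and y > \<eta> x.\<close>

lemma powr_add_le_weighted:
  fixes x y \<beta> \<eta> :: real
  assumes "0 \<le> x" "0 \<le> y" "0 \<le> \<beta>" "0 < \<eta>"
  shows "(x + y) powr \<beta> \<le> (1 + \<eta>) powr \<beta> * x powr \<beta> + (1 + 1 / \<eta>) powr \<beta> * y powr \<beta>"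
proof (cases "y \<le> \<eta> * x")
  case True
  then have "(x + y) powr \<beta> \<le> ((1 + \<eta>) * x) powr \<beta>"
    using assms by (intro powr_mono2) (auto simp: algebra_simps)
  then show ?thesis using assms by (simp add: powr_mult add_increasing2)
next
  case False
  then have "x \<le> 1 / \<eta> * y" using assms by (simp add: field_simps)
  then have "(x + y) powr \<beta> \<le> ((1 + 1 / \<eta>) * y) powr \<beta>"
    using assms by (intro powr_mono2) (auto simp: algebra_simps)
  then show ?thesis using assms by (simp add: powr_mult add_increasing)
qed

lemma powr_le_exp_mult: "0 \<le> x \<Longrightarrow> 0 \<le> \<beta> \<Longrightarrow> x powr \<beta> \<le> exp (\<beta> * x)" for x \<beta> :: real
  using powr_mono2[of \<beta> x "exp x"] exp_ge_add_one_self[of x] by (simp add: exp_powr_real mult.commute)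

lemma powr_le_1_plus: "0 \<le> x \<Longrightarrow> 0 \<le> s \<Longrightarrow> s \<le> 1 \<Longrightarrow> x powr s \<le> 1 + x" for x s :: real
  using powr_mono2[of s x "1 + x"] powr_mono[of s 1 "1 + x"] by auto

context
  fixes \<gamma> :: real and b :: "real \<Rightarrow> real" and lb :: real and e :: "'a::euclidean_space"
  assumes \<gamma>: "0 \<le> \<gamma>" and b_meas [measurable]: "b \<in> borel_measurable borel" and b_nonneg: "\<And>x. 0 \<le> b x"
    and dim: "2 \<le> DIM('a)" and e: "norm e = 1" and lb: "0 < lb"
    and b_int: "(\<integral>\<^sup>+\<sigma>. ennreal (b (e \<bullet> \<sigma>)) \<partial>sphere_borel) = ennreal lb"
begin

lemmas kernel_facts = \<gamma> b_meas b_nonneg dim e lb b_int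

text \<open>Detailed balance: in the gain the product of the two Maxwellians after the collision
  equals the product before it, so the Maxwellian at \<open>v\<close> factors out and the collision
  frequency remains.\<close>

lemma maxwellian_stationary:
  "(\<integral>\<^sup>+w. carleman_kernel \<gamma> b v w * ennreal (maxwellian w) \<partial>lborel)
    = ennreal (coll_freq \<gamma> b v) * ennreal (maxwellian (v :: 'a))"
proof -
  have "(\<integral>\<^sup>+w. carleman_kernel \<gamma> b v w * ennreal (maxwellian w) \<partial>lborel)
      = (\<integral>\<^sup>+\<sigma>. \<integral>\<^sup>+vs. ennreal (coll_kernel \<gamma> b v vs \<sigma> * maxwellian (post_vs v vs \<sigma>)) * ennreal (maxwellian (post_v v vs \<sigma>)) \<partial>lborel \<partial>sphere_borel)"
    by (rule nn_integral_gain_carleman[OF b_meas b_nonneg _ dim]) measurable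
  also have "\<dots> = (\<integral>\<^sup>+\<sigma>. \<integral>\<^sup>+vs. ennreal (coll_kernel \<gamma> b v vs \<sigma> * maxwellian vs) * ennreal (maxwellian v) \<partial>lborel \<partial>sphere_borel)"
  proof (rule nn_integral_cong_AE)
    have "(\<integral>\<^sup>+vs. ennreal (coll_kernel \<gamma> b v vs \<sigma> * maxwellian (post_vs v vs \<sigma>)) * ennreal (maxwellian (post_v v vs \<sigma>)) \<partial>lborel)
        = (\<integral>\<^sup>+vs. ennreal (coll_kernel \<gamma> b v vs \<sigma> * maxwellian vs) * ennreal (maxwellian v) \<partial>lborel)" if "norm \<sigma> = 1" for \<sigma>
    proof (rule nn_integral_cong)
      fix vs
      have "0 \<le> coll_kernel \<gamma> b v vs \<sigma>" using b_nonneg by (simp add: coll_kernel_def)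
      then show "ennreal (coll_kernel \<gamma> b v vs \<sigma> * maxwellian (post_vs v vs \<sigma>)) * ennreal (maxwellian (post_v v vs \<sigma>))
        = ennreal (coll_kernel \<gamma> b v vs \<sigma> * maxwellian vs) * ennreal (maxwellian v)"
        using maxwellian_post[OF that, of v vs] by (simp add: ennreal_mult[symmetric] mult.assoc)
    qed
    then show "AE \<sigma> in sphere_borel. (\<integral>\<^sup>+vs. ennreal (coll_kernel \<gamma> b v vs \<sigma> * maxwellian (post_vs v vs \<sigma>)) * ennreal (maxwellian (post_v v vs \<sigma>)) \<partial>lborel)
        = (\<integral>\<^sup>+vs. ennreal (coll_kernel \<gamma> b v vs \<sigma> * maxwellian vs) * ennreal (maxwellian v) \<partial>lborel)"
      using AE_sphere_borel by (auto elim!: eventually_mono)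
  qed
  also have "\<dots> = (\<integral>\<^sup>+\<sigma>. \<integral>\<^sup>+vs. ennreal (coll_kernel \<gamma> b v vs \<sigma> * maxwellian vs) \<partial>lborel \<partial>sphere_borel) * ennreal (maxwellian v)"
    by (simp add: nn_integral_multc)
  also have "(\<integral>\<^sup>+\<sigma>. \<integral>\<^sup>+vs. ennreal (coll_kernel \<gamma> b v vs \<sigma> * maxwellian vs) \<partial>lborel \<partial>sphere_borel) = ennreal (coll_freq \<gamma> b v)"
    using nn_integral_coll_kernel[OF b_meas maxwellian_measurable b_nonneg maxwellian_nonneg e, of \<gamma> v]
    by (simp add: coll_freq_ennreal[OF kernel_facts] b_int)
  finally show ?thesis .
qed

lemma AE_inner_less_1: "AE \<sigma> in sphere_borel. e \<bullet> \<sigma> < 1"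
  using AE_sphere_borel AE_sphere_borel_neq[OF dim, of e]
proof eventually_elim
  case (elim \<sigma>)
  have "(norm (\<sigma> - e))\<^sup>2 = 2 - 2 * (e \<bullet> \<sigma>)"
    using elim(1) e unfolding power2_norm_eq_inner
    by (simp add: inner_diff_left inner_diff_right inner_commute norm_eq_1)
  moreover have "0 < (norm (\<sigma> - e))\<^sup>2" using elim(2) by simp
  ultimately show ?case by simp
qed

text \<open>The origin of \<open>th < 1\<close> for the algebraic weights. Equality would make b (1
  - h) vanish almost everywhere, hence \<open>b\<close> itself since h < 1 off a null set, against
  the positivity of \<open>lb\<close>.\<close>

lemma nn_integral_angular_strict:
  assumes [measurable]: "h \<in> borel_measurable borel" and h: "\<And>x. 0 \<le> h x" "\<And>x. h x \<le> 1" "\<And>x. x < 1 \<Longrightarrow> h x < 1"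
  shows "(\<integral>\<^sup>+\<sigma>. ennreal (b (e \<bullet> \<sigma>) * h (e \<bullet> \<sigma>)) \<partial>sphere_borel) < ennreal lb"
proof (rule ccontr)
  assume "\<not> ?thesis"
  then have ge: "ennreal lb \<le> (\<integral>\<^sup>+\<sigma>. ennreal (b (e \<bullet> \<sigma>) * h (e \<bullet> \<sigma>)) \<partial>sphere_borel)" (is "_ \<le> ?I") by simp
  let ?J = "\<integral>\<^sup>+\<sigma>. ennreal (b (e \<bullet> \<sigma>) * (1 - h (e \<bullet> \<sigma>))) \<partial>sphere_borel"
  have "?J + ?I = (\<integral>\<^sup>+\<sigma>. ennreal (b (e \<bullet> \<sigma>) * (1 - h (e \<bullet> \<sigma>))) + ennreal (b (e \<bullet> \<sigma>) * h (e \<bullet> \<sigma>)) \<partial>sphere_borel)"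
    by (rule nn_integral_add[symmetric]) measurable
  also have "\<dots> = ennreal lb"
    unfolding b_int[symmetric] using h b_nonneg
    by (intro nn_integral_cong) (subst ennreal_plus[symmetric], auto simp: algebra_simps mult_left_le)
  finally have "?J + ?I = ennreal lb" .
  then have "?J + ennreal lb \<le> 0 + ennreal lb" using add_left_mono[OF ge, of ?J] by simp
  then have "?J = 0" using ennreal_le_of_add_le[of ?J "ennreal lb" 0] by simp
  then have "AE \<sigma> in sphere_borel. ennreal (b (e \<bullet> \<sigma>) * (1 - h (e \<bullet> \<sigma>))) = 0"
    by (subst (asm) nn_integral_0_iff_AE) auto
  with AE_inner_less_1 have "AE \<sigma> in sphere_borel. ennreal (b (e \<bullet> \<sigma>)) = 0"
  proof eventually_elim
    case (elim \<sigma>)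
    have "0 < 1 - h (e \<bullet> \<sigma>)" using h(3)[OF elim(1)] by simp
    moreover have "b (e \<bullet> \<sigma>) * (1 - h (e \<bullet> \<sigma>)) \<le> 0" using elim(2) by (simp only: ennreal_eq_0_iff)
    ultimately have "b (e \<bullet> \<sigma>) \<le> 0" by (simp add: mult_le_0_iff)
    then show ?case by (simp add: ennreal_neg)
  qed
  then have "(\<integral>\<^sup>+\<sigma>. ennreal (b (e \<bullet> \<sigma>)) \<partial>sphere_borel) = 0"
    by (subst nn_integral_0_iff_AE) auto
  then show False using lb by (simp add: b_int)
qed

text \<open>1 - 2 t^2 is the cosine of the deviation angle when t is the cosine of the angle between
  w - v and \<sigma>. The positivity of this integral is not computed by a change of variables on
  the sphere: if all these integrals were zero, the kernel would vanish identically, against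
  \<open>carleman_kernel_mass\<close> and the positive collision frequency.\<close>

lemma angular_mass_near_equator_pos:
  obtains t\<^sub>0 where "0 < t\<^sub>0" "0 < (\<integral>\<^sup>+\<sigma>. indicator {t\<^sub>0..} (e \<bullet> \<sigma>) * ennreal (b (1 - 2 * (e \<bullet> \<sigma>)\<^sup>2)) \<partial>sphere_borel)"
proof -
  have "\<exists>n::nat. 0 < (\<integral>\<^sup>+\<sigma>. indicator {1 / real (Suc n)..} (e \<bullet> \<sigma>) * ennreal (b (1 - 2 * (e \<bullet> \<sigma>)\<^sup>2)) \<partial>sphere_borel)"
  proof (rule ccontr)
    assume "\<not> ?thesis"
    then have "AE \<sigma> in sphere_borel. indicator {1 / real (Suc n)..} (e \<bullet> \<sigma>) * ennreal (b (1 - 2 * (e \<bullet> \<sigma>)\<^sup>2)) = 0" for n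
      by (subst nn_integral_0_iff_AE[symmetric]) (auto simp: zero_less_iff_neq_zero)
    then have "AE \<sigma> in sphere_borel. \<forall>n. indicator {1 / real (Suc n)..} (e \<bullet> \<sigma>) * ennreal (b (1 - 2 * (e \<bullet> \<sigma>)\<^sup>2)) = 0"
      unfolding AE_all_countable by blast
    then have "AE \<sigma> in sphere_borel. indicator {0<..} (e \<bullet> \<sigma>) * ennreal (b (1 - 2 * (e \<bullet> \<sigma>)\<^sup>2)) = 0"
    proof eventually_elim
      case (elim \<sigma>)
      show ?case
      proof (cases "0 < e \<bullet> \<sigma>")
        case True
        then obtain n where "inverse (real (Suc n)) < e \<bullet> \<sigma>" using reals_Archimedean by blast
        then show ?thesis using elim[rule_format, of n] by (auto simp: inverse_eq_divide)
      qed simp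
    qed
    then have 0: "(\<integral>\<^sup>+\<sigma>. indicator {0<..} (e \<bullet> \<sigma>) * ennreal (b (1 - 2 * (e \<bullet> \<sigma>)\<^sup>2)) \<partial>sphere_borel) = 0"
      by (subst nn_integral_0_iff_AE) auto
    have "carleman_kernel \<gamma> b v w = 0" for v w :: 'a
    proof (cases "v = w")
      case False
      define z where "z = w - v"
      define u where "u = sgn z"
      have z: "0 < norm z" "norm u = 1" "z = norm z *\<^sub>R u"
        using False by (auto simp: z_def u_def norm_sgn sgn_div_norm)
      have "(\<integral>\<^sup>+\<sigma>. indicator {0<..} (u \<bullet> \<sigma>) * ennreal (b (1 - 2 * (u \<bullet> \<sigma>)\<^sup>2)) \<partial>sphere_borel) = 0"
        using sphere_borel_inner_indep[OF z(2) e, of "\<lambda>x. indicator {0<..} x * ennreal (b (1 - 2 * x\<^sup>2))"] 0 by simp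
      then have "AE \<sigma> in sphere_borel. indicator {0<..} (u \<bullet> \<sigma>) * ennreal (b (1 - 2 * (u \<bullet> \<sigma>)\<^sup>2)) = 0"
        by (subst (asm) nn_integral_0_iff_AE) auto
      then have "AE \<sigma> in sphere_borel. indicator {0<..} (z \<bullet> \<sigma>) * ennreal (carleman_integrand \<gamma> b z w \<sigma>) = 0"
      proof eventually_elim
        case (elim \<sigma>)
        show ?case
        proof (cases "0 < z \<bullet> \<sigma>")
          case True
          have zu: "z \<bullet> \<sigma> = norm z * (u \<bullet> \<sigma>)" by (subst z(3)) simp
          then have "0 < u \<bullet> \<sigma>" using True z(1) by (simp add: zero_less_mult_iff)
          then have "b (1 - 2 * (u \<bullet> \<sigma>)\<^sup>2) = 0" using elim b_nonneg by (simp add: antisym)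
          moreover have "2 * (z \<bullet> \<sigma>)\<^sup>2 / (norm z)\<^sup>2 = 2 * (u \<bullet> \<sigma>)\<^sup>2" unfolding zu using z(1) by (simp add: power_mult_distrib)
          ultimately show ?thesis by (simp add: carleman_integrand_def)
        qed simp
      qed
      then show ?thesis unfolding carleman_kernel_def z_def[symmetric]
        by (subst nn_integral_0_iff_AE) auto
    qed (simp add: carleman_kernel_def)
    then have "ennreal (coll_freq \<gamma> b e) = 0"
      using carleman_kernel_mass[OF kernel_facts, of e] by simp
    moreover obtain c where c: "0 < c" "\<And>v :: 'a. c * (1 + norm v) powr \<gamma> \<le> coll_freq \<gamma> b v"
      using coll_freq_lower[OF kernel_facts] by blast
    have "0 < c * (1 + norm e) powr \<gamma>" using c(1) by (simp add: e)
    then have "0 < coll_freq \<gamma> b e" using c(2)[of e] by (rule less_le_trans)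
    ultimately show False by simp
  qed
  then show ?thesis using that[of "1 / real (Suc _)"] by auto
qed

text \<open>Directions with u \<bullet> \<sigma> \<ge> \<open>t\<^sub>0\<close>, where u is the
  direction of w - v, keep the relative speed r = |w - v| / (u \<bullet> \<sigma>) below L /
  \<open>t\<^sub>0\<close>. The argument of the Maxwellian then stays in a ball of radius
  \<open>R\<close>, while |w - v| \<ge> 1 makes the speed factor and the Jacobian at least
  1.\<close>

lemma carleman_kernel_lower:
  fixes \<rho> L :: real
  assumes "0 \<le> \<rho>" "1 \<le> L"
  obtains c where "0 < c" "c < \<infinity>" "\<And>v w :: 'a. norm w \<le> \<rho> \<Longrightarrow> 1 \<le> norm (w - v) \<Longrightarrow> norm (w - v) \<le> L \<Longrightarrow> c \<le> carleman_kernel \<gamma> b v w"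
proof -
  obtain t\<^sub>0 where t\<^sub>0: "0 < t\<^sub>0" and H: "0 < (\<integral>\<^sup>+\<sigma>. indicator {t\<^sub>0..} (e \<bullet> \<sigma>) * ennreal (b (1 - 2 * (e \<bullet> \<sigma>)\<^sup>2)) \<partial>sphere_borel)" (is "0 < ?H")
    using angular_mass_near_equator_pos by blast
  define R where "R = \<rho> + L / t\<^sub>0"
  define m where "m = (2 * pi) powr (- real DIM('a) / 2) * exp (- R\<^sup>2 / 2)"
  have m: "0 < m" by (simp add: m_def)
  \<comment> \<open>The truncation at 1 provides a finite constant without an upper bound on the
    angular integral \<open>?H\<close>.\<close>
  have main: "ennreal m * min ?H 1 \<le> carleman_kernel \<gamma> b v w"
    if w: "norm w \<le> \<rho>" and z1: "1 \<le> norm (w - v)" and zL: "norm (w - v) \<le> L" for v w :: 'a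
  proof -
    define z where "z = w - v"
    define u where "u = sgn z"
    have "z \<noteq> 0" using z1 by (auto simp: z_def)
    then have z: "0 < norm z" "norm u = 1" "z = norm z *\<^sub>R u"
      by (simp_all add: u_def norm_sgn sgn_div_norm)
    have Hu: "?H = (\<integral>\<^sup>+\<sigma>. indicator {t\<^sub>0..} (u \<bullet> \<sigma>) * ennreal (b (1 - 2 * (u \<bullet> \<sigma>)\<^sup>2)) \<partial>sphere_borel)"
      using sphere_borel_inner_indep[OF e z(2), of "\<lambda>x. indicator {t\<^sub>0..} x * ennreal (b (1 - 2 * x\<^sup>2))"] by simp
    have "ennreal m * min ?H 1 \<le> ennreal m * (\<integral>\<^sup>+\<sigma>. indicator {t\<^sub>0..} (u \<bullet> \<sigma>) * ennreal (b (1 - 2 * (u \<bullet> \<sigma>)\<^sup>2)) \<partial>sphere_borel)"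
      unfolding Hu[symmetric] by (intro mult_left_mono) auto
    also have "\<dots> = (\<integral>\<^sup>+\<sigma>. ennreal m * (indicator {t\<^sub>0..} (u \<bullet> \<sigma>) * ennreal (b (1 - 2 * (u \<bullet> \<sigma>)\<^sup>2))) \<partial>sphere_borel)"
      by (rule nn_integral_cmult[symmetric]) measurable
    also have "\<dots> \<le> carleman_kernel \<gamma> b v w"
      unfolding carleman_kernel_def z_def[symmetric]
    proof (rule nn_integral_sphere_mono)
      fix \<sigma> :: 'a assume \<sigma>: "norm \<sigma> = 1"
      show "ennreal m * (indicator {t\<^sub>0..} (u \<bullet> \<sigma>) * ennreal (b (1 - 2 * (u \<bullet> \<sigma>)\<^sup>2)))
        \<le> indicator {0<..} (z \<bullet> \<sigma>) * ennreal (carleman_integrand \<gamma> b z w \<sigma>)"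
      proof (cases "t\<^sub>0 \<le> u \<bullet> \<sigma>")
        case True
        define t where "t = u \<bullet> \<sigma>"
        have t: "t\<^sub>0 \<le> t" "0 < t" "t \<le> 1"
          using True t\<^sub>0 Cauchy_Schwarz_ineq2[of u \<sigma>] z(2) \<sigma> by (auto simp: t_def)
        have zu: "z \<bullet> \<sigma> = norm z * t" unfolding t_def by (subst z(3)) simp
        define r where "r = (norm z)\<^sup>2 / (z \<bullet> \<sigma>)"
        have r: "r = norm z / t" using z(1) t by (simp add: r_def zu power2_eq_square)
        have r1: "1 \<le> r" using z1 t mult_right_mono[of 1 "norm z" 1] by (simp add: r z_def[symmetric] pos_le_divide_eq)
        have rL: "r \<le> L / t\<^sub>0"
          unfolding r using zL t t\<^sub>0 z(1) assms(2) by (intro frac_le) (auto simp: z_def)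
        have "norm (w - r *\<^sub>R \<sigma>) \<le> norm w + r" using norm_triangle_ineq4[of w "r *\<^sub>R \<sigma>"] r1 \<sigma> by simp
        also have "\<dots> \<le> R" using w rL by (simp add: R_def)
        finally have "(norm (w - r *\<^sub>R \<sigma>))\<^sup>2 \<le> R\<^sup>2" by (intro power_mono) auto
        then have M: "m \<le> maxwellian (w - r *\<^sub>R \<sigma>)"
          unfolding m_def maxwellian_def by (intro mult_left_mono) auto
        have cosn: "1 - 2 * (z \<bullet> \<sigma>)\<^sup>2 / (norm z)\<^sup>2 = 1 - 2 * t\<^sup>2" unfolding zu using z(1) by (simp add: power_mult_distrib)
        have jac: "1 \<le> 2 ^ (DIM('a) - 1) * ((norm z)\<^sup>2 / (z \<bullet> \<sigma>)\<^sup>2)"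
        proof -
          have "(norm z)\<^sup>2 / (z \<bullet> \<sigma>)\<^sup>2 = (1 / t)\<^sup>2" unfolding zu using z(1) by (simp add: power_mult_distrib power_divide)
          moreover have "1 \<le> (1 / t)\<^sup>2" using t by (intro one_le_power) simp
          ultimately show ?thesis using mult_mono[of 1 "2 ^ (DIM('a) - 1)" 1 "(1 / t)\<^sup>2"] by simp
        qed
        have "m * b (1 - 2 * t\<^sup>2) = 1 * b (1 - 2 * t\<^sup>2) * 1 * m" by simp
        also have "\<dots> \<le> carleman_integrand \<gamma> b z w \<sigma>"
          unfolding carleman_integrand_def cosn r_def[symmetric]
          using b_nonneg m M jac r1 \<gamma> by (intro mult_mono mult_right_mono) (auto intro!: ge_one_powr_ge_zero)
        finally have "ennreal (m * b (1 - 2 * t\<^sup>2)) \<le> ennreal (carleman_integrand \<gamma> b z w \<sigma>)" by (rule ennreal_leI)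
        moreover have "0 < z \<bullet> \<sigma>" using z(1) t by (simp add: zu)
        ultimately show ?thesis using True m b_nonneg unfolding t_def[symmetric] by (simp add: ennreal_mult)
      qed simp
    qed
    finally show ?thesis .
  qed
  show ?thesis
  proof (rule that[OF _ _ main])
    show "0 < ennreal m * min ?H 1" using m H by (simp add: ennreal_zero_less_mult_iff)
    have "min ?H 1 \<le> 1" by simp
    then have "min ?H 1 < \<infinity>" by (rule le_less_trans) simp
    then show "ennreal m * min ?H 1 < \<infinity>" by (simp add: ennreal_mult_less_top)
  qed
qed

text \<open>A collision multiplies |v|^\<beta> by about cos(\<theta>/2)^\<beta>, whose angular
  average is strictly smaller than \<open>lb\<close>, so the contraction sits in \<kappa>1. The
  partner velocity enters additively and is negligible relative to a large weight, which is
  \<kappa>2.\<close>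

lemma algebraic_lyapunov:
  fixes \<beta> :: real
  assumes \<beta>: "0 < \<beta>"
  obtains th C where "0 \<le> th" "th < 1" "0 \<le> C"
    "\<And>w :: 'a. (\<integral>\<^sup>+v. carleman_kernel \<gamma> b v w * ennreal (1 + norm v powr \<beta>) \<partial>lborel)
      \<le> ennreal (th * (coll_freq \<gamma> b w * (1 + norm w powr \<beta>)) + C)"
proof -
  define k0 where "k0 = enn2real (\<integral>\<^sup>+\<sigma>. ennreal (b (e \<bullet> \<sigma>) * half_angle_cos (e \<bullet> \<sigma>) powr \<beta>) \<partial>sphere_borel)"
  have lt: "(\<integral>\<^sup>+\<sigma>. ennreal (b (e \<bullet> \<sigma>) * half_angle_cos (e \<bullet> \<sigma>) powr \<beta>) \<partial>sphere_borel) < ennreal lb"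
  proof (rule nn_integral_angular_strict)
    fix x :: real
    show "half_angle_cos x powr \<beta> \<le> 1" using powr_mono2[of \<beta> "half_angle_cos x" 1] half_angle_cos_bounds[of x] \<beta> by simp
    show "half_angle_cos x powr \<beta> < 1" if "x < 1"
      using powr_less_mono2[of \<beta> "half_angle_cos x" 1] half_angle_cos_bounds[of x] half_angle_cos_less_1[OF that] \<beta> by simp
  qed auto
  then have k0: "(\<integral>\<^sup>+\<sigma>. ennreal (b (e \<bullet> \<sigma>) * half_angle_cos (e \<bullet> \<sigma>) powr \<beta>) \<partial>sphere_borel) = ennreal k0" "0 \<le> k0"
    using less_trans[OF lt ennreal_less_top] by (auto simp: k0_def)
  have "k0 < lb" using lt k0 by (simp add: ennreal_less_iff)
  \<comment> \<open>The loss (1 + \<eta>)^\<beta> in the splitting of the power must not exhaust the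
    gap between \<open>k0\<close> and \<open>lb\<close>.\<close>
  have "((\<lambda>\<eta>. (1 + \<eta>) powr \<beta> * k0) \<longlongrightarrow> (1 + 0) powr \<beta> * k0) (at_right 0)"
    by (intro tendsto_intros) auto
  then have "\<forall>\<^sub>F \<eta> in at_right 0. (1 + \<eta>) powr \<beta> * k0 < lb"
    using \<open>k0 < lb\<close> by (intro order_tendstoD(2)) auto
  then have "\<forall>\<^sub>F \<eta> in at_right 0. 0 < \<eta> \<and> (1 + \<eta>) powr \<beta> * k0 < lb"
    using eventually_at_right_less[of 0] by eventually_elim auto
  then obtain \<eta> where \<eta>: "0 < \<eta>" "(1 + \<eta>) powr \<beta> * k0 < lb"
    using eventually_happens[of _ "at_right (0 :: real)"] by (auto simp: trivial_limit_at_right_real)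
  define B where "B = (1 + 1 / \<eta>) powr \<beta> * 2 powr \<beta>"
  define E where "E = (1 + \<eta>) powr \<beta>"
  \<comment> \<open>The part 2 + B dominates the additive term 1 + B |vs|^\<beta>, the part E
    dominates \<kappa>1 in the crude bound.\<close>
  define A where "A = 2 + B + E"
  have BE: "0 \<le> B" "0 \<le> E" by (auto simp: B_def E_def)
  define W where "W v = 1 + norm v powr \<beta>" for v :: 'a
  define \<kappa>1 where "\<kappa>1 x = E * half_angle_cos x powr \<beta>" for x
  \<comment> \<open>For |v| \<ge> n the weight of \<open>v\<close> times this number is at least 1,
    which turns an additive constant into a multiple of the weight.\<close>
  define \<kappa>2 where "\<kappa>2 n x = 1 / (1 + real n powr \<beta>)" for n :: nat and x :: real
  have W1: "1 \<le> W v" for v by (simp add: W_def)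
  have E1: "half_angle_cos x powr \<beta> \<le> 1" for x
    using powr_mono2[of \<beta> "half_angle_cos x" 1] half_angle_cos_bounds[of x] \<beta> by simp
  have pe: "x powr \<beta> \<le> exp (\<beta> * x)" "1 \<le> exp (\<beta> * x)" if "0 \<le> x" for x
    using powr_le_exp_mult[of x \<beta>] that \<beta> by auto
  have post: "W (post_v v vs \<sigma>) \<le> W v * \<kappa>1 (cos_dev v vs \<sigma>) + (1 + B * norm vs powr \<beta>)"
    if "norm \<sigma> = 1" "v \<noteq> vs" for v vs \<sigma>
  proof -
    let ?h = "half_angle_cos (cos_dev v vs \<sigma>)"
    have "norm (post_v v vs \<sigma>) powr \<beta> \<le> (?h * norm v + 2 * norm vs) powr \<beta>"
      using norm_post_v_le[OF that] \<beta> by (intro powr_mono2) auto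
    also have "\<dots> \<le> E * (?h * norm v) powr \<beta> + (1 + 1 / \<eta>) powr \<beta> * (2 * norm vs) powr \<beta>"
      unfolding E_def using \<beta> \<eta> half_angle_cos_bounds by (intro powr_add_le_weighted) auto
    also have "\<dots> = \<kappa>1 (cos_dev v vs \<sigma>) * norm v powr \<beta> + B * norm vs powr \<beta>"
      using half_angle_cos_bounds by (simp add: powr_mult B_def \<kappa>1_def)
    finally have "norm (post_v v vs \<sigma>) powr \<beta> \<le> \<kappa>1 (cos_dev v vs \<sigma>) * norm v powr \<beta> + B * norm vs powr \<beta>" .
    moreover have "0 \<le> \<kappa>1 (cos_dev v vs \<sigma>)" using BE by (simp add: \<kappa>1_def)
    ultimately show ?thesis by (simp add: W_def algebra_simps)
  qed
  have rest: "1 + B * norm vs powr \<beta> \<le> (A - E) * exp (\<beta> * norm vs)" for vs :: 'a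
  proof -
    have "1 + B * norm vs powr \<beta> \<le> B * exp (\<beta> * norm vs) + 2 * exp (\<beta> * norm vs)"
      using mult_left_mono[OF pe(1)[of "norm vs"] BE(1)] pe(2)[of "norm vs"] norm_ge_zero[of vs] by linarith
    then show ?thesis by (simp add: A_def algebra_simps)
  qed
  show ?thesis
  proof (rule carleman_lyapunov[OF kernel_facts, of W A \<beta> \<kappa>1 \<kappa>2])
    show "W \<in> borel_measurable borel" unfolding W_def[abs_def] by measurable
    show "\<kappa>1 \<in> borel_measurable borel" unfolding \<kappa>1_def[abs_def] by measurable
    show "\<kappa>2 n \<in> borel_measurable borel" for n unfolding \<kappa>2_def[abs_def] by measurable
    show "0 \<le> A" using BE by (simp add: A_def)
    show "W v \<le> A * exp (\<beta> * norm v)" for v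
    proof -
      have "W v \<le> 2 * exp (\<beta> * norm v)" unfolding W_def using pe(1)[OF norm_ge_zero[of v]] pe(2)[OF norm_ge_zero[of v]] by linarith
      also have "\<dots> \<le> A * exp (\<beta> * norm v)" using BE by (intro mult_right_mono) (auto simp: A_def)
      finally show ?thesis .
    qed
    show "0 \<le> \<kappa>1 x" for x using BE by (simp add: \<kappa>1_def)
    show "(\<integral>\<^sup>+\<sigma>. ennreal (b (e \<bullet> \<sigma>) * \<kappa>1 (e \<bullet> \<sigma>)) \<partial>sphere_borel) < ennreal lb"
    proof -
      have "(\<integral>\<^sup>+\<sigma>. ennreal (b (e \<bullet> \<sigma>) * \<kappa>1 (e \<bullet> \<sigma>)) \<partial>sphere_borel)
          = (\<integral>\<^sup>+\<sigma>. ennreal E * ennreal (b (e \<bullet> \<sigma>) * half_angle_cos (e \<bullet> \<sigma>) powr \<beta>) \<partial>sphere_borel)"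
        using BE b_nonneg by (intro nn_integral_cong) (simp add: \<kappa>1_def ennreal_mult[symmetric] mult_ac)
      also have "\<dots> = ennreal E * ennreal k0" unfolding k0(1)[symmetric] by (rule nn_integral_cmult) measurable
      also have "\<dots> < ennreal lb" using \<eta>(2) BE k0 by (simp add: ennreal_mult[symmetric] ennreal_less_iff E_def)
      finally show ?thesis .
    qed
    show "(\<lambda>n. \<integral>\<^sup>+\<sigma>. ennreal (b (e \<bullet> \<sigma>) * \<kappa>2 n (e \<bullet> \<sigma>)) \<partial>sphere_borel) \<longlonglongrightarrow> 0"
    proof -
      have "(\<integral>\<^sup>+\<sigma>. ennreal (b (e \<bullet> \<sigma>) * \<kappa>2 n (e \<bullet> \<sigma>)) \<partial>sphere_borel) = ennreal (lb * (1 / (1 + real n powr \<beta>)))" for n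
      proof -
        have "(\<integral>\<^sup>+\<sigma>. ennreal (b (e \<bullet> \<sigma>) * \<kappa>2 n (e \<bullet> \<sigma>)) \<partial>sphere_borel)
            = (\<integral>\<^sup>+\<sigma>. ennreal (b (e \<bullet> \<sigma>)) * ennreal (1 / (1 + real n powr \<beta>)) \<partial>sphere_borel)"
          using b_nonneg by (intro nn_integral_cong) (simp add: \<kappa>2_def ennreal_mult[symmetric] add_nonneg_nonneg)
        also have "\<dots> = ennreal lb * ennreal (1 / (1 + real n powr \<beta>))"
          unfolding b_int[symmetric] by (rule nn_integral_multc) measurable
        finally show ?thesis using lb by (simp add: ennreal_mult[symmetric] add_nonneg_nonneg)
      qed
      moreover have "(\<lambda>n. lb * (1 / (1 + real n powr \<beta>))) \<longlonglongrightarrow> 0"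
      proof -
        have "(\<lambda>n. inverse (1 + real n powr \<beta>)) \<longlonglongrightarrow> 0"
          by (intro tendsto_inverse_0_at_top filterlim_tendsto_add_at_top[OF tendsto_const] filterlim_real_powr_at_top \<beta>)
        from tendsto_mult_left[OF this, of lb] show ?thesis by (simp add: inverse_eq_divide)
      qed
      then have "(\<lambda>n. ennreal (lb * (1 / (1 + real n powr \<beta>)))) \<longlonglongrightarrow> ennreal 0" by (rule tendsto_ennrealI)
      ultimately show ?thesis by simp
    qed
    show fine: "W (post_v v vs \<sigma>) \<le> W v * (\<kappa>1 (cos_dev v vs \<sigma>) + \<kappa>2 n (cos_dev v vs \<sigma>) * (A * exp (\<beta> * norm vs)))"
      if "norm \<sigma> = 1" "v \<noteq> vs" "real n \<le> norm v" for n v vs \<sigma>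
    proof -
      have "real n powr \<beta> \<le> norm v powr \<beta>" using that(3) \<beta> by (intro powr_mono2) auto
      then have k2: "1 \<le> W v * \<kappa>2 n (cos_dev v vs \<sigma>)" by (simp add: W_def \<kappa>2_def add_pos_nonneg)
      have "1 + B * norm vs powr \<beta> \<le> 1 * (A * exp (\<beta> * norm vs))"
      proof -
        have "(A - E) * exp (\<beta> * norm vs) \<le> A * exp (\<beta> * norm vs)" using BE by (intro mult_right_mono) auto
        from order_trans[OF rest this] show ?thesis by simp
      qed
      also have "\<dots> \<le> (W v * \<kappa>2 n (cos_dev v vs \<sigma>)) * (A * exp (\<beta> * norm vs))"
        using k2 BE by (intro mult_right_mono) (auto simp: A_def)
      finally show ?thesis using post[OF that(1,2)] by (simp add: distrib_left mult.assoc)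
    qed
    show "W (post_v v vs \<sigma>) \<le> W v * (A * exp (\<beta> * norm vs))" if "norm \<sigma> = 1" for v vs \<sigma>
    proof (cases "v = vs")
      case True
      have "1 * 1 \<le> A * exp (\<beta> * norm vs)" using BE \<beta> by (intro mult_mono) (auto simp: A_def)
      then show ?thesis using True W1[of v] mult_left_mono[of 1 "A * exp (\<beta> * norm vs)" "W v"] by (simp add: post_v_same)
    next
      case False
      have "W (post_v v vs \<sigma>) \<le> W v * \<kappa>1 (cos_dev v vs \<sigma>) + 1 * ((A - E) * exp (\<beta> * norm vs))"
        using post[OF that False] rest[of vs] by simp
      also have "\<dots> \<le> W v * (E * exp (\<beta> * norm vs)) + W v * ((A - E) * exp (\<beta> * norm vs))"
      proof (intro add_mono mult_left_mono mult_right_mono)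
        have "\<kappa>1 (cos_dev v vs \<sigma>) \<le> E * 1" unfolding \<kappa>1_def using E1 BE by (intro mult_left_mono) auto
        also have "\<dots> \<le> E * exp (\<beta> * norm vs)" using BE \<beta> by (intro mult_left_mono) auto
        finally show "\<kappa>1 (cos_dev v vs \<sigma>) \<le> E * exp (\<beta> * norm vs)" .
      qed (use W1[of v] BE in \<open>auto simp: A_def\<close>)
      also have "\<dots> = W v * (A * exp (\<beta> * norm vs))" by (simp add: algebra_simps)
      finally show ?thesis .
    qed
    fix th C
    assume "0 \<le> th" "th < 1" "0 \<le> C"
      "\<And>w. (\<integral>\<^sup>+v. carleman_kernel \<gamma> b v w * ennreal (W v) \<partial>lborel) \<le> ennreal (th * (coll_freq \<gamma> b w * W w) + C)"
    then show thesis by (intro that[of th C]) (auto simp: W_def)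
  qed (use W1 \<beta> in \<open>auto simp: \<kappa>2_def add_nonneg_nonneg\<close>)
qed

text \<open>For s \<le> 1 the power is subadditive, so the partner velocity contributes only a
  factor of exponential growth. The deflection contributes exp(-a (1 - cos(\<theta>/2)^s) |v|^s),
  which tends to zero at large velocities for every \<theta> other than 0. Hence \<kappa>1 is zero
  and the average of \<kappa>2 vanishes by dominated convergence with majorant \<open>b\<close>; no
  rate uniform in the angle is required.\<close>

lemma exponential_lyapunov:
  fixes a s :: real
  assumes a: "0 < a" and s: "0 < s" "s \<le> 1"
  obtains th C where "0 \<le> th" "th < 1" "0 \<le> C"
    "\<And>w :: 'a. (\<integral>\<^sup>+v. carleman_kernel \<gamma> b v w * ennreal (exp (a * norm v powr s)) \<partial>lborel)
      \<le> ennreal (th * (coll_freq \<gamma> b w * exp (a * norm w powr s)) + C)"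
proof -
  define W where "W v = exp (a * norm v powr s)" for v :: 'a
  define A where "A = exp (2 * a)"
  define \<kappa>2 where "\<kappa>2 n x = exp (- (a * (1 - half_angle_cos x powr s)) * real n powr s)" for n :: nat and x :: real
  have h1: "half_angle_cos x powr s \<le> 1" for x
    using powr_mono2[of s "half_angle_cos x" 1] half_angle_cos_bounds[of x] s by simp
  have lin: "a * norm v powr s \<le> a + a * norm v" for v :: 'a
    using mult_left_mono[OF powr_le_1_plus[of "norm v" s], of a] s a by (simp add: distrib_left)
  have post: "W (post_v v vs \<sigma>) \<le> exp (a * half_angle_cos (cos_dev v vs \<sigma>) powr s * norm v powr s) * (A * exp (2 * a * norm vs))"
    if "norm \<sigma> = 1" "v \<noteq> vs" for v vs \<sigma>
  proof -
    let ?h = "half_angle_cos (cos_dev v vs \<sigma>)"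
    have "norm (post_v v vs \<sigma>) powr s \<le> (?h * norm v + 2 * norm vs) powr s"
      using norm_post_v_le[OF that] s by (intro powr_mono2) auto
    also have "\<dots> \<le> (?h * norm v) powr s + (2 * norm vs) powr s"
      using s half_angle_cos_bounds by (intro powr_add_le_powr) auto
    also have "\<dots> \<le> ?h powr s * norm v powr s + (1 + 2 * norm vs)"
      using s powr_le_1_plus[of "2 * norm vs" s] half_angle_cos_bounds by (simp add: powr_mult)
    finally have "a * norm (post_v v vs \<sigma>) powr s \<le> a * (?h powr s * norm v powr s + (1 + 2 * norm vs))"
      using a by (intro mult_left_mono) auto
    also have "\<dots> \<le> a * ?h powr s * norm v powr s + (2 * a + 2 * a * norm vs)"
      using a by (simp add: distrib_left mult.assoc)
    finally have "W (post_v v vs \<sigma>) \<le> exp (a * ?h powr s * norm v powr s + (2 * a + 2 * a * norm vs))"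
      by (simp add: W_def)
    then show ?thesis by (simp add: exp_add A_def)
  qed
  have AE_pos: "1 \<le> A * exp (2 * a * norm vs)" for vs :: 'a
    using a by (simp add: A_def exp_add[symmetric])
  have fine: "W (post_v v vs \<sigma>) \<le> W v * (\<kappa>2 n (cos_dev v vs \<sigma>) * (A * exp (2 * a * norm vs)))"
    if "norm \<sigma> = 1" "v \<noteq> vs" "real n \<le> norm v" for n v vs \<sigma>
  proof -
    let ?h = "half_angle_cos (cos_dev v vs \<sigma>)"
    have "real n powr s \<le> norm v powr s" using that(3) s by (intro powr_mono2) auto
    then have "a * (1 - ?h powr s) * real n powr s \<le> a * (1 - ?h powr s) * norm v powr s"
      using a h1 by (intro mult_left_mono) auto
    then have "exp (a * ?h powr s * norm v powr s) \<le> exp (a * norm v powr s + - (a * (1 - ?h powr s)) * real n powr s)"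
      by (simp add: algebra_simps)
    also have "\<dots> = W v * \<kappa>2 n (cos_dev v vs \<sigma>)" unfolding exp_add by (simp add: W_def \<kappa>2_def)
    finally have "exp (a * ?h powr s * norm v powr s) * (A * exp (2 * a * norm vs))
        \<le> (W v * \<kappa>2 n (cos_dev v vs \<sigma>)) * (A * exp (2 * a * norm vs))"
      using AE_pos[of vs] by (intro mult_right_mono) auto
    with post[OF that(1,2)] show ?thesis by (simp add: mult.assoc)
  qed
  have \<kappa>2_le: "\<kappa>2 n x \<le> 1" for n x using a h1[of x] by (simp add: \<kappa>2_def)
  have \<kappa>2_meas [measurable]: "\<kappa>2 n \<in> borel_measurable borel" for n unfolding \<kappa>2_def[abs_def] by measurable
  show ?thesis
  proof (rule carleman_lyapunov[OF kernel_facts, of W A "2 * a" "\<lambda>_. 0" \<kappa>2])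
    show "W \<in> borel_measurable borel" unfolding W_def[abs_def] by measurable
    show "1 \<le> W v" for v using a by (simp add: W_def)
    show "W v \<le> A * exp (2 * a * norm v)" for v
    proof -
      have "a * norm v powr s \<le> 2 * a + 2 * a * norm v"
      proof -
        have "0 \<le> a * norm v" using a by simp
        then show ?thesis using lin[of v] a by linarith
      qed
      then show ?thesis unfolding W_def A_def exp_add[symmetric] by simp
    qed
    show "(\<lambda>n. \<integral>\<^sup>+\<sigma>. ennreal (b (e \<bullet> \<sigma>) * \<kappa>2 n (e \<bullet> \<sigma>)) \<partial>sphere_borel) \<longlonglongrightarrow> 0"
    proof -
      have "(\<lambda>n. \<integral>\<^sup>+\<sigma>. ennreal (b (e \<bullet> \<sigma>) * \<kappa>2 n (e \<bullet> \<sigma>)) \<partial>sphere_borel) \<longlonglongrightarrow> (\<integral>\<^sup>+\<sigma>. 0 \<partial>(sphere_borel :: 'a measure))"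
      proof (rule nn_integral_dominated_convergence[where w = "\<lambda>\<sigma>. ennreal (b (e \<bullet> \<sigma>))"])
        show "AE \<sigma> in sphere_borel. ennreal (b (e \<bullet> \<sigma>) * \<kappa>2 n (e \<bullet> \<sigma>)) \<le> ennreal (b (e \<bullet> \<sigma>))" for n
          using b_nonneg \<kappa>2_le by (intro AE_I2 ennreal_leI mult_left_le) auto
        show "(\<integral>\<^sup>+\<sigma>. ennreal (b (e \<bullet> \<sigma>)) \<partial>sphere_borel) < \<infinity>" by (simp add: b_int)
        show "AE \<sigma> in sphere_borel. (\<lambda>n. ennreal (b (e \<bullet> \<sigma>) * \<kappa>2 n (e \<bullet> \<sigma>))) \<longlonglongrightarrow> 0"
          using AE_inner_less_1
        proof eventually_elim
          case (elim \<sigma>)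
          define q where "q = a * (1 - half_angle_cos (e \<bullet> \<sigma>) powr s)"
          have "half_angle_cos (e \<bullet> \<sigma>) powr s < 1"
            using powr_less_mono2[of s "half_angle_cos (e \<bullet> \<sigma>)" 1] half_angle_cos_bounds[of "e \<bullet> \<sigma>"] half_angle_cos_less_1[OF elim] s by simp
          then have q: "0 < q" using a by (simp add: q_def)
          have "(\<lambda>n. exp (- q * real n powr s)) \<longlonglongrightarrow> 0"
          proof -
            have "filterlim (\<lambda>n. q * real n powr s) at_top sequentially"
              by (intro filterlim_tendsto_pos_mult_at_top[OF tendsto_const q] filterlim_real_powr_at_top s)
            then have "filterlim (\<lambda>n. - (q * real n powr s)) at_bot sequentially"
              by (simp add: filterlim_uminus_at_top)
            from filterlim_compose[OF exp_at_bot this] show ?thesis by simp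
          qed
          then have "(\<lambda>n. b (e \<bullet> \<sigma>) * \<kappa>2 n (e \<bullet> \<sigma>)) \<longlonglongrightarrow> b (e \<bullet> \<sigma>) * 0"
            unfolding \<kappa>2_def q_def[symmetric] by (intro tendsto_mult tendsto_const)
          then have "(\<lambda>n. ennreal (b (e \<bullet> \<sigma>) * \<kappa>2 n (e \<bullet> \<sigma>))) \<longlonglongrightarrow> ennreal (b (e \<bullet> \<sigma>) * 0)" by (rule tendsto_ennrealI)
          then show ?case by simp
        qed
      qed measurable
      then show ?thesis by simp
    qed
    show "W (post_v v vs \<sigma>) \<le> W v * (A * exp (2 * a * norm vs))" if "norm \<sigma> = 1" for v vs \<sigma>
    proof (cases "v = vs")
      case True
      then show ?thesis using AE_pos[of vs] mult_left_mono[of 1 "A * exp (2 * a * norm vs)" "W v"] by (simp add: post_v_same W_def)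
    next
      case False
      \<comment> \<open>For n = 0 the condition on |v| in \<open>fine\<close> is empty.\<close>
      have "W (post_v v vs \<sigma>) \<le> W v * (\<kappa>2 0 (cos_dev v vs \<sigma>) * (A * exp (2 * a * norm vs)))"
        using False that by (intro fine) auto
      also have "\<dots> \<le> W v * (1 * (A * exp (2 * a * norm vs)))"
        using \<kappa>2_le by (intro mult_left_mono mult_right_mono) (auto simp: W_def A_def)
      finally show ?thesis by simp
    qed
    fix th C
    assume "0 \<le> th" "th < 1" "0 \<le> C"
      "\<And>w. (\<integral>\<^sup>+v. carleman_kernel \<gamma> b v w * ennreal (W v) \<partial>lborel) \<le> ennreal (th * (coll_freq \<gamma> b w * W w) + C)"
    then show thesis by (intro that[of th C]) (auto simp: W_def)
  qed (use a fine lb in \<open>auto simp: \<kappa>2_def[abs_def] A_def\<close>)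
qed

end

section \<open>The linear Boltzmann semigroup\<close>

interpretation lborel_sphere_pair: pair_sigma_finite lborel "sphere_measure :: 'a::euclidean_space measure" ..

lemma measurable_lborel_sphere:
  fixes F :: "'a::euclidean_space \<times> 'a \<Rightarrow> real"
  assumes "F \<in> borel_measurable (borel \<Otimes>\<^sub>M borel)"
  shows "F \<in> borel_measurable (lborel \<Otimes>\<^sub>M sphere_measure)"
proof -
  have "(\<lambda>p. (fst p, snd p)) \<in> measurable (lborel \<Otimes>\<^sub>M sphere_measure) (borel \<Otimes>\<^sub>M (borel :: 'a measure))"
    using measurable_compose[OF measurable_snd measurable_id_sphere]
    by (intro measurable_Pair) (auto intro: measurable_compose[OF measurable_fst])
  from measurable_compose[OF this assms] show ?thesis by simp
qed

lemma coll_kernel_cong: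
  fixes v vs \<sigma> :: "'a::euclidean_space"
  assumes "norm \<sigma> = 1" and "\<And>x. x \<in> {-1..1} \<Longrightarrow> b x = b' x"
  shows "coll_kernel \<gamma> b v vs \<sigma> = coll_kernel \<gamma> b' v vs \<sigma>"
proof -
  have "\<bar>cos_dev v vs \<sigma>\<bar> \<le> norm (sgn (v - vs)) * norm \<sigma>"
    unfolding cos_dev_def by (rule Cauchy_Schwarz_ineq2)
  also have "\<dots> \<le> 1" using assms(1) by (simp add: norm_sgn)
  finally have "cos_dev v vs \<sigma> \<in> {-1..1}" by auto
  then show ?thesis by (simp add: coll_kernel_def assms(2))
qed

lemma lin_boltzmann_cong:
  fixes f :: "'a::euclidean_space \<Rightarrow> real"
  assumes "\<And>x. x \<in> {-1..1} \<Longrightarrow> b x = b' x"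
  shows "lin_boltzmann \<gamma> b f = lin_boltzmann \<gamma> b' f"
proof -
  have c: "coll_kernel \<gamma> b v (fst p) (snd p) = coll_kernel \<gamma> b' v (fst p) (snd p)"
    if "p \<in> space (lborel \<Otimes>\<^sub>M sphere_measure)" for p and v :: 'a
    using that by (intro coll_kernel_cong assms) (auto simp: space_pair_measure)
  show ?thesis
    unfolding lin_boltzmann_def[abs_def] gain_def coll_freq_def split_beta'
    by (simp add: c cong: Bochner_Integration.integral_cong)
qed

lemma gain_meas:
  fixes f :: "'a::euclidean_space \<Rightarrow> real"
  assumes [measurable]: "b \<in> borel_measurable borel" "f \<in> borel_measurable borel"
  shows "gain \<gamma> b f \<in> borel_measurable borel"
proof -
  have m: "(\<lambda>q. coll_kernel \<gamma> b (fst q) (fst (snd q)) (snd (snd q)) * f (post_v (fst q) (fst (snd q)) (snd (snd q)))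
      * maxwellian (post_vs (fst q) (fst (snd q)) (snd (snd q)))) \<in> borel_measurable (borel \<Otimes>\<^sub>M (borel \<Otimes>\<^sub>M borel))"
    by measurable
  have "(\<lambda>q. (fst q, fst (snd q), snd (snd q)))
      \<in> measurable (borel \<Otimes>\<^sub>M (lborel \<Otimes>\<^sub>M sphere_measure)) (borel \<Otimes>\<^sub>M (borel \<Otimes>\<^sub>M (borel :: 'a measure)))"
    using measurable_compose[OF measurable_snd measurable_compose[OF measurable_snd measurable_id_sphere]]
    by (intro measurable_Pair) (auto intro: measurable_compose[OF measurable_snd] measurable_compose[OF measurable_fst])
  from measurable_compose[OF this m] show ?thesis
    unfolding gain_def[abs_def] split_beta'
    by (intro lborel_sphere_pair.borel_measurable_lebesgue_integral) (simp add: split_beta')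
qed

text \<open>The Bochner integral defining \<open>gain\<close> is 0 by default where the integrand is
  not integrable. The two finiteness hypotheses are exactly the integrability of its positive and
  negative parts, which the multiplier \<plusminus>1 in \<open>eq\<close> treats together.\<close>

lemma gain_eq_carleman:
  fixes f :: "'a::euclidean_space \<Rightarrow> real"
  assumes b_meas [measurable]: "b \<in> borel_measurable borel" and b_nonneg: "\<And>x. 0 \<le> b x" and dim: "2 \<le> DIM('a)"
    and [measurable]: "f \<in> borel_measurable borel"
    and fin: "(\<integral>\<^sup>+w. carleman_kernel \<gamma> b v w * ennreal (f w) \<partial>lborel) < \<infinity>"
      "(\<integral>\<^sup>+w. carleman_kernel \<gamma> b v w * ennreal (- f w) \<partial>lborel) < \<infinity>"
  shows "gain \<gamma> b f v = enn2real (\<integral>\<^sup>+w. carleman_kernel \<gamma> b v w * ennreal (f w) \<partial>lborel)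
    - enn2real (\<integral>\<^sup>+w. carleman_kernel \<gamma> b v w * ennreal (- f w) \<partial>lborel)"
proof -
  define F where "F p = coll_kernel \<gamma> b v (fst p) (snd p) * f (post_v v (fst p) (snd p)) * maxwellian (post_vs v (fst p) (snd p))" for p :: "'a \<times> 'a"
  have F_borel [measurable]: "F \<in> borel_measurable (borel \<Otimes>\<^sub>M borel)" unfolding F_def[abs_def] by measurable
  have eq: "(\<integral>\<^sup>+p. ennreal (s * F p) \<partial>(lborel \<Otimes>\<^sub>M sphere_measure)) = (\<integral>\<^sup>+w. carleman_kernel \<gamma> b v w * ennreal (s * f w) \<partial>lborel)" for s
  proof -
    have "(\<integral>\<^sup>+p. ennreal (s * F p) \<partial>(lborel \<Otimes>\<^sub>M sphere_measure))
        = (\<integral>\<^sup>+\<sigma>. \<integral>\<^sup>+vs. ennreal (s * F (vs, \<sigma>)) \<partial>lborel \<partial>sphere_borel)"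
      by (rule nn_integral_pair_sphere) measurable
    also have "\<dots> = (\<integral>\<^sup>+\<sigma>. \<integral>\<^sup>+vs. ennreal (coll_kernel \<gamma> b v vs \<sigma> * maxwellian (post_vs v vs \<sigma>)) * ennreal (s * f (post_v v vs \<sigma>)) \<partial>lborel \<partial>sphere_borel)"
    proof (intro nn_integral_cong)
      fix \<sigma> vs :: 'a
      have "0 \<le> coll_kernel \<gamma> b v vs \<sigma> * maxwellian (post_vs v vs \<sigma>)" using b_nonneg by (simp add: coll_kernel_def)
      from ennreal_mult'[OF this, of "s * f (post_v v vs \<sigma>)"]
      show "ennreal (s * F (vs, \<sigma>)) = ennreal (coll_kernel \<gamma> b v vs \<sigma> * maxwellian (post_vs v vs \<sigma>)) * ennreal (s * f (post_v v vs \<sigma>))"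
        by (simp add: F_def mult_ac)
    qed
    also have "\<dots> = (\<integral>\<^sup>+w. carleman_kernel \<gamma> b v w * ennreal (s * f w) \<partial>lborel)"
      by (rule nn_integral_gain_carleman[OF b_meas b_nonneg _ dim, symmetric]) measurable
    finally show ?thesis .
  qed
  have [measurable]: "F \<in> borel_measurable (lborel \<Otimes>\<^sub>M sphere_measure)" by (rule measurable_lborel_sphere[OF F_borel])
  have "integrable (lborel \<Otimes>\<^sub>M sphere_measure) F"
  proof (rule integrableI_bounded)
    have "(\<integral>\<^sup>+p. ennreal (norm (F p)) \<partial>(lborel \<Otimes>\<^sub>M sphere_measure))
        = (\<integral>\<^sup>+p. ennreal (1 * F p) + ennreal (- 1 * F p) \<partial>(lborel \<Otimes>\<^sub>M sphere_measure))"
      by (simp add: ennreal_abs_eq)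
    also have "\<dots> = (\<integral>\<^sup>+p. ennreal (1 * F p) \<partial>(lborel \<Otimes>\<^sub>M sphere_measure)) + (\<integral>\<^sup>+p. ennreal (- 1 * F p) \<partial>(lborel \<Otimes>\<^sub>M sphere_measure))"
      by (rule nn_integral_add) measurable
    also have "\<dots> < \<infinity>" unfolding eq using fin by simp
    finally show "(\<integral>\<^sup>+p. ennreal (norm (F p)) \<partial>(lborel \<Otimes>\<^sub>M sphere_measure)) < \<infinity>" .
  qed measurable
  from real_lebesgue_integral_def[OF this] have "integral\<^sup>L (lborel \<Otimes>\<^sub>M sphere_measure) F
      = enn2real (\<integral>\<^sup>+w. carleman_kernel \<gamma> b v w * ennreal (f w) \<partial>lborel)
        - enn2real (\<integral>\<^sup>+w. carleman_kernel \<gamma> b v w * ennreal (- f w) \<partial>lborel)"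
    using eq[of 1] eq[of "-1"] by simp
  then show ?thesis by (simp add: gain_def F_def[abs_def] split_beta')
qed

lemma powr_le_imp_le:
  fixes x p R :: real
  assumes "x powr p \<le> R" "0 \<le> x" "0 < p" "0 \<le> R"
  shows "x \<le> R powr (1 / p)"
proof -
  have "x = (x powr p) powr (1 / p)" using assms by (cases "x = 0") (simp_all add: powr_powr)
  also have "\<dots> \<le> R powr (1 / p)" using assms by (intro powr_mono2) auto
  finally show ?thesis .
qed

theorem theorem1p1:
  fixes m :: "real ^ 'n \<Rightarrow> real" and \<gamma> :: real and b :: "real \<Rightarrow> real"
  assumes dim: "CARD('n) \<ge> 2"
    and weight: "(\<exists>a s. a > 0 \<and> 0 < s \<and> s \<le> 1 \<and> m = exp_weight a s) \<or>
                 (\<exists>\<beta>. \<beta> > 0 \<and> m = alg_weight \<beta>)"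
    and gamma: "0 \<le> \<gamma>" "\<gamma> \<le> real CARD('n) - 2"
    and b_measurable: "b \<in> borel_measurable (restrict_space borel {-1..1})"
    and b_nonneg: "\<And>x. x \<in> {-1..1} \<Longrightarrow> 0 \<le> b x"
    and b_L1: "\<And>v vs :: real ^ 'n. v \<noteq> vs \<Longrightarrow>
                 integrable sphere_measure (\<lambda>\<sigma>. b (cos_dev v vs \<sigma>))"
    and ell_pos: "\<And>v vs :: real ^ 'n. v \<noteq> vs \<Longrightarrow> 0 < ell b v vs"
  shows "\<exists>V. C0_semigroup (X_measure m) V \<and>
             positive_semigroup (X_measure m) V \<and>
             is_generator (X_measure m) V (L1 (Y_measure \<gamma> m)) (lin_boltzmann \<gamma> b) \<and>
             (\<exists>C>0. \<exists>rate>0. \<forall>f\<^sub>0\<in>L1 (X_measure m). (AE v in X_measure m. 0 \<le> f\<^sub>0 v) \<longrightarrow>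
               (\<forall>t\<ge>0. L1_norm (X_measure m) (\<lambda>v. V t f\<^sub>0 v - (LINT w|lborel. f\<^sub>0 w) * maxwellian v)
                        \<le> C * exp (- rate * t) * L1_norm (X_measure m) f\<^sub>0))"
proof -
  \<comment> \<open>\<open>b\<close> is measurable and nonnegative on [-1, 1] only. Its extension by
    zero has both properties on the real line and leaves the operator unchanged, as cos \<theta>
    stays in [-1, 1].\<close>
  define b' where "b' x = indicator {-1..1} x *\<^sub>R b x" for x :: real
  have b'_eq: "b x = b' x" if "x \<in> {-1..1}" for x using that by (simp add: b'_def)
  have b'_meas [measurable]: "b' \<in> borel_measurable borel"
    using b_measurable by (subst (asm) borel_measurable_restrict_space_iff) (simp_all add: b'_def[abs_def])
  have b'_nonneg: "0 \<le> b' x" for x using b_nonneg by (auto simp: b'_def indicator_def)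
  have dim': "2 \<le> DIM(real ^ 'n)" using dim by simp
  define e :: "real ^ 'n" where "e = (SOME x. x \<in> Basis)"
  have e: "norm e = 1" unfolding e_def by (rule norm_Basis[OF SOME_Basis])
  then have "e \<noteq> 0" by auto
  define lb where "lb = ell b e 0"
  have lb: "0 < lb" unfolding lb_def by (rule ell_pos) fact
  have cos_e: "cos_dev e 0 \<sigma> = e \<bullet> \<sigma>" for \<sigma> by (simp add: cos_dev_def sgn_div_norm e)
  have b'_int: "(\<integral>\<^sup>+\<sigma>. ennreal (b' (e \<bullet> \<sigma>)) \<partial>sphere_borel) = ennreal lb"
  proof -
    have range: "e \<bullet> \<sigma> \<in> {-1..1}" if "norm \<sigma> = 1" for \<sigma>
      using Cauchy_Schwarz_ineq2[of e \<sigma>] e that by auto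
    have "(\<integral>\<^sup>+\<sigma>. ennreal (b' (e \<bullet> \<sigma>)) \<partial>sphere_borel) = (\<integral>\<^sup>+\<sigma>. ennreal (b' (e \<bullet> \<sigma>)) \<partial>sphere_measure)"
      by (rule nn_integral_sphere_borel[symmetric]) measurable
    also have "\<dots> = (\<integral>\<^sup>+\<sigma>. ennreal (b (cos_dev e 0 \<sigma>)) \<partial>sphere_measure)"
      using range by (intro nn_integral_cong) (simp add: cos_e b'_eq)
    also have "\<dots> = ennreal (LINT \<sigma>|sphere_measure. b (cos_dev e 0 \<sigma>))"
    proof (intro nn_integral_eq_integral b_L1 \<open>e \<noteq> 0\<close>)
      show "AE \<sigma> in sphere_measure. 0 \<le> b (cos_dev e 0 \<sigma>)"
        using range b_nonneg by (intro AE_I2) (simp add: cos_e)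
    qed
    finally show ?thesis by (simp add: lb_def ell_def)
  qed
  note facts = gamma(1) b'_meas b'_nonneg dim' e lb b'_int
  define W where "W v = inverse (m v)" for v
  have W_cases: "(\<exists>a s. 0 < a \<and> 0 < s \<and> s \<le> 1 \<and> W = (\<lambda>v. exp (a * norm v powr s))) \<or>
      (\<exists>\<beta>. 0 < \<beta> \<and> W = (\<lambda>v. 1 + norm v powr \<beta>))"
    using weight
  proof (elim disjE exE conjE)
    fix a s :: real assume "0 < a" "0 < s" "s \<le> 1" "m = exp_weight a s"
    then show ?thesis by (intro disjI1 exI[of _ a] exI[of _ s]) (auto simp: W_def[abs_def] exp_weight_def exp_minus)
  next
    fix \<beta> :: real assume "0 < \<beta>" "m = alg_weight \<beta>"
    then show ?thesis by (intro disjI2 exI[of _ \<beta>]) (auto simp: W_def[abs_def] alg_weight_def)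
  qed
  have W_meas [measurable]: "W \<in> borel_measurable borel" using W_cases by auto
  have W1: "1 \<le> W v" for v using W_cases by auto
  have W_sublevel: "\<exists>\<rho>\<ge>0. \<forall>v. W v \<le> R \<longrightarrow> norm v \<le> \<rho>" for R
    using W_cases
  proof (elim disjE exE conjE)
    fix a s :: real assume a: "0 < a" "0 < s" "s \<le> 1" "W = (\<lambda>v. exp (a * norm v powr s))"
    have "norm v \<le> (max R 0 / a) powr (1 / s)" if "W v \<le> R" for v
    proof (rule powr_le_imp_le)
      have "a * norm v powr s \<le> W v" unfolding a(4) using exp_ge_add_one_self[of "a * norm v powr s"] by linarith
      then have "a * norm v powr s \<le> max R 0" using that by simp
      then show "norm v powr s \<le> max R 0 / a" using a(1) by (simp add: pos_le_divide_eq mult.commute)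
    qed (use a in auto)
    then show ?thesis by (intro exI[of _ "(max R 0 / a) powr (1 / s)"]) auto
  next
    fix \<beta> :: real assume \<beta>: "0 < \<beta>" "W = (\<lambda>v. 1 + norm v powr \<beta>)"
    have "norm v \<le> (max R 0) powr (1 / \<beta>)" if "W v \<le> R" for v
      using that by (intro powr_le_imp_le) (auto simp: \<beta>)
    then show ?thesis by (intro exI[of _ "(max R 0) powr (1 / \<beta>)"]) auto
  qed
  have W_growth: "\<exists>A c. 0 \<le> A \<and> (\<forall>v. W v \<le> A * exp (c * norm v))"
    using W_cases
  proof (elim disjE exE conjE)
    fix a s :: real assume a: "0 < a" "0 < s" "s \<le> 1" "W = (\<lambda>v. exp (a * norm v powr s))"
    have "W v \<le> exp a * exp (a * norm v)" for v
      using mult_left_mono[OF powr_le_1_plus[of "norm v" s], of a] a by (simp add: exp_add[symmetric] distrib_left)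
    then show ?thesis by (intro exI[of _ "exp a"] exI[of _ a]) auto
  next
    fix \<beta> :: real assume \<beta>: "0 < \<beta>" "W = (\<lambda>v. 1 + norm v powr \<beta>)"
    have "W v \<le> 2 * exp (\<beta> * norm v)" for v
    proof -
      have "0 \<le> \<beta> * norm v" using \<beta> by simp
      then have "1 \<le> exp (\<beta> * norm v)" by simp
      moreover have "norm v powr \<beta> \<le> exp (\<beta> * norm v)" using \<beta>(1) by (intro powr_le_exp_mult) auto
      ultimately show ?thesis unfolding \<beta>(2) by linarith
    qed
    then show ?thesis by (intro exI[of _ 2] exI[of _ \<beta>]) auto
  qed
  obtain th C where th: "0 \<le> th" "th < 1" "0 \<le> C"
    and lyap: "\<And>w. (\<integral>\<^sup>+v. carleman_kernel \<gamma> b' v w * ennreal (W v) \<partial>lborel) \<le> ennreal (th * (coll_freq \<gamma> b' w * W w) + C)"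
  proof -
    from W_cases show thesis
    proof (elim disjE exE conjE)
      fix a s :: real assume a: "0 < a" "0 < s" "s \<le> 1" and W: "W = (\<lambda>v. exp (a * norm v powr s))"
      show thesis
      proof (rule exponential_lyapunov[OF facts a])
        fix th C assume "0 \<le> th" "th < 1" "0 \<le> C" "\<And>w :: real ^ 'n. (\<integral>\<^sup>+v. carleman_kernel \<gamma> b' v w * ennreal (exp (a * norm v powr s)) \<partial>lborel)
          \<le> ennreal (th * (coll_freq \<gamma> b' w * exp (a * norm w powr s)) + C)"
        then show thesis unfolding W by (rule that[unfolded W])
      qed
    next
      fix \<beta> :: real assume \<beta>: "0 < \<beta>" and W: "W = (\<lambda>v. 1 + norm v powr \<beta>)"
      show thesis
      proof (rule algebraic_lyapunov[OF facts \<beta>])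
        fix th C assume "0 \<le> th" "th < 1" "0 \<le> C" "\<And>w :: real ^ 'n. (\<integral>\<^sup>+v. carleman_kernel \<gamma> b' v w * ennreal (1 + norm v powr \<beta>) \<partial>lborel)
          \<le> ennreal (th * (coll_freq \<gamma> b' w * (1 + norm w powr \<beta>)) + C)"
        then show thesis unfolding W by (rule that[unfolded W])
      qed
    qed
  qed
  \<comment> \<open>The collision frequency is comparable with (1 + |v|)^\<gamma>, which makes
    \<open>ynorm\<close> equivalent to the norm of \<open>Y_measure\<close>. The lower constant also
    serves as the lower bound \<open>S\<^sub>0\<close>.\<close>
  obtain s where s: "0 < s" "\<And>v :: real ^ 'n. s * (1 + norm v) powr \<gamma> \<le> coll_freq \<gamma> b' v"
    using coll_freq_lower[OF facts] by blast
  obtain u where u: "0 < u" "\<And>v :: real ^ 'n. coll_freq \<gamma> b' v \<le> u * (1 + norm v) powr \<gamma>"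
    using coll_freq_upper[OF facts] by blast
  have s_le: "s \<le> coll_freq \<gamma> b' v" for v :: "real ^ 'n"
  proof -
    have "s * 1 \<le> s * (1 + norm v) powr \<gamma>"
      using s(1) gamma(1) by (intro mult_left_mono ge_one_powr_ge_zero) auto
    then show ?thesis using s(2)[of v] by simp
  qed
  interpret harris_process "lborel :: (real ^ 'n) measure" "carleman_kernel \<gamma> b'" "coll_freq \<gamma> b'" W th C s maxwellian
  proof unfold_locales
    show "(\<lambda>(x, y). carleman_kernel \<gamma> b' x y) \<in> borel_measurable (lborel \<Otimes>\<^sub>M (lborel :: (real ^ 'n) measure))"
      by (rule carleman_kernel_meas[OF b'_meas])
    show "coll_freq \<gamma> b' \<in> borel_measurable (lborel :: (real ^ 'n) measure)"
      using coll_freq_meas[OF facts] by simp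
    show "(\<integral>\<^sup>+v. carleman_kernel \<gamma> b' v w \<partial>lborel) = ennreal (coll_freq \<gamma> b' w)" for w :: "real ^ 'n"
      by (rule carleman_kernel_mass[OF facts])
    show "(\<integral>\<^sup>+w. carleman_kernel \<gamma> b' v w * ennreal (maxwellian w) \<partial>lborel) = ennreal (coll_freq \<gamma> b' v) * ennreal (maxwellian v)"
      for v :: "real ^ 'n"
      by (rule maxwellian_stationary[OF facts])
    show "(\<integral>\<^sup>+v. ennreal (W v) * ennreal (maxwellian v) \<partial>lborel) < \<infinity>"
    proof -
      obtain A c where A: "0 \<le> A" "\<And>v. W v \<le> A * exp (c * norm v)" using W_growth by blast
      have "(\<integral>\<^sup>+v. ennreal (W v) * ennreal (maxwellian v) \<partial>lborel)
          \<le> (\<integral>\<^sup>+v. ennreal A * ennreal (exp (c * norm v) * maxwellian v) \<partial>(lborel :: (real ^ 'n) measure))"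
      proof (rule nn_integral_mono)
        fix v
        have "W v * maxwellian v \<le> A * exp (c * norm v) * maxwellian v" by (intro mult_right_mono A) auto
        then show "ennreal (W v) * ennreal (maxwellian v) \<le> ennreal A * ennreal (exp (c * norm v) * maxwellian v)"
          using A(1) W1[of v] by (simp add: ennreal_mult[symmetric] mult.assoc ennreal_leI)
      qed
      also have "\<dots> = ennreal A * (\<integral>\<^sup>+v. ennreal (exp (c * norm v) * maxwellian v) \<partial>(lborel :: (real ^ 'n) measure))"
        by (rule nn_integral_cmult) measurable
      also have "\<dots> < \<infinity>" using nn_integral_exp_maxwellian[of c, where 'a="real ^ 'n"] by (simp add: ennreal_mult_less_top)
      finally show ?thesis .
    qed
    show "\<exists>\<nu> A. \<nu> \<in> borel_measurable lborel \<and> 0 < (\<integral>\<^sup>+v. \<nu> v \<partial>lborel) \<and> (\<integral>\<^sup>+v. \<nu> v \<partial>lborel) < \<infinity> \<and>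
      (\<forall>v w. W w \<le> R \<longrightarrow> \<nu> v \<le> carleman_kernel \<gamma> b' v w) \<and> (\<forall>w. W w \<le> R \<longrightarrow> coll_freq \<gamma> b' w \<le> A) \<and>
      (\<forall>v. \<nu> v \<noteq> 0 \<longrightarrow> coll_freq \<gamma> b' v \<le> A)" for R
    proof -
      obtain \<rho> where \<rho>: "0 \<le> \<rho>" "\<And>v. W v \<le> R \<Longrightarrow> norm v \<le> \<rho>" using W_sublevel by blast
      obtain c where c: "0 < c" "c < \<infinity>"
        "\<And>v w :: real ^ 'n. norm w \<le> \<rho> \<Longrightarrow> 1 \<le> norm (w - v) \<Longrightarrow> norm (w - v) \<le> 2 * \<rho> + 3 \<Longrightarrow> c \<le> carleman_kernel \<gamma> b' v w"
        using carleman_kernel_lower[OF facts, of \<rho> "2 * \<rho> + 3"] \<rho>(1) by auto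
      \<comment> \<open>The unit ball around \<open>p\<close> lies at distance at least 1 from the
        ball of radius \<rho> that contains the sublevel set, and points of the two balls are at
        most 2 \<rho> + 3 apart. The measure \<nu> is a multiple of Lebesgue measure on it.\<close>
      define p where "p = (\<rho> + 2) *\<^sub>R e"
      have [measurable]: "ball p 1 \<in> sets borel" by simp
      have p: "norm p = \<rho> + 2" using \<rho>(1) e by (simp add: p_def)
      define \<nu> where "\<nu> v = c * indicator (ball p 1) v" for v
      have ball: "\<rho> + 1 \<le> norm v \<and> norm v \<le> \<rho> + 3" if "v \<in> ball p 1" for v
        using that p norm_triangle_ineq2[of p v] norm_triangle_ineq2[of v p] by (simp add: dist_norm norm_minus_commute)
      have freq: "coll_freq \<gamma> b' v \<le> u * (4 + \<rho>) powr \<gamma>" if "norm v \<le> \<rho> + 3" for v :: "real ^ 'n"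
      proof -
        have "u * (1 + norm v) powr \<gamma> \<le> u * (4 + \<rho>) powr \<gamma>"
          using u(1) that gamma(1) by (intro mult_left_mono powr_mono2) auto
        with u(2)[of v] show ?thesis by linarith
      qed
      have int: "(\<integral>\<^sup>+v. \<nu> v \<partial>lborel) = c * emeasure lborel (ball p 1)"
        unfolding \<nu>_def by (rule nn_integral_cmult_indicator) simp
      have "emeasure lborel (ball p 1) \<noteq> 0"
        using content_ball_pos[of 1 p] by (auto simp: measure_def)
      then have "0 < (\<integral>\<^sup>+v. \<nu> v \<partial>lborel)"
        unfolding int using c(1) by (simp add: ennreal_zero_less_mult_iff zero_less_iff_neq_zero)
      moreover have "(\<integral>\<^sup>+v. \<nu> v \<partial>lborel) < \<infinity>"
        unfolding int using c(2) emeasure_lborel_ball_finite[of p 1] by (simp add: ennreal_mult_less_top)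
      moreover have "\<nu> v \<le> carleman_kernel \<gamma> b' v w" if "W w \<le> R" for v w
      proof (cases "v \<in> ball p 1")
        case True
        have w: "norm w \<le> \<rho>" by (rule \<rho>(2)[OF that])
        have "1 \<le> norm (w - v)" using ball[OF True] w norm_triangle_ineq2[of v w] by (simp add: norm_minus_commute)
        moreover have "norm (w - v) \<le> 2 * \<rho> + 3" using ball[OF True] w norm_triangle_ineq4[of w v] by simp
        ultimately show ?thesis using c(3)[OF w] True by (simp add: \<nu>_def)
      qed (simp add: \<nu>_def)
      moreover have "coll_freq \<gamma> b' w \<le> u * (4 + \<rho>) powr \<gamma>" if "W w \<le> R" for w
        using \<rho>(2)[OF that] by (intro freq) simp
      moreover have "coll_freq \<gamma> b' v \<le> u * (4 + \<rho>) powr \<gamma>" if "\<nu> v \<noteq> 0" for v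
        using that ball[of v] by (intro freq) (auto simp: \<nu>_def indicator_def split: if_splits)
      moreover have "\<nu> \<in> borel_measurable lborel" unfolding \<nu>_def[abs_def] by measurable
      ultimately show ?thesis by blast
    qed
  qed (use s s_le W1 th lyap nn_integral_maxwellian in auto)
  have X_eq: "X_measure m = X" by (simp add: X_measure_def W_def)
  have Y_iff: "f \<in> L1 (Y_measure \<gamma> m) \<longleftrightarrow> f \<in> borel_measurable borel \<and> ynorm (\<lambda>v. ennreal \<bar>f v\<bar>) < \<infinity>" for f
  proof -
    define w where "w v = (1 + norm v) powr \<gamma> * W v" for v
    have w_nonneg: "0 \<le> w v" for v using W1[of v] by (simp add: w_def)
    have [measurable]: "w \<in> borel_measurable borel" unfolding w_def[abs_def] by measurable
    have Y_eq: "Y_measure \<gamma> m = density lborel (\<lambda>v. ennreal (w v))" by (simp add: Y_measure_def W_def w_def)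
    have "(\<integral>\<^sup>+v. ennreal (norm (f v)) \<partial>Y_measure \<gamma> m) = (\<integral>\<^sup>+v. ennreal (w v) * ennreal \<bar>f v\<bar> \<partial>lborel)"
      if [measurable]: "f \<in> borel_measurable borel"
      unfolding Y_eq by (subst nn_integral_density) auto
    moreover have "(\<integral>\<^sup>+v. ennreal (w v) * ennreal \<bar>f v\<bar> \<partial>lborel) < \<infinity> \<longleftrightarrow> ynorm (\<lambda>v. ennreal \<bar>f v\<bar>) < \<infinity>"
      if [measurable]: "f \<in> borel_measurable borel"
    proof
      assume fin: "(\<integral>\<^sup>+v. ennreal (w v) * ennreal \<bar>f v\<bar> \<partial>lborel) < \<infinity>"
      have "ynorm (\<lambda>v. ennreal \<bar>f v\<bar>) \<le> (\<integral>\<^sup>+v. ennreal u * (ennreal (w v) * ennreal \<bar>f v\<bar>) \<partial>lborel)"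
        unfolding ynorm_def
      proof (rule nn_integral_mono)
        fix v
        have "coll_freq \<gamma> b' v * W v \<le> u * w v"
          unfolding w_def mult.assoc[symmetric] using W1[of v] by (intro mult_right_mono u) auto
        then have "coll_freq \<gamma> b' v * W v * \<bar>f v\<bar> \<le> u * w v * \<bar>f v\<bar>" by (rule mult_right_mono) simp
        then show "ennreal (coll_freq \<gamma> b' v * W v) * ennreal \<bar>f v\<bar> \<le> ennreal u * (ennreal (w v) * ennreal \<bar>f v\<bar>)"
          using u(1) w_nonneg[of v] by (simp add: ennreal_mult''[symmetric] ennreal_mult[symmetric] mult.assoc ennreal_leI)
      qed
      also have "\<dots> = ennreal u * (\<integral>\<^sup>+v. ennreal (w v) * ennreal \<bar>f v\<bar> \<partial>lborel)" by (rule nn_integral_cmult) measurable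
      also have "\<dots> < \<infinity>" using fin by (simp add: ennreal_mult_less_top)
      finally show "ynorm (\<lambda>v. ennreal \<bar>f v\<bar>) < \<infinity>" .
    next
      assume fin: "ynorm (\<lambda>v. ennreal \<bar>f v\<bar>) < \<infinity>"
      have "(\<integral>\<^sup>+v. ennreal (w v) * ennreal \<bar>f v\<bar> \<partial>lborel) \<le> (\<integral>\<^sup>+v. ennreal (1 / s) * (ennreal (coll_freq \<gamma> b' v * W v) * ennreal \<bar>f v\<bar>) \<partial>lborel)"
      proof (rule nn_integral_mono)
        fix v
        have "s * w v \<le> coll_freq \<gamma> b' v * W v"
          unfolding w_def mult.assoc[symmetric] using W1[of v] by (intro mult_right_mono s) auto
        then have "w v \<le> 1 / s * (coll_freq \<gamma> b' v * W v)" using s(1) by (simp add: field_simps)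
        then have "w v * \<bar>f v\<bar> \<le> 1 / s * (coll_freq \<gamma> b' v * W v) * \<bar>f v\<bar>" by (rule mult_right_mono) simp
        then have "ennreal (w v * \<bar>f v\<bar>) \<le> ennreal (1 / s * (coll_freq \<gamma> b' v * W v) * \<bar>f v\<bar>)" by (rule ennreal_leI)
        also have "ennreal (1 / s * (coll_freq \<gamma> b' v * W v) * \<bar>f v\<bar>) = ennreal (1 / s) * (ennreal (coll_freq \<gamma> b' v * W v) * ennreal \<bar>f v\<bar>)"
        proof -
          have "0 \<le> coll_freq \<gamma> b' v * W v" using coll_freq_nonneg[OF facts, of v] W1[of v] by simp
          then have "ennreal (coll_freq \<gamma> b' v * W v * \<bar>f v\<bar>) = ennreal (coll_freq \<gamma> b' v * W v) * ennreal \<bar>f v\<bar>"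
            by (rule ennreal_mult')
          moreover have "ennreal (1 / s * (coll_freq \<gamma> b' v * W v * \<bar>f v\<bar>)) = ennreal (1 / s) * ennreal (coll_freq \<gamma> b' v * W v * \<bar>f v\<bar>)"
            using s(1) by (intro ennreal_mult') simp
          ultimately show ?thesis by (simp only: mult.assoc)
        qed
        finally show "ennreal (w v) * ennreal \<bar>f v\<bar> \<le> ennreal (1 / s) * (ennreal (coll_freq \<gamma> b' v * W v) * ennreal \<bar>f v\<bar>)"
          using ennreal_mult'[OF w_nonneg[of v], of "\<bar>f v\<bar>"] by simp
      qed
      also have "\<dots> = ennreal (1 / s) * ynorm (\<lambda>v. ennreal \<bar>f v\<bar>)" unfolding ynorm_def by (rule nn_integral_cmult) measurable
      also have "\<dots> < \<infinity>" using fin by (simp add: ennreal_mult_less_top)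
      finally show "(\<integral>\<^sup>+v. ennreal (w v) * ennreal \<bar>f v\<bar> \<partial>lborel) < \<infinity>" .
    qed
    moreover have "f \<in> borel_measurable (Y_measure \<gamma> m) \<longleftrightarrow> f \<in> borel_measurable borel" by (simp add: Y_eq)
    ultimately show ?thesis unfolding L1_def mem_Collect_eq integrable_iff_bounded by auto
  qed
  have in_graph: "(f, lin_boltzmann \<gamma> b f) \<in> generator_graph X op" if f: "f \<in> L1 (Y_measure \<gamma> m)" for f
  proof -
    from f have [measurable]: "f \<in> borel_measurable borel" and fin: "ynorm (\<lambda>v. ennreal \<bar>f v\<bar>) < \<infinity>"
      by (auto simp: Y_iff)
    have L: "lin_boltzmann \<gamma> b f = lin_boltzmann \<gamma> b' f" by (rule lin_boltzmann_cong) (rule b'_eq)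
    note [measurable] = gain_meas[OF b'_meas \<open>f \<in> borel_measurable borel\<close>, of \<gamma>] coll_freq_meas[OF facts]
    show ?thesis
    proof (rule op_generator_on_domain)
      show "lin_boltzmann \<gamma> b f \<in> borel_measurable lborel"
        unfolding L unfolding lin_boltzmann_def[abs_def] by measurable
      have y: "ynorm (\<lambda>v. ennreal (f v)) < \<infinity>" "ynorm (\<lambda>v. ennreal (- f v)) < \<infinity>"
        using fin unfolding ennreal_abs_eq by (auto simp: ynorm_add)
      \<comment> \<open>Finite \<open>ynorm\<close> makes both gains finite almost everywhere, and
        there the Bochner integral in \<open>gain\<close> has its genuine value. On the exceptional
        null set \<open>lin_boltzmann\<close> and \<open>generator\<close> take default values that
        need not agree.\<close>
      have "AE v in lborel. gainK (\<lambda>v. ennreal (f v)) v < \<infinity>" "AE v in lborel. gainK (\<lambda>v. ennreal (- f v)) v < \<infinity>"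
        using wnorm_finite_AE[OF _ wnorm_gainK_finite[OF _ y(1)]] wnorm_finite_AE[OF _ wnorm_gainK_finite[OF _ y(2)]] by auto
      then show "AE v in lborel. lin_boltzmann \<gamma> b f v = generator f v"
      proof eventually_elim
        case (elim v)
        then show ?case
          unfolding L unfolding lin_boltzmann_def generator_def gainK_def
          by (subst gain_eq_carleman[OF b'_meas b'_nonneg dim']) auto
      qed
    qed (use fin in auto)
  qed
  have "is_generator X op (L1 (Y_measure \<gamma> m)) (lin_boltzmann \<gamma> b)"
    unfolding is_generator_def
  proof (intro conjI ballI in_graph set_eqI iffI)
    fix f assume "f \<in> L1 (Y_measure \<gamma> m)"
    then show "f \<in> Domain (generator_graph X op)" using in_graph by blast
  next
    fix f assume "f \<in> Domain (generator_graph X op)"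
    then obtain h where "(f, h) \<in> generator_graph X op" by blast
    then show "f \<in> L1 (Y_measure \<gamma> m)" using generator_graph_domain[of f h] by (simp add: Y_iff)
  qed
  moreover obtain c r where "0 < c" "0 < r"
    "\<And>f t. f \<in> L1 X \<Longrightarrow> 0 \<le> t \<Longrightarrow>
      L1_norm X (\<lambda>v. op t f v - (\<integral>w. f w \<partial>lborel) * maxwellian v) \<le> c * exp (- r * t) * L1_norm X f"
    using op_exponential_decay by blast
  ultimately show ?thesis
    unfolding X_eq by (intro exI[of _ op] conjI op_C0_semigroup op_positive_semigroup exI[of _ c] exI[of _ r]) auto
qed

end
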